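(* For any $\delta\in\left(0,(\beta_0-\alpha_0)/2\right)$ there exist $\varepsilon_\delta>0$ and a neighborhood $\mathcal N_\delta$ of the Maxwell point $\Delta_0=(\sigma_0,b_0)$ such that, for every $\varepsilon\in(0,\varepsilon_\delta)$ and every $r\in\mathcal R_\delta:=[\alpha_0+\delta,\beta_0-\delta]$, the problem $$\begin{cases} Q''(\varepsilon z')z''=F'(z)-\sigma \quad\text{in } (-\varepsilon^{-1},\varepsilon^{-1}),\\ z'(\pm\varepsilon^{-1})=0,\\ \displaystyle\int_{-\varepsilon^{-1}}^{\varepsilon^{-1}}z(x)\,dx=2r\varepsilon^{-1},\end{cases}$$ (with unknowns the positive function $z$ and the constant $\sigma\in\mathbb R$) has exactly one simple solution whose corresponding admissible pair $\Delta(\varepsilon,r)$ belongs to $\mathcal N_\delta$. Moreover, there is a constant $C=C_\delta>0$ such that, as $\varepsilon\to0^+$, $$\Delta(\varepsilon,r)=\Delta_0+O(\exp(-C/\varepsilon)),\qquad z_1(\Delta(\varepsilon,r))=\alpha_0+O(\exp(-C/\varepsilon)),\qquad z_2(\Delta(\varepsilon,r))=\beta_0+O(\exp(-C/\varepsilon)),$$ uniformly for $r\in\mathcal R_\delta$.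
   Context: $Q(s)=\sqrt{1+s^2}-1$. Fix $0<\overline\alpha<\underline\beta$ and $F\in C^5(0,\infty)$ (real valued) with $F''>0$ on $(0,\overline\alpha)\cup(\underline\beta,\infty)$, $F''<0$ on $(\overline\alpha,\underline\beta)$, $F'(0)<F'(\underline\beta)$ and $F'(\infty)>F'(\overline\alpha)$, where $F'(0),F'(\infty)$ denote the limits of $F'$ at $0^+$ and $+\infty$. Put $\underline\sigma:=F'(\underline\beta)$, $\overline\sigma:=F'(\overline\alpha)$ and, for $\sigma\in[\underline\sigma,\overline\sigma]$, let $\Phi_\sigma(z):=F(z)-\sigma z$ (Gibbs function). Its critical points are $\alpha_\sigma\le\zeta_\sigma\le\beta_\sigma$, the solutions of $F'(\cdot)=\sigma$ in $(0,\overline\alpha]$, $[\overline\alpha,\underline\beta]$, $[\underline\beta,\infty)$ respectively. The value $\sigma_0\in(\underline\sigma,\overline\sigma)$ is the unique one for which $\Phi_{\sigma_0}(\alpha_{\sigma_0})=\Phi_{\sigma_0}(\beta_{\sigma_0})$; write $\alpha_0=\alpha_{\sigma_0}$, $\zeta_0=\zeta_{\sigma_0}$, $\beta_0=\beta_{\sigma_0}$, $b_0=\Phi_{\sigma_0}(\alpha_0)=\Phi_{\sigma_0}(\beta_0)$. The Maxwell point is $\Delta_0=(\sigma_0,b_0)$. A pair $\Delta=(\sigma,b)$ is admissible if $\sigma\in(\underline\sigma,\overline\sigma)$ and $\max\{\Phi_\sigma(\alpha_\sigma),\Phi_\sigma(\beta_\sigma)\}<b<\Phi_\sigma(\zeta_\sigma)$.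 For admissible $\Delta$, $z_1(\Delta)\in(\alpha_\sigma,\zeta_\sigma)$ and $z_2(\Delta)\in(\zeta_\sigma,\beta_\sigma)$ are the solutions of $\Phi_\sigma(z_i)=b$. A simple solution is a (non-constant) increasing solution of the boundary value problem in the claim. Multiplying the equation by $z'$ and integrating, such a solution satisfies $P_\varepsilon(z')=\Phi_\sigma(z)-b$ for some constant $b$, where $P_\varepsilon(s)=\int_0^sQ''(\varepsilon u)u\,du=\varepsilon^{-2}\bigl(1-\tfrac1{\sqrt{1+\varepsilon^2s^2}}\bigr)$; the corresponding admissible pair is $\Delta=(\sigma,b)$, and $z(-\varepsilon^{-1})=z_1(\Delta)$, $z(\varepsilon^{-1})=z_2(\Delta)$. *)

theory Defs
  imports "HOL-Analysis.Analysis"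
begin

text \<open>Intended for open \<open>S\<close>, where the iterated two-sided \<^const>\<open>deriv\<close> is the
  usual higher derivative and depends only on the values of \<open>f\<close> on \<open>S\<close>.\<close>
definition Ck_on :: "nat \<Rightarrow> (real \<Rightarrow> real) \<Rightarrow> real set \<Rightarrow> bool" where
  "Ck_on k f S \<longleftrightarrow> (\<forall>j<k. (deriv ^^ j) f differentiable_on S) \<and> continuous_on S ((deriv ^^ k) f)"

definition Q :: "real \<Rightarrow> real" where
  "Q s = sqrt (1 + s\<^sup>2) - 1"

definition P :: "real \<Rightarrow> real \<Rightarrow> real" where
  "P \<epsilon> s = (LBINT u=0..ereal s. (deriv ^^ 2) Q (\<epsilon> * u) * u)"

text \<open>Throughout, \<open>a\<close> and \<open>b\<close> are the points at which \<open>F\<close> changes from convex to concave and from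
  concave to convex. Under the hypotheses on \<open>F\<close> used below, all the descriptions have
  a unique solution in the parameter range in which they are used.\<close>

definition Gibbs :: "(real \<Rightarrow> real) \<Rightarrow> real \<Rightarrow> real \<Rightarrow> real" where
  "Gibbs F \<sigma> z = F z - \<sigma> * z"

definition crit_\<alpha> :: "(real \<Rightarrow> real) \<Rightarrow> real \<Rightarrow> real \<Rightarrow> real" where
  "crit_\<alpha> F a \<sigma> = (THE z. z \<in> {0<..a} \<and> deriv F z = \<sigma>)"

definition crit_\<zeta> :: "(real \<Rightarrow> real) \<Rightarrow> real \<Rightarrow> real \<Rightarrow> real \<Rightarrow> real" where
  "crit_\<zeta> F a b \<sigma> = (THE z. z \<in> {a..b} \<and> deriv F z = \<sigma>)"

definition crit_\<beta> :: "(real \<Rightarrow> real) \<Rightarrow> real \<Rightarrow> real \<Rightarrow> real" where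
  "crit_\<beta> F b \<sigma> = (THE z. z \<in> {b..} \<and> deriv F z = \<sigma>)"

definition \<sigma>_range :: "(real \<Rightarrow> real) \<Rightarrow> real \<Rightarrow> real \<Rightarrow> real set" where
  "\<sigma>_range F a b = {deriv F b<..<deriv F a}"

definition Maxwell_\<sigma> :: "(real \<Rightarrow> real) \<Rightarrow> real \<Rightarrow> real \<Rightarrow> real" where
  "Maxwell_\<sigma> F a b =
     (THE \<sigma>. \<sigma> \<in> \<sigma>_range F a b \<and> Gibbs F \<sigma> (crit_\<alpha> F a \<sigma>) = Gibbs F \<sigma> (crit_\<beta> F b \<sigma>))"

definition Maxwell_\<alpha> :: "(real \<Rightarrow> real) \<Rightarrow> real \<Rightarrow> real \<Rightarrow> real" where
  "Maxwell_\<alpha> F a b = crit_\<alpha> F a (Maxwell_\<sigma> F a b)"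

definition Maxwell_\<beta> :: "(real \<Rightarrow> real) \<Rightarrow> real \<Rightarrow> real \<Rightarrow> real" where
  "Maxwell_\<beta> F a b = crit_\<beta> F b (Maxwell_\<sigma> F a b)"

definition Maxwell_point :: "(real \<Rightarrow> real) \<Rightarrow> real \<Rightarrow> real \<Rightarrow> real \<times> real" where
  "Maxwell_point F a b = (Maxwell_\<sigma> F a b, Gibbs F (Maxwell_\<sigma> F a b) (Maxwell_\<alpha> F a b))"

definition admissible :: "(real \<Rightarrow> real) \<Rightarrow> real \<Rightarrow> real \<Rightarrow> real \<times> real \<Rightarrow> bool" where
  "admissible F a b = (\<lambda>(\<sigma>, c). \<sigma> \<in> \<sigma>_range F a b \<and>
     max (Gibbs F \<sigma> (crit_\<alpha> F a \<sigma>)) (Gibbs F \<sigma> (crit_\<beta> F b \<sigma>)) < c \<and>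
     c < Gibbs F \<sigma> (crit_\<zeta> F a b \<sigma>))"

definition z\<^sub>1 :: "(real \<Rightarrow> real) \<Rightarrow> real \<Rightarrow> real \<Rightarrow> real \<times> real \<Rightarrow> real" where
  "z\<^sub>1 F a b = (\<lambda>(\<sigma>, c). THE z. z \<in> {crit_\<alpha> F a \<sigma><..<crit_\<zeta> F a b \<sigma>} \<and> Gibbs F \<sigma> z = c)"

definition z\<^sub>2 :: "(real \<Rightarrow> real) \<Rightarrow> real \<Rightarrow> real \<Rightarrow> real \<times> real \<Rightarrow> real" where
  "z\<^sub>2 F a b = (\<lambda>(\<sigma>, c). THE z. z \<in> {crit_\<zeta> F a b \<sigma><..<crit_\<beta> F b \<sigma>} \<and> Gibbs F \<sigma> z = c)"

text \<open>The derivative of \<open>z\<close> on the closed interval, one-sided at the two end points.\<close>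
definition slope :: "real \<Rightarrow> (real \<Rightarrow> real) \<Rightarrow> real \<Rightarrow> real" where
  "slope \<epsilon> z x = vector_derivative z (at x within {-1/\<epsilon>..1/\<epsilon>})"

text \<open>Classical solutions: \<open>z\<close> is \<open>C\<^sup>1\<close> on the closed and \<open>C\<^sup>2\<close> on the open interval. Values of
  \<open>z\<close> outside the closed interval play no role.\<close>
definition simple_solution ::
  "(real \<Rightarrow> real) \<Rightarrow> real \<Rightarrow> real \<Rightarrow> (real \<Rightarrow> real) \<Rightarrow> real \<Rightarrow> bool" where
  "simple_solution F \<epsilon> r z \<sigma> \<longleftrightarrow>
     z differentiable_on {-1/\<epsilon>..1/\<epsilon>} \<and> continuous_on {-1/\<epsilon>..1/\<epsilon>} (slope \<epsilon> z) \<and>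
     slope \<epsilon> z differentiable_on {-1/\<epsilon><..<1/\<epsilon>} \<and>
     continuous_on {-1/\<epsilon><..<1/\<epsilon>} (deriv (slope \<epsilon> z)) \<and>
     (\<forall>x\<in>{-1/\<epsilon>..1/\<epsilon>}. z x > 0) \<and>
     mono_on {-1/\<epsilon>..1/\<epsilon>} z \<and> \<not> z constant_on {-1/\<epsilon>..1/\<epsilon>} \<and>
     (\<forall>x\<in>{-1/\<epsilon><..<1/\<epsilon>}.
        (deriv ^^ 2) Q (\<epsilon> * slope \<epsilon> z x) * deriv (slope \<epsilon> z) x = deriv F (z x) - \<sigma>) \<and>
     slope \<epsilon> z (-1/\<epsilon>) = 0 \<and> slope \<epsilon> z (1/\<epsilon>) = 0 \<and>
     (z has_integral (2 * r / \<epsilon>)) {-1/\<epsilon>..1/\<epsilon>}"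

text \<open>The pair \<open>(\<sigma>, c)\<close>, with \<open>c\<close> the constant in the first integral of the equation. Admissibility
  is a consequence for simple solutions and is therefore not required here.\<close>
definition corresponding_pair ::
  "(real \<Rightarrow> real) \<Rightarrow> real \<Rightarrow> (real \<Rightarrow> real) \<Rightarrow> real \<times> real \<Rightarrow> bool" where
  "corresponding_pair F \<epsilon> z = (\<lambda>(\<sigma>, c).
     \<forall>x\<in>{-1/\<epsilon>..1/\<epsilon>}. P \<epsilon> (slope \<epsilon> z x) = Gibbs F \<sigma> (z x) - c)"

end

theory Submission
  imports Defs
begin

text \<open>By the energy integral \<open>P\<^sub>\<epsilon>(z') = \<Phi>\<^sub>\<sigma>(z) - c\<close>, a simple solution traverses \<open>[z\<^sub>1, z\<^sub>2]\<close> with a speed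
  determined by \<open>(\<sigma>, c)\<close>, so that the length and the mass constraint become two equations for
  integrals over \<open>[z\<^sub>1, z\<^sub>2]\<close>. They are combined with the affine weights which are \<open>1\<close> at one
  Maxwell state and \<open>0\<close> at the other. In the coordinates \<open>p = -ln (c - \<Phi>\<^sub>\<sigma>(\<alpha>\<^sub>\<sigma>))\<close> and
  \<open>q = -ln (c - \<Phi>\<^sub>\<sigma>(\<beta>\<^sub>\<sigma>))\<close> the two weighted integrals equal \<open>p / (2 sqrt (F''(\<alpha>\<^sub>0)))\<close> and
  \<open>q / (2 sqrt (F''(\<beta>\<^sub>0)))\<close> up to an error that is small relative to
  \<open>p\<close> and \<open>q\<close> and has a small Lipschitz constant.
  Banach's fixed point theorem therefore gives exactly one admissible pair near \<open>\<Delta>\<^sub>0\<close>; its \<open>p\<close> and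
  \<open>q\<close> are of order \<open>1/\<epsilon>\<close>, whence the exponentially small deviations. Inverting the time map of the
  corresponding orbit yields a solution. Conversely, by Gronwall's inequality a solution cannot leave
  a critical state, which forces the pair of a simple solution to be admissible; a plateau at a
  turning point would force \<open>F' = \<sigma>\<close> there, so the solution runs along the orbit without rest and
  is determined by its pair.\<close>

section \<open>A single convex well\<close>

text \<open>Both integrals diverge logarithmically at the Maxwell point, so there is no regular
  limit problem to which an implicit function theorem would apply. In p and q the leading part is
  linear. The rest changes by \<open>\<theta>\<close> times the change of p and q, small because the
  wells are cut at a small distance \<open>\<eta>\<close> from their bottoms, plus a term with a
  large constant times the change of \<sigma> and c and a factor of order p + q. That term is
  harmless: \<sigma> and c depend on p and q only through exp (-p) and exp (-q). The neighborhood
  must not shrink with \<epsilon>, whereas the contraction acts on a box of radius of order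
  1/\<epsilon>; an a priori bound of order 1/\<epsilon> on p + q puts every competing pair into the
  box. The distance \<open>\<delta>\<close> of r from the Maxwell states keeps both weighted times,
  hence both p and q, of order 1/\<epsilon>. Read as a first-order equation, the energy integral is
  not Lipschitz at a turning point and would allow rests there; the second-order equation excludes
  them.\<close>

lemma FTC_interior_real:
  fixes f f' :: "real \<Rightarrow> real"
  assumes "p \<le> q" and "continuous_on {p..q} f"
    and "\<And>x. p < x \<Longrightarrow> x < q \<Longrightarrow> (f has_real_derivative f' x) (at x)"
  shows "(f' has_integral (f q - f p)) {p..q}"
  by (rule fundamental_theorem_of_calculus_interior)
     (use assms in \<open>auto simp: has_real_derivative_iff_has_vector_derivative[symmetric]\<close>)

lemma has_real_derivative_integral:
  fixes f :: "real \<Rightarrow> real"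
  assumes "continuous_on {p..q} f" and "p < x" and "x < q"
  shows "((\<lambda>x. integral {p..x} f) has_real_derivative f x) (at x)"
proof -
  have "((\<lambda>x. integral {p..x} f) has_real_derivative f x) (at x within {p..q})"
    by (rule integral_has_real_derivative) (use assms in auto)
  moreover have "at x within {p..q} = at x"
    by (rule at_within_Icc_at) (use assms in auto)
  ultimately show ?thesis by simp
qed

lemma abs_integral_diff_le:
  fixes f g k :: "real \<Rightarrow> real"
  assumes "f integrable_on S" "g integrable_on S" "k integrable_on S"
    and "\<And>x. x \<in> S \<Longrightarrow> \<bar>f x - g x\<bar> \<le> k x"
  shows "\<bar>integral S f - integral S g\<bar> \<le> integral S k"
proof -
  have "norm (integral S (\<lambda>x. f x - g x)) \<le> integral S k"
    by (rule integral_norm_bound_integral) (use assms in \<open>auto intro: integrable_diff\<close>)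
  then show ?thesis using integral_diff[OF assms(1,2)] by simp
qed

lemma abs_integral_diff_le_const:
  fixes f g :: "real \<Rightarrow> real"
  assumes "continuous_on {p..q} f" "continuous_on {p..q} g" "p \<le> q"
    and "\<And>x. x \<in> {p..q} \<Longrightarrow> \<bar>f x - g x\<bar> \<le> c"
  shows "\<bar>integral {p..q} f - integral {p..q} g\<bar> \<le> c * (q - p)"
proof -
  have "\<bar>integral {p..q} f - integral {p..q} g\<bar> \<le> integral {p..q} (\<lambda>_. c)"
    by (rule abs_integral_diff_le) (use assms in \<open>auto intro!: integrable_continuous_real\<close>)
  then show ?thesis using assms(3) by (simp add: mult.commute)
qed

lemma continuous_on_real_lipschitz:
  fixes f :: "real \<Rightarrow> real"
  assumes "\<And>x y. x \<in> S \<Longrightarrow> y \<in> S \<Longrightarrow> \<bar>f x - f y\<bar> \<le> C * \<bar>x - y\<bar>"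
  shows "continuous_on S f"
proof -
  \<comment> \<open>\<open>lipschitz_on\<close> asks for a nonnegative constant, which the
    hypothesis does not enforce when S has at most one point.\<close>
  have "lipschitz_on (max C 0) S f"
  proof (rule lipschitz_onI)
    fix x y assume "x \<in> S" "y \<in> S"
    then have "\<bar>f x - f y\<bar> \<le> C * \<bar>x - y\<bar>" by (rule assms)
    also have "\<dots> \<le> max C 0 * \<bar>x - y\<bar>" by (rule mult_right_mono) auto
    finally show "dist (f x) (f y) \<le> max C 0 * dist x y" by (simp add: dist_real_def)
  qed simp
  then show ?thesis by (rule lipschitz_on_continuous_on)
qed

text \<open>Telescoping, one factor at a time; the order of replacement decides which primed and
  unprimed factors need a bound.\<close>

lemma abs_mult3_diff_le:
  fixes p q r p' q' r' :: real
  assumes "\<bar>p - p'\<bar> \<le> dp" "\<bar>q - q'\<bar> \<le> dq" "\<bar>r - r'\<bar> \<le> dr"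
    and "\<bar>p'\<bar> \<le> Mp" "\<bar>q\<bar> \<le> Mq" "\<bar>q'\<bar> \<le> Mq" "\<bar>r\<bar> \<le> Mr"
  shows "\<bar>p * q * r - p' * q' * r'\<bar> \<le> dp * Mq * Mr + Mp * dq * Mr + Mp * Mq * dr"
proof -
  have nn: "0 \<le> dp" "0 \<le> dq" "0 \<le> dr" "0 \<le> Mp" "0 \<le> Mq" "0 \<le> Mr"
    using assms abs_ge_zero order_trans by blast+
  have "p * q * r - p' * q' * r' = (p - p') * q * r + p' * (q - q') * r + p' * q' * (r - r')"
    by (simp add: algebra_simps)
  also have "\<bar>\<dots>\<bar> \<le> \<bar>(p - p') * q * r\<bar> + \<bar>p' * (q - q') * r\<bar> + \<bar>p' * q' * (r - r')\<bar>"
    by linarith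
  also have "\<dots> = \<bar>p - p'\<bar> * \<bar>q\<bar> * \<bar>r\<bar> + \<bar>p'\<bar> * \<bar>q - q'\<bar> * \<bar>r\<bar> + \<bar>p'\<bar> * \<bar>q'\<bar> * \<bar>r - r'\<bar>"
    by (simp add: abs_mult)
  also have "\<dots> \<le> dp * Mq * Mr + Mp * dq * Mr + Mp * Mq * dr"
    by (intro add_mono mult_mono mult_nonneg_nonneg abs_ge_zero assms nn)
  finally show ?thesis .
qed

text \<open>Rationalizing gives the numerator B - A over sqrt A sqrt B (sqrt A + sqrt B), and this
  denominator is at least m sqrt m.\<close>

lemma inverse_sqrt_lipschitz:
  fixes A B m :: real
  assumes "0 < m" "m \<le> A" "m \<le> B"
  shows "\<bar>1 / sqrt A - 1 / sqrt B\<bar> \<le> \<bar>A - B\<bar> / (m * sqrt m)"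
proof -
  have s: "sqrt m > 0" "sqrt A \<ge> sqrt m" "sqrt B \<ge> sqrt m" using assms by auto
  then have pos: "sqrt A > 0" "sqrt B > 0" by linarith+
  have "A - B = (sqrt A - sqrt B) * (sqrt A + sqrt B)"
    using assms by (simp add: algebra_simps)
  then have "(1 / sqrt A - 1 / sqrt B) * (sqrt A * sqrt B * (sqrt A + sqrt B)) = B - A"
    using pos by (simp add: field_simps)
  then have eq: "1 / sqrt A - 1 / sqrt B = (B - A) / (sqrt A * sqrt B * (sqrt A + sqrt B))"
    using pos by (metis add_pos_pos mult_pos_pos nonzero_eq_divide_eq less_irrefl)
  have "m * sqrt m = sqrt m * sqrt m * sqrt m" using assms by simp
  also have "\<dots> \<le> sqrt A * sqrt B * (sqrt A + sqrt B)"
    using s pos assms(1) by (intro mult_mono) (auto intro: add_increasing2)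
  finally have "m * sqrt m \<le> sqrt A * sqrt B * (sqrt A + sqrt B)" .
  then show ?thesis unfolding eq using assms pos
    by (auto simp: abs_mult abs_divide intro!: frac_le)
qed

text \<open>\<open>slowness_factor (\<epsilon>\<^sup>2 y) / sqrt y\<close> is the reciprocal slope \<open>1/z'\<close> expressed through
  \<open>y = \<Phi>\<^sub>\<sigma>(z) - c\<close>.\<close>
definition slowness_factor :: "real \<Rightarrow> real" where
  "slowness_factor s = (1 - s) / sqrt (2 - s)"

lemma slowness_factor_bound: "0 \<le> s \<Longrightarrow> s \<le> 1 \<Longrightarrow> \<bar>slowness_factor s\<bar> \<le> 1"
  unfolding slowness_factor_def by (auto simp: abs_divide field_simps) (smt (verit) real_sqrt_ge_1_iff)

lemma slowness_factor_lipschitz: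
  assumes "0 \<le> s" "s \<le> 1" "0 \<le> t" "t \<le> 1"
  shows "\<bar>slowness_factor s - slowness_factor t\<bar> \<le> 2 * \<bar>s - t\<bar>"
proof -
  have 1: "\<bar>1 / sqrt (2 - s) - 1 / sqrt (2 - t)\<bar> \<le> \<bar>s - t\<bar>"
    using inverse_sqrt_lipschitz[of 1 "2 - s" "2 - t"] assms by simp
  have 2: "\<bar>1 / sqrt (2 - s)\<bar> \<le> 1" using assms by simp
  have "slowness_factor s - slowness_factor t = (t - s) * (1 / sqrt (2 - s)) + (1 - t) * (1 / sqrt (2 - s) - 1 / sqrt (2 - t))"
    unfolding slowness_factor_def by (simp add: algebra_simps diff_divide_distrib)
  also have "\<bar>\<dots>\<bar> \<le> \<bar>t - s\<bar> * \<bar>1 / sqrt (2 - s)\<bar> + \<bar>1 - t\<bar> * \<bar>1 / sqrt (2 - s) - 1 / sqrt (2 - t)\<bar>"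
    by (metis abs_mult abs_triangle_ineq)
  also have "\<dots> \<le> \<bar>t - s\<bar> * 1 + 1 * \<bar>s - t\<bar>"
    using assms 1 2 by (intro add_mono mult_mono) auto
  finally show ?thesis by (simp add: abs_minus_commute[of t s])
qed

lemma continuous_on_slowness_factor: "continuous_on {0..1} slowness_factor"
  by (rule continuous_on_real_lipschitz) (use slowness_factor_lipschitz in auto)

text \<open>For fixed s the root is the Euclidean norm of (sqrt (1 - s) y, sqrt s x), so this is the
  reverse triangle inequality; it holds even where the radicand vanishes and the root is not
  differentiable.\<close>

lemma sqrt_interpolation_lipschitz:
  fixes s x y x' y' :: real
  assumes "0 \<le> s" "s \<le> 1"
  shows "\<bar>sqrt ((1 - s) * y\<^sup>2 + s * x\<^sup>2) - sqrt ((1 - s) * y'\<^sup>2 + s * x'\<^sup>2)\<bar> \<le> \<bar>y - y'\<bar> + \<bar>x - x'\<bar>"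
proof -
  define v where "v x y = (sqrt (1 - s) * y, sqrt s * x)" for x y :: real
  have n: "norm (v x y) = sqrt ((1 - s) * y\<^sup>2 + s * x\<^sup>2)" for x y
    using assms by (simp add: v_def norm_Pair power_mult_distrib)
  have "\<bar>norm (v x y) - norm (v x' y')\<bar> \<le> norm (v x y - v x' y')"
    by (rule norm_triangle_ineq3)
  also have "v x y - v x' y' = v (x - x') (y - y')"
    by (simp add: v_def algebra_simps)
  also have "norm (v (x - x') (y - y')) \<le> norm (sqrt (1 - s) * (y - y')) + norm (sqrt s * (x - x'))"
    unfolding v_def by (rule norm_Pair_le)
  also have "\<dots> \<le> \<bar>y - y'\<bar> + \<bar>x - x'\<bar>"
    using assms by (auto simp: abs_mult intro!: add_mono mult_left_le_one_le)
  finally show ?thesis by (simp add: n)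
qed

lemma sqrt_interpolation_bounds:
  fixes s x y :: real
  assumes "0 \<le> s" "s \<le> 1" "0 \<le> y" "y \<le> x"
  shows "0 \<le> sqrt ((1 - s) * y\<^sup>2 + s * x\<^sup>2)" "sqrt ((1 - s) * y\<^sup>2 + s * x\<^sup>2) \<le> x"
proof -
  have "(1 - s) * y\<^sup>2 + s * x\<^sup>2 \<le> (1 - s) * x\<^sup>2 + s * x\<^sup>2"
    using assms by (intro add_mono mult_left_mono power_mono) auto
  then show "sqrt ((1 - s) * y\<^sup>2 + s * x\<^sup>2) \<le> x"
    using assms by (intro real_le_lsqrt) (auto simp: algebra_simps)
qed (use assms in auto)

text \<open>x0 is a fixed center around which the bottoms \<alpha> for different parameters move.
  \<open>rho_hi\<close> keeps the energies inside the well at most 1, so that for \<epsilon> <= 1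
  the argument of \<open>slowness_factor\<close> stays in [0, 1] and the logarithmic height is
  nonnegative.\<close>

locale well =
  fixes F F1 F2 :: "real \<Rightarrow> real" and x0 \<rho> K lo hi :: real
  assumes rho: "0 < \<rho>" and lo: "0 < lo"
    and DF: "\<And>z. \<bar>z - x0\<bar> \<le> \<rho> \<Longrightarrow> (F has_real_derivative F1 z) (at z)"
    and DF1: "\<And>z. \<bar>z - x0\<bar> \<le> \<rho> \<Longrightarrow> (F1 has_real_derivative F2 z) (at z)"
    and lip: "\<And>y z. \<bar>y - x0\<bar> \<le> \<rho> \<Longrightarrow> \<bar>z - x0\<bar> \<le> \<rho> \<Longrightarrow> \<bar>F2 y - F2 z\<bar> \<le> K * \<bar>y - z\<bar>"
    and bnd: "\<And>z. \<bar>z - x0\<bar> \<le> \<rho> \<Longrightarrow> lo \<le> F2 z \<and> F2 z \<le> hi"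
    and rho_hi: "2 * \<rho>\<^sup>2 * hi \<le> 1"
begin

lemma hi: "0 < hi" using bnd[of x0] lo rho by auto

lemma K: "0 \<le> K"
proof -
  have "0 \<le> K * \<rho>" using lip[of x0 "x0 + \<rho>"] rho by (smt (verit))
  then show ?thesis using rho by (simp add: zero_le_mult_iff)
qed

lemma cont_F2: "continuous_on {x0-\<rho>..x0+\<rho>} F2"
  by (rule continuous_on_real_lipschitz[of _ _ K], rule lip) auto

definition dom :: "real \<Rightarrow> real \<Rightarrow> bool" where
  "dom \<alpha> x \<longleftrightarrow> 0 \<le> x \<and> x0 - \<rho> \<le> \<alpha> \<and> \<alpha> + x \<le> x0 + \<rho>"

lemma dom_mono: "dom \<alpha> x \<Longrightarrow> 0 \<le> y \<Longrightarrow> y \<le> x \<Longrightarrow> dom \<alpha> y"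
  by (auto simp: dom_def)

lemma dom_abs: "dom \<alpha> x \<Longrightarrow> \<bar>\<alpha> + x - x0\<bar> \<le> \<rho>" "dom \<alpha> x \<Longrightarrow> \<bar>\<alpha> - x0\<bar> \<le> \<rho>"
  by (auto simp: dom_def)

lemma dom_Icc: "dom \<alpha> x \<Longrightarrow> \<alpha> + x \<in> {x0-\<rho>..x0+\<rho>}"
  by (auto simp: dom_def)

lemma dom_scale: "dom \<alpha> x \<Longrightarrow> 0 \<le> t \<Longrightarrow> t \<le> 1 \<Longrightarrow> dom \<alpha> (t * x)"
  by (rule dom_mono[of \<alpha> x]) (auto simp: dom_def mult_left_le_one_le)

text \<open>\<open>m1 \<alpha> x\<close> is the difference quotient \<open>(F' (\<alpha> + x) - F' \<alpha>) / x\<close>, and \<open>dd \<alpha> y x\<close> that of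
  \<open>F(\<alpha> + r) - F \<alpha> - F'(\<alpha>) r\<close> as a function of \<open>r\<^sup>2\<close>, both extended to coinciding arguments.\<close>
definition m1 :: "real \<Rightarrow> real \<Rightarrow> real" where
  "m1 \<alpha> x = integral {0..1} (\<lambda>t. F2 (\<alpha> + t * x))"

definition dd :: "real \<Rightarrow> real \<Rightarrow> real \<Rightarrow> real" where
  "dd \<alpha> y x = integral {0..1} (\<lambda>s. m1 \<alpha> (sqrt ((1 - s) * y\<^sup>2 + s * x\<^sup>2))) / 2"

lemma m1_cont: "dom \<alpha> x \<Longrightarrow> continuous_on {0..1} (\<lambda>t. F2 (\<alpha> + t * x))"
  by (rule continuous_on_compose2[OF cont_F2], intro continuous_intros, rule image_subsetI)
     (use dom_Icc[OF dom_scale[of \<alpha> x]] in auto)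

lemma m1_bounds: assumes "dom \<alpha> x" shows "lo \<le> m1 \<alpha> x" "m1 \<alpha> x \<le> hi"
proof -
  have i: "(\<lambda>t. F2 (\<alpha> + t * x)) integrable_on {0..1}"
    by (intro integrable_continuous_real m1_cont assms)
  have b: "lo \<le> F2 (\<alpha> + t * x) \<and> F2 (\<alpha> + t * x) \<le> hi" if "t \<in> {0..1}" for t
    by (rule bnd) (use dom_abs(1)[OF dom_scale[OF assms, of t]] that in auto)
  have "integral {0..1::real} (\<lambda>_. lo) \<le> m1 \<alpha> x" unfolding m1_def
    by (rule integral_le) (use b i in auto)
  moreover have "m1 \<alpha> x \<le> integral {0..1::real} (\<lambda>_. hi)" unfolding m1_def
    by (rule integral_le) (use b i in auto)
  ultimately show "lo \<le> m1 \<alpha> x" "m1 \<alpha> x \<le> hi" by auto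
qed

lemma m1_lip:
  assumes "dom \<alpha> x" "dom \<alpha>' x'"
  shows "\<bar>m1 \<alpha> x - m1 \<alpha>' x'\<bar> \<le> K * (\<bar>\<alpha> - \<alpha>'\<bar> + \<bar>x - x'\<bar>)"
proof -
  have "\<bar>F2 (\<alpha> + t * x) - F2 (\<alpha>' + t * x')\<bar> \<le> K * (\<bar>\<alpha> - \<alpha>'\<bar> + \<bar>x - x'\<bar>)" if t: "t \<in> {0..1}" for t
  proof -
    have "\<bar>F2 (\<alpha> + t * x) - F2 (\<alpha>' + t * x')\<bar> \<le> K * \<bar>(\<alpha> + t * x) - (\<alpha>' + t * x')\<bar>"
      by (rule lip) (use t dom_abs(1)[OF dom_scale[OF assms(1), of t]]
          dom_abs(1)[OF dom_scale[OF assms(2), of t]] in auto)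
    also have "(\<alpha> + t * x) - (\<alpha>' + t * x') = (\<alpha> - \<alpha>') + t * (x - x')" by (simp add: algebra_simps)
    also have "\<bar>\<dots>\<bar> \<le> \<bar>\<alpha> - \<alpha>'\<bar> + \<bar>t * (x - x')\<bar>" by (rule abs_triangle_ineq)
    also have "\<bar>t * (x - x')\<bar> \<le> \<bar>x - x'\<bar>" using t by (auto simp: abs_mult mult_left_le_one_le)
    finally show ?thesis using K by (simp add: mult_left_mono)
  qed
  from abs_integral_diff_le_const[OF m1_cont[OF assms(1)] m1_cont[OF assms(2)] _ this]
  show ?thesis by (simp add: m1_def)
qed

lemma m1_eq:
  assumes "dom \<alpha> x" shows "x * m1 \<alpha> x = F1 (\<alpha> + x) - F1 \<alpha>"
proof -
  have "((\<lambda>t. x * F2 (\<alpha> + t * x)) has_integral (F1 (\<alpha> + 1 * x) - F1 (\<alpha> + 0 * x))) {0..1}"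
  proof (rule fundamental_theorem_of_calculus)
    fix t :: real assume t: "t \<in> {0..1}"
    have "((\<lambda>t. F1 (\<alpha> + t * x)) has_real_derivative F2 (\<alpha> + t * x) * x) (at t)"
      by (rule DERIV_chain2[OF DF1]) (use t dom_abs(1)[OF dom_scale[OF assms, of t]] in
          \<open>auto intro!: derivative_eq_intros\<close>)
    then show "((\<lambda>t. F1 (\<alpha> + t * x)) has_vector_derivative x * F2 (\<alpha> + t * x)) (at t within {0..1})"
      by (simp add: has_real_derivative_iff_has_vector_derivative mult.commute
          has_vector_derivative_at_within)
  qed auto
  from integral_unique[OF this] show ?thesis by (simp add: m1_def)
qed

lemma dd_cont:
  assumes "dom \<alpha> x" "0 \<le> y" "y \<le> x"
  shows "continuous_on {0..1} (\<lambda>s. m1 \<alpha> (sqrt ((1 - s) * y\<^sup>2 + s * x\<^sup>2)))"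
proof (rule continuous_on_compose2[of "{0..x}" "m1 \<alpha>"])
  show "continuous_on {0..x} (m1 \<alpha>)"
    by (rule continuous_on_real_lipschitz[of _ _ K])
       (use m1_lip[of \<alpha> _ \<alpha>] dom_mono[OF assms(1)] in auto)
  show "(\<lambda>s. sqrt ((1 - s) * y\<^sup>2 + s * x\<^sup>2)) ` {0..1} \<subseteq> {0..x}"
    using sqrt_interpolation_bounds[OF _ _ assms(2,3)] by auto
qed (auto intro!: continuous_intros)

lemma dd_bounds:
  assumes "dom \<alpha> x" "0 \<le> y" "y \<le> x"
  shows "lo / 2 \<le> dd \<alpha> y x" "dd \<alpha> y x \<le> hi / 2"
proof -
  let ?f = "\<lambda>s. m1 \<alpha> (sqrt ((1 - s) * y\<^sup>2 + s * x\<^sup>2))"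
  have i: "?f integrable_on {0..1}"
    by (intro integrable_continuous_real dd_cont assms)
  have b: "lo \<le> ?f t \<and> ?f t \<le> hi" if "t \<in> {0..1}" for t
    using m1_bounds dom_mono[OF assms(1) sqrt_interpolation_bounds[OF _ _ assms(2,3)]] that by auto
  have "integral {0..1::real} (\<lambda>_. lo) \<le> integral {0..1} ?f"
    by (rule integral_le) (use b i in auto)
  moreover have "integral {0..1} ?f \<le> integral {0..1::real} (\<lambda>_. hi)"
    by (rule integral_le) (use b i in auto)
  ultimately show "lo / 2 \<le> dd \<alpha> y x" "dd \<alpha> y x \<le> hi / 2" by (auto simp: dd_def)
qed

lemma dd_pos:
  assumes "dom \<alpha> x" "0 \<le> y" "y \<le> x" shows "0 < dd \<alpha> y x"
  using dd_bounds(1)[OF assms] lo by auto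

text \<open>The bound stays uniform down to y = x and x = 0, which the literal quotient would not
  show; the integral form of \<open>dd\<close> serves this purpose.\<close>

lemma dd_lip:
  assumes "dom \<alpha> x" "0 \<le> y" "y \<le> x" "dom \<alpha>' x'" "0 \<le> y'" "y' \<le> x'"
  shows "\<bar>dd \<alpha> y x - dd \<alpha>' y' x'\<bar> \<le> K / 2 * (\<bar>\<alpha> - \<alpha>'\<bar> + \<bar>y - y'\<bar> + \<bar>x - x'\<bar>)"
proof -
  let ?r = "\<lambda>y x s. sqrt ((1 - s) * y\<^sup>2 + s * x\<^sup>2)"
  have "\<bar>m1 \<alpha> (?r y x s) - m1 \<alpha>' (?r y' x' s)\<bar> \<le> K * (\<bar>\<alpha> - \<alpha>'\<bar> + \<bar>y - y'\<bar> + \<bar>x - x'\<bar>)"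
    if s: "s \<in> {0..1}" for s
  proof -
    have "\<bar>m1 \<alpha> (?r y x s) - m1 \<alpha>' (?r y' x' s)\<bar> \<le> K * (\<bar>\<alpha> - \<alpha>'\<bar> + \<bar>?r y x s - ?r y' x' s\<bar>)"
      by (rule m1_lip) (use s dom_mono[OF assms(1) sqrt_interpolation_bounds[OF _ _ assms(2,3)]]
          dom_mono[OF assms(4) sqrt_interpolation_bounds[OF _ _ assms(5,6)]] in auto)
    also have "\<dots> \<le> K * (\<bar>\<alpha> - \<alpha>'\<bar> + (\<bar>y - y'\<bar> + \<bar>x - x'\<bar>))"
      using s K by (intro mult_left_mono add_left_mono sqrt_interpolation_lipschitz) auto
    finally show ?thesis by (simp add: algebra_simps)
  qed
  from abs_integral_diff_le_const[OF dd_cont[OF assms(1-3)] dd_cont[OF assms(4-6)] _ this]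
  show ?thesis by (simp add: dd_def abs_if split: if_splits)
qed

text \<open>F (\<alpha> + r) - F' (\<alpha>) r has derivative r \<open>m1\<close> in r, hence
  \<open>m1\<close> / 2 in the variable r^2; \<open>dd\<close> averages this along the segment from
  y^2 to x^2.\<close>

lemma dd_eq:
  assumes "dom \<alpha> x" "0 \<le> y" "y \<le> x"
  shows "F (\<alpha> + x) - F (\<alpha> + y) - F1 \<alpha> * (x - y) = (x\<^sup>2 - y\<^sup>2) * dd \<alpha> y x"
proof (cases "y = x")
  case False
  let ?r = "\<lambda>s. sqrt ((1 - s) * y\<^sup>2 + s * x\<^sup>2)"
  let ?G = "\<lambda>s. F (\<alpha> + ?r s) - F1 \<alpha> * ?r s"
  have d: "dom \<alpha> (?r s)" if "s \<in> {0..1}" for s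
    using dom_mono[OF assms(1) sqrt_interpolation_bounds[OF _ _ assms(2,3)]] that by auto
  have cF: "continuous_on {x0-\<rho>..x0+\<rho>} F"
    by (rule DERIV_continuous_on[of _ _ F1], rule has_field_derivative_at_within, rule DF) auto
  \<comment> \<open>For y = 0 the root is not differentiable at s = 0, so only continuity is used at
    the end points.\<close>
  have "((\<lambda>s. (x\<^sup>2 - y\<^sup>2) / 2 * m1 \<alpha> (?r s)) has_integral (?G 1 - ?G 0)) {0..1}"
  proof (rule FTC_interior_real)
    have "continuous_on {0..1} (\<lambda>s. F (\<alpha> + ?r s))"
    proof (rule continuous_on_compose2[OF cF])
      show "(\<lambda>s. \<alpha> + ?r s) ` {0..1} \<subseteq> {x0-\<rho>..x0+\<rho>}"
        by (rule image_subsetI) (rule dom_Icc[OF d])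
    qed (auto intro!: continuous_intros)
    then show "continuous_on {0..1} ?G" by (auto intro!: continuous_intros)
    fix s :: real assume s: "0 < s" "s < 1"
    have pos: "0 < (1 - s) * y\<^sup>2 + s * x\<^sup>2"
      using s assms False by (intro add_nonneg_pos mult_nonneg_nonneg mult_pos_pos) auto
    have dr: "(?r has_real_derivative (x\<^sup>2 - y\<^sup>2) / (2 * ?r s)) (at s)"
      using pos by (auto intro!: derivative_eq_intros simp: field_simps)
    have m: "?r s * m1 \<alpha> (?r s) = F1 (\<alpha> + ?r s) - F1 \<alpha>" by (rule m1_eq[OF d]) (use s in auto)
    have "(?G has_real_derivative F1 (\<alpha> + ?r s) * ((x\<^sup>2 - y\<^sup>2) / (2 * ?r s))
        - F1 \<alpha> * ((x\<^sup>2 - y\<^sup>2) / (2 * ?r s))) (at s)"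
    proof (rule DERIV_diff)
      show "((\<lambda>s. F (\<alpha> + ?r s)) has_real_derivative F1 (\<alpha> + ?r s) * ((x\<^sup>2 - y\<^sup>2) / (2 * ?r s))) (at s)"
        by (rule DERIV_chain2[OF DF])
           (use dom_abs(1)[OF d[of s]] s DERIV_add[OF DERIV_const dr, of \<alpha>] in auto)
      show "((\<lambda>s. F1 \<alpha> * ?r s) has_real_derivative F1 \<alpha> * ((x\<^sup>2 - y\<^sup>2) / (2 * ?r s))) (at s)"
        by (rule DERIV_cmult[OF dr])
    qed
    moreover have "F1 (\<alpha> + ?r s) * ((x\<^sup>2 - y\<^sup>2) / (2 * ?r s)) - F1 \<alpha> * ((x\<^sup>2 - y\<^sup>2) / (2 * ?r s))
        = (?r s * m1 \<alpha> (?r s)) * ((x\<^sup>2 - y\<^sup>2) / (2 * ?r s))"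
      unfolding m by (rule left_diff_distrib[symmetric])
    moreover have "\<dots> = (x\<^sup>2 - y\<^sup>2) / 2 * m1 \<alpha> (?r s)"
      using pos by simp
    ultimately show "(?G has_real_derivative (x\<^sup>2 - y\<^sup>2) / 2 * m1 \<alpha> (?r s)) (at s)" by metis
  qed auto
  from integral_unique[OF this]
  have "(x\<^sup>2 - y\<^sup>2) / 2 * integral {0..1} (\<lambda>s. m1 \<alpha> (?r s))
      = F (\<alpha> + x) - F1 \<alpha> * x - (F (\<alpha> + y) - F1 \<alpha> * y)" using assms by simp
  then show ?thesis by (simp add: dd_def right_diff_distrib[of "F1 \<alpha>"])
qed simp

text \<open>Controls how a bottom moves with \<sigma>: by the mean value theorem F' has slope at
  least \<open>lo\<close>.\<close>

lemma F1_inverse_lipschitz: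
  assumes "\<bar>x - x0\<bar> \<le> \<rho>" "\<bar>y - x0\<bar> \<le> \<rho>"
  shows "\<bar>x - y\<bar> \<le> \<bar>F1 x - F1 y\<bar> / lo"
proof -
  have *: "lo * (y - x) \<le> F1 y - F1 x" if "x < y" "\<bar>x - x0\<bar> \<le> \<rho>" "\<bar>y - x0\<bar> \<le> \<rho>" for x y
  proof -
    have i: "\<bar>z - x0\<bar> \<le> \<rho>" if "x \<le> z" "z \<le> y" for z
      using that \<open>\<bar>x - x0\<bar> \<le> \<rho>\<close> \<open>\<bar>y - x0\<bar> \<le> \<rho>\<close> by linarith
    have "\<exists>z>x. z < y \<and> F1 y - F1 x = (y - x) * F2 z"
      by (rule MVT2[OF that(1)]) (use i DF1 in auto)
    then obtain z where "x < z" "z < y" "F1 y - F1 x = (y - x) * F2 z" by auto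
    then show ?thesis using bnd[OF i[of z]] that(1) by (simp add: mult.commute)
  qed
  have "lo * \<bar>x - y\<bar> \<le> \<bar>F1 x - F1 y\<bar>"
    using *[of x y] *[of y x] assms by (cases x y rule: linorder_cases) (auto simp: abs_if split: if_splits)
  then show ?thesis using lo by (simp add: field_simps)
qed

end

section \<open>The regularized time integral of a weighted well\<close>

locale weighted_well = well +
  fixes \<omega> :: "real \<Rightarrow> real" and M :: real
  assumes w_bound: "\<And>z. \<bar>z - x0\<bar> \<le> \<rho> \<Longrightarrow> \<bar>\<omega> z\<bar> \<le> M"
    and w_lip: "\<And>y z. \<bar>y - x0\<bar> \<le> \<rho> \<Longrightarrow> \<bar>z - x0\<bar> \<le> \<rho> \<Longrightarrow> \<bar>\<omega> y - \<omega> z\<bar> \<le> M * \<bar>y - z\<bar>"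
begin

lemma M: "0 \<le> M" using w_bound[of x0] rho by auto

text \<open>With z = \<alpha> + y cosh t the energy above the turning level is (y sinh t)^2
  \<open>dd\<close>, and dz = y sinh t dt cancels its root. What remains is regular, also at y =
  0.\<close>

definition well_integrand :: "real \<Rightarrow> real \<Rightarrow> real \<Rightarrow> real \<Rightarrow> real" where
  "well_integrand \<epsilon> \<alpha> y t = \<omega> (\<alpha> + y * cosh t) * slowness_factor (\<epsilon>\<^sup>2 * ((y * sinh t)\<^sup>2 * dd \<alpha> y (y * cosh t)))
     * (1 / sqrt (dd \<alpha> y (y * cosh t)))"

lemma y_cosh:
  fixes y t :: real
  assumes "0 \<le> y" "0 \<le> t"
  shows "y \<le> y * cosh t" "0 \<le> y * sinh t" "y * sinh t \<le> y * cosh t"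
proof -
  show "y \<le> y * cosh t" using assms cosh_real_ge_1[of t] mult_left_mono[of 1 "cosh t" y] by simp
  show "y * sinh t \<le> y * cosh t" using assms by (intro mult_left_mono) (auto simp: sinh_le_cosh_real)
qed (use assms in auto)

lemma slowness_factor_arg_bounds:
  assumes "dom \<alpha> (y * cosh t)" "0 \<le> y" "0 \<le> t" "0 \<le> \<epsilon>" "\<epsilon> \<le> 1"
  shows "0 \<le> \<epsilon>\<^sup>2 * ((y * sinh t)\<^sup>2 * dd \<alpha> y (y * cosh t))"
    "\<epsilon>\<^sup>2 * ((y * sinh t)\<^sup>2 * dd \<alpha> y (y * cosh t)) \<le> 1"
proof -
  note yc = y_cosh[OF assms(2,3)]
  have d: "0 < dd \<alpha> y (y * cosh t)" "dd \<alpha> y (y * cosh t) \<le> hi / 2"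
    using dd_pos[OF assms(1,2) yc(1)] dd_bounds(2)[OF assms(1,2) yc(1)] by auto
  then show "0 \<le> \<epsilon>\<^sup>2 * ((y * sinh t)\<^sup>2 * dd \<alpha> y (y * cosh t))" by simp
  have "y * cosh t \<le> 2 * \<rho>" using assms(1) by (auto simp: dom_def)
  then have "(y * sinh t)\<^sup>2 \<le> (2 * \<rho>)\<^sup>2" using yc by (intro power_mono) auto
  then have "(y * sinh t)\<^sup>2 * dd \<alpha> y (y * cosh t) \<le> (2 * \<rho>)\<^sup>2 * (hi / 2)"
    using d by (intro mult_mono) auto
  also have "\<dots> \<le> 1" using rho_hi by (simp add: power_mult_distrib mult_ac)
  finally have "(y * sinh t)\<^sup>2 * dd \<alpha> y (y * cosh t) \<le> 1" .
  moreover have "\<epsilon>\<^sup>2 \<le> 1" using assms by (simp add: power_le_one)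
  ultimately show "\<epsilon>\<^sup>2 * ((y * sinh t)\<^sup>2 * dd \<alpha> y (y * cosh t)) \<le> 1"
    using mult_mono[of "\<epsilon>\<^sup>2" 1 "(y * sinh t)\<^sup>2 * dd \<alpha> y (y * cosh t)" 1] d by simp
qed

text \<open>The summands are the changes of the weight, the slowness factor and the inverse root in
  \<open>abs_mult3_diff_le\<close>; the unchanged factors enter with their bounds M, 1 and 1 / sqrt
  (\<open>lo\<close> / 2).\<close>

definition C1 :: real where
  "C1 = M * 1 * (1 / sqrt (lo / 2)) + M * (2 * (2 * \<rho> * hi + 4 * \<rho>\<^sup>2 * K)) * (1 / sqrt (lo / 2))
     + M * 1 * (K / (lo / 2 * sqrt (lo / 2)))"

lemma C1: "0 \<le> C1"
  unfolding C1_def using M K lo hi rho by (intro add_nonneg_nonneg mult_nonneg_nonneg) auto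

text \<open>At fixed t the point \<alpha> + y cosh t moves by at most |\<alpha> - \<alpha>'| + |y -
  y'| cosh t, and each factor is Lipschitz uniformly in \<epsilon> and t. The exponentially large
  cosh t is tamed only after integration.\<close>

lemma well_integrand_lip:
  assumes "dom \<alpha> (y * cosh t)" "0 \<le> y" "0 \<le> t" "0 \<le> \<epsilon>" "\<epsilon> \<le> 1"
    and "dom \<alpha>' (y' * cosh t)" "0 \<le> y'"
  shows "\<bar>well_integrand \<epsilon> \<alpha> y t - well_integrand \<epsilon> \<alpha>' y' t\<bar> \<le> C1 * (\<bar>\<alpha> - \<alpha>'\<bar> + \<bar>y - y'\<bar> * cosh t)"
proof -
  define E where "E = \<bar>\<alpha> - \<alpha>'\<bar> + \<bar>y - y'\<bar> * cosh t"
  define d where "d = dd \<alpha> y (y * cosh t)"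
  define d' where "d' = dd \<alpha>' y' (y' * cosh t)"
  note yc = y_cosh[OF assms(2,3)] and yc' = y_cosh[OF assms(7,3)]
  have d: "lo / 2 \<le> d" "d \<le> hi / 2" "lo / 2 \<le> d'" "d' \<le> hi / 2"
    unfolding d_def d'_def
    using dd_bounds[OF assms(1,2) yc(1)] dd_bounds[OF assms(6,7) yc'(1)] by auto
  have dy: "\<bar>y - y'\<bar> \<le> \<bar>y - y'\<bar> * cosh t"
    using cosh_real_ge_1[of t] mult_left_mono[of 1 "cosh t" "\<bar>y - y'\<bar>"] by simp
  have dX: "\<bar>y * cosh t - y' * cosh t\<bar> = \<bar>y - y'\<bar> * cosh t"
    by (simp add: abs_mult left_diff_distrib[symmetric])
  have E: "0 \<le> E" unfolding E_def by auto
  have dE: "\<bar>d - d'\<bar> \<le> K * E"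
  proof -
    have "\<bar>d - d'\<bar> \<le> K / 2 * (\<bar>\<alpha> - \<alpha>'\<bar> + \<bar>y - y'\<bar> + \<bar>y * cosh t - y' * cosh t\<bar>)"
      unfolding d_def d'_def by (rule dd_lip) (use assms yc yc' in auto)
    also have "\<dots> \<le> K / 2 * (2 * E)"
    proof (rule mult_left_mono)
      have "a + b + c \<le> 2 * (a + c)" if "0 \<le> a" "b \<le> c" for a b c :: real using that by simp
      from this[OF abs_ge_zero dy]
      show "\<bar>\<alpha> - \<alpha>'\<bar> + \<bar>y - y'\<bar> + \<bar>y * cosh t - y' * cosh t\<bar> \<le> 2 * E" unfolding E_def dX .
    qed (use K in simp)
    finally show ?thesis by simp
  qed
  have w: "\<bar>\<omega> (\<alpha> + y * cosh t) - \<omega> (\<alpha>' + y' * cosh t)\<bar> \<le> M * E"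
  proof -
    have "\<bar>\<omega> (\<alpha> + y * cosh t) - \<omega> (\<alpha>' + y' * cosh t)\<bar>
        \<le> M * \<bar>(\<alpha> + y * cosh t) - (\<alpha>' + y' * cosh t)\<bar>"
      by (rule w_lip) (use assms dom_abs in auto)
    also have "\<dots> \<le> M * E" unfolding E_def using dX M by (intro mult_left_mono) auto
    finally show ?thesis .
  qed
  have S: "\<bar>y * sinh t - y' * sinh t\<bar> \<le> E"
  proof -
    have "\<bar>y * sinh t - y' * sinh t\<bar> = \<bar>y - y'\<bar> * sinh t"
      using assms(3) by (simp add: abs_mult left_diff_distrib[symmetric])
    also have "\<dots> \<le> \<bar>y - y'\<bar> * cosh t"
      by (intro mult_left_mono) (auto simp: sinh_le_cosh_real)
    finally show ?thesis unfolding E_def by auto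
  qed
  have X2: "y * cosh t \<le> 2 * \<rho>" "y' * cosh t \<le> 2 * \<rho>" using assms(1,6) by (auto simp: dom_def)
  have q: "\<bar>\<epsilon>\<^sup>2 * ((y * sinh t)\<^sup>2 * d) - \<epsilon>\<^sup>2 * ((y' * sinh t)\<^sup>2 * d')\<bar>
      \<le> (2 * \<rho> * hi + 4 * \<rho>\<^sup>2 * K) * E"
  proof -
    have "\<bar>(y * sinh t)\<^sup>2 * d - (y' * sinh t)\<^sup>2 * d'\<bar>
        = \<bar>(y * sinh t - y' * sinh t) * (y * sinh t + y' * sinh t) * d + (y' * sinh t)\<^sup>2 * (d - d')\<bar>"
      by (simp add: algebra_simps power2_eq_square)
    also have "\<dots> \<le> \<bar>y * sinh t - y' * sinh t\<bar> * \<bar>y * sinh t + y' * sinh t\<bar> * \<bar>d\<bar>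
        + (y' * sinh t)\<^sup>2 * \<bar>d - d'\<bar>"
      by (rule order_trans[OF abs_triangle_ineq]) (simp add: abs_mult)
    also have "\<dots> \<le> E * (4 * \<rho>) * (hi / 2) + (2 * \<rho>)\<^sup>2 * (K * E)"
    proof -
      have "(y' * sinh t)\<^sup>2 \<le> (2 * \<rho>)\<^sup>2" by (rule power_mono) (use yc' X2 in auto)
      moreover have "\<bar>y * sinh t + y' * sinh t\<bar> \<le> 4 * \<rho>" using yc yc' X2 by auto
      moreover have "\<bar>d\<bar> \<le> hi / 2" using d lo by auto
      ultimately show ?thesis
        using S dE E K rho hi by (intro add_mono mult_mono mult_nonneg_nonneg) auto
    qed
    finally have 1: "\<bar>(y * sinh t)\<^sup>2 * d - (y' * sinh t)\<^sup>2 * d'\<bar> \<le> (2 * \<rho> * hi + 4 * \<rho>\<^sup>2 * K) * E"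
      by (simp add: algebra_simps power_mult_distrib)
    have "\<bar>\<epsilon>\<^sup>2 * ((y * sinh t)\<^sup>2 * d) - \<epsilon>\<^sup>2 * ((y' * sinh t)\<^sup>2 * d')\<bar>
        = \<epsilon>\<^sup>2 * \<bar>(y * sinh t)\<^sup>2 * d - (y' * sinh t)\<^sup>2 * d'\<bar>"
      by (simp add: right_diff_distrib[symmetric] abs_mult)
    also have "\<dots> \<le> 1 * \<bar>(y * sinh t)\<^sup>2 * d - (y' * sinh t)\<^sup>2 * d'\<bar>"
      using assms by (intro mult_right_mono) (auto simp: power_le_one)
    finally show ?thesis using 1 by simp
  qed
  note a = slowness_factor_arg_bounds[OF assms(1-5)] and a' = slowness_factor_arg_bounds[OF assms(6,7,3-5)]
  have h: "\<bar>slowness_factor (\<epsilon>\<^sup>2 * ((y * sinh t)\<^sup>2 * d)) - slowness_factor (\<epsilon>\<^sup>2 * ((y' * sinh t)\<^sup>2 * d'))\<bar>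
      \<le> 2 * (2 * \<rho> * hi + 4 * \<rho>\<^sup>2 * K) * E"
    using order_trans[OF slowness_factor_lipschitz[OF a a'] mult_left_mono[OF q[unfolded d_def d'_def], of 2]]
    unfolding d_def d'_def by (simp only: mult.assoc)
  have r: "\<bar>1 / sqrt d - 1 / sqrt d'\<bar> \<le> K * E / (lo / 2 * sqrt (lo / 2))"
  proof -
    have "\<bar>1 / sqrt d - 1 / sqrt d'\<bar> \<le> \<bar>d - d'\<bar> / (lo / 2 * sqrt (lo / 2))"
      by (rule inverse_sqrt_lipschitz) (use lo d in auto)
    also have "\<dots> \<le> K * E / (lo / 2 * sqrt (lo / 2))"
      by (rule divide_right_mono[OF dE]) (use lo in auto)
    finally show ?thesis .
  qed
  have "\<bar>well_integrand \<epsilon> \<alpha> y t - well_integrand \<epsilon> \<alpha>' y' t\<bar> \<le> M * E * 1 * (1 / sqrt (lo / 2))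
      + M * (2 * (2 * \<rho> * hi + 4 * \<rho>\<^sup>2 * K) * E) * (1 / sqrt (lo / 2))
      + M * 1 * (K * E / (lo / 2 * sqrt (lo / 2)))"
    unfolding well_integrand_def d_def[symmetric] d'_def[symmetric]
    by (rule abs_mult3_diff_le)
       (use w h r w_bound[OF dom_abs(1)[OF assms(6)]] slowness_factor_bound[OF a] slowness_factor_bound[OF a'] d lo
         in \<open>auto simp: d_def d'_def intro!: divide_left_mono\<close>)
  also have "\<dots> = C1 * E" unfolding C1_def by (simp add: algebra_simps add_divide_distrib)
  finally show ?thesis unfolding E_def .
qed

lemma well_integrand_cont:
  assumes "dom \<alpha> (y * cosh T)" "0 \<le> y" "0 \<le> T" "0 \<le> \<epsilon>" "\<epsilon> \<le> 1"
  shows "continuous_on {0..T} (well_integrand \<epsilon> \<alpha> y)"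
proof -
  have d: "dom \<alpha> (y * cosh t)" if "t \<in> {0..T}" for t
    by (rule dom_mono[OF assms(1)])
       (use that assms in \<open>auto intro!: mult_left_mono simp: cosh_real_nonneg_le_iff\<close>)
  have yle: "y \<le> y * cosh t" if "t \<in> {0..T}" for t using y_cosh(1) assms that by auto
  have cd: "continuous_on {0..T} (\<lambda>t. dd \<alpha> y (y * cosh t))"
  proof (rule continuous_on_compose2[of "{y..y * cosh T}" "dd \<alpha> y"])
    show "continuous_on {y..y * cosh T} (dd \<alpha> y)"
      by (rule continuous_on_real_lipschitz[of _ _ "K/2"])
         (use dd_lip[of \<alpha> _ y \<alpha> _ y] dom_mono[OF assms(1)] assms(2) in auto)
    show "(\<lambda>t. y * cosh t) ` {0..T} \<subseteq> {y..y * cosh T}"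
      using yle assms by (auto intro!: mult_left_mono simp: cosh_real_nonneg_le_iff)
  qed (auto intro!: continuous_intros)
  have cw: "continuous_on {x0-\<rho>..x0+\<rho>} \<omega>"
    by (rule continuous_on_real_lipschitz[of _ _ M], rule w_lip) auto
  have dp: "0 < dd \<alpha> y (y * cosh t)" if "t \<in> {0..T}" for t
    using dd_pos[OF d assms(2) yle] that by auto
  have "continuous_on {0..T} (\<lambda>t. \<omega> (\<alpha> + y * cosh t))"
    by (rule continuous_on_compose2[OF cw], intro continuous_intros, rule image_subsetI)
       (use dom_Icc[OF d] in auto)
  moreover have "continuous_on {0..T} (\<lambda>t. slowness_factor (\<epsilon>\<^sup>2 * ((y * sinh t)\<^sup>2 * dd \<alpha> y (y * cosh t))))"
    by (rule continuous_on_compose2[OF continuous_on_slowness_factor])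
       (use slowness_factor_arg_bounds[OF d] assms cd in \<open>auto intro!: continuous_intros\<close>)
  moreover have "continuous_on {0..T} (\<lambda>t. 1 / sqrt (dd \<alpha> y (y * cosh t)))"
    using dp cd by (fastforce intro!: continuous_intros)
  ultimately show ?thesis unfolding well_integrand_def by (intro continuous_on_mult)
qed

text \<open>The value of t at which z reaches the cut x0 + \<eta>. The cut is fixed relative to x0
  and not to \<alpha>, so that the remaining middle interval is the same for all parameters.\<close>

definition te :: "real \<Rightarrow> real \<Rightarrow> real \<Rightarrow> real" where
  "te \<eta> \<alpha> y = arcosh ((x0 + \<eta> - \<alpha>) / y)"

definition half_time :: "real \<Rightarrow> real \<Rightarrow> real \<Rightarrow> real \<Rightarrow> real" where
  "half_time \<epsilon> \<eta> \<alpha> y = integral {0..te \<eta> \<alpha> y} (well_integrand \<epsilon> \<alpha> y)"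

text \<open>The substitution \<open>z = \<alpha> + y cosh t\<close> removes the square-root singularity at the turning point
  \<open>z = \<alpha> + y\<close>.\<close>
lemma half_time_has_integral:
  assumes "0 < y" "x0 - \<rho> \<le> \<alpha>" "\<alpha> + y < x0 + \<eta>" "\<eta> \<le> \<rho>" "0 \<le> \<epsilon>" "\<epsilon> \<le> 1"
  defines "Y \<equiv> \<lambda>z. F z - F1 \<alpha> * z - (F (\<alpha> + y) - F1 \<alpha> * (\<alpha> + y))"
  shows "((\<lambda>z. \<omega> z * slowness_factor (\<epsilon>\<^sup>2 * Y z) / sqrt (Y z)) has_integral half_time \<epsilon> \<eta> \<alpha> y) {\<alpha> + y..x0 + \<eta>}"
proof -
  define T where "T = te \<eta> \<alpha> y"
  let ?t = "\<lambda>z. arcosh ((z - \<alpha>) / y)"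
  have x: "1 < (x0 + \<eta> - \<alpha>) / y" using assms by (simp add: field_simps)
  have T: "0 < T" using x unfolding T_def te_def by (subst arcosh_real_gt_1_iff) auto
  have dT: "dom \<alpha> (y * cosh T)"
    using assms x by (auto simp: T_def te_def dom_def)
  have cg: "continuous_on {0..T} (well_integrand \<epsilon> \<alpha> y)"
    by (rule well_integrand_cont) (use dT assms T in auto)
  \<comment> \<open>\<open>arcosh\<close> has an infinite derivative at the turning point, so the
    primitive is only continuous there and the fundamental theorem is applied in its interior
    form.\<close>
  have "((\<lambda>z. \<omega> z * slowness_factor (\<epsilon>\<^sup>2 * Y z) / sqrt (Y z)) has_integral
      (integral {0..?t (x0 + \<eta>)} (well_integrand \<epsilon> \<alpha> y) - integral {0..?t (\<alpha> + y)} (well_integrand \<epsilon> \<alpha> y))) {\<alpha> + y..x0 + \<eta>}"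
  proof (rule FTC_interior_real)
    have tm: "?t z \<in> {0..T}" if "z \<in> {\<alpha> + y..x0 + \<eta>}" for z
    proof -
      have "1 \<le> (z - \<alpha>) / y" using that assms by (simp add: field_simps)
      moreover have "(z - \<alpha>) / y \<le> (x0 + \<eta> - \<alpha>) / y" using that assms by (simp add: divide_right_mono)
      ultimately show ?thesis unfolding T_def te_def
        using arcosh_real_strict_mono[of "(z - \<alpha>) / y" "(x0 + \<eta> - \<alpha>) / y"]
        by (cases "(z - \<alpha>) / y = (x0 + \<eta> - \<alpha>) / y") (auto simp del: arcosh_less_iff_real)
    qed
    show "continuous_on {\<alpha> + y..x0 + \<eta>} (\<lambda>z. integral {0..?t z} (well_integrand \<epsilon> \<alpha> y))"
    proof (rule continuous_on_compose2[of "{0..T}" "\<lambda>s. integral {0..s} (well_integrand \<epsilon> \<alpha> y)"])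
      show "continuous_on {0..T} (\<lambda>s. integral {0..s} (well_integrand \<epsilon> \<alpha> y))"
        by (intro indefinite_integral_continuous_1 integrable_continuous_real cg)
      show "continuous_on {\<alpha> + y..x0 + \<eta>} ?t"
        using assms(1) by (auto intro!: continuous_intros simp: field_simps)
    qed (use tm in blast)
    fix z assume z: "\<alpha> + y < z" "z < x0 + \<eta>"
    define s where "s = ?t z"
    have z1: "1 < (z - \<alpha>) / y" using z assms by (simp add: field_simps)
    have s0: "0 < s" "s < T"
      using z1 z assms x unfolding s_def T_def te_def
      by (auto intro!: divide_strict_right_mono)
    have c: "y * cosh s = z - \<alpha>" using z1 assms(1) by (simp add: s_def)
    have sh: "(y * sinh s)\<^sup>2 = (z - \<alpha>)\<^sup>2 - y\<^sup>2"
    proof -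
      have "(y * sinh s)\<^sup>2 = y\<^sup>2 * ((cosh s)\<^sup>2 - 1)" by (simp add: power_mult_distrib cosh_square_eq)
      also have "\<dots> = (y * cosh s)\<^sup>2 - y\<^sup>2" by (simp add: algebra_simps power_mult_distrib)
      finally show ?thesis by (simp add: c)
    qed
    have dz: "dom \<alpha> (z - \<alpha>)" using z assms by (auto simp: dom_def)
    have Yz: "Y z = ((z - \<alpha>)\<^sup>2 - y\<^sup>2) * dd \<alpha> y (z - \<alpha>)"
      using dd_eq[OF dz, of y] assms(1) z by (simp add: Y_def algebra_simps)
    have pos: "0 < (z - \<alpha>)\<^sup>2 - y\<^sup>2"
      using z assms(1) power_strict_mono[of y "z - \<alpha>" 2] by simp
    have dt: "(?t has_real_derivative (1 / y) / sqrt (((z - \<alpha>) / y)\<^sup>2 - 1)) (at z)"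
    proof -
      have "((\<lambda>z. (z - \<alpha>) / y) has_real_derivative 1 / y) (at z)"
        using assms(1) by (auto intro!: derivative_eq_intros)
      from DERIV_chain2[OF arcosh_real_has_field_derivative[OF z1] this]
      show ?thesis by (simp add: mult.commute)
    qed
    have "sqrt (((z - \<alpha>) / y)\<^sup>2 - 1) = sqrt ((z - \<alpha>)\<^sup>2 - y\<^sup>2) / y"
    proof -
      have "((z - \<alpha>) / y)\<^sup>2 - 1 = ((z - \<alpha>)\<^sup>2 - y\<^sup>2) / y\<^sup>2"
        by (subst power_divide) (use assms(1) in \<open>simp add: diff_divide_distrib[of "(z - \<alpha>)\<^sup>2"]\<close>)
      then show ?thesis using assms(1) by (simp add: real_sqrt_divide)
    qed
    then have dt: "(?t has_real_derivative 1 / sqrt ((z - \<alpha>)\<^sup>2 - y\<^sup>2)) (at z)"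
      using dt assms(1) by simp
    have "((\<lambda>z. integral {0..?t z} (well_integrand \<epsilon> \<alpha> y)) has_real_derivative
        well_integrand \<epsilon> \<alpha> y s * (1 / sqrt ((z - \<alpha>)\<^sup>2 - y\<^sup>2))) (at z)"
      unfolding s_def
      by (rule DERIV_chain2[OF has_real_derivative_integral[OF cg]])
         (use s0 dt in \<open>auto simp: s_def\<close>)
    moreover have "well_integrand \<epsilon> \<alpha> y s * (1 / sqrt ((z - \<alpha>)\<^sup>2 - y\<^sup>2)) = \<omega> z * slowness_factor (\<epsilon>\<^sup>2 * Y z) / sqrt (Y z)"
      unfolding well_integrand_def c sh Yz by (simp add: real_sqrt_mult)
    ultimately show "((\<lambda>z. integral {0..?t z} (well_integrand \<epsilon> \<alpha> y)) has_real_derivative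
        \<omega> z * slowness_factor (\<epsilon>\<^sup>2 * Y z) / sqrt (Y z)) (at z)" by simp
  qed (use assms in auto)
  then show ?thesis using assms(1) by (simp add: half_time_def te_def)
qed

end

section \<open>Logarithmic growth of the time spent in a well\<close>

lemma ln_lipschitz:
  fixes A B m :: real
  assumes "0 < m" "m \<le> A" "m \<le> B"
  shows "\<bar>ln A - ln B\<bar> \<le> \<bar>A - B\<bar> / m"
proof -
  have "ln x - ln y \<le> \<bar>A - B\<bar> / m" if "m \<le> x" "m \<le> y" "\<bar>x - y\<bar> = \<bar>A - B\<bar>" for x y :: real
  proof -
    have "ln x - ln y \<le> (x - y) / y" by (rule ln_diff_le) (use that assms in auto)
    also have "\<dots> \<le> \<bar>x - y\<bar> / m" using that assms by (intro frac_le) auto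
    finally show ?thesis using that by simp
  qed
  from this[OF assms(2,3) refl] this[OF assms(3,2) abs_minus_commute] show ?thesis
    by (intro abs_leI) simp_all
qed

text \<open>The mean value inequality for ln read backwards: a change of y costs only y times the
  change of its logarithm. It turns errors in y into errors in the logarithmic coordinates.\<close>

lemma abs_diff_le_ln:
  fixes x y :: real
  assumes "0 < x" "0 < y"
  shows "\<bar>x - y\<bar> \<le> max x y * \<bar>ln x - ln y\<bar>"
proof -
  have *: "y - x \<le> y * (ln y - ln x)" if "0 < x" "0 < y" for x y :: real
    using ln_diff_le[OF that] that by (simp add: field_simps)
  show ?thesis
  proof (cases "x \<le> y")
    case True
    then show ?thesis using *[of x y] assms by (auto simp: abs_if max_def)
  next
    case False
    then show ?thesis using *[of y x] assms by (auto simp: abs_if max_def)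
  qed
qed

lemma sqrt_lipschitz:
  fixes A B m :: real
  assumes "0 < m" "m\<^sup>2 \<le> A" "m\<^sup>2 \<le> B"
  shows "\<bar>sqrt A - sqrt B\<bar> \<le> \<bar>A - B\<bar> / (2 * m)"
proof -
  have s: "m \<le> sqrt A" "m \<le> sqrt B" using assms by (auto intro: real_le_rsqrt)
  have AB: "0 \<le> A" "0 \<le> B" using assms zero_le_power2[of m] by linarith+
  have "A - B = (sqrt A - sqrt B) * (sqrt A + sqrt B)"
    using AB by (simp add: algebra_simps)
  then have "\<bar>A - B\<bar> = \<bar>sqrt A - sqrt B\<bar> * \<bar>sqrt A + sqrt B\<bar>" by (simp add: abs_mult)
  moreover have "2 * m \<le> \<bar>sqrt A + sqrt B\<bar>" using s by simp
  ultimately have "\<bar>sqrt A - sqrt B\<bar> * (2 * m) \<le> \<bar>A - B\<bar>" by (simp add: mult_left_mono)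
  then show ?thesis using assms by (simp add: field_simps)
qed

context weighted_well
begin

text \<open>The value of the integrand at the bottom, hence the coefficient of the logarithm. It is
  0 for a weight that vanishes at x0, which is what decouples the two wells.\<close>

definition bottom_integrand :: real where "bottom_integrand = \<omega> x0 / sqrt (F2 x0)"

lemma well_integrand_center: "well_integrand \<epsilon> x0 0 t = bottom_integrand"
proof -
  have "m1 x0 0 = F2 x0" by (simp add: m1_def)
  then have "dd x0 0 0 = F2 x0 / 2" by (simp add: dd_def)
  then have "sqrt 2 * sqrt (dd x0 0 0) = sqrt (F2 x0)" by (simp add: real_sqrt_mult[symmetric])
  then show ?thesis by (simp add: well_integrand_def bottom_integrand_def slowness_factor_def)
qed

text \<open>The margins keep bottom and turning point well inside the cut: \<open>xe\<close> stays
  between \<eta>/2 and 3\<eta>/2 and is at least 2y.\<close>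

definition ok :: "real \<Rightarrow> real \<Rightarrow> real \<Rightarrow> bool" where
  "ok \<eta> \<alpha> y \<longleftrightarrow> 0 < \<eta> \<and> \<eta> \<le> \<rho> \<and> \<bar>\<alpha> - x0\<bar> \<le> \<eta> / 2 \<and> 0 < y \<and> y \<le> \<eta> / 4"

definition xe :: "real \<Rightarrow> real \<Rightarrow> real" where "xe \<eta> \<alpha> = x0 + \<eta> - \<alpha>"

text \<open>As arcosh (x/y) = ln ((x + sqrt (x^2 - y^2)) / y), this is what remains of
  \<open>te\<close> after splitting off - ln y; it is bounded and Lipschitz as y tends to 0.\<close>

definition NN :: "real \<Rightarrow> real \<Rightarrow> real \<Rightarrow> real" where
  "NN \<eta> \<alpha> y = ln (xe \<eta> \<alpha> + sqrt ((xe \<eta> \<alpha>)\<^sup>2 - y\<^sup>2))"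

lemma okD:
  assumes "ok \<eta> \<alpha> y"
  shows "0 < \<eta>" "\<eta> \<le> \<rho>" "0 < y" "y \<le> \<eta> / 4" "\<eta> / 2 \<le> xe \<eta> \<alpha>" "xe \<eta> \<alpha> \<le> 3 * \<eta> / 2" "1 < xe \<eta> \<alpha> / y"
    "dom \<alpha> (xe \<eta> \<alpha>)" "2 * y \<le> xe \<eta> \<alpha>"
proof -
  have "x0 - \<eta> / 2 \<le> \<alpha>" "\<alpha> \<le> x0 + \<eta> / 2" using assms unfolding ok_def abs_le_iff by linarith+
  with assms show "0 < \<eta>" "\<eta> \<le> \<rho>" "0 < y" "y \<le> \<eta> / 4" "\<eta> / 2 \<le> xe \<eta> \<alpha>" "xe \<eta> \<alpha> \<le> 3 * \<eta> / 2" "1 < xe \<eta> \<alpha> / y"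
    "dom \<alpha> (xe \<eta> \<alpha>)" "2 * y \<le> xe \<eta> \<alpha>"
    by (auto simp: ok_def xe_def dom_def)
qed

lemma cosh_te: "ok \<eta> \<alpha> y \<Longrightarrow> cosh (te \<eta> \<alpha> y) = xe \<eta> \<alpha> / y"
  using okD(7)[of \<eta> \<alpha> y] by (simp add: te_def xe_def)

lemma te_pos: "ok \<eta> \<alpha> y \<Longrightarrow> 0 < te \<eta> \<alpha> y"
  using okD(7)[of \<eta> \<alpha> y] unfolding te_def xe_def by (subst arcosh_real_gt_1_iff) auto

lemma NN_arg:
  assumes "ok \<eta> \<alpha> y"
  shows "\<eta> / 2 \<le> xe \<eta> \<alpha> + sqrt ((xe \<eta> \<alpha>)\<^sup>2 - y\<^sup>2)" "xe \<eta> \<alpha> + sqrt ((xe \<eta> \<alpha>)\<^sup>2 - y\<^sup>2) \<le> 3 * \<eta>"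
    "(\<eta> / 4)\<^sup>2 \<le> (xe \<eta> \<alpha>)\<^sup>2 - y\<^sup>2"
proof -
  note o = okD[OF assms]
  have "(\<eta> / 2)\<^sup>2 \<le> (xe \<eta> \<alpha>)\<^sup>2" "y\<^sup>2 \<le> (\<eta> / 4)\<^sup>2" using o by (auto intro!: power_mono)
  moreover have "(\<eta> / 4)\<^sup>2 + (\<eta> / 4)\<^sup>2 \<le> (\<eta> / 2)\<^sup>2" by (simp add: power2_eq_square)
  ultimately show 3: "(\<eta> / 4)\<^sup>2 \<le> (xe \<eta> \<alpha>)\<^sup>2 - y\<^sup>2" by linarith
  then have "0 \<le> (xe \<eta> \<alpha>)\<^sup>2 - y\<^sup>2" by (rule order_trans[OF zero_le_power2])
  then have "0 \<le> sqrt ((xe \<eta> \<alpha>)\<^sup>2 - y\<^sup>2)" by simp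
  then show "\<eta> / 2 \<le> xe \<eta> \<alpha> + sqrt ((xe \<eta> \<alpha>)\<^sup>2 - y\<^sup>2)" using o by linarith
  have "sqrt ((xe \<eta> \<alpha>)\<^sup>2 - y\<^sup>2) \<le> xe \<eta> \<alpha>" using o 3 zero_le_power2[of "\<eta> / 4"] zero_le_power2[of y]
    by (intro real_le_lsqrt) linarith+
  then show "xe \<eta> \<alpha> + sqrt ((xe \<eta> \<alpha>)\<^sup>2 - y\<^sup>2) \<le> 3 * \<eta>" using o by linarith
qed

lemma te_eq:
  assumes "ok \<eta> \<alpha> y" shows "te \<eta> \<alpha> y = - ln y + NN \<eta> \<alpha> y"
proof -
  note o = okD[OF assms]
  have "sqrt ((xe \<eta> \<alpha> / y)\<^sup>2 - 1) = sqrt ((xe \<eta> \<alpha>)\<^sup>2 - y\<^sup>2) / y"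
  proof -
    have "(xe \<eta> \<alpha> / y)\<^sup>2 - 1 = ((xe \<eta> \<alpha>)\<^sup>2 - y\<^sup>2) / y\<^sup>2"
      by (subst power_divide) (use o(3) in \<open>simp add: diff_divide_distrib[of "(xe \<eta> \<alpha>)\<^sup>2"]\<close>)
    then show ?thesis using o(3) by (simp add: real_sqrt_divide)
  qed
  then have "te \<eta> \<alpha> y = ln ((xe \<eta> \<alpha> + sqrt ((xe \<eta> \<alpha>)\<^sup>2 - y\<^sup>2)) / y)"
    using o(7) by (simp add: te_def xe_def[symmetric] arcosh_real_def add_divide_distrib)
  also have "\<dots> = NN \<eta> \<alpha> y - ln y"
    unfolding NN_def using o(1,3) NN_arg(1)[OF assms] by (subst ln_div) auto
  finally show ?thesis by simp
qed

lemma NN_bound: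
  assumes "ok \<eta> \<alpha> y" shows "\<bar>NN \<eta> \<alpha> y\<bar> \<le> \<bar>ln (\<eta> / 2)\<bar> + \<bar>ln (3 * \<eta>)\<bar>"
proof -
  note o = okD[OF assms] and n = NN_arg[OF assms]
  have "ln (\<eta> / 2) \<le> NN \<eta> \<alpha> y" unfolding NN_def using o n by (subst ln_le_cancel_iff) linarith+
  moreover have "NN \<eta> \<alpha> y \<le> ln (3 * \<eta>)" unfolding NN_def using o n by (subst ln_le_cancel_iff) linarith+
  ultimately show ?thesis by linarith
qed

lemma NN_lip:
  assumes "ok \<eta> \<alpha> y" "ok \<eta> \<alpha>' y'"
  shows "\<bar>NN \<eta> \<alpha> y - NN \<eta> \<alpha>' y'\<bar> \<le> 14 / \<eta> * \<bar>\<alpha> - \<alpha>'\<bar> + 2 / \<eta> * \<bar>y - y'\<bar>"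
proof -
  note o = okD[OF assms(1)] and o' = okD[OF assms(2)]
  define x x' where "x = xe \<eta> \<alpha>" and "x' = xe \<eta> \<alpha>'"
  have xd: "\<bar>x - x'\<bar> = \<bar>\<alpha> - \<alpha>'\<bar>" by (simp add: x_def x'_def xe_def)
  have "\<bar>(x\<^sup>2 - y\<^sup>2) - (x'\<^sup>2 - y'\<^sup>2)\<bar> = \<bar>(x - x') * (x + x') - (y - y') * (y + y')\<bar>"
    by (simp add: algebra_simps power2_eq_square)
  also have "\<dots> \<le> \<bar>x - x'\<bar> * \<bar>x + x'\<bar> + \<bar>y - y'\<bar> * \<bar>y + y'\<bar>"
    by (rule order_trans[OF abs_triangle_ineq4]) (simp add: abs_mult)
  also have "\<dots> \<le> \<bar>\<alpha> - \<alpha>'\<bar> * (3 * \<eta>) + \<bar>y - y'\<bar> * (\<eta> / 2)"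
    unfolding xd using o o' by (intro add_mono mult_left_mono) (auto simp: x_def x'_def)
  finally have 1: "\<bar>(x\<^sup>2 - y\<^sup>2) - (x'\<^sup>2 - y'\<^sup>2)\<bar> \<le> \<bar>\<alpha> - \<alpha>'\<bar> * (3 * \<eta>) + \<bar>y - y'\<bar> * (\<eta> / 2)" .
  have "\<bar>sqrt (x\<^sup>2 - y\<^sup>2) - sqrt (x'\<^sup>2 - y'\<^sup>2)\<bar> \<le> \<bar>(x\<^sup>2 - y\<^sup>2) - (x'\<^sup>2 - y'\<^sup>2)\<bar> / (2 * (\<eta> / 4))"
    using NN_arg(3)[OF assms(1)] NN_arg(3)[OF assms(2)] o(1)
    by (intro sqrt_lipschitz) (auto simp: x_def x'_def)
  also have "\<dots> \<le> (\<bar>\<alpha> - \<alpha>'\<bar> * (3 * \<eta>) + \<bar>y - y'\<bar> * (\<eta> / 2)) / (2 * (\<eta> / 4))"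
    using 1 o(1) by (intro divide_right_mono) auto
  also have "\<dots> = 6 * \<bar>\<alpha> - \<alpha>'\<bar> + \<bar>y - y'\<bar>" using o(1) by (simp add: field_simps)
  finally have 2: "\<bar>sqrt (x\<^sup>2 - y\<^sup>2) - sqrt (x'\<^sup>2 - y'\<^sup>2)\<bar> \<le> 6 * \<bar>\<alpha> - \<alpha>'\<bar> + \<bar>y - y'\<bar>" .
  have "\<bar>NN \<eta> \<alpha> y - NN \<eta> \<alpha>' y'\<bar>
      \<le> \<bar>(x + sqrt (x\<^sup>2 - y\<^sup>2)) - (x' + sqrt (x'\<^sup>2 - y'\<^sup>2))\<bar> / (\<eta> / 2)"
    unfolding NN_def x_def x'_def using NN_arg(1)[OF assms(1)] NN_arg(1)[OF assms(2)] o(1)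
    by (intro ln_lipschitz) auto
  also have "\<dots> \<le> (7 * \<bar>\<alpha> - \<alpha>'\<bar> + \<bar>y - y'\<bar>) / (\<eta> / 2)"
  proof (rule divide_right_mono)
    have "\<bar>(x + sqrt (x\<^sup>2 - y\<^sup>2)) - (x' + sqrt (x'\<^sup>2 - y'\<^sup>2))\<bar>
        \<le> \<bar>x - x'\<bar> + \<bar>sqrt (x\<^sup>2 - y\<^sup>2) - sqrt (x'\<^sup>2 - y'\<^sup>2)\<bar>"
      by (rule abs_diff_triangle_ineq)
    also have "\<dots> \<le> \<bar>\<alpha> - \<alpha>'\<bar> + (6 * \<bar>\<alpha> - \<alpha>'\<bar> + \<bar>y - y'\<bar>)" unfolding xd by (rule add_left_mono[OF 2])
    finally show "\<bar>(x + sqrt (x\<^sup>2 - y\<^sup>2)) - (x' + sqrt (x'\<^sup>2 - y'\<^sup>2))\<bar> \<le> 7 * \<bar>\<alpha> - \<alpha>'\<bar> + \<bar>y - y'\<bar>" by simp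
  qed (use o(1) in simp)
  also have "\<dots> = 14 / \<eta> * \<bar>\<alpha> - \<alpha>'\<bar> + 2 / \<eta> * \<bar>y - y'\<bar>"
    using o(1) by (simp add: field_simps)
  finally show ?thesis .
qed

lemma dom_te:
  assumes "ok \<eta> \<alpha> y" "0 \<le> t" "t \<le> te \<eta> \<alpha> y"
  shows "dom \<alpha> (y * cosh t)" "y * cosh t \<le> xe \<eta> \<alpha>"
proof -
  note o = okD[OF assms(1)]
  have "cosh t \<le> cosh (te \<eta> \<alpha> y)" using assms by (simp add: cosh_real_nonneg_le_iff)
  then have "cosh t \<le> xe \<eta> \<alpha> / y" by (simp add: cosh_te[OF assms(1)])
  then show "y * cosh t \<le> xe \<eta> \<alpha>" using o(3) by (simp add: field_simps)
  then show "dom \<alpha> (y * cosh t)"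
    using o(3) cosh_real_ge_1[of t] by (intro dom_mono[OF o(8)]) auto
qed

lemma well_integrand_te_cont:
  assumes "ok \<eta> \<alpha> y" "0 \<le> \<epsilon>" "\<epsilon> \<le> 1"
  shows "continuous_on {0..te \<eta> \<alpha> y} (well_integrand \<epsilon> \<alpha> y)"
  by (rule well_integrand_cont) (use okD[OF assms(1)] dom_te[OF assms(1), of "te \<eta> \<alpha> y"] te_pos[OF assms(1)] assms in auto)

text \<open>The displacements |\<alpha> - x0| and y cosh t stay below \<eta>/2 and 3\<eta>/2 on the
  whole range of t, although that range becomes infinite as y tends to 0. Smallness thus comes from
  the cut alone.\<close>

lemma well_integrand_near_center:
  assumes "ok \<eta> \<alpha> y" "0 \<le> t" "t \<le> te \<eta> \<alpha> y" "0 \<le> \<epsilon>" "\<epsilon> \<le> 1"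
  shows "\<bar>well_integrand \<epsilon> \<alpha> y t - bottom_integrand\<bar> \<le> 2 * C1 * \<eta>"
proof -
  note o = okD[OF assms(1)] and d = dom_te[OF assms(1-3)]
  have "\<bar>well_integrand \<epsilon> \<alpha> y t - well_integrand \<epsilon> x0 0 t\<bar> \<le> C1 * (\<bar>\<alpha> - x0\<bar> + \<bar>y - 0\<bar> * cosh t)"
    by (rule well_integrand_lip) (use o d assms rho in \<open>auto simp: dom_def\<close>)
  also have "\<dots> \<le> C1 * (2 * \<eta>)"
    using C1 o d assms(1) by (intro mult_left_mono) (auto simp: ok_def)
  finally show ?thesis by (simp add: well_integrand_center)
qed

lemma half_time_estimate:
  assumes "ok \<eta> \<alpha> y" "0 \<le> \<epsilon>" "\<epsilon> \<le> 1"
  shows "\<bar>half_time \<epsilon> \<eta> \<alpha> y - bottom_integrand * te \<eta> \<alpha> y\<bar> \<le> 2 * C1 * \<eta> * te \<eta> \<alpha> y"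
  using abs_integral_diff_le_const[OF well_integrand_te_cont[OF assms], of "\<lambda>_. bottom_integrand" "2 * C1 * \<eta>"]
    well_integrand_near_center[OF assms(1) _ _ assms(2,3)] te_pos[OF assms(1)]
  by (simp add: half_time_def mult.commute)

text \<open>On the shorter range both integrands are defined and the Lipschitz bound applies; on the
  excess range the integrand is compared with its bottom value.\<close>

lemma half_time_diff_aux:
  assumes "ok \<eta> \<alpha> y" "ok \<eta> \<alpha>' y'" "0 \<le> \<epsilon>" "\<epsilon> \<le> 1" "te \<eta> \<alpha> y \<le> te \<eta> \<alpha>' y'"
  shows "\<bar>(half_time \<epsilon> \<eta> \<alpha> y - half_time \<epsilon> \<eta> \<alpha>' y') - bottom_integrand * (te \<eta> \<alpha> y - te \<eta> \<alpha>' y')\<bar>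
    \<le> C1 * (\<bar>\<alpha> - \<alpha>'\<bar> * te \<eta> \<alpha> y + 3 / 2 * \<eta> * \<bar>ln y - ln y'\<bar>)
      + 2 * C1 * \<eta> * \<bar>te \<eta> \<alpha> y - te \<eta> \<alpha>' y'\<bar>"
proof -
  note o = okD[OF assms(1)] and o' = okD[OF assms(2)]
  define T T' where "T = te \<eta> \<alpha> y" and "T' = te \<eta> \<alpha>' y'"
  have T: "0 < T" "T \<le> T'" using te_pos[OF assms(1)] assms(5) by (auto simp: T_def T'_def)
  have c: "continuous_on {0..T} (well_integrand \<epsilon> \<alpha> y)" "continuous_on {0..T'} (well_integrand \<epsilon> \<alpha>' y')"
    using well_integrand_te_cont assms by (auto simp: T_def T'_def)
  have c': "continuous_on {0..T} (well_integrand \<epsilon> \<alpha>' y')" "continuous_on {T..T'} (well_integrand \<epsilon> \<alpha>' y')"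
    by (rule continuous_on_subset[OF c(2)], use T in auto)+
  have split: "half_time \<epsilon> \<eta> \<alpha>' y' = integral {0..T} (well_integrand \<epsilon> \<alpha>' y') + integral {T..T'} (well_integrand \<epsilon> \<alpha>' y')"
    unfolding half_time_def T'_def[symmetric]
    by (rule Henstock_Kurzweil_Integration.integral_combine[symmetric])
       (use T c in \<open>auto intro: integrable_continuous_real\<close>)
  have 1: "\<bar>integral {T..T'} (well_integrand \<epsilon> \<alpha>' y') - integral {T..T'} (\<lambda>_. bottom_integrand)\<bar> \<le> 2 * C1 * \<eta> * (T' - T)"
    by (rule abs_integral_diff_le_const)
       (use c' T well_integrand_near_center[OF assms(2) _ _ assms(3,4)] in \<open>auto simp: T'_def\<close>)
  have "\<bar>integral {0..T} (well_integrand \<epsilon> \<alpha> y) - integral {0..T} (well_integrand \<epsilon> \<alpha>' y')\<bar>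
      \<le> integral {0..T} (\<lambda>t. C1 * (\<bar>\<alpha> - \<alpha>'\<bar> + \<bar>y - y'\<bar> * cosh t))"
  proof (rule abs_integral_diff_le)
    fix t assume "t \<in> {0..T}"
    then show "\<bar>well_integrand \<epsilon> \<alpha> y t - well_integrand \<epsilon> \<alpha>' y' t\<bar> \<le> C1 * (\<bar>\<alpha> - \<alpha>'\<bar> + \<bar>y - y'\<bar> * cosh t)"
      by (intro well_integrand_lip) (use o o' T assms dom_te[OF assms(1)] dom_te[OF assms(2)] in \<open>auto simp: T_def T'_def\<close>)
  qed (use c c' in \<open>auto intro!: integrable_continuous_real continuous_intros\<close>)
  also have "integral {0..T} (\<lambda>t. C1 * (\<bar>\<alpha> - \<alpha>'\<bar> + \<bar>y - y'\<bar> * cosh t))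
      = C1 * (\<bar>\<alpha> - \<alpha>'\<bar> * T + \<bar>y - y'\<bar> * sinh T)"
  proof -
    have "((\<lambda>t. C1 * (\<bar>\<alpha> - \<alpha>'\<bar> + \<bar>y - y'\<bar> * cosh t)) has_integral
        (C1 * (\<bar>\<alpha> - \<alpha>'\<bar> * T + \<bar>y - y'\<bar> * sinh T) - C1 * (\<bar>\<alpha> - \<alpha>'\<bar> * 0 + \<bar>y - y'\<bar> * sinh 0))) {0..T}"
      by (rule FTC_interior_real)
         (use T in \<open>auto intro!: continuous_intros derivative_eq_intros\<close>)
    then have "((\<lambda>t. C1 * (\<bar>\<alpha> - \<alpha>'\<bar> + \<bar>y - y'\<bar> * cosh t)) has_integral
        (C1 * (\<bar>\<alpha> - \<alpha>'\<bar> * T + \<bar>y - y'\<bar> * sinh T))) {0..T}" by simp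
    then show ?thesis by (rule integral_unique)
  qed
  \<comment> \<open>The decisive cancellation: |y - y'| is at most the larger of y and y' times the
    change of the logarithm, and that larger one times sinh T is at most \<open>xe\<close>, because
    T is the shorter of the two times. The exponential growth is gone and a factor \<eta> is
    left.\<close>
  also have "\<bar>y - y'\<bar> * sinh T \<le> 3 / 2 * \<eta> * \<bar>ln y - ln y'\<bar>"
  proof -
    have b: "z * sinh T \<le> 3 / 2 * \<eta>" if "z = max y y'" for z
    proof (cases "y \<le> y'")
      case True
      have "y' * sinh T \<le> y' * cosh T" using o'(3) by (intro mult_left_mono) (auto simp: sinh_le_cosh_real)
      also have "\<dots> \<le> y' * cosh T'" using o'(3) T by (intro mult_left_mono) (auto simp: cosh_real_nonneg_le_iff)
      also have "\<dots> = xe \<eta> \<alpha>'" using o'(3) by (simp add: T'_def cosh_te[OF assms(2)])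
      finally show ?thesis using o' True that by (simp add: max_def)
    next
      case False
      have "y * sinh T \<le> y * cosh T" using o(3) by (intro mult_left_mono) (auto simp: sinh_le_cosh_real)
      also have "\<dots> = xe \<eta> \<alpha>" using o(3) by (simp add: T_def cosh_te[OF assms(1)])
      finally show ?thesis using o False that by (simp add: max_def)
    qed
    have "\<bar>y - y'\<bar> * sinh T \<le> (max y y' * \<bar>ln y - ln y'\<bar>) * sinh T"
      using T o o' by (intro mult_right_mono abs_diff_le_ln) auto
    also have "\<dots> = (max y y' * sinh T) * \<bar>ln y - ln y'\<bar>" by simp
    also have "\<dots> \<le> 3 / 2 * \<eta> * \<bar>ln y - ln y'\<bar>" by (intro mult_right_mono b) auto
    finally show ?thesis .
  qed
  finally have 2: "\<bar>integral {0..T} (well_integrand \<epsilon> \<alpha> y) - integral {0..T} (well_integrand \<epsilon> \<alpha>' y')\<bar>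
      \<le> C1 * (\<bar>\<alpha> - \<alpha>'\<bar> * T + 3 / 2 * \<eta> * \<bar>ln y - ln y'\<bar>)"
    using C1 by (simp add: mult_left_mono)
  have "(half_time \<epsilon> \<eta> \<alpha> y - half_time \<epsilon> \<eta> \<alpha>' y') - bottom_integrand * (T - T')
      = (integral {0..T} (well_integrand \<epsilon> \<alpha> y) - integral {0..T} (well_integrand \<epsilon> \<alpha>' y'))
       - (integral {T..T'} (well_integrand \<epsilon> \<alpha>' y') - integral {T..T'} (\<lambda>_. bottom_integrand))"
    using T unfolding split by (simp add: half_time_def T_def[symmetric] algebra_simps)
  moreover have "\<bar>T - T'\<bar> = T' - T" using T by simp
  ultimately show ?thesis using order_trans[OF abs_triangle_ineq4 add_mono[OF 2 1]]
    unfolding T_def[symmetric] T'_def[symmetric] by simp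
qed

lemma half_time_diff:
  assumes "ok \<eta> \<alpha> y" "ok \<eta> \<alpha>' y'" "0 \<le> \<epsilon>" "\<epsilon> \<le> 1"
  shows "\<bar>(half_time \<epsilon> \<eta> \<alpha> y - half_time \<epsilon> \<eta> \<alpha>' y') - bottom_integrand * (te \<eta> \<alpha> y - te \<eta> \<alpha>' y')\<bar>
    \<le> C1 * (\<bar>\<alpha> - \<alpha>'\<bar> * max (te \<eta> \<alpha> y) (te \<eta> \<alpha>' y') + 3 / 2 * \<eta> * \<bar>ln y - ln y'\<bar>)
      + 2 * C1 * \<eta> * \<bar>te \<eta> \<alpha> y - te \<eta> \<alpha>' y'\<bar>" (is "_ \<le> ?R \<alpha> y \<alpha>' y'")
proof -
  have *: "\<bar>(half_time \<epsilon> \<eta> \<alpha> y - half_time \<epsilon> \<eta> \<alpha>' y') - bottom_integrand * (te \<eta> \<alpha> y - te \<eta> \<alpha>' y')\<bar> \<le> ?R \<alpha> y \<alpha>' y'"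
    if "ok \<eta> \<alpha> y" "ok \<eta> \<alpha>' y'" "te \<eta> \<alpha> y \<le> te \<eta> \<alpha>' y'" for \<alpha> y \<alpha>' y'
    by (rule order_trans[OF half_time_diff_aux[OF that(1,2) assms(3,4) that(3)]])
       (use C1 in \<open>auto intro!: add_right_mono mult_left_mono\<close>)
  show ?thesis
  proof (cases "te \<eta> \<alpha> y \<le> te \<eta> \<alpha>' y'")
    case False
    have "\<bar>(half_time \<epsilon> \<eta> \<alpha> y - half_time \<epsilon> \<eta> \<alpha>' y') - bottom_integrand * (te \<eta> \<alpha> y - te \<eta> \<alpha>' y')\<bar>
      = \<bar>(half_time \<epsilon> \<eta> \<alpha>' y' - half_time \<epsilon> \<eta> \<alpha> y) - bottom_integrand * (te \<eta> \<alpha>' y' - te \<eta> \<alpha> y)\<bar>"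
      by (simp add: algebra_simps abs_if)
    also have "\<dots> \<le> ?R \<alpha>' y' \<alpha> y" using False assms by (intro *) auto
    finally show ?thesis by (simp add: abs_minus_commute max.commute)
  qed (use * assms in auto)
qed

text \<open>Minus the logarithm of the energy between the turning level and the bottom: the
  coordinate p or q seen from a single well.\<close>

definition log_height :: "real \<Rightarrow> real \<Rightarrow> real" where
  "log_height \<alpha> y = - ln (F (\<alpha> + y) - F \<alpha> - F1 \<alpha> * y)"

lemma log_height_eq:
  assumes "dom \<alpha> y" "0 < y"
  shows "log_height \<alpha> y = - 2 * ln y - ln (dd \<alpha> 0 y)"
proof -
  have "F (\<alpha> + y) - F \<alpha> - F1 \<alpha> * y = y\<^sup>2 * dd \<alpha> 0 y" using dd_eq[OF assms(1), of 0] assms by simp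
  moreover have "0 < dd \<alpha> 0 y" using dd_pos[OF assms(1)] assms by simp
  ultimately show ?thesis using assms by (simp add: log_height_def ln_mult_pos ln_realpow)
qed

lemma log_height_lip:
  assumes "ok \<eta> \<alpha> y" "ok \<eta> \<alpha>' y'"
  shows "\<bar>(log_height \<alpha> y - log_height \<alpha>' y') - 2 * (ln y' - ln y)\<bar> \<le> K / lo * (\<bar>\<alpha> - \<alpha>'\<bar> + \<bar>y - y'\<bar>)"
proof -
  note o = okD[OF assms(1)] and o' = okD[OF assms(2)]
  have d: "dom \<alpha> y" "dom \<alpha>' y'" using o o' by (auto intro: dom_mono)
  have "(log_height \<alpha> y - log_height \<alpha>' y') - 2 * (ln y' - ln y) = ln (dd \<alpha>' 0 y') - ln (dd \<alpha> 0 y)"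
    using o o' d by (simp add: log_height_eq)
  also have "\<bar>\<dots>\<bar> \<le> \<bar>dd \<alpha>' 0 y' - dd \<alpha> 0 y\<bar> / (lo / 2)"
    by (rule ln_lipschitz) (use d lo o o' in \<open>auto intro!: dd_bounds[simplified]\<close>)
  also have "\<dots> \<le> (K / 2 * (\<bar>\<alpha>' - \<alpha>\<bar> + \<bar>0 - 0\<bar> + \<bar>y' - y\<bar>)) / (lo / 2)"
    by (intro divide_right_mono dd_lip) (use d lo o o' in auto)
  also have "\<dots> = K / lo * (\<bar>\<alpha> - \<alpha>'\<bar> + \<bar>y - y'\<bar>)"
    using lo by (simp add: abs_minus_commute field_simps)
  finally show ?thesis .
qed

lemma log_height_bound:
  assumes "ok \<eta> \<alpha> y"
  shows "\<bar>log_height \<alpha> y + 2 * ln y\<bar> \<le> \<bar>ln (lo / 2)\<bar> + \<bar>ln (hi / 2)\<bar>"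
proof -
  note o = okD[OF assms(1)]
  have d: "dom \<alpha> y" using o by (auto intro: dom_mono)
  have b: "lo / 2 \<le> dd \<alpha> 0 y" "dd \<alpha> 0 y \<le> hi / 2" using dd_bounds[OF d, of 0] o by auto
  have "ln (lo / 2) \<le> ln (dd \<alpha> 0 y)" using b lo by (subst ln_le_cancel_iff) auto
  moreover have "ln (dd \<alpha> 0 y) \<le> ln (hi / 2)" using b lo hi by (subst ln_le_cancel_iff) auto
  ultimately show ?thesis using log_height_eq[OF d o(3)] by linarith
qed

lemma log_height_nonneg:
  assumes "ok \<eta> \<alpha> y" shows "0 \<le> log_height \<alpha> y"
proof -
  note o = okD[OF assms(1)]
  have d: "dom \<alpha> y" using o by (auto intro: dom_mono)
  have b: "0 < dd \<alpha> 0 y" "dd \<alpha> 0 y \<le> hi / 2" using dd_bounds[OF d, of 0] dd_pos[OF d, of 0] o by auto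
  have e: "F (\<alpha> + y) - F \<alpha> - F1 \<alpha> * y = y\<^sup>2 * dd \<alpha> 0 y" using dd_eq[OF d, of 0] o by simp
  have "y\<^sup>2 * dd \<alpha> 0 y \<le> \<rho>\<^sup>2 * (hi / 2)" using b o by (intro mult_mono power_mono) auto
  also have "\<dots> \<le> 1" using rho_hi rho hi by simp
  finally show ?thesis using b o by (simp add: log_height_def e)
qed

text \<open>The second estimate is a Lipschitz bound on the error of the first. Only
  \<open>\<theta>\<close> multiplies the change of height; the large C comes with the displacement
  of the bottom and with a factor of the height, as the displacement is felt along the whole time
  spent.\<close>

definition log_estimate :: "real \<Rightarrow> real \<Rightarrow> real \<Rightarrow> real \<Rightarrow> bool" where
  "log_estimate \<theta> \<eta> Y C \<longleftrightarrow>
       (\<forall>\<epsilon> \<alpha> y. 0 \<le> \<epsilon> \<and> \<epsilon> \<le> 1 \<and> \<bar>\<alpha> - x0\<bar> \<le> \<eta> / 2 \<and> 0 < y \<and> y \<le> Y \<longrightarrow>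
          0 \<le> log_height \<alpha> y \<and> \<bar>half_time \<epsilon> \<eta> \<alpha> y - bottom_integrand / 2 * log_height \<alpha> y\<bar> \<le> \<theta> * log_height \<alpha> y + C \<and>
          (\<forall>\<alpha>' y'. \<bar>\<alpha>' - x0\<bar> \<le> \<eta> / 2 \<and> 0 < y' \<and> y' \<le> Y \<longrightarrow>
            \<bar>(half_time \<epsilon> \<eta> \<alpha> y - half_time \<epsilon> \<eta> \<alpha>' y') - bottom_integrand / 2 * (log_height \<alpha> y - log_height \<alpha>' y')\<bar>
              \<le> \<theta> * \<bar>log_height \<alpha> y - log_height \<alpha>' y'\<bar> + C * (1 + max (log_height \<alpha> y) (log_height \<alpha>' y')) * \<bar>\<alpha> - \<alpha>'\<bar>))"

text \<open>The order of choices matters: \<eta> is small depending on \<theta> and makes the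
  integrand nearly constant, then Y is small depending on \<eta> and makes the nonlogarithmic
  corrections negligible; only C may be large.\<close>

lemma half_time_log_estimate:
  assumes "0 < \<theta>"
  obtains \<eta>0 where "0 < \<eta>0" "\<eta>0 \<le> \<rho>"
    "\<And>\<eta>. 0 < \<eta> \<Longrightarrow> \<eta> \<le> \<eta>0 \<Longrightarrow> \<exists>Y>0. \<exists>C\<ge>0. Y \<le> \<eta> / 4 \<and> log_estimate \<theta> \<eta> Y C"
proof -
  \<comment> \<open>Gives 8 \<open>C1\<close> \<eta> <= \<theta>, with + 1 against division by zero.
    The terms (3/2 + 2) \<open>C1\<close> \<eta> l below then use at most half of \<theta>.\<close>
  define \<eta>0 where "\<eta>0 = min \<rho> (\<theta> / (8 * C1 + 1))"
  have e0: "0 < \<eta>0" "\<eta>0 \<le> \<rho>" using rho assms C1 by (auto simp: \<eta>0_def)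
  show thesis
  proof (rule that[OF e0])
    fix \<eta> :: real assume eta: "0 < \<eta>" "\<eta> \<le> \<eta>0"
    have C1e: "C1 * \<eta> \<le> \<theta> / 8"
    proof -
      have "8 * (C1 * \<eta>) \<le> (8 * C1 + 1) * \<eta>0" using mult_mono[of "8 * C1" "8 * C1 + 1" \<eta> \<eta>0] eta C1 by simp
      also have "\<dots> \<le> (8 * C1 + 1) * (\<theta> / (8 * C1 + 1))" using C1 by (intro mult_left_mono) (auto simp: \<eta>0_def)
      also have "\<dots> = \<theta>" using C1 by simp
      finally show ?thesis by simp
    qed
    define g where "g = \<bar>bottom_integrand\<bar> + 2 * C1 * \<eta>"
    define k where "k = K / lo"
    define N where "N = \<bar>ln (\<eta> / 2)\<bar> + \<bar>ln (3 * \<eta>)\<bar>"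
    define D where "D = \<bar>ln (lo / 2)\<bar> + \<bar>ln (hi / 2)\<bar>"
    \<comment> \<open>Collects the coefficients of Y l met below: Y B <= \<theta>/2 lets them use
      the other half of \<theta>, and Y B <= 1 allows l to be absorbed in the step from logarithms
      to heights.\<close>
    define B where "B = g * (2 / \<eta>) + \<bar>bottom_integrand\<bar> * k + k + 1"
    define Y where "Y = min (\<eta> / 4) (min 1 (min (1 / B) (\<theta> / (2 * B))))"
    have nn: "0 \<le> g" "0 \<le> k" "0 \<le> N" "0 \<le> D" "0 \<le> C1"
      using C1 eta K lo by (auto simp: g_def k_def N_def D_def)
    have B: "1 \<le> B" unfolding B_def using nn eta by (simp add: add_nonneg_nonneg)
    have Y: "0 < Y" "Y \<le> \<eta> / 4" "Y \<le> 1" using B eta assms by (auto simp: Y_def)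
    have YB: "Y * B \<le> 1" "Y * B \<le> \<theta> / 2"
    proof -
      have "Y \<le> 1 / B" "Y \<le> \<theta> / (2 * B)" by (auto simp: Y_def)
      then show "Y * B \<le> 1" "Y * B \<le> \<theta> / 2" using B by (auto simp: field_simps)
    qed
    define C where "C = (\<bar>bottom_integrand\<bar> + 2 * C1 * \<eta>) * (N + D) + \<theta> * k + g * (14 / \<eta>) + \<bar>bottom_integrand\<bar> * k
        + C1 * (1 + N + D)"
    have Cnn: "0 \<le> C" unfolding C_def using nn eta assms by (intro add_nonneg_nonneg mult_nonneg_nonneg) auto
    have okI: "ok \<eta> \<alpha> y" if "\<bar>\<alpha> - x0\<bar> \<le> \<eta> / 2" "0 < y" "y \<le> Y" for \<alpha> y
      using that eta e0 Y by (auto simp: ok_def)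
    have bounds: "0 \<le> log_height \<alpha> y" "\<bar>te \<eta> \<alpha> y - log_height \<alpha> y / 2\<bar> \<le> N + D" "0 < te \<eta> \<alpha> y"
      if "ok \<eta> \<alpha> y" for \<alpha> y
    proof -
      have "\<bar>te \<eta> \<alpha> y + ln y\<bar> \<le> N" using te_eq[OF that] NN_bound[OF that] by (simp add: N_def)
      moreover have "\<bar>log_height \<alpha> y + 2 * ln y\<bar> \<le> D" using log_height_bound[OF that] by (simp add: D_def)
      ultimately show "\<bar>te \<eta> \<alpha> y - log_height \<alpha> y / 2\<bar> \<le> N + D" by linarith
    qed (use log_height_nonneg te_pos that in auto)
    have est: "\<bar>half_time \<epsilon> \<eta> \<alpha> y - bottom_integrand / 2 * log_height \<alpha> y\<bar> \<le> \<theta> * log_height \<alpha> y + C"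
      if "ok \<eta> \<alpha> y" "0 \<le> \<epsilon>" "\<epsilon> \<le> 1" for \<epsilon> \<alpha> y
    proof -
      note b = bounds[OF that(1)]
      have "half_time \<epsilon> \<eta> \<alpha> y - bottom_integrand / 2 * log_height \<alpha> y
          = (half_time \<epsilon> \<eta> \<alpha> y - bottom_integrand * te \<eta> \<alpha> y) + bottom_integrand * (te \<eta> \<alpha> y - log_height \<alpha> y / 2)"
        by (simp add: algebra_simps)
      also have "\<bar>\<dots>\<bar> \<le> 2 * C1 * \<eta> * te \<eta> \<alpha> y + \<bar>bottom_integrand\<bar> * (N + D)"
        by (rule order_trans[OF abs_triangle_ineq], rule add_mono[OF half_time_estimate[OF that]])
           (use b in \<open>auto simp: abs_mult intro!: mult_left_mono\<close>)
      also have "2 * C1 * \<eta> * te \<eta> \<alpha> y \<le> 2 * C1 * \<eta> * (log_height \<alpha> y / 2 + (N + D))"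
        using b nn eta by (intro mult_left_mono) (auto simp: abs_le_iff)
      also have "\<dots> = (C1 * \<eta>) * log_height \<alpha> y + 2 * C1 * \<eta> * (N + D)" by (simp add: algebra_simps)
      also have "(C1 * \<eta>) * log_height \<alpha> y \<le> \<theta> * log_height \<alpha> y"
        using C1e assms b by (intro mult_right_mono) auto
      finally have "\<bar>half_time \<epsilon> \<eta> \<alpha> y - bottom_integrand / 2 * log_height \<alpha> y\<bar>
          \<le> \<theta> * log_height \<alpha> y + (2 * C1 * \<eta> * (N + D) + \<bar>bottom_integrand\<bar> * (N + D))" by simp
      also have "2 * C1 * \<eta> * (N + D) + \<bar>bottom_integrand\<bar> * (N + D) \<le> C"
      proof -
        have "0 \<le> \<theta> * k + g * (14 / \<eta>) + \<bar>bottom_integrand\<bar> * k + C1 * (1 + N + D)"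
          using nn eta assms by (intro add_nonneg_nonneg mult_nonneg_nonneg) auto
        then show ?thesis unfolding C_def by (simp add: algebra_simps)
      qed
      finally show ?thesis by simp
    qed
    have dif: "\<bar>(half_time \<epsilon> \<eta> \<alpha> y - half_time \<epsilon> \<eta> \<alpha>' y') - bottom_integrand / 2 * (log_height \<alpha> y - log_height \<alpha>' y')\<bar>
              \<le> \<theta> * \<bar>log_height \<alpha> y - log_height \<alpha>' y'\<bar> + C * (1 + max (log_height \<alpha> y) (log_height \<alpha>' y')) * \<bar>\<alpha> - \<alpha>'\<bar>"
      if o: "ok \<eta> \<alpha> y" "ok \<eta> \<alpha>' y'" and yY: "y \<le> Y" "y' \<le> Y" and eps: "0 \<le> \<epsilon>" "\<epsilon> \<le> 1"
      for \<epsilon> \<alpha> y \<alpha>' y'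
    proof -
      note b = bounds[OF o(1)] and b' = bounds[OF o(2)]
      define T T' where "T = te \<eta> \<alpha> y" and "T' = te \<eta> \<alpha>' y'"
      define p p' where "p = log_height \<alpha> y" and "p' = log_height \<alpha>' y'"
      define l where "l = \<bar>ln y - ln y'\<bar>"
      define a where "a = \<bar>\<alpha> - \<alpha>'\<bar>"
      have yp: "0 < y" "0 < y'" using o okD(3) by auto
      have dy: "\<bar>y - y'\<bar> \<le> Y * l"
        unfolding l_def by (rule order_trans[OF abs_diff_le_ln[OF yp]]) (use yY in \<open>auto intro: mult_right_mono\<close>)
      have ann: "0 \<le> a" "0 \<le> l" by (auto simp: a_def l_def)
      have dT: "\<bar>(T - T') - (ln y' - ln y)\<bar> \<le> 14 / \<eta> * a + 2 / \<eta> * (Y * l)"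
      proof -
        have "(T - T') - (ln y' - ln y) = NN \<eta> \<alpha> y - NN \<eta> \<alpha>' y'"
          by (simp add: T_def T'_def te_eq o)
        also have "\<bar>\<dots>\<bar> \<le> 14 / \<eta> * a + 2 / \<eta> * \<bar>y - y'\<bar>" unfolding a_def by (rule NN_lip[OF o])
        also have "\<dots> \<le> 14 / \<eta> * a + 2 / \<eta> * (Y * l)"
          using dy eta by (intro add_left_mono mult_left_mono) auto
        finally show ?thesis .
      qed
      define n where "n = 14 / \<eta> * a + 2 / \<eta> * (Y * l)"
      have dT: "\<bar>(T - T') - (ln y' - ln y)\<bar> \<le> n" using dT by (simp add: n_def)
      have dp: "\<bar>(p - p') / 2 - (ln y' - ln y)\<bar> \<le> k / 2 * (a + Y * l)"
      proof -
        have "\<bar>(p - p') - 2 * (ln y' - ln y)\<bar> \<le> k * (a + \<bar>y - y'\<bar>)"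
          unfolding p_def p'_def k_def a_def by (rule log_height_lip[OF o])
        also have "\<dots> \<le> k * (a + Y * l)" using dy nn by (intro mult_left_mono) auto
        finally have h: "\<bar>(p - p') - 2 * (ln y' - ln y)\<bar> \<le> k * (a + Y * l)" .
        have "(p - p') / 2 - (ln y' - ln y) = ((p - p') - 2 * (ln y' - ln y)) / 2"
          by (simp add: diff_divide_distrib)
        then show ?thesis using h by (simp only: abs_divide) simp
      qed
      have "\<bar>(half_time \<epsilon> \<eta> \<alpha> y - half_time \<epsilon> \<eta> \<alpha>' y') - bottom_integrand * (T - T')\<bar>
          \<le> C1 * (a * max T T' + 3 / 2 * \<eta> * l) + 2 * C1 * \<eta> * \<bar>T - T'\<bar>"
        using half_time_diff[OF o eps] by (simp add: T_def T'_def a_def l_def)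
      also have "\<dots> \<le> C1 * (a * max T T' + 3 / 2 * \<eta> * l) + 2 * C1 * \<eta> * (l + n)"
      proof -
        have "\<bar>T - T'\<bar> \<le> l + n" using dT by (auto simp: l_def)
        then show ?thesis using nn eta by (intro add_left_mono mult_left_mono) auto
      qed
      finally have 1: "\<bar>(half_time \<epsilon> \<eta> \<alpha> y - half_time \<epsilon> \<eta> \<alpha>' y') - bottom_integrand * (T - T')\<bar>
          \<le> C1 * (a * max T T' + 3 / 2 * \<eta> * l) + 2 * C1 * \<eta> * (l + n)" .
      have 2: "\<bar>bottom_integrand * (T - T') - bottom_integrand / 2 * (p - p')\<bar> \<le> \<bar>bottom_integrand\<bar> * (n + k / 2 * (a + Y * l))"
      proof -
        have "\<bar>bottom_integrand * (T - T') - bottom_integrand / 2 * (p - p')\<bar> = \<bar>bottom_integrand\<bar> * \<bar>(T - T') - (p - p') / 2\<bar>"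
          by (simp add: abs_mult[symmetric] algebra_simps)
        also have "\<bar>(T - T') - (p - p') / 2\<bar> \<le> n + k / 2 * (a + Y * l)" using dT dp by linarith
        finally show ?thesis by (simp add: mult_left_mono)
      qed
      have m: "max T T' \<le> max p p' / 2 + (N + D)"
        using b(2) b'(2) by (auto simp: T_def T'_def p_def p'_def abs_le_iff max_def)
      \<comment> \<open>Passes from the change of ln y to the change of height; the term k Y l on
        the right is at most l and is absorbed on the left.\<close>
      have ll: "l \<le> \<bar>p - p'\<bar> + k * a"
      proof -
        have "(k * Y) * l \<le> 1 * l"
        proof (rule mult_right_mono)
          have "k * Y \<le> B * Y" using Y nn eta by (intro mult_right_mono) (auto simp: B_def)
          then show "k * Y \<le> 1" using YB by (simp add: mult.commute)
        qed (use ann in simp)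
        then have "k * Y * l \<le> l" by simp
        moreover have "l \<le> \<bar>p - p'\<bar> / 2 + k / 2 * (a + Y * l)"
        proof -
          have "l \<le> \<bar>(p - p') / 2\<bar> + \<bar>(p - p') / 2 - (ln y' - ln y)\<bar>" unfolding l_def by linarith
          also have "\<dots> \<le> \<bar>(p - p') / 2\<bar> + k / 2 * (a + Y * l)" by (rule add_left_mono[OF dp])
          finally show ?thesis by simp
        qed
        moreover have "k / 2 * (a + Y * l) = (k * a + k * Y * l) / 2" by (simp add: algebra_simps)
        moreover have "l \<le> X + A" if "Z \<le> l" "l \<le> X / 2 + W" "W = (A + Z) / 2" for X A Z W :: real
          using that by (simp add: add_divide_distrib)
        ultimately show ?thesis by blast
      qed
      have f1: "7 / 2 * (C1 * \<eta>) \<le> \<theta> / 2" using C1e assms by linarith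
      have f2: "0 \<le> g * (14 / \<eta>)" using nn eta by simp
      have f3: "\<bar>bottom_integrand\<bar> * k / 2 \<le> \<bar>bottom_integrand\<bar> * k" using nn by simp
      have "\<bar>(half_time \<epsilon> \<eta> \<alpha> y - half_time \<epsilon> \<eta> \<alpha>' y') - bottom_integrand / 2 * (p - p')\<bar>
          \<le> (C1 * (a * max T T' + 3 / 2 * \<eta> * l) + 2 * C1 * \<eta> * (l + n))
            + \<bar>bottom_integrand\<bar> * (n + k / 2 * (a + Y * l))"
        using 1 2 by linarith
      also have "\<dots> = C1 * a * max T T' + (7 / 2 * (C1 * \<eta>)) * l + g * (14 / \<eta>) * a
          + (Y * (g * (2 / \<eta>) + \<bar>bottom_integrand\<bar> * k / 2)) * l + \<bar>bottom_integrand\<bar> * k / 2 * a"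
        by (simp add: n_def g_def algebra_simps)
      also have "\<dots> \<le> C1 * a * (max p p' / 2 + (N + D)) + (\<theta> / 2) * l + g * (14 / \<eta>) * a
          + (\<theta> / 2) * l + \<bar>bottom_integrand\<bar> * k * a"
      proof (intro add_mono mult_left_mono mult_right_mono m)
        have "Y * (g * (2 / \<eta>) + \<bar>bottom_integrand\<bar> * k / 2) \<le> Y * B"
          unfolding B_def using Y nn by (intro mult_left_mono) auto
        then show "Y * (g * (2 / \<eta>) + \<bar>bottom_integrand\<bar> * k / 2) \<le> \<theta> / 2" using YB by linarith
      qed (fact f1 f2 f3 | (use nn ann assms in \<open>simp; fail\<close>))+
      also have "\<dots> = \<theta> * l + (C1 * (max p p' / 2 + (N + D)) + g * (14 / \<eta>) + \<bar>bottom_integrand\<bar> * k) * a"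
        by (simp add: algebra_simps)
      also have "\<dots> \<le> \<theta> * (\<bar>p - p'\<bar> + k * a) + (C1 * (max p p' / 2 + (N + D)) + g * (14 / \<eta>) + \<bar>bottom_integrand\<bar> * k) * a"
        using ll assms by (intro add_right_mono mult_left_mono) auto
      also have "\<dots> = \<theta> * \<bar>p - p'\<bar> + (C1 * (max p p' / 2 + (N + D)) + (\<theta> * k + g * (14 / \<eta>) + \<bar>bottom_integrand\<bar> * k) * 1) * a"
        by (simp add: algebra_simps)
      also have "\<dots> \<le> \<theta> * \<bar>p - p'\<bar> + (C * (1 + max p p')) * a"
      proof (intro add_left_mono mult_right_mono)
        define P where "P = max p p'"
        have P: "0 \<le> P" using b(1) by (auto simp: P_def p_def)
        define R where "R = \<theta> * k + g * (14 / \<eta>) + \<bar>bottom_integrand\<bar> * k"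
        have R: "0 \<le> R" unfolding R_def using nn eta assms by (intro add_nonneg_nonneg mult_nonneg_nonneg) auto
        have "C1 * (P / 2 + (N + D)) + R * 1 \<le> C1 * ((1 + N + D) * (1 + P)) + R * (1 + P)"
        proof (intro add_mono mult_left_mono)
          have "0 \<le> (N + D) * P" using nn P by simp
          then show "P / 2 + (N + D) \<le> (1 + N + D) * (1 + P)" using P by (simp add: algebra_simps)
        qed (use nn P R in auto)
        also have "\<dots> \<le> C * (1 + P)"
        proof -
          have "0 \<le> g * (N + D) * (1 + P)" using nn P by simp
          moreover have "C = g * (N + D) + R + C1 * (1 + N + D)" by (simp add: C_def R_def g_def)
          ultimately show ?thesis by (simp add: algebra_simps)
        qed
        finally show "C1 * (max p p' / 2 + (N + D)) + (\<theta> * k + g * (14 / \<eta>) + \<bar>bottom_integrand\<bar> * k) * 1 \<le> C * (1 + max p p')"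
          by (simp add: P_def R_def)
      qed (use ann in auto)
      finally show ?thesis by (simp add: p_def p'_def a_def)
    qed
    show "\<exists>Y>0. \<exists>C\<ge>0. Y \<le> \<eta> / 4 \<and> log_estimate \<theta> \<eta> Y C"
      unfolding log_estimate_def
      by (rule exI[of _ Y], rule conjI[OF Y(1)], rule exI[of _ C])
         (use Cnn Y(2) bounds(1) est dif okI in blast)
  qed
qed

end

section \<open>The double-well potential\<close>

lemma deriv_pos_imp_less:
  fixes f f' :: "real \<Rightarrow> real"
  assumes "x < y" "\<And>z. x \<le> z \<Longrightarrow> z \<le> y \<Longrightarrow> (f has_real_derivative f' z) (at z)"
    and "\<And>z. x < z \<Longrightarrow> z < y \<Longrightarrow> 0 < f' z"
  shows "f x < f y"
proof (rule DERIV_pos_imp_increasing_open[OF assms(1)])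
  show "continuous_on {x..y} f"
    using assms(2) by (auto intro!: DERIV_atLeastAtMost_imp_continuous_on)
  fix z assume "x < z" "z < y"
  then show "\<exists>D. (f has_real_derivative D) (at z) \<and> 0 < D"
    using assms(2)[of z] assms(3)[of z] by auto
qed

lemma deriv_neg_imp_less:
  fixes f f' :: "real \<Rightarrow> real"
  assumes "x < y" "\<And>z. x \<le> z \<Longrightarrow> z \<le> y \<Longrightarrow> (f has_real_derivative f' z) (at z)"
    and "\<And>z. x < z \<Longrightarrow> z < y \<Longrightarrow> f' z < 0"
  shows "f y < f x"
  using deriv_pos_imp_less[of x y "\<lambda>z. - f z" "\<lambda>z. - f' z"] assms by (auto intro: DERIV_minus)

text \<open>The conditions on the limits of F' enter as the witnesses \<open>low\<close> and
  \<open>high\<close>, in the form in which the intermediate value theorem takes them.\<close>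

locale double_well =
  fixes F :: "real \<Rightarrow> real" and a b :: real
  assumes a_pos: "0 < a" and ab: "a < b"
    and DF: "\<And>z. 0 < z \<Longrightarrow> (F has_real_derivative deriv F z) (at z)"
    and D2: "\<And>z. 0 < z \<Longrightarrow> (deriv F has_real_derivative (deriv ^^ 2) F z) (at z)"
    and D3: "\<And>z. 0 < z \<Longrightarrow> ((deriv ^^ 2) F has_real_derivative (deriv ^^ 3) F z) (at z)"
    and C3: "continuous_on {0<..} ((deriv ^^ 3) F)"
    and convex: "\<And>z. z \<in> {0<..<a} \<union> {b<..} \<Longrightarrow> 0 < (deriv ^^ 2) F z"
    and concave: "\<And>z. z \<in> {a<..<b} \<Longrightarrow> (deriv ^^ 2) F z < 0"
    and low: "\<exists>z. 0 < z \<and> z < a \<and> deriv F z < deriv F b"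
    and high: "\<exists>z>b. deriv F a < deriv F z"
begin

abbreviation F1 :: "real \<Rightarrow> real" where "F1 \<equiv> deriv F"
abbreviation F2 :: "real \<Rightarrow> real" where "F2 \<equiv> (deriv ^^ 2) F"
abbreviation al :: "real \<Rightarrow> real" where "al \<equiv> crit_\<alpha> F a"
abbreviation ze :: "real \<Rightarrow> real" where "ze \<equiv> crit_\<zeta> F a b"
abbreviation be :: "real \<Rightarrow> real" where "be \<equiv> crit_\<beta> F b"

lemma F1_inc1: "0 < x \<Longrightarrow> x < y \<Longrightarrow> y \<le> a \<Longrightarrow> F1 x < F1 y"
  by (rule deriv_pos_imp_less[OF _ D2]) (auto intro: convex)

lemma F1_dec: "a \<le> x \<Longrightarrow> x < y \<Longrightarrow> y \<le> b \<Longrightarrow> F1 y < F1 x"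
  by (rule deriv_neg_imp_less[OF _ D2]) (use a_pos in \<open>auto intro: concave\<close>)

lemma F1_inc2: "b \<le> x \<Longrightarrow> x < y \<Longrightarrow> F1 x < F1 y"
  by (rule deriv_pos_imp_less[OF _ D2]) (use a_pos ab in \<open>auto intro: convex\<close>)

lemma F1_ba: "F1 b < F1 a"
  using F1_dec[of a b] ab by auto

lemma cont_F1: "0 < x \<Longrightarrow> continuous_on {x..y} F1"
  by (rule DERIV_continuous_on[where D=F2], rule has_field_derivative_at_within, rule D2) auto

text \<open>Closed, unlike \<open>\<sigma>_range\<close>: at the end values two critical points
  merge, and the intermediate value argument for the Maxwell parameter starts from there.\<close>

definition rng :: "real set" where "rng = {F1 b..F1 a}"

lemma al_ex1: assumes "\<sigma> \<in> rng" shows "\<exists>!z. z \<in> {0<..a} \<and> F1 z = \<sigma>"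
proof -
  obtain z0 where z0: "0 < z0" "z0 < a" "F1 z0 < F1 b" using low by auto
  have "\<exists>z. z0 \<le> z \<and> z \<le> a \<and> F1 z = \<sigma>"
    by (rule IVT'[of F1]) (use z0 assms cont_F1[of z0] in \<open>auto simp: rng_def\<close>)
  then obtain z where z: "z0 \<le> z" "z \<le> a" "F1 z = \<sigma>" by auto
  show ?thesis
  proof (rule ex1I[of _ z])
    show "z \<in> {0<..a} \<and> F1 z = \<sigma>" using z z0 by auto
    fix w assume "w \<in> {0<..a} \<and> F1 w = \<sigma>"
    then show "w = z" using F1_inc1[of w z] F1_inc1[of z w] z z0 by (cases w z rule: linorder_cases) auto
  qed
qed

lemma ze_ex1: assumes "\<sigma> \<in> rng" shows "\<exists>!z. z \<in> {a..b} \<and> F1 z = \<sigma>"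
proof -
  have "\<exists>z. a \<le> z \<and> z \<le> b \<and> F1 z = \<sigma>"
    by (rule IVT2'[of F1]) (use ab a_pos assms cont_F1[of a] in \<open>auto simp: rng_def\<close>)
  then obtain z where z: "a \<le> z" "z \<le> b" "F1 z = \<sigma>" by auto
  show ?thesis
  proof (rule ex1I[of _ z])
    show "z \<in> {a..b} \<and> F1 z = \<sigma>" using z by auto
    fix w assume "w \<in> {a..b} \<and> F1 w = \<sigma>"
    then show "w = z" using F1_dec[of w z] F1_dec[of z w] z by (cases w z rule: linorder_cases) auto
  qed
qed

lemma be_ex1: assumes "\<sigma> \<in> rng" shows "\<exists>!z. z \<in> {b..} \<and> F1 z = \<sigma>"
proof -
  obtain z0 where z0: "b < z0" "F1 a < F1 z0" using high by auto
  have "\<exists>z. b \<le> z \<and> z \<le> z0 \<and> F1 z = \<sigma>"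
    by (rule IVT'[of F1]) (use z0 assms ab a_pos cont_F1[of b] in \<open>auto simp: rng_def\<close>)
  then obtain z where z: "b \<le> z" "F1 z = \<sigma>" by auto
  show ?thesis
  proof (rule ex1I[of _ z])
    show "z \<in> {b..} \<and> F1 z = \<sigma>" using z by auto
    fix w assume "w \<in> {b..} \<and> F1 w = \<sigma>"
    then show "w = z" using F1_inc2[of w z] F1_inc2[of z w] z by (cases w z rule: linorder_cases) auto
  qed
qed

lemma al: assumes "\<sigma> \<in> rng" shows "0 < al \<sigma>" "al \<sigma> \<le> a" "F1 (al \<sigma>) = \<sigma>"
  using theI'[OF al_ex1[OF assms]] by (auto simp: crit_\<alpha>_def)

lemma ze: assumes "\<sigma> \<in> rng" shows "a \<le> ze \<sigma>" "ze \<sigma> \<le> b" "F1 (ze \<sigma>) = \<sigma>"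
  using theI'[OF ze_ex1[OF assms]] by (auto simp: crit_\<zeta>_def)

lemma be: assumes "\<sigma> \<in> rng" shows "b \<le> be \<sigma>" "F1 (be \<sigma>) = \<sigma>"
  using theI'[OF be_ex1[OF assms]] by (auto simp: crit_\<beta>_def)

lemma \<sigma>_range_subset: "\<sigma> \<in> \<sigma>_range F a b \<Longrightarrow> \<sigma> \<in> rng"
  by (auto simp: \<sigma>_range_def rng_def)

lemma crit_strict:
  assumes "\<sigma> \<in> \<sigma>_range F a b"
  shows "al \<sigma> < a" "a < ze \<sigma>" "ze \<sigma> < b" "b < be \<sigma>"
proof -
  note r = \<sigma>_range_subset[OF assms]
  have "F1 b < \<sigma>" "\<sigma> < F1 a" using assms by (auto simp: \<sigma>_range_def)
  then have "al \<sigma> \<noteq> a" "a \<noteq> ze \<sigma>" "ze \<sigma> \<noteq> b" "b \<noteq> be \<sigma>"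
    using al(3)[OF r] ze(3)[OF r] be(2)[OF r] by auto
  then show "al \<sigma> < a" "a < ze \<sigma>" "ze \<sigma> < b" "b < be \<sigma>"
    using al(2)[OF r] ze(1,2)[OF r] be(1)[OF r] by auto
qed

lemma F1_sign:
  assumes "\<sigma> \<in> rng"
  shows "0 < z \<Longrightarrow> z < al \<sigma> \<Longrightarrow> F1 z < \<sigma>"
    "al \<sigma> < z \<Longrightarrow> z < ze \<sigma> \<Longrightarrow> \<sigma> < F1 z"
    "ze \<sigma> < z \<Longrightarrow> z < be \<sigma> \<Longrightarrow> F1 z < \<sigma>"
    "be \<sigma> < z \<Longrightarrow> \<sigma> < F1 z"
proof -
  note c = al[OF assms] ze[OF assms] be[OF assms]
  show "0 < z \<Longrightarrow> z < al \<sigma> \<Longrightarrow> F1 z < \<sigma>" using F1_inc1[of z "al \<sigma>"] c by auto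
  show "\<sigma> < F1 z" if "al \<sigma> < z" "z < ze \<sigma>"
    using F1_inc1[of "al \<sigma>" z] F1_dec[of z "ze \<sigma>"] c that by (cases "z \<le> a") auto
  show "F1 z < \<sigma>" if "ze \<sigma> < z" "z < be \<sigma>"
    using F1_dec[of "ze \<sigma>" z] F1_inc2[of z "be \<sigma>"] c that by (cases "z \<le> b") auto
  show "be \<sigma> < z \<Longrightarrow> \<sigma> < F1 z" using F1_inc2[of "be \<sigma>" z] c by auto
qed

lemma D_Gibbs: "0 < z \<Longrightarrow> (Gibbs F \<sigma> has_real_derivative (F1 z - \<sigma>)) (at z)"
  unfolding Gibbs_def by (auto intro!: derivative_eq_intros DF)

lemma cont_Gibbs: "0 < x \<Longrightarrow> continuous_on {x..y} (Gibbs F \<sigma>)"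
  by (rule DERIV_continuous_on[where D="\<lambda>z. F1 z - \<sigma>"], rule has_field_derivative_at_within, rule D_Gibbs) auto

lemma Gibbs_mono:
  assumes "\<sigma> \<in> rng"
  shows "0 < x \<Longrightarrow> x < y \<Longrightarrow> y \<le> al \<sigma> \<Longrightarrow> Gibbs F \<sigma> y < Gibbs F \<sigma> x"
    "al \<sigma> \<le> x \<Longrightarrow> x < y \<Longrightarrow> y \<le> ze \<sigma> \<Longrightarrow> Gibbs F \<sigma> x < Gibbs F \<sigma> y"
    "ze \<sigma> \<le> x \<Longrightarrow> x < y \<Longrightarrow> y \<le> be \<sigma> \<Longrightarrow> Gibbs F \<sigma> y < Gibbs F \<sigma> x"
    "be \<sigma> \<le> x \<Longrightarrow> x < y \<Longrightarrow> Gibbs F \<sigma> x < Gibbs F \<sigma> y"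
proof -
  note c = al[OF assms] ze[OF assms] be[OF assms] and s = F1_sign[OF assms]
  show "0 < x \<Longrightarrow> x < y \<Longrightarrow> y \<le> al \<sigma> \<Longrightarrow> Gibbs F \<sigma> y < Gibbs F \<sigma> x"
    by (rule deriv_neg_imp_less[OF _ D_Gibbs]) (use s in auto)
  show "al \<sigma> \<le> x \<Longrightarrow> x < y \<Longrightarrow> y \<le> ze \<sigma> \<Longrightarrow> Gibbs F \<sigma> x < Gibbs F \<sigma> y"
    by (rule deriv_pos_imp_less[OF _ D_Gibbs]) (use s c in auto)
  show "ze \<sigma> \<le> x \<Longrightarrow> x < y \<Longrightarrow> y \<le> be \<sigma> \<Longrightarrow> Gibbs F \<sigma> y < Gibbs F \<sigma> x"
    by (rule deriv_neg_imp_less[OF _ D_Gibbs]) (use s c a_pos in auto)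
  show "be \<sigma> \<le> x \<Longrightarrow> x < y \<Longrightarrow> Gibbs F \<sigma> x < Gibbs F \<sigma> y"
    by (rule deriv_pos_imp_less[OF _ D_Gibbs]) (use s c a_pos ab in auto)
qed

section \<open>Minimal levels of the two wells as functions of the parameter\<close>

definition left_min :: "real \<Rightarrow> real" where "left_min \<sigma> = Gibbs F \<sigma> (al \<sigma>)"
definition right_min :: "real \<Rightarrow> real" where "right_min \<sigma> = Gibbs F \<sigma> (be \<sigma>)"

lemma left_min_le: "\<sigma> \<in> rng \<Longrightarrow> 0 < z \<Longrightarrow> z \<le> a \<Longrightarrow> left_min \<sigma> \<le> Gibbs F \<sigma> z"
  using Gibbs_mono(1)[of \<sigma> z "al \<sigma>"] Gibbs_mono(2)[of \<sigma> "al \<sigma>" z] ze(1)[of \<sigma>]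
  by (cases z "al \<sigma>" rule: linorder_cases) (auto simp: left_min_def)

lemma right_min_le: "\<sigma> \<in> rng \<Longrightarrow> b \<le> z \<Longrightarrow> right_min \<sigma> \<le> Gibbs F \<sigma> z"
  using Gibbs_mono(3)[of \<sigma> z "be \<sigma>"] Gibbs_mono(4)[of \<sigma> "be \<sigma>" z] ze(2)[of \<sigma>]
  by (cases z "be \<sigma>" rule: linorder_cases) (auto simp: right_min_def)

text \<open>Comparing the minimum for one parameter with the value at the minimizer for the other.\<close>
lemma left_min_comparison: assumes "\<sigma> \<in> rng" "\<sigma>' \<in> rng" shows "left_min \<sigma>' \<le> left_min \<sigma> - (\<sigma>' - \<sigma>) * al \<sigma>"
  using left_min_le[OF assms(2) al(1,2)[OF assms(1)]] by (simp add: left_min_def Gibbs_def algebra_simps)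

lemma right_min_comparison: assumes "\<sigma> \<in> rng" "\<sigma>' \<in> rng" shows "right_min \<sigma>' \<le> right_min \<sigma> - (\<sigma>' - \<sigma>) * be \<sigma>"
  using right_min_le[OF assms(2) be(1)[OF assms(1)]] by (simp add: right_min_def Gibbs_def algebra_simps)

text \<open>The right minimizer increases with \<sigma>, so its value at the upper end of the range
  serves as Lipschitz constant of \<open>right_min\<close>.\<close>

definition bmax :: real where "bmax = be (F1 a)"

lemma be_le_bmax: assumes "\<sigma> \<in> rng" shows "be \<sigma> \<le> bmax"
proof -
  have r: "F1 a \<in> rng" using F1_ba by (auto simp: rng_def)
  show ?thesis
    using F1_inc2[of bmax "be \<sigma>"] be[OF assms] be[OF r] assms
    by (cases "bmax < be \<sigma>") (auto simp: bmax_def rng_def)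
qed

lemma left_min_lip:
  assumes "\<sigma> \<in> rng" "\<sigma>' \<in> rng" shows "\<bar>left_min \<sigma> - left_min \<sigma>'\<bar> \<le> a * \<bar>\<sigma> - \<sigma>'\<bar>"
proof -
  have "left_min \<sigma>' - left_min \<sigma> \<le> a * \<bar>\<sigma> - \<sigma>'\<bar>" if "\<sigma> \<in> rng" "\<sigma>' \<in> rng" for \<sigma> \<sigma>'
  proof -
    have "left_min \<sigma>' - left_min \<sigma> \<le> al \<sigma> * (\<sigma> - \<sigma>')" using left_min_comparison[OF that] by (simp add: algebra_simps)
    also have "\<dots> \<le> al \<sigma> * \<bar>\<sigma> - \<sigma>'\<bar>" using al[OF that(1)] by (intro mult_left_mono) auto
    also have "\<dots> \<le> a * \<bar>\<sigma> - \<sigma>'\<bar>" using al[OF that(1)] by (intro mult_right_mono) auto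
    finally show ?thesis .
  qed
  from this[OF assms] this[OF assms(2,1)] show ?thesis by (simp add: abs_minus_commute abs_le_iff)
qed

lemma right_min_lip:
  assumes "\<sigma> \<in> rng" "\<sigma>' \<in> rng" shows "\<bar>right_min \<sigma> - right_min \<sigma>'\<bar> \<le> bmax * \<bar>\<sigma> - \<sigma>'\<bar>"
proof -
  have "right_min \<sigma>' - right_min \<sigma> \<le> bmax * \<bar>\<sigma> - \<sigma>'\<bar>" if "\<sigma> \<in> rng" "\<sigma>' \<in> rng" for \<sigma> \<sigma>'
  proof -
    have "right_min \<sigma>' - right_min \<sigma> \<le> be \<sigma> * (\<sigma> - \<sigma>')" using right_min_comparison[OF that] by (simp add: algebra_simps)
    also have "\<dots> \<le> be \<sigma> * \<bar>\<sigma> - \<sigma>'\<bar>" using be[OF that(1)] a_pos ab by (intro mult_left_mono) auto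
    also have "\<dots> \<le> bmax * \<bar>\<sigma> - \<sigma>'\<bar>" using be_le_bmax[OF that(1)] by (intro mult_right_mono) auto
    finally show ?thesis .
  qed
  from this[OF assms] this[OF assms(2,1)] show ?thesis by (simp add: abs_minus_commute abs_le_iff)
qed

definition min_gap :: "real \<Rightarrow> real" where "min_gap \<sigma> = left_min \<sigma> - right_min \<sigma>"

text \<open>The minima have slopes -\<open>al\<close> and -\<open>be\<close> in \<sigma>, so their
  difference has slope \<open>be\<close> - \<open>al\<close>, which is at least b - a. The
  comparison inequalities express this without differentiating the minimizers.\<close>

lemma min_gap_expanding_aux:
  assumes "\<sigma> \<in> rng" "\<sigma>' \<in> rng" "\<sigma> \<le> \<sigma>'"
  shows "(b - a) * (\<sigma>' - \<sigma>) \<le> min_gap \<sigma>' - min_gap \<sigma>"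
proof -
  have "(be \<sigma> - al \<sigma>') * (\<sigma>' - \<sigma>) \<le> min_gap \<sigma>' - min_gap \<sigma>"
    using left_min_comparison[OF assms(2,1)] right_min_comparison[OF assms(1,2)] by (simp add: min_gap_def algebra_simps)
  moreover have "(b - a) * (\<sigma>' - \<sigma>) \<le> (be \<sigma> - al \<sigma>') * (\<sigma>' - \<sigma>)"
    using al[OF assms(2)] be[OF assms(1)] assms(3) by (intro mult_right_mono) auto
  ultimately show ?thesis by linarith
qed

lemma min_gap_expanding:
  assumes "\<sigma> \<in> rng" "\<sigma>' \<in> rng"
  shows "(b - a) * \<bar>\<sigma> - \<sigma>'\<bar> \<le> \<bar>min_gap \<sigma> - min_gap \<sigma>'\<bar>"
  using min_gap_expanding_aux[of \<sigma> \<sigma>'] min_gap_expanding_aux[of \<sigma>' \<sigma>] assms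
  by (cases "\<sigma> \<le> \<sigma>'") (auto simp: abs_if)

lemma cont_min_gap: "continuous_on rng min_gap"
  unfolding min_gap_def
  by (intro continuous_on_diff continuous_on_real_lipschitz[OF left_min_lip] continuous_on_real_lipschitz[OF right_min_lip])

text \<open>For \<sigma> = F' (b) the points \<zeta> and \<beta> merge at b, and \<Phi> increases
  from \<alpha> up to b; for \<sigma> = F' (a) the points \<alpha> and \<zeta> merge at a, and
  \<Phi> decreases from a to \<beta>.\<close>

lemma min_gap_ends: "min_gap (F1 b) < 0" "0 < min_gap (F1 a)"
proof -
  have r: "F1 a \<in> rng" "F1 b \<in> rng" using F1_ba by (auto simp: rng_def)
  have e1: "be (F1 b) = b"
    unfolding crit_\<beta>_def by (rule the1_equality[OF be_ex1[OF r(2)]]) (use a_pos ab in auto)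
  have e2: "ze (F1 b) = b"
    unfolding crit_\<zeta>_def by (rule the1_equality[OF ze_ex1[OF r(2)]]) (use a_pos ab in auto)
  have e3: "al (F1 a) = a"
    unfolding crit_\<alpha>_def by (rule the1_equality[OF al_ex1[OF r(1)]]) (use a_pos ab in auto)
  have e4: "ze (F1 a) = a"
    unfolding crit_\<zeta>_def by (rule the1_equality[OF ze_ex1[OF r(1)]]) (use a_pos ab in auto)
  show "min_gap (F1 b) < 0"
    using Gibbs_mono(2)[OF r(2), of "al (F1 b)" b] al[OF r(2)] ab e1 e2
    by (simp add: min_gap_def left_min_def right_min_def)
  show "0 < min_gap (F1 a)"
    using Gibbs_mono(3)[OF r(1), of a "be (F1 a)"] be[OF r(1)] ab e3 e4
    by (simp add: min_gap_def left_min_def right_min_def)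
qed

lemma min_gap_onto:
  assumes "min_gap (F1 b) < t" "t < min_gap (F1 a)"
  obtains \<sigma> where "\<sigma> \<in> \<sigma>_range F a b" "min_gap \<sigma> = t"
proof -
  have "\<exists>\<sigma>. F1 b \<le> \<sigma> \<and> \<sigma> \<le> F1 a \<and> min_gap \<sigma> = t"
    by (rule IVT'[of min_gap]) (use assms cont_min_gap F1_ba in \<open>auto simp: rng_def\<close>)
  then obtain \<sigma> where s: "F1 b \<le> \<sigma>" "\<sigma> \<le> F1 a" "min_gap \<sigma> = t" by auto
  then have "\<sigma> \<noteq> F1 b" "\<sigma> \<noteq> F1 a" using assms by auto
  then show thesis using s by (intro that[of \<sigma>]) (auto simp: \<sigma>_range_def)
qed

section \<open>The Maxwell point and the turning points of admissible pairs\<close>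

abbreviation s0 :: real where "s0 \<equiv> Maxwell_\<sigma> F a b"
abbreviation a0 :: real where "a0 \<equiv> Maxwell_\<alpha> F a b"
abbreviation b0 :: real where "b0 \<equiv> Maxwell_\<beta> F a b"
definition c0 :: real where "c0 = left_min s0"

lemma s0: "s0 \<in> \<sigma>_range F a b" "min_gap s0 = 0"
proof -
  obtain s where s: "s \<in> \<sigma>_range F a b" "min_gap s = 0" using min_gap_onto[of 0] min_gap_ends by auto
  have "\<exists>!\<sigma>. \<sigma> \<in> \<sigma>_range F a b \<and> Gibbs F \<sigma> (crit_\<alpha> F a \<sigma>) = Gibbs F \<sigma> (crit_\<beta> F b \<sigma>)"
  proof (rule ex1I[of _ s])
    show "s \<in> \<sigma>_range F a b \<and> Gibbs F s (al s) = Gibbs F s (be s)"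
      using s by (simp add: min_gap_def left_min_def right_min_def)
    fix w assume w: "w \<in> \<sigma>_range F a b \<and> Gibbs F w (al w) = Gibbs F w (be w)"
    then have "min_gap w = 0" by (simp add: min_gap_def left_min_def right_min_def)
    then have "(b - a) * \<bar>w - s\<bar> \<le> 0"
      using min_gap_expanding[of w s] s w \<sigma>_range_subset by auto
    then have "\<bar>w - s\<bar> \<le> 0" using ab by (simp add: mult_le_0_iff)
    then show "w = s" by simp
  qed
  from theI'[OF this] show "s0 \<in> \<sigma>_range F a b" "min_gap s0 = 0"
    by (auto simp: Maxwell_\<sigma>_def min_gap_def left_min_def right_min_def)
qed

lemma s0_rng: "s0 \<in> rng" using s0 \<sigma>_range_subset by auto

lemma c0: "left_min s0 = c0" "right_min s0 = c0" using s0 by (auto simp: c0_def min_gap_def)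

lemma a0b0: "a0 = al s0" "b0 = be s0" "0 < a0" "a0 < a" "b < b0" "a0 < b0"
  using crit_strict[OF s0(1)] al[OF s0_rng] ab by (auto simp: Maxwell_\<alpha>_def Maxwell_\<beta>_def)

lemma Maxwell_point_eq: "Maxwell_point F a b = (s0, c0)"
  by (simp add: Maxwell_point_def c0_def left_min_def Maxwell_\<alpha>_def)

text \<open>Continuity of both minimizers at the Maxwell parameter: F' is strictly increasing on
  each convex side, so a value between its values at a0 - q and a0 + q is attained between these
  points, and likewise at b0.\<close>

lemma al_near:
  assumes "0 < r"
  obtains d where "0 < d" "\<And>\<sigma>. \<bar>\<sigma> - s0\<bar> < d \<Longrightarrow> \<sigma> \<in> \<sigma>_range F a b \<and> \<bar>al \<sigma> - a0\<bar> < r \<and> \<bar>be \<sigma> - b0\<bar> < r"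
proof -
  define q where "q = min r (min (a0 / 2) (min ((a - a0) / 2) ((b0 - b) / 2)))"
  have q: "0 < q" "q \<le> r" "0 < a0 - q" "a0 + q < a" "b < b0 - q"
  proof -
    show "0 < q" using assms a0b0(3-5) by (simp add: q_def)
    show "q \<le> r" unfolding q_def by (rule min.cobounded1)
    have "q \<le> min (a0 / 2) (min ((a - a0) / 2) ((b0 - b) / 2))" unfolding q_def by (rule min.cobounded2)
    then have "q \<le> a0 / 2" "q \<le> (a - a0) / 2" "q \<le> (b0 - b) / 2"
      unfolding min.bounded_iff by blast+
    then show "0 < a0 - q" "a0 + q < a" "b < b0 - q" using a0b0(3-5) by (simp_all add: field_simps)
  qed
  have F: "F1 a0 = s0" "F1 b0 = s0" using al(3)[OF s0_rng] be(2)[OF s0_rng] a0b0 by auto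
  have i: "F1 (a0 - q) < s0" "s0 < F1 (a0 + q)" "F1 (b0 - q) < s0" "s0 < F1 (b0 + q)"
    using F1_inc1[of "a0 - q" a0] F1_inc1[of a0 "a0 + q"] F1_inc2[of "b0 - q" b0] F1_inc2[of b0 "b0 + q"]
      F q a0b0 by auto
  have s: "F1 b < s0" "s0 < F1 a" using s0 by (auto simp: \<sigma>_range_def)
  define d where "d = min (min (min (s0 - F1 (a0 - q)) (F1 (a0 + q) - s0)) (min (s0 - F1 (b0 - q)) (F1 (b0 + q) - s0)))
    (min (s0 - F1 b) (F1 a - s0))"
  show thesis
  proof (rule that[of d])
    show "0 < d" using i s by (simp add: d_def)
    fix \<sigma> assume "\<bar>\<sigma> - s0\<bar> < d"
    then have h: "F1 (a0 - q) < \<sigma>" "\<sigma> < F1 (a0 + q)" "F1 (b0 - q) < \<sigma>" "\<sigma> < F1 (b0 + q)" "F1 b < \<sigma>" "\<sigma> < F1 a"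
      unfolding d_def by linarith+
    have r: "\<sigma> \<in> \<sigma>_range F a b" using h by (auto simp: \<sigma>_range_def)
    note c = al[OF \<sigma>_range_subset[OF r]] be[OF \<sigma>_range_subset[OF r]]
    have "a0 - q < al \<sigma>" using F1_inc1[of "al \<sigma>" "a0 - q"] c h q a0b0
      by (cases "al \<sigma>" "a0 - q" rule: linorder_cases) auto
    moreover have "al \<sigma> < a0 + q" using F1_inc1[of "a0 + q" "al \<sigma>"] c h q a0b0
      by (cases "al \<sigma>" "a0 + q" rule: linorder_cases) auto
    moreover have "b0 - q < be \<sigma>" using F1_inc2[of "be \<sigma>" "b0 - q"] c h q a0b0
      by (cases "be \<sigma>" "b0 - q" rule: linorder_cases) auto
    moreover have "be \<sigma> < b0 + q" using F1_inc2[of "b0 + q" "be \<sigma>"] c h q a0b0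
      by (cases "be \<sigma>" "b0 + q" rule: linorder_cases) auto
    ultimately show "\<sigma> \<in> \<sigma>_range F a b \<and> \<bar>al \<sigma> - a0\<bar> < r \<and> \<bar>be \<sigma> - b0\<bar> < r"
      using r q by (auto simp: abs_less_iff)
  qed
qed

abbreviation zl :: "real \<Rightarrow> real \<Rightarrow> real" where "zl \<sigma> c \<equiv> z\<^sub>1 F a b (\<sigma>, c)"
abbreviation zr :: "real \<Rightarrow> real \<Rightarrow> real" where "zr \<sigma> c \<equiv> z\<^sub>2 F a b (\<sigma>, c)"

lemma z1:
  assumes "admissible F a b (\<sigma>, c)"
  shows "al \<sigma> < zl \<sigma> c" "zl \<sigma> c < ze \<sigma>" "Gibbs F \<sigma> (zl \<sigma> c) = c"
    "\<And>z. al \<sigma> < z \<Longrightarrow> z < ze \<sigma> \<Longrightarrow> Gibbs F \<sigma> z = c \<Longrightarrow> zl \<sigma> c = z"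
proof -
  have A: "\<sigma> \<in> \<sigma>_range F a b" "Gibbs F \<sigma> (al \<sigma>) < c" "c < Gibbs F \<sigma> (ze \<sigma>)"
    using assms by (auto simp: admissible_def)
  note r = \<sigma>_range_subset[OF A(1)]
  note cc = al[OF r] crit_strict[OF A(1)]
  have "\<exists>z. al \<sigma> \<le> z \<and> z \<le> ze \<sigma> \<and> Gibbs F \<sigma> z = c"
    by (rule IVT'[of "Gibbs F \<sigma>"]) (use A cc cont_Gibbs[of "al \<sigma>"] in auto)
  then obtain z where z: "al \<sigma> \<le> z" "z \<le> ze \<sigma>" "Gibbs F \<sigma> z = c" by auto
  then have z': "z \<noteq> al \<sigma>" "z \<noteq> ze \<sigma>" using A by auto
  have "\<exists>!z. z \<in> {al \<sigma><..<ze \<sigma>} \<and> Gibbs F \<sigma> z = c"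
  proof (rule ex1I[of _ z])
    fix w assume "w \<in> {al \<sigma><..<ze \<sigma>} \<and> Gibbs F \<sigma> w = c"
    then show "w = z" using Gibbs_mono(2)[OF r, of w z] Gibbs_mono(2)[OF r, of z w] z
      by (cases w z rule: linorder_cases) auto
  qed (use z z' in auto)
  note E = this
  have eq: "zl \<sigma> c = (THE z. z \<in> {al \<sigma><..<ze \<sigma>} \<and> Gibbs F \<sigma> z = c)"
    by (simp add: z\<^sub>1_def)
  show "al \<sigma> < zl \<sigma> c" "zl \<sigma> c < ze \<sigma>" "Gibbs F \<sigma> (zl \<sigma> c) = c"
    using theI'[OF E, folded eq] by simp_all
  show "zl \<sigma> c = z" if "al \<sigma> < z" "z < ze \<sigma>" "Gibbs F \<sigma> z = c" for z
    unfolding eq by (rule the1_equality[OF E]) (use that in simp)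
qed

lemma z2:
  assumes "admissible F a b (\<sigma>, c)"
  shows "ze \<sigma> < zr \<sigma> c" "zr \<sigma> c < be \<sigma>" "Gibbs F \<sigma> (zr \<sigma> c) = c"
    "\<And>z. ze \<sigma> < z \<Longrightarrow> z < be \<sigma> \<Longrightarrow> Gibbs F \<sigma> z = c \<Longrightarrow> zr \<sigma> c = z"
proof -
  have A: "\<sigma> \<in> \<sigma>_range F a b" "Gibbs F \<sigma> (be \<sigma>) < c" "c < Gibbs F \<sigma> (ze \<sigma>)"
    using assms by (auto simp: admissible_def)
  note r = \<sigma>_range_subset[OF A(1)]
  note cc = al[OF r] crit_strict[OF A(1)]
  have "\<exists>z. ze \<sigma> \<le> z \<and> z \<le> be \<sigma> \<and> Gibbs F \<sigma> z = c"
    by (rule IVT2'[of "Gibbs F \<sigma>"]) (use A cc a_pos cont_Gibbs[of "ze \<sigma>"] in auto)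
  then obtain z where z: "ze \<sigma> \<le> z" "z \<le> be \<sigma>" "Gibbs F \<sigma> z = c" by auto
  then have z': "z \<noteq> be \<sigma>" "z \<noteq> ze \<sigma>" using A by auto
  have "\<exists>!z. z \<in> {ze \<sigma><..<be \<sigma>} \<and> Gibbs F \<sigma> z = c"
  proof (rule ex1I[of _ z])
    fix w assume "w \<in> {ze \<sigma><..<be \<sigma>} \<and> Gibbs F \<sigma> w = c"
    then show "w = z" using Gibbs_mono(3)[OF r, of w z] Gibbs_mono(3)[OF r, of z w] z
      by (cases w z rule: linorder_cases) auto
  qed (use z z' in auto)
  note E = this
  have eq: "zr \<sigma> c = (THE z. z \<in> {ze \<sigma><..<be \<sigma>} \<and> Gibbs F \<sigma> z = c)"
    by (simp add: z\<^sub>2_def)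
  show "ze \<sigma> < zr \<sigma> c" "zr \<sigma> c < be \<sigma>" "Gibbs F \<sigma> (zr \<sigma> c) = c"
    using theI'[OF E, folded eq] by simp_all
  show "zr \<sigma> c = z" if "ze \<sigma> < z" "z < be \<sigma>" "Gibbs F \<sigma> z = c" for z
    unfolding eq by (rule the1_equality[OF E]) (use that in simp)
qed

lemma Gibbs_above:
  assumes "admissible F a b (\<sigma>, c)" "zl \<sigma> c < z" "z < zr \<sigma> c"
  shows "c < Gibbs F \<sigma> z"
proof -
  have r: "\<sigma> \<in> rng" using assms(1) by (auto simp: admissible_def dest: \<sigma>_range_subset)
  show ?thesis
    using Gibbs_mono(2)[OF r, of "zl \<sigma> c" z] Gibbs_mono(3)[OF r, of z "zr \<sigma> c"]
      z1(1-3)[OF assms(1)] z2(1-3)[OF assms(1)] assms(2,3) by (cases "z \<le> ze \<sigma>") auto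
qed

end

text \<open>In \<open>well\<close> the turning point lies to the right of the bottom. The right well
  has its turning point on the left, and reflection makes the one-sided estimates available for
  it.\<close>

lemma well_reflect:
  assumes "well F F1 F2 x0 \<rho> K lo hi"
  shows "well (\<lambda>x. F (- x)) (\<lambda>x. - F1 (- x)) (\<lambda>x. F2 (- x)) (- x0) \<rho> K lo hi"
proof -
  interpret well F F1 F2 x0 \<rho> K lo hi by fact
  have n: "\<bar>- z - x0\<bar> \<le> \<rho>" if "\<bar>z - - x0\<bar> \<le> \<rho>" for z using that by (simp add: abs_le_iff)
  show ?thesis
  proof
    fix z assume z: "\<bar>z - - x0\<bar> \<le> \<rho>"
    show "((\<lambda>x. F (- x)) has_real_derivative - F1 (- z)) (at z)"
      using DERIV_chain2[OF DF[OF n[OF z]] DERIV_minus[OF DERIV_ident]] by simp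
    show "((\<lambda>x. - F1 (- x)) has_real_derivative F2 (- z)) (at z)"
      using DERIV_minus[OF DERIV_chain2[OF DF1[OF n[OF z]] DERIV_minus[OF DERIV_ident]]] by simp
    show "lo \<le> F2 (- z) \<and> F2 (- z) \<le> hi" by (rule bnd[OF n[OF z]])
    fix y assume y: "\<bar>y - - x0\<bar> \<le> \<rho>"
    show "\<bar>F2 (- y) - F2 (- z)\<bar> \<le> K * \<bar>y - z\<bar>"
      using lip[OF n[OF y] n[OF z]] by (simp add: abs_minus_commute)
  qed (fact rho lo rho_hi)+
qed

text \<open>A single constant has to bound both the size and the slope of the weight; the summand 1
  takes care of the slope.\<close>

lemma affine_weighted_well:
  assumes "well F F1 F2 x0 \<rho> K lo hi"
  shows "weighted_well F F1 F2 x0 \<rho> K lo hi (\<lambda>z. p * z + q) (\<bar>p\<bar> * (\<bar>x0\<bar> + \<rho> + 1) + \<bar>q\<bar>)"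
proof -
  interpret well F F1 F2 x0 \<rho> K lo hi by fact
  show ?thesis
  proof
    fix z assume "\<bar>z - x0\<bar> \<le> \<rho>"
    then have "\<bar>z\<bar> \<le> \<bar>x0\<bar> + \<rho> + 1" by linarith
    then have "\<bar>p * z\<bar> \<le> \<bar>p\<bar> * (\<bar>x0\<bar> + \<rho> + 1)" by (simp add: abs_mult mult_left_mono)
    then show "\<bar>p * z + q\<bar> \<le> \<bar>p\<bar> * (\<bar>x0\<bar> + \<rho> + 1) + \<bar>q\<bar>" by linarith
  next
    fix y z
    have "\<bar>p * y + q - (p * z + q)\<bar> = \<bar>p\<bar> * \<bar>y - z\<bar>" by (simp add: abs_mult[symmetric] algebra_simps)
    also have "\<dots> \<le> (\<bar>p\<bar> * (\<bar>x0\<bar> + \<rho> + 1) + \<bar>q\<bar>) * \<bar>y - z\<bar>"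
    proof (rule mult_right_mono)
      have "\<bar>p\<bar> * 1 \<le> \<bar>p\<bar> * (\<bar>x0\<bar> + \<rho> + 1)" using rho by (intro mult_left_mono) auto
      then show "\<bar>p\<bar> \<le> \<bar>p\<bar> * (\<bar>x0\<bar> + \<rho> + 1) + \<bar>q\<bar>" by simp
    qed simp
    finally show "\<bar>p * y + q - (p * z + q)\<bar> \<le> (\<bar>p\<bar> * (\<bar>x0\<bar> + \<rho> + 1) + \<bar>q\<bar>) * \<bar>y - z\<bar>" .
  qed
qed

lemma slowness_factor_sqrt_lipschitz:
  assumes "0 < m" "m \<le> y" "m \<le> y'" "0 \<le> \<epsilon>" "\<epsilon> \<le> 1" "\<epsilon>\<^sup>2 * y \<le> 1" "\<epsilon>\<^sup>2 * y' \<le> 1"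
  shows "\<bar>slowness_factor (\<epsilon>\<^sup>2 * y) / sqrt y - slowness_factor (\<epsilon>\<^sup>2 * y') / sqrt y'\<bar> \<le> (2 / sqrt m + 1 / (m * sqrt m)) * \<bar>y - y'\<bar>"
proof -
  have h: "\<bar>slowness_factor (\<epsilon>\<^sup>2 * y) - slowness_factor (\<epsilon>\<^sup>2 * y')\<bar> \<le> 2 * \<bar>y - y'\<bar>"
  proof -
    have "\<bar>slowness_factor (\<epsilon>\<^sup>2 * y) - slowness_factor (\<epsilon>\<^sup>2 * y')\<bar> \<le> 2 * \<bar>\<epsilon>\<^sup>2 * y - \<epsilon>\<^sup>2 * y'\<bar>"
      by (rule slowness_factor_lipschitz) (use assms in auto)
    also have "\<bar>\<epsilon>\<^sup>2 * y - \<epsilon>\<^sup>2 * y'\<bar> = \<epsilon>\<^sup>2 * \<bar>y - y'\<bar>" by (simp add: right_diff_distrib[symmetric] abs_mult)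
    also have "\<dots> \<le> 1 * \<bar>y - y'\<bar>" using assms by (intro mult_right_mono power_le_one) auto
    finally show ?thesis by simp
  qed
  have b: "\<bar>slowness_factor (\<epsilon>\<^sup>2 * y')\<bar> \<le> 1" by (rule slowness_factor_bound) (use assms in auto)
  have s: "\<bar>1 / sqrt y\<bar> \<le> 1 / sqrt m" using assms by (auto intro: divide_left_mono)
  have i: "\<bar>1 / sqrt y - 1 / sqrt y'\<bar> \<le> \<bar>y - y'\<bar> / (m * sqrt m)"
    by (rule inverse_sqrt_lipschitz) (use assms in auto)
  have "slowness_factor (\<epsilon>\<^sup>2 * y) / sqrt y - slowness_factor (\<epsilon>\<^sup>2 * y') / sqrt y'
      = (slowness_factor (\<epsilon>\<^sup>2 * y) - slowness_factor (\<epsilon>\<^sup>2 * y')) * (1 / sqrt y) + slowness_factor (\<epsilon>\<^sup>2 * y') * (1 / sqrt y - 1 / sqrt y')"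
    by (simp add: algebra_simps diff_divide_distrib)
  also have "\<bar>\<dots>\<bar> \<le> \<bar>slowness_factor (\<epsilon>\<^sup>2 * y) - slowness_factor (\<epsilon>\<^sup>2 * y')\<bar> * \<bar>1 / sqrt y\<bar>
      + \<bar>slowness_factor (\<epsilon>\<^sup>2 * y')\<bar> * \<bar>1 / sqrt y - 1 / sqrt y'\<bar>"
    by (metis abs_mult abs_triangle_ineq)
  also have "\<dots> \<le> 2 * \<bar>y - y'\<bar> * (1 / sqrt m) + 1 * (\<bar>y - y'\<bar> / (m * sqrt m))"
    by (intro add_mono mult_mono h s b i) auto
  finally show ?thesis by (simp add: algebra_simps)
qed

section \<open>Well estimates at the two Maxwell states\<close>

context double_well
begin

text \<open>All constants come from compactness, K as the maximum of |F'''|. To avoid circularity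
  \<open>hi\<close> is taken on a larger interval first, and the radius is then shrunk below 1 and 1
  / (2 \<open>hi\<close>) for the sake of \<open>rho_hi\<close>.\<close>

lemma exists_well:
  assumes "0 < c" "c < a \<or> b < c"
  obtains \<rho> K lo hi where "well F F1 F2 c \<rho> K lo hi" "0 < c - \<rho>" "c < a \<Longrightarrow> c + \<rho> < a" "b < c \<Longrightarrow> b < c - \<rho>"
proof -
  define r where "r = min (c / 2) (if c < a then (a - c) / 2 else (c - b) / 2)"
  have r: "0 < r" using assms by (auto simp: r_def)
  have rr: "0 < c - r" "c < a \<Longrightarrow> c + r < a" "b < c \<Longrightarrow> b < c - r"
  proof -
    have "r \<le> c / 2" by (simp add: r_def)
    then show "0 < c - r" using assms by simp
    show "c + r < a" if "c < a"
    proof -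
      have "r \<le> (a - c) / 2" unfolding r_def using that by (intro min.coboundedI2) simp
      then show ?thesis using that by (simp add: field_simps)
    qed
    show "b < c - r" if "b < c"
    proof -
      have "r \<le> (c - b) / 2" unfolding r_def using that ab by (intro min.coboundedI2) simp
      then show ?thesis using that by (simp add: field_simps)
    qed
  qed
  let ?I = "{c - r..c + r}"
  have I: "0 < z" "0 < F2 z" if "z \<in> ?I" for z
  proof -
    show "0 < z" using that rr by auto
    then show "0 < F2 z" using that rr assms(2) by (intro convex) auto
  qed
  have c2: "continuous_on ?I F2"
    by (rule DERIV_continuous_on[where D="(deriv ^^ 3) F"], rule has_field_derivative_at_within, rule D3) (rule I)
  have c3: "continuous_on ?I ((deriv ^^ 3) F)"
    by (rule continuous_on_subset[OF C3]) (use I in auto)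
  have ne: "?I \<noteq> {}" using r by auto
  obtain zl where zl: "zl \<in> ?I" "\<And>z. z \<in> ?I \<Longrightarrow> F2 zl \<le> F2 z"
    using continuous_attains_inf[OF compact_Icc ne c2] by blast
  obtain zh where zh: "zh \<in> ?I" "\<And>z. z \<in> ?I \<Longrightarrow> F2 z \<le> F2 zh"
    using continuous_attains_sup[OF compact_Icc ne c2] by blast
  obtain zk where zk: "zk \<in> ?I" "\<And>z. z \<in> ?I \<Longrightarrow> \<bar>(deriv ^^ 3) F z\<bar> \<le> \<bar>(deriv ^^ 3) F zk\<bar>"
    using continuous_attains_sup[OF compact_Icc ne continuous_on_rabs[OF c3]] by blast
  define hi where "hi = F2 zh"
  have hi: "0 < hi" using I(2)[OF zh(1)] by (simp add: hi_def)
  define \<rho> where "\<rho> = min r (min 1 (1 / (2 * hi)))"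
  have rho: "0 < \<rho>" "\<rho> \<le> r" "\<rho> \<le> 1" "\<rho> \<le> 1 / (2 * hi)" using r hi by (auto simp: \<rho>_def)
  have sub: "z \<in> ?I" if "\<bar>z - c\<bar> \<le> \<rho>" for z using that rho by auto
  have "well F F1 F2 c \<rho> \<bar>(deriv ^^ 3) F zk\<bar> (F2 zl) hi"
  proof
    show "0 < \<rho>" by fact
    show "0 < F2 zl" by (rule I(2)[OF zl(1)])
    fix z assume z: "\<bar>z - c\<bar> \<le> \<rho>"
    show "(F has_real_derivative F1 z) (at z)" "(F1 has_real_derivative F2 z) (at z)"
      using DF D2 I(1)[OF sub[OF z]] by auto
    show "F2 zl \<le> F2 z \<and> F2 z \<le> hi" using zl(2) zh(2) sub[OF z] by (auto simp: hi_def)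
    fix y assume y: "\<bar>y - c\<bar> \<le> \<rho>"
    have "norm (F2 y - F2 z) \<le> \<bar>(deriv ^^ 3) F zk\<bar> * norm (y - z)"
    proof (rule field_differentiable_bound[of ?I])
      show "(F2 has_field_derivative (deriv ^^ 3) F w) (at w within ?I)" if "w \<in> ?I" for w
        by (rule has_field_derivative_at_within, rule D3, rule I[OF that])
    qed (use zk(2) sub y z in auto)
    then show "\<bar>F2 y - F2 z\<bar> \<le> \<bar>(deriv ^^ 3) F zk\<bar> * \<bar>y - z\<bar>" by simp
  next
    have "2 * \<rho>\<^sup>2 * hi = \<rho> * (\<rho> * (2 * hi))" by (simp add: power2_eq_square)
    also have "\<dots> \<le> 1 * (1 / (2 * hi) * (2 * hi))" using rho hi by (intro mult_mono) auto
    also have "\<dots> = 1" using hi by simp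
    finally show "2 * \<rho>\<^sup>2 * hi \<le> 1" .
  qed
  then show thesis
  proof (rule that)
    show "0 < c - \<rho>" using rr rho by linarith
    show "c < a \<Longrightarrow> c + \<rho> < a" using rr(2) rho by linarith
    show "b < c \<Longrightarrow> b < c - \<rho>" using rr(3) rho by linarith
  qed
qed

definition slowness :: "real \<Rightarrow> real \<Rightarrow> real \<Rightarrow> real \<Rightarrow> real" where
  "slowness \<epsilon> \<sigma> c z = slowness_factor (\<epsilon>\<^sup>2 * (Gibbs F \<sigma> z - c)) / sqrt (Gibbs F \<sigma> z - c)"

text \<open>Admissibility is included because a square around the Maxwell point also contains pairs
  below one of the minima, for which the logarithms p and q make no sense.\<close>

definition near :: "real \<Rightarrow> real \<Rightarrow> real \<Rightarrow> bool" where
  "near d \<sigma> c \<longleftrightarrow> admissible F a b (\<sigma>, c) \<and> \<bar>\<sigma> - s0\<bar> < d \<and> \<bar>c - c0\<bar> < d"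

lemma near_mono: "near d \<sigma> c \<Longrightarrow> d \<le> d' \<Longrightarrow> near d' \<sigma> c"
  by (auto simp: near_def)

definition pA :: "real \<Rightarrow> real \<Rightarrow> real" where "pA \<sigma> c = - ln (c - left_min \<sigma>)"
definition pB :: "real \<Rightarrow> real \<Rightarrow> real" where "pB \<sigma> c = - ln (c - right_min \<sigma>)"

text \<open>This is \<open>log_estimate\<close> in terms of the parameters: the displacement of the
  bottom is now measured by that of \<sigma>.\<close>

definition half_estimate ::
  "(real \<Rightarrow> real \<Rightarrow> real \<Rightarrow> real) \<Rightarrow> (real \<Rightarrow> real \<Rightarrow> real) \<Rightarrow> real \<Rightarrow> real \<Rightarrow> real \<Rightarrow> real \<Rightarrow> bool" where
  "half_estimate L p g \<theta> d C \<longleftrightarrow> (\<forall>\<epsilon> \<sigma> c. 0 \<le> \<epsilon> \<and> \<epsilon> \<le> 1 \<and> near d \<sigma> c \<longrightarrow>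
     0 \<le> p \<sigma> c \<and> \<bar>L \<epsilon> \<sigma> c - g * p \<sigma> c\<bar> \<le> \<theta> * p \<sigma> c + C \<and>
     (\<forall>\<sigma>' c'. near d \<sigma>' c' \<longrightarrow>
        \<bar>L \<epsilon> \<sigma> c - L \<epsilon> \<sigma>' c' - g * (p \<sigma> c - p \<sigma>' c')\<bar>
        \<le> \<theta> * \<bar>p \<sigma> c - p \<sigma>' c'\<bar> + C * (1 + max (p \<sigma> c) (p \<sigma>' c')) * \<bar>\<sigma> - \<sigma>'\<bar>))"

lemma near_energy:
  assumes "near d \<sigma> c"
  shows "\<sigma> \<in> \<sigma>_range F a b" "\<sigma> \<in> rng" "0 < c - left_min \<sigma>" "0 < c - right_min \<sigma>"
    "c - left_min \<sigma> \<le> (1 + a) * d" "c - right_min \<sigma> \<le> (1 + bmax) * d"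
proof -
  have A: "\<sigma> \<in> \<sigma>_range F a b" "left_min \<sigma> < c" "right_min \<sigma> < c" "\<bar>\<sigma> - s0\<bar> < d" "\<bar>c - c0\<bar> < d"
    using assms by (auto simp: near_def admissible_def left_min_def right_min_def)
  show "\<sigma> \<in> \<sigma>_range F a b" "0 < c - left_min \<sigma>" "0 < c - right_min \<sigma>" using A by auto
  show r: "\<sigma> \<in> rng" using A(1) by (rule \<sigma>_range_subset)
  have "0 < bmax" using be_le_bmax[OF s0_rng] be(1)[OF s0_rng] a_pos ab by linarith
  then have "a * \<bar>\<sigma> - s0\<bar> \<le> a * d" "bmax * \<bar>\<sigma> - s0\<bar> \<le> bmax * d"
    using A a_pos by (auto intro!: mult_left_mono)
  moreover have "c - left_min \<sigma> \<le> \<bar>c - c0\<bar> + \<bar>left_min \<sigma> - left_min s0\<bar>" "c - right_min \<sigma> \<le> \<bar>c - c0\<bar> + \<bar>right_min \<sigma> - right_min s0\<bar>"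
    using c0 by linarith+
  ultimately show "c - left_min \<sigma> \<le> (1 + a) * d" "c - right_min \<sigma> \<le> (1 + bmax) * d"
    using left_min_lip[OF r s0_rng] right_min_lip[OF r s0_rng] A by (auto simp: algebra_simps)
qed

text \<open>Both wells at once: \<open>s = 1\<close> is the left well, \<open>s = -1\<close> the right one seen through the
  reflection \<open>z \<mapsto> -z\<close>. Here \<open>cr \<sigma>\<close> is the bottom of the well and \<open>ep \<sigma> c\<close> the turning point.\<close>
lemma half_well_estimate:
  fixes s :: real
  assumes theta: "0 < \<theta>" and W: "well G G1 G2 x0 \<rho> K lo hi"
    and G: "\<And>\<sigma> z. \<sigma> \<in> rng \<Longrightarrow> G z - G1 (cr \<sigma>) * z = Gibbs F \<sigma> (s * z)"
    and G1: "\<And>\<sigma> \<sigma>'. \<sigma> \<in> rng \<Longrightarrow> \<sigma>' \<in> rng \<Longrightarrow> \<bar>G1 (cr \<sigma>) - G1 (cr \<sigma>')\<bar> = \<bar>\<sigma> - \<sigma>'\<bar>"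
    and cr0: "cr s0 = x0"
    and cr: "\<And>r. 0 < r \<Longrightarrow> \<exists>d>0. \<forall>\<sigma>. \<bar>\<sigma> - s0\<bar> < d \<longrightarrow> \<bar>cr \<sigma> - x0\<bar> \<le> r"
    and ep: "\<And>d \<sigma> c. near d \<sigma> c \<Longrightarrow> cr \<sigma> < ep \<sigma> c \<and> Gibbs F \<sigma> (s * ep \<sigma> c) = c"
    and below: "\<And>d \<sigma> c x. near d \<sigma> c \<Longrightarrow> cr \<sigma> \<le> x \<Longrightarrow> x < ep \<sigma> c \<Longrightarrow> Gibbs F \<sigma> (s * x) < c"
    and lev: "\<And>d \<sigma> c. near d \<sigma> c \<Longrightarrow> c - Gibbs F \<sigma> (s * cr \<sigma>) \<le> \<Lambda> * d" and Lam: "0 < \<Lambda>"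
  obtains \<eta>0 where "0 < \<eta>0" "\<eta>0 \<le> \<rho>"
    "\<And>\<eta>. 0 < \<eta> \<Longrightarrow> \<eta> \<le> \<eta>0 \<Longrightarrow> \<exists>d>0. \<exists>C\<ge>0. \<exists>L.
      half_estimate L (\<lambda>\<sigma> c. - ln (c - Gibbs F \<sigma> (s * cr \<sigma>))) ((p * s * x0 + q) / sqrt (G2 x0) / 2) \<theta> d C \<and>
      (\<forall>\<epsilon> \<sigma> c. 0 \<le> \<epsilon> \<and> \<epsilon> \<le> 1 \<and> near d \<sigma> c \<longrightarrow>
         ((\<lambda>z. (p * (s * z) + q) * slowness \<epsilon> \<sigma> c (s * z)) has_integral L \<epsilon> \<sigma> c) {ep \<sigma> c..x0 + \<eta>} \<and>
         ep \<sigma> c < x0 + \<eta> \<and> \<bar>ep \<sigma> c - x0\<bar> \<le> C * (\<bar>\<sigma> - s0\<bar> + sqrt (c - Gibbs F \<sigma> (s * cr \<sigma>))))"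
proof -
  define M where "M = \<bar>p * s\<bar> * (\<bar>x0\<bar> + \<rho> + 1) + \<bar>q\<bar>"
  interpret weighted_well G G1 G2 x0 \<rho> K lo hi "\<lambda>z. p * s * z + q" M
    unfolding M_def by (rule affine_weighted_well[OF W])
  obtain \<eta>0 where e0: "0 < \<eta>0" "\<eta>0 \<le> \<rho>" and
    est: "\<And>\<eta>. 0 < \<eta> \<Longrightarrow> \<eta> \<le> \<eta>0 \<Longrightarrow> \<exists>Y>0. \<exists>C\<ge>0. Y \<le> \<eta> / 4 \<and> log_estimate \<theta> \<eta> Y C"
    by (rule half_time_log_estimate[OF theta], rule that, assumption+)
  show thesis
  proof (rule that[OF e0])
    fix \<eta> :: real assume eta: "0 < \<eta>" "\<eta> \<le> \<eta>0"
    obtain Y C where Y: "0 < Y" "Y \<le> \<eta> / 4" and C: "0 \<le> C" and E: "log_estimate \<theta> \<eta> Y C"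
      using est[OF eta] by blast
    obtain d0 where d0: "0 < d0" "\<And>\<sigma>. \<bar>\<sigma> - s0\<bar> < d0 \<Longrightarrow> \<bar>cr \<sigma> - x0\<bar> \<le> \<eta> / 2"
      using cr[of "\<eta> / 2"] eta by auto
    \<comment> \<open>A near pair has energy at most \<Lambda> d above the bottom, less than the
      energy at distance Y from it; hence the turning point lies within Y of the bottom.\<close>
    define d where "d = min d0 (lo / 2 * Y\<^sup>2 / (2 * \<Lambda>))"
    have d: "0 < d" "d \<le> d0" using d0 lo Y Lam by (auto simp: d_def)
    have dlo: "\<Lambda> * d < lo / 2 * Y\<^sup>2"
    proof -
      have "\<Lambda> * d \<le> \<Lambda> * (lo / 2 * Y\<^sup>2 / (2 * \<Lambda>))" using Lam by (intro mult_left_mono) (auto simp: d_def)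
      also have "\<dots> = lo / 2 * Y\<^sup>2 / 2" using Lam by (simp add: field_simps)
      also have "\<dots> < lo / 2 * Y\<^sup>2" using lo Y by simp
      finally show ?thesis .
    qed
    define C' where "C' = C / lo + C + 1 / lo + sqrt (2 / lo)"
    have C': "0 \<le> C'" "C \<le> C'" "C / lo \<le> C'" "1 / lo \<le> C'" "sqrt (2 / lo) \<le> C'"
      using C lo by (auto simp: C'_def)
    define y where "y \<sigma> c = ep \<sigma> c - cr \<sigma>" for \<sigma> c
    define en where "en \<sigma> c = c - Gibbs F \<sigma> (s * cr \<sigma>)" for \<sigma> c
    have zy: "cr \<sigma> + y \<sigma> c = ep \<sigma> c" for \<sigma> c by (simp add: y_def)
    have F': "\<bar>cr \<sigma> - x0\<bar> \<le> \<eta> / 2" "0 < y \<sigma> c" "y \<sigma> c \<le> Y"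
      "en \<sigma> c = G (cr \<sigma> + y \<sigma> c) - G (cr \<sigma>) - G1 (cr \<sigma>) * y \<sigma> c"
      "lo / 2 * (y \<sigma> c)\<^sup>2 \<le> en \<sigma> c" "\<sigma> \<in> rng" if n: "near d \<sigma> c" for \<sigma> c
    proof -
      show r: "\<sigma> \<in> rng" by (rule near_energy(2)[OF n])
      show cn: "\<bar>cr \<sigma> - x0\<bar> \<le> \<eta> / 2" by (rule d0(2)) (use n d in \<open>auto simp: near_def\<close>)
      show y0: "0 < y \<sigma> c" using ep[OF n] by (simp add: y_def)
      have dY: "dom (cr \<sigma>) Y" using cn[unfolded abs_le_iff] Y eta e0 by (auto simp: dom_def)
      have e: "Gibbs F \<sigma> (s * (cr \<sigma> + x)) - Gibbs F \<sigma> (s * cr \<sigma>) = x\<^sup>2 * dd (cr \<sigma>) 0 x"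
        "lo / 2 * x\<^sup>2 \<le> x\<^sup>2 * dd (cr \<sigma>) 0 x" if "0 \<le> x" "x \<le> Y" for x
      proof -
        have dx: "dom (cr \<sigma>) x" by (rule dom_mono[OF dY that])
        show "Gibbs F \<sigma> (s * (cr \<sigma> + x)) - Gibbs F \<sigma> (s * cr \<sigma>) = x\<^sup>2 * dd (cr \<sigma>) 0 x"
          using dd_eq[OF dx, of 0] that unfolding G[OF r, symmetric] by (simp add: algebra_simps)
        show "lo / 2 * x\<^sup>2 \<le> x\<^sup>2 * dd (cr \<sigma>) 0 x"
          using dd_bounds(1)[OF dx, of 0] that by (subst mult.commute, intro mult_left_mono) auto
      qed
      show yY: "y \<sigma> c \<le> Y"
      proof (rule ccontr)
        assume "\<not> y \<sigma> c \<le> Y"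
        then have "Gibbs F \<sigma> (s * (cr \<sigma> + Y)) < c" using Y by (intro below[OF n]) (auto simp: y_def)
        then show False using e[of Y] Y dlo lev[OF n] by linarith
      qed
      have c: "Gibbs F \<sigma> (s * (cr \<sigma> + y \<sigma> c)) = c" unfolding zy using ep[OF n] by simp
      show "en \<sigma> c = G (cr \<sigma> + y \<sigma> c) - G (cr \<sigma>) - G1 (cr \<sigma>) * y \<sigma> c"
        using c unfolding en_def G[OF r, symmetric] by (simp add: algebra_simps)
      show "lo / 2 * (y \<sigma> c)\<^sup>2 \<le> en \<sigma> c"
        using e[of "y \<sigma> c"] y0 yY unfolding c en_def by linarith
    qed
    define L where "L \<epsilon> \<sigma> c = half_time \<epsilon> \<eta> (cr \<sigma>) (y \<sigma> c)" for \<epsilon> \<sigma> c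
    define P where "P \<sigma> c = - ln (en \<sigma> c)" for \<sigma> c
    have P: "log_height (cr \<sigma>) (y \<sigma> c) = P \<sigma> c" if "near d \<sigma> c" for \<sigma> c
      using F'(4)[OF that] by (simp add: log_height_def P_def)
    have int: "((\<lambda>z. (p * (s * z) + q) * slowness \<epsilon> \<sigma> c (s * z)) has_integral L \<epsilon> \<sigma> c) {ep \<sigma> c..x0 + \<eta>}"
      if n: "near d \<sigma> c" and eps: "0 \<le> \<epsilon>" "\<epsilon> \<le> 1" for \<epsilon> \<sigma> c
    proof -
      note f = F'[OF n]
      have "G (cr \<sigma> + y \<sigma> c) - G1 (cr \<sigma>) * (cr \<sigma> + y \<sigma> c) = c" unfolding G[OF f(6)] zy using ep[OF n] by simp
      then have Yc: "G z - G1 (cr \<sigma>) * z - (G (cr \<sigma> + y \<sigma> c) - G1 (cr \<sigma>) * (cr \<sigma> + y \<sigma> c)) = Gibbs F \<sigma> (s * z) - c" for z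
        by (simp add: G[OF f(6)])
      have b1: "x0 - \<rho> \<le> cr \<sigma>" "cr \<sigma> + y \<sigma> c < x0 + \<eta>" "\<eta> \<le> \<rho>"
        using f(1)[unfolded abs_le_iff] f(2,3) Y eta e0 by auto
      show ?thesis
        using half_time_has_integral[OF f(2) b1 eps] unfolding Yc unfolding zy slowness_def L_def by (simp add: mult.assoc)
    qed
    have cr_lip: "\<bar>cr \<sigma> - cr \<sigma>'\<bar> \<le> \<bar>\<sigma> - \<sigma>'\<bar> / lo"
      if "\<bar>cr \<sigma> - x0\<bar> \<le> \<eta> / 2" "\<bar>cr \<sigma>' - x0\<bar> \<le> \<eta> / 2" "\<sigma> \<in> rng" "\<sigma>' \<in> rng" for \<sigma> \<sigma>'
      using F1_inverse_lipschitz[of "cr \<sigma>" "cr \<sigma>'"] that eta e0 unfolding G1[OF that(3,4)] by simp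
    have GGe: "bottom_integrand / 2 = (p * s * x0 + q) / sqrt (G2 x0) / 2" unfolding bottom_integrand_def by simp
    have "half_estimate L P (bottom_integrand / 2) \<theta> d C'"
      unfolding half_estimate_def
    proof (intro allI impI conjI; elim conjE)
      fix \<epsilon> \<sigma> c :: real assume eps: "0 \<le> \<epsilon>" "\<epsilon> \<le> 1" and n: "near d \<sigma> c"
      note e = E[unfolded log_estimate_def, rule_format, OF conjI[OF eps(1) conjI[OF eps(2)
            conjI[OF F'(1)[OF n] conjI[OF F'(2,3)[OF n]]]]], unfolded P[OF n], folded L_def]
      show "0 \<le> P \<sigma> c" using e by simp
      show "\<bar>L \<epsilon> \<sigma> c - bottom_integrand / 2 * P \<sigma> c\<bar> \<le> \<theta> * P \<sigma> c + C'" using e C' by linarith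
      fix \<sigma>' c' assume n': "near d \<sigma>' c'"
      note f = F'[OF n] and f' = F'[OF n']
      have "\<bar>L \<epsilon> \<sigma> c - L \<epsilon> \<sigma>' c' - bottom_integrand / 2 * (P \<sigma> c - P \<sigma>' c')\<bar>
        \<le> \<theta> * \<bar>P \<sigma> c - P \<sigma>' c'\<bar> + C * (1 + max (P \<sigma> c) (P \<sigma>' c')) * \<bar>cr \<sigma> - cr \<sigma>'\<bar>"
        using e f'(1-3) P[OF n'] unfolding L_def[of _ \<sigma>' c'] by metis
      also have "C * (1 + max (P \<sigma> c) (P \<sigma>' c')) * \<bar>cr \<sigma> - cr \<sigma>'\<bar>
          \<le> C * (1 + max (P \<sigma> c) (P \<sigma>' c')) * (\<bar>\<sigma> - \<sigma>'\<bar> / lo)"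
        using e C by (intro mult_left_mono cr_lip f f') auto
      also have "\<dots> = (C / lo) * (1 + max (P \<sigma> c) (P \<sigma>' c')) * \<bar>\<sigma> - \<sigma>'\<bar>" by simp
      also have "\<dots> \<le> C' * (1 + max (P \<sigma> c) (P \<sigma>' c')) * \<bar>\<sigma> - \<sigma>'\<bar>"
        using e C' by (intro mult_right_mono) auto
      finally show "\<bar>L \<epsilon> \<sigma> c - L \<epsilon> \<sigma>' c' - bottom_integrand / 2 * (P \<sigma> c - P \<sigma>' c')\<bar>
        \<le> \<theta> * \<bar>P \<sigma> c - P \<sigma>' c'\<bar> + C' * (1 + max (P \<sigma> c) (P \<sigma>' c')) * \<bar>\<sigma> - \<sigma>'\<bar>" by simp
    qed
    \<comment> \<open>The turning point is off by the shift of the bottom, linear in \<sigma> - s0,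
      plus its distance from the bottom, of the order of the root of the energy.\<close>
    moreover have "ep \<sigma> c < x0 + \<eta>" "\<bar>ep \<sigma> c - x0\<bar> \<le> C' * (\<bar>\<sigma> - s0\<bar> + sqrt (en \<sigma> c))"
      if n: "near d \<sigma> c" for \<sigma> c
    proof -
      note f = F'[OF n]
      show "ep \<sigma> c < x0 + \<eta>" using f(1)[unfolded abs_le_iff] f(2,3) Y eta unfolding zy[symmetric] by auto
      have 1: "\<bar>cr \<sigma> - x0\<bar> \<le> C' * \<bar>\<sigma> - s0\<bar>"
      proof -
        have "\<bar>cr \<sigma> - cr s0\<bar> \<le> \<bar>\<sigma> - s0\<bar> / lo"
          by (rule cr_lip) (use f s0_rng eta in \<open>auto simp: cr0\<close>)
        also have "\<dots> = 1 / lo * \<bar>\<sigma> - s0\<bar>" by simp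
        also have "\<dots> \<le> C' * \<bar>\<sigma> - s0\<bar>" using C' by (intro mult_right_mono) auto
        finally show ?thesis by (simp add: cr0)
      qed
      have 2: "y \<sigma> c \<le> C' * sqrt (en \<sigma> c)"
      proof -
        have p: "0 \<le> en \<sigma> c" using f(5) lo zero_le_power2[of "y \<sigma> c"] by (meson half_gt_zero less_imp_le mult_nonneg_nonneg order_trans)
        have "(y \<sigma> c)\<^sup>2 \<le> 2 / lo * en \<sigma> c" using f(5) lo by (simp add: field_simps)
        then have "y \<sigma> c \<le> sqrt (2 / lo * en \<sigma> c)" by (rule real_le_rsqrt)
        also have "\<dots> = sqrt (2 / lo) * sqrt (en \<sigma> c)" by (rule real_sqrt_mult)
        also have "\<dots> \<le> C' * sqrt (en \<sigma> c)" using C' p by (intro mult_right_mono) auto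
        finally show ?thesis .
      qed
      show "\<bar>ep \<sigma> c - x0\<bar> \<le> C' * (\<bar>\<sigma> - s0\<bar> + sqrt (en \<sigma> c))"
        using 1 2 f(2) unfolding zy[symmetric] distrib_left by linarith
    qed
    ultimately show "\<exists>d>0. \<exists>C\<ge>0. \<exists>L.
      half_estimate L (\<lambda>\<sigma> c. - ln (c - Gibbs F \<sigma> (s * cr \<sigma>))) ((p * s * x0 + q) / sqrt (G2 x0) / 2) \<theta> d C \<and>
      (\<forall>\<epsilon> \<sigma> c. 0 \<le> \<epsilon> \<and> \<epsilon> \<le> 1 \<and> near d \<sigma> c \<longrightarrow>
         ((\<lambda>z. (p * (s * z) + q) * slowness \<epsilon> \<sigma> c (s * z)) has_integral L \<epsilon> \<sigma> c) {ep \<sigma> c..x0 + \<eta>} \<and>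
         ep \<sigma> c < x0 + \<eta> \<and> \<bar>ep \<sigma> c - x0\<bar> \<le> C * (\<bar>\<sigma> - s0\<bar> + sqrt (c - Gibbs F \<sigma> (s * cr \<sigma>))))"
      using d(1) C'(1) int unfolding GGe P_def en_def by blast
  qed
qed

lemma left_half:
  assumes "0 < \<theta>"
  obtains \<eta>0 where "0 < \<eta>0" "a0 + \<eta>0 < a"
    "\<And>\<eta>. 0 < \<eta> \<Longrightarrow> \<eta> \<le> \<eta>0 \<Longrightarrow> \<exists>d>0. \<exists>C\<ge>0. \<exists>L. half_estimate L pA ((p * a0 + q) / sqrt (F2 a0) / 2) \<theta> d C \<and>
      (\<forall>\<epsilon> \<sigma> c. 0 \<le> \<epsilon> \<and> \<epsilon> \<le> 1 \<and> near d \<sigma> c \<longrightarrow>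
         ((\<lambda>z. (p * z + q) * slowness \<epsilon> \<sigma> c z) has_integral L \<epsilon> \<sigma> c) {zl \<sigma> c..a0 + \<eta>} \<and>
         zl \<sigma> c < a0 + \<eta> \<and> \<bar>zl \<sigma> c - a0\<bar> \<le> C * (\<bar>\<sigma> - s0\<bar> + sqrt (c - left_min \<sigma>)))"
proof -
  obtain \<rho> K lo hi where W: "well F F1 F2 a0 \<rho> K lo hi" "a0 + \<rho> < a"
    using exists_well[of a0] a0b0(3,4) by metis
  show thesis
  proof (rule half_well_estimate[where s=1 and cr=al and ep=zl and p=p and q=q, OF assms W(1)])
    show "F z - F1 (al \<sigma>) * z = Gibbs F \<sigma> (1 * z)" if "\<sigma> \<in> rng" for \<sigma> z using al(3)[OF that] by (simp add: Gibbs_def)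
    show "\<bar>F1 (al \<sigma>) - F1 (al \<sigma>')\<bar> = \<bar>\<sigma> - \<sigma>'\<bar>" if "\<sigma> \<in> rng" "\<sigma>' \<in> rng" for \<sigma> \<sigma>'
      using al(3)[OF that(1)] al(3)[OF that(2)] by simp
    show "al s0 = a0" by (simp add: a0b0(1))
    show "\<exists>d>0. \<forall>\<sigma>. \<bar>\<sigma> - s0\<bar> < d \<longrightarrow> \<bar>al \<sigma> - a0\<bar> \<le> r" if "0 < r" for r
      using al_near[OF that] by (metis less_imp_le)
    show "0 < 1 + a" using a_pos by simp
    fix d \<sigma> c assume n: "near d \<sigma> c"
    have adm: "admissible F a b (\<sigma>, c)" using n by (simp add: near_def)
    show "c - Gibbs F \<sigma> (1 * al \<sigma>) \<le> (1 + a) * d" using near_energy(5)[OF n] by (simp add: left_min_def)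
    show "al \<sigma> < zl \<sigma> c \<and> Gibbs F \<sigma> (1 * zl \<sigma> c) = c" using z1(1,3)[OF adm] by simp
    show "Gibbs F \<sigma> (1 * x) < c" if "al \<sigma> \<le> x" "x < zl \<sigma> c" for x
      using Gibbs_mono(2)[OF near_energy(2)[OF n] that] z1(2,3)[OF adm] by simp
  qed (rule that, assumption, insert W(2), linarith, simp add: pA_def[abs_def] left_min_def)
qed

lemma right_half:
  assumes "0 < \<theta>"
  obtains \<eta>0 where "0 < \<eta>0" "b < b0 - \<eta>0"
    "\<And>\<eta>. 0 < \<eta> \<Longrightarrow> \<eta> \<le> \<eta>0 \<Longrightarrow> \<exists>d>0. \<exists>C\<ge>0. \<exists>L. half_estimate L pB ((p * b0 + q) / sqrt (F2 b0) / 2) \<theta> d C \<and>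
      (\<forall>\<epsilon> \<sigma> c. 0 \<le> \<epsilon> \<and> \<epsilon> \<le> 1 \<and> near d \<sigma> c \<longrightarrow>
         ((\<lambda>z. (p * z + q) * slowness \<epsilon> \<sigma> c z) has_integral L \<epsilon> \<sigma> c) {b0 - \<eta>..zr \<sigma> c} \<and>
         b0 - \<eta> < zr \<sigma> c \<and> \<bar>zr \<sigma> c - b0\<bar> \<le> C * (\<bar>\<sigma> - s0\<bar> + sqrt (c - right_min \<sigma>)))"
proof -
  obtain \<rho> K lo hi where W: "well F F1 F2 b0 \<rho> K lo hi" "b < b0 - \<rho>"
    using exists_well[of b0] a0b0(5) a_pos ab by (metis less_trans)
  have refl: "((\<lambda>z. (p * (- 1 * z) + q) * slowness \<epsilon> \<sigma> c (- 1 * z)) has_integral I) {- zr \<sigma> c..- b0 + \<eta>}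
      \<longleftrightarrow> ((\<lambda>z. (p * z + q) * slowness \<epsilon> \<sigma> c z) has_integral I) {b0 - \<eta>..zr \<sigma> c}" for \<epsilon> \<sigma> c I \<eta>
    using has_integral_reflect_real[of "\<lambda>z. (p * z + q) * slowness \<epsilon> \<sigma> c z" I "zr \<sigma> c" "b0 - \<eta>"] by simp
  show thesis
  proof (rule half_well_estimate[where s="- 1" and cr="\<lambda>\<sigma>. - be \<sigma>" and ep="\<lambda>\<sigma> c. - zr \<sigma> c" and p=p and q=q,
        OF assms well_reflect[OF W(1)]])
    show "F (- z) - - F1 (- (- be \<sigma>)) * z = Gibbs F \<sigma> (- 1 * z)" if "\<sigma> \<in> rng" for \<sigma> z
      using be(2)[OF that] by (simp add: Gibbs_def)
    show "\<bar>- F1 (- (- be \<sigma>)) - - F1 (- (- be \<sigma>'))\<bar> = \<bar>\<sigma> - \<sigma>'\<bar>" if "\<sigma> \<in> rng" "\<sigma>' \<in> rng" for \<sigma> \<sigma>'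
      using be(2)[OF that(1)] be(2)[OF that(2)] by (simp add: abs_minus_commute)
    show "- be s0 = - b0" by (simp add: a0b0(2))
    show "\<exists>d>0. \<forall>\<sigma>. \<bar>\<sigma> - s0\<bar> < d \<longrightarrow> \<bar>- be \<sigma> - - b0\<bar> \<le> r" if r: "0 < r" for r
    proof -
      obtain d where "0 < d" "\<And>\<sigma>. \<bar>\<sigma> - s0\<bar> < d \<Longrightarrow> \<bar>be \<sigma> - b0\<bar> < r" using al_near[OF r] by metis
      then show ?thesis by (intro exI[of _ d]) (auto simp: abs_minus_commute less_imp_le)
    qed
    show "0 < 1 + bmax" using be_le_bmax[OF s0_rng] be(1)[OF s0_rng] a_pos ab by linarith
    fix d \<sigma> c assume n: "near d \<sigma> c"
    have adm: "admissible F a b (\<sigma>, c)" using n by (simp add: near_def)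
    show "c - Gibbs F \<sigma> (- 1 * (- be \<sigma>)) \<le> (1 + bmax) * d" using near_energy(6)[OF n] by (simp add: right_min_def)
    show "- be \<sigma> < - zr \<sigma> c \<and> Gibbs F \<sigma> (- 1 * (- zr \<sigma> c)) = c" using z2(2,3)[OF adm] by simp
    show "Gibbs F \<sigma> (- 1 * x) < c" if "- be \<sigma> \<le> x" "x < - zr \<sigma> c" for x
      using Gibbs_mono(3)[OF near_energy(2)[OF n], of "zr \<sigma> c" "- x"] z2(1,3)[OF adm] that by simp
  next
    fix \<eta>0 assume e0: "0 < \<eta>0" "\<eta>0 \<le> \<rho>" and est: "\<And>\<eta>. 0 < \<eta> \<Longrightarrow> \<eta> \<le> \<eta>0 \<Longrightarrow> \<exists>d>0. \<exists>C\<ge>0. \<exists>L.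
      half_estimate L (\<lambda>\<sigma> c. - ln (c - Gibbs F \<sigma> (- 1 * (- be \<sigma>)))) ((p * (- 1) * (- b0) + q) / sqrt (F2 (- (- b0))) / 2) \<theta> d C \<and>
      (\<forall>\<epsilon> \<sigma> c. 0 \<le> \<epsilon> \<and> \<epsilon> \<le> 1 \<and> near d \<sigma> c \<longrightarrow>
         ((\<lambda>z. (p * (- 1 * z) + q) * slowness \<epsilon> \<sigma> c (- 1 * z)) has_integral L \<epsilon> \<sigma> c) {- zr \<sigma> c..- b0 + \<eta>} \<and>
         - zr \<sigma> c < - b0 + \<eta> \<and>
         \<bar>- zr \<sigma> c - (- b0)\<bar> \<le> C * (\<bar>\<sigma> - s0\<bar> + sqrt (c - Gibbs F \<sigma> (- 1 * (- be \<sigma>)))))"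
    have pB: "(\<lambda>\<sigma> c. - ln (c - Gibbs F \<sigma> (- 1 * (- be \<sigma>)))) = pB" by (simp add: pB_def[abs_def] right_min_def)
    have eq: "- zr \<sigma> c < - b0 + \<eta> \<longleftrightarrow> b0 - \<eta> < zr \<sigma> c" "\<bar>- zr \<sigma> c - (- b0)\<bar> = \<bar>zr \<sigma> c - b0\<bar>"
      "Gibbs F \<sigma> (- 1 * (- be \<sigma>)) = right_min \<sigma>" "p * (- 1) * (- b0) = p * b0" "- (- b0) = b0" for \<sigma> c \<eta>
      by (auto simp: abs_minus_commute right_min_def)
    show thesis
      by (rule that[OF e0(1)]) (use e0 W(2) est[unfolded refl pB, unfolded eq] in auto)
  qed
qed

end

section \<open>The time and mass equations\<close>

text \<open>Energies are exp (-p) and exp (-q). Beyond r they vary by only exp (-r) times the change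
  of p and q, which beats the large constants in the estimates.\<close>

lemma exp_minus_lipschitz:
  fixes r p p' :: real
  assumes "r \<le> p" "r \<le> p'"
  shows "\<bar>exp (- p) - exp (- p')\<bar> \<le> exp (- r) * \<bar>p - p'\<bar>"
proof -
  have *: "exp (- p) - exp (- p') \<le> exp (- r) * (p' - p)" if "r \<le> p" "p \<le> p'" for p p'
  proof -
    have "1 - (p' - p) \<le> exp (- (p' - p))"
      unfolding minus_diff_eq using exp_ge_add_one_self[of "p - p'"] by linarith
    then have "exp (- p) * (1 - exp (- (p' - p))) \<le> exp (- p) * (p' - p)" by (intro mult_left_mono) auto
    also have "\<dots> \<le> exp (- r) * (p' - p)" using that by (intro mult_right_mono) auto
    finally show ?thesis by (simp add: right_diff_distrib exp_add[symmetric])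
  qed
  show ?thesis
  proof (cases "p \<le> p'")
    case True
    have "exp (- p') \<le> exp (- p)" using True by simp
    then show ?thesis using *[OF assms(1) True] True by (simp add: abs_if)
  next
    case False
    then have le: "p' \<le> p" by simp
    have "exp (- p) \<le> exp (- p')" using le by simp
    then show ?thesis using *[OF assms(2) le] le by (simp add: abs_if)
  qed
qed

text \<open>Banach's fixed point theorem for \<open>(p, q) \<mapsto> (p + (Y1 - H1 p q) / g1, q + (Y2 - H2 p q) / g2)\<close>.\<close>
lemma unique_solution_in_box:
  fixes H1 H2 :: "real \<Rightarrow> real \<Rightarrow> real" and x y R g1 g2 Y1 Y2 :: real
  defines "S \<equiv> {x - R..x + R} \<times> {y - R..y + R}"
  assumes g: "0 < g1" "0 < g2" and R: "0 \<le> R"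
    and c1: "\<bar>H1 x y - Y1\<bar> \<le> g1 * R / 2" and c2: "\<bar>H2 x y - Y2\<bar> \<le> g2 * R / 2"
    and L1: "\<And>p q p' q'. (p, q) \<in> S \<Longrightarrow> (p', q') \<in> S \<Longrightarrow>
      \<bar>H1 p q - H1 p' q' - g1 * (p - p')\<bar> \<le> g1 / 8 * (\<bar>p - p'\<bar> + \<bar>q - q'\<bar>)"
    and L2: "\<And>p q p' q'. (p, q) \<in> S \<Longrightarrow> (p', q') \<in> S \<Longrightarrow>
      \<bar>H2 p q - H2 p' q' - g2 * (q - q')\<bar> \<le> g2 / 8 * (\<bar>p - p'\<bar> + \<bar>q - q'\<bar>)"
  shows "\<exists>p q. (p, q) \<in> S \<and> H1 p q = Y1 \<and> H2 p q = Y2 \<and>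
    (\<forall>p' q'. (p', q') \<in> S \<and> H1 p' q' = Y1 \<and> H2 p' q' = Y2 \<longrightarrow> p' = p \<and> q' = q)"
proof -
  define f1 where "f1 p q = p + (Y1 - H1 p q) / g1" for p q
  define f2 where "f2 p q = q + (Y2 - H2 p q) / g2" for p q
  have D1: "\<bar>f1 p q - f1 p' q'\<bar> \<le> (\<bar>p - p'\<bar> + \<bar>q - q'\<bar>) / 8" if "(p, q) \<in> S" "(p', q') \<in> S" for p q p' q'
  proof -
    have "f1 p q - f1 p' q' = - (H1 p q - H1 p' q' - g1 * (p - p')) / g1"
      using g by (simp add: f1_def field_simps)
    also have "\<bar>\<dots>\<bar> = \<bar>H1 p q - H1 p' q' - g1 * (p - p')\<bar> / g1" using g by (simp add: abs_divide)
    also have "\<dots> \<le> (g1 / 8 * (\<bar>p - p'\<bar> + \<bar>q - q'\<bar>)) / g1" using g by (intro divide_right_mono L1 that) auto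
    finally show ?thesis using g by simp
  qed
  have D2: "\<bar>f2 p q - f2 p' q'\<bar> \<le> (\<bar>p - p'\<bar> + \<bar>q - q'\<bar>) / 8" if "(p, q) \<in> S" "(p', q') \<in> S" for p q p' q'
  proof -
    have "f2 p q - f2 p' q' = - (H2 p q - H2 p' q' - g2 * (q - q')) / g2"
      using g by (simp add: f2_def field_simps)
    also have "\<bar>\<dots>\<bar> = \<bar>H2 p q - H2 p' q' - g2 * (q - q')\<bar> / g2" using g by (simp add: abs_divide)
    also have "\<dots> \<le> (g2 / 8 * (\<bar>p - p'\<bar> + \<bar>q - q'\<bar>)) / g2" using g by (intro divide_right_mono L2 that) auto
    finally show ?thesis using g by simp
  qed
  have cS: "(x, y) \<in> S" using R by (simp add: S_def)
  have m1: "\<bar>f1 x y - x\<bar> \<le> R / 2" using c1 g by (simp add: f1_def abs_divide field_simps abs_minus_commute)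
  have m2: "\<bar>f2 x y - y\<bar> \<le> R / 2" using c2 g by (simp add: f2_def abs_divide field_simps abs_minus_commute)
  let ?f = "\<lambda>z. (f1 (fst z) (snd z), f2 (fst z) (snd z))"
  have "\<exists>!z\<in>S. ?f z = z"
  proof (rule Banach_fix[where c="1/2"])
    have "compact S" unfolding S_def by (intro compact_Times compact_Icc)
    then show "complete S" by (rule compact_imp_complete)
    show "S \<noteq> {}" using cS by auto
    show "?f ` S \<subseteq> S"
    proof (rule image_subsetI)
      fix z assume z: "z \<in> S"
      obtain p q where pq: "z = (p, q)" by (cases z)
      have b: "\<bar>p - x\<bar> \<le> R" "\<bar>q - y\<bar> \<le> R" using z by (auto simp: pq S_def abs_le_iff)
      have pS: "(p, q) \<in> S" using z pq by simp
      \<comment> \<open>Each coordinate of the image differs by at most (R + R)/8 from that of the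
        image of the center, which itself lies within R/2 of the center.\<close>
      have "\<bar>f1 p q - f1 x y\<bar> \<le> R / 4" "\<bar>f2 p q - f2 x y\<bar> \<le> R / 4"
        using D1[OF pS cS] D2[OF pS cS] b by simp_all
      then have "\<bar>f1 p q - x\<bar> \<le> R" "\<bar>f2 p q - y\<bar> \<le> R"
        using m1 m2 R by linarith+
      then show "?f z \<in> S" by (auto simp: pq S_def abs_le_iff)
    qed
    fix z z' assume z: "z \<in> S" "z' \<in> S"
    obtain p q p' q' where pq: "z = (p, q)" "z' = (p', q')" by (cases z, cases z')
    have "dist (?f z) (?f z') \<le> \<bar>f1 p q - f1 p' q'\<bar> + \<bar>f2 p q - f2 p' q'\<bar>"
      by (simp add: pq dist_Pair_Pair dist_real_def sqrt_sum_squares_le_sum_abs)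
    \<comment> \<open>The sum of the coordinate changes contracts by 1/4; returning to the Euclidean
      distance costs at most a factor 2.\<close>
    also have "\<dots> \<le> (\<bar>p - p'\<bar> + \<bar>q - q'\<bar>) / 4"
      using D1[of p q p' q'] D2[of p q p' q'] z pq by simp
    also have "\<dots> \<le> 1 / 2 * dist z z'"
    proof -
      have "\<bar>p - p'\<bar> \<le> dist z z'" "\<bar>q - q'\<bar> \<le> dist z z'"
        using dist_fst_le[of z z'] dist_snd_le[of z z'] by (auto simp: pq dist_real_def)
      then show ?thesis by simp
    qed
    finally show "dist (?f z) (?f z') \<le> 1 / 2 * dist z z'" .
  qed auto
  moreover have eq: "?f (p, q) = (p, q) \<longleftrightarrow> H1 p q = Y1 \<and> H2 p q = Y2" for p q
    using g by (auto simp: f1_def f2_def)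
  ultimately obtain z where z: "z \<in> S" "?f z = z" "\<And>z'. z' \<in> S \<Longrightarrow> ?f z' = z' \<Longrightarrow> z' = z" by blast
  obtain p q where pq: "z = (p, q)" by (cases z)
  show ?thesis
  proof (intro exI conjI allI impI)
    show "(p, q) \<in> S" using z(1) pq by simp
    show "H1 p q = Y1" "H2 p q = Y2" using z(2) eq[of p q] unfolding pq by blast+
    fix p' q' assume h: "(p', q') \<in> S \<and> H1 p' q' = Y1 \<and> H2 p' q' = Y2"
    then have "(p', q') = z" using z(3)[of "(p', q')"] eq[of p' q'] by blast
    then show "p' = p" "q' = q" by (auto simp: pq)
  qed
qed

section \<open>Splitting the weighted integrals into two wells and a middle piece\<close>

context double_well
begin

text \<open>The slope at energy y is finite only for \<epsilon>^2 y < 1, and 1/2 keeps a margin.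
  Along an orbit the energy is largest at \<zeta>, where it is bounded uniformly over near
  pairs.\<close>

lemma energy_bound:
  obtains \<epsilon>1 where "0 < \<epsilon>1" "\<epsilon>1 \<le> 1"
    "\<And>\<epsilon> \<sigma> c z. 0 \<le> \<epsilon> \<Longrightarrow> \<epsilon> < \<epsilon>1 \<Longrightarrow> near 1 \<sigma> c \<Longrightarrow> z \<in> {zl \<sigma> c..zr \<sigma> c} \<Longrightarrow>
      \<epsilon>\<^sup>2 * (Gibbs F \<sigma> z - c) \<le> 1 / 2"
proof -
  have "continuous_on {a..b} F"
    by (rule DERIV_continuous_on[where D=F1], rule has_field_derivative_at_within, rule DF) (use a_pos in auto)
  then obtain x where x: "\<And>z. z \<in> {a..b} \<Longrightarrow> F z \<le> F x"
    using continuous_attains_sup[OF compact_Icc, of a b F] ab by (metis atLeastAtMost_iff empty_iff less_imp_le order_refl)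
  define Y where "Y = \<bar>F x\<bar> + (\<bar>s0\<bar> + 1) * b + \<bar>c0\<bar> + 1"
  have Y: "1 \<le> Y" using a_pos ab by (simp add: Y_def)
  show thesis
  proof (rule that[of "min 1 (1 / (2 * Y))"])
    fix \<epsilon> \<sigma> c z assume eps: "0 \<le> \<epsilon>" "\<epsilon> < min 1 (1 / (2 * Y))" and n: "near 1 \<sigma> c"
      and z: "z \<in> {zl \<sigma> c..zr \<sigma> c}"
    note ne = near_energy[OF n]
    have adm: "admissible F a b (\<sigma>, c)" and sc: "\<bar>\<sigma> - s0\<bar> < 1" "\<bar>c - c0\<bar> < 1" using n by (auto simp: near_def)
    note zz = ze[OF ne(2)]
    have "Gibbs F \<sigma> z \<le> Gibbs F \<sigma> (ze \<sigma>)"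
      using Gibbs_mono(2)[OF ne(2), of z "ze \<sigma>"] Gibbs_mono(3)[OF ne(2), of "ze \<sigma>" z] z z1(1-3)[OF adm] z2(1-3)[OF adm]
      by (cases z "ze \<sigma>" rule: linorder_cases) auto
    also have "\<dots> \<le> \<bar>F x\<bar> + (\<bar>s0\<bar> + 1) * b"
    proof -
      have "- \<sigma> * ze \<sigma> \<le> \<bar>\<sigma>\<bar> * ze \<sigma>" using zz a_pos by (intro mult_right_mono) auto
      also have "\<dots> \<le> (\<bar>s0\<bar> + 1) * b" using zz a_pos sc by (intro mult_mono) auto
      finally show ?thesis using x[of "ze \<sigma>"] zz by (simp add: Gibbs_def)
    qed
    finally have "Gibbs F \<sigma> z - c \<le> Y" using sc by (simp add: Y_def)
    then have "\<epsilon>\<^sup>2 * (Gibbs F \<sigma> z - c) \<le> \<epsilon>\<^sup>2 * Y" by (intro mult_left_mono) auto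
    also have "\<dots> \<le> \<epsilon> * Y"
    proof (rule mult_right_mono)
      show "\<epsilon>\<^sup>2 \<le> \<epsilon>" using eps power_decreasing[of 1 2 \<epsilon>] by simp
    qed (use Y in simp)
    also have "\<dots> \<le> 1 / (2 * Y) * Y" using eps Y by (intro mult_right_mono) auto
    also have "\<dots> = 1 / 2" using Y by simp
    finally show "\<epsilon>\<^sup>2 * (Gibbs F \<sigma> z - c) \<le> 1 / 2" .
  qed (use Y in auto)
qed

text \<open>At the Maxwell parameters the energy between the wells is positive, by compactness at
  least 2m; a perturbation of size d changes it by at most (1 + b0) d <= m.\<close>

lemma middle_bound:
  assumes "0 < \<eta>" "a0 + \<eta> < a" "b < b0 - \<eta>"
  obtains m d where "0 < m" "0 < d" "d \<le> 1"
    "\<And>\<sigma> c z. \<bar>\<sigma> - s0\<bar> < d \<Longrightarrow> \<bar>c - c0\<bar> < d \<Longrightarrow> z \<in> {a0 + \<eta>..b0 - \<eta>} \<Longrightarrow> m \<le> Gibbs F \<sigma> z - c"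
proof -
  have "continuous_on {a0 + \<eta>..b0 - \<eta>} (Gibbs F s0)" using cont_Gibbs[of "a0 + \<eta>"] a0b0 assms by auto
  then obtain x where x: "x \<in> {a0 + \<eta>..b0 - \<eta>}" "\<And>z. z \<in> {a0 + \<eta>..b0 - \<eta>} \<Longrightarrow> Gibbs F s0 x \<le> Gibbs F s0 z"
    using continuous_attains_inf[OF compact_Icc, of "a0 + \<eta>" "b0 - \<eta>" "Gibbs F s0"] assms ab by auto
  have "c0 < Gibbs F s0 x"
  proof (cases "x \<le> ze s0")
    case True
    then have "Gibbs F s0 (al s0) < Gibbs F s0 x"
      using Gibbs_mono(2)[OF s0_rng, of "al s0" x] x assms a0b0(1) by auto
    then show ?thesis using c0(1) by (simp add: left_min_def)
  next
    case False
    then have "Gibbs F s0 (be s0) < Gibbs F s0 x"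
      using Gibbs_mono(3)[OF s0_rng, of x "be s0"] x assms a0b0(2) by auto
    then show ?thesis using c0(2) by (simp add: right_min_def)
  qed
  define m where "m = (Gibbs F s0 x - c0) / 2"
  have m: "0 < m" using \<open>c0 < Gibbs F s0 x\<close> by (simp add: m_def)
  have b0: "0 < b0" using a0b0 by linarith
  define d where "d = min 1 (m / (1 + b0))"
  have dm: "(1 + b0) * d \<le> m"
  proof -
    have "(1 + b0) * d \<le> (1 + b0) * (m / (1 + b0))" using b0 by (intro mult_left_mono) (auto simp: d_def)
    then show ?thesis using b0 by simp
  qed
  show thesis
  proof (rule that[OF m])
    show "0 < d" "d \<le> 1" using m b0 by (auto simp: d_def)
    fix \<sigma> c z assume sc: "\<bar>\<sigma> - s0\<bar> < d" "\<bar>c - c0\<bar> < d" and z: "z \<in> {a0 + \<eta>..b0 - \<eta>}"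
    have zb: "0 < z" "z \<le> b0" using z assms a0b0 by auto
    have "(\<sigma> - s0) * z \<le> \<bar>\<sigma> - s0\<bar> * z" using zb by (intro mult_right_mono) auto
    also have "\<dots> \<le> d * b0" using sc zb by (intro mult_mono) auto
    finally have "(\<sigma> - s0) * z + (c - c0) \<le> (1 + b0) * d" using sc by (simp add: algebra_simps)
    moreover have "2 * m \<le> Gibbs F s0 z - c0" using x(2)[OF z] by (simp add: m_def)
    moreover have "Gibbs F \<sigma> z - c = Gibbs F s0 z - c0 - ((\<sigma> - s0) * z + (c - c0))"
      by (simp add: Gibbs_def algebra_simps)
    ultimately show "m \<le> Gibbs F \<sigma> z - c" using dm by linarith
  qed
qed

text \<open>Near the Maxwell point the upper bound in \<open>admissible\<close> is automatic: \<Phi>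
  at a, and all the more at \<zeta>, exceeds c by a fixed margin. Only the two lower bounds remain
  as conditions.\<close>

lemma near_admissible:
  obtains d where "0 < d" "\<And>\<sigma> c. \<bar>\<sigma> - s0\<bar> < d \<Longrightarrow> \<bar>c - c0\<bar> < d \<Longrightarrow> left_min \<sigma> < c \<Longrightarrow> right_min \<sigma> < c \<Longrightarrow> admissible F a b (\<sigma>, c)"
    "\<And>\<sigma>. \<bar>\<sigma> - s0\<bar> < d \<Longrightarrow> \<sigma> \<in> \<sigma>_range F a b"
proof -
  define \<eta> where "\<eta> = min ((a - a0) / 2) ((b0 - b) / 2)"
  have "\<eta> \<le> (a - a0) / 2" "\<eta> \<le> (b0 - b) / 2" unfolding \<eta>_def by (rule min.cobounded1, rule min.cobounded2)
  then have e: "0 < \<eta>" "a0 + \<eta> < a" "b < b0 - \<eta>" using a0b0 by (auto simp: \<eta>_def field_simps)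
  obtain m d1 where m: "0 < m" "0 < d1"
    "\<And>\<sigma> c z. \<bar>\<sigma> - s0\<bar> < d1 \<Longrightarrow> \<bar>c - c0\<bar> < d1 \<Longrightarrow> z \<in> {a0 + \<eta>..b0 - \<eta>} \<Longrightarrow> m \<le> Gibbs F \<sigma> z - c"
    using middle_bound[OF e] by metis
  obtain d2 where d2: "0 < d2" "\<And>\<sigma>. \<bar>\<sigma> - s0\<bar> < d2 \<Longrightarrow> \<sigma> \<in> \<sigma>_range F a b \<and> \<bar>al \<sigma> - a0\<bar> < 1 \<and> \<bar>be \<sigma> - b0\<bar> < 1"
    using al_near[of 1] by auto
  show thesis
  proof (rule that[of "min d1 d2"])
    fix \<sigma> c assume h: "\<bar>\<sigma> - s0\<bar> < min d1 d2" "\<bar>c - c0\<bar> < min d1 d2" "left_min \<sigma> < c" "right_min \<sigma> < c"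
    have r: "\<sigma> \<in> \<sigma>_range F a b" using d2 h by auto
    note cs = crit_strict[OF r]
    have "m \<le> Gibbs F \<sigma> a - c" by (rule m(3)) (use h e ab in auto)
    moreover have "Gibbs F \<sigma> a < Gibbs F \<sigma> (ze \<sigma>)"
      using Gibbs_mono(2)[OF \<sigma>_range_subset[OF r], of a "ze \<sigma>"] cs by auto
    ultimately show "admissible F a b (\<sigma>, c)"
      using r h m(1) by (auto simp: admissible_def left_min_def right_min_def)
  qed (use m d2 in auto)
qed

definition weighted_integral :: "(real \<Rightarrow> real) \<Rightarrow> real \<Rightarrow> real \<Rightarrow> real \<Rightarrow> real" where
  "weighted_integral w \<epsilon> \<sigma> c = integral {zl \<sigma> c..zr \<sigma> c} (\<lambda>z. w z * slowness \<epsilon> \<sigma> c z)"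

text \<open>Bundles all information about one weight so that d, C and the range of \<epsilon> can be
  adjusted jointly; gA and gB are the coefficients of the two logarithms.\<close>

definition time_estimate ::
  "(real \<Rightarrow> real) \<Rightarrow> real \<Rightarrow> real \<Rightarrow> real \<Rightarrow> real \<Rightarrow> real \<Rightarrow> real \<Rightarrow> bool" where
  "time_estimate w gA gB \<theta> d C \<epsilon>1 \<longleftrightarrow> (\<forall>\<epsilon> \<sigma> c. 0 < \<epsilon> \<and> \<epsilon> < \<epsilon>1 \<and> near d \<sigma> c \<longrightarrow>
     (\<lambda>z. w z * slowness \<epsilon> \<sigma> c z) integrable_on {zl \<sigma> c..zr \<sigma> c} \<and>
     (\<forall>z\<in>{zl \<sigma> c..zr \<sigma> c}. \<epsilon>\<^sup>2 * (Gibbs F \<sigma> z - c) \<le> 1 / 2) \<and>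
     0 \<le> pA \<sigma> c \<and> 0 \<le> pB \<sigma> c \<and>
     \<bar>weighted_integral w \<epsilon> \<sigma> c - (gA * pA \<sigma> c + gB * pB \<sigma> c)\<bar> \<le> \<theta> * (pA \<sigma> c + pB \<sigma> c) + C \<and>
     \<bar>zl \<sigma> c - a0\<bar> \<le> C * (\<bar>\<sigma> - s0\<bar> + sqrt (c - left_min \<sigma>)) \<and>
     \<bar>zr \<sigma> c - b0\<bar> \<le> C * (\<bar>\<sigma> - s0\<bar> + sqrt (c - right_min \<sigma>)) \<and>
     (\<forall>\<sigma>' c'. near d \<sigma>' c' \<longrightarrow>
        \<bar>weighted_integral w \<epsilon> \<sigma> c - weighted_integral w \<epsilon> \<sigma>' c' - (gA * (pA \<sigma> c - pA \<sigma>' c') + gB * (pB \<sigma> c - pB \<sigma>' c'))\<bar>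
        \<le> \<theta> * (\<bar>pA \<sigma> c - pA \<sigma>' c'\<bar> + \<bar>pB \<sigma> c - pB \<sigma>' c'\<bar>)
          + C * (1 + max (max (pA \<sigma> c) (pA \<sigma>' c')) (max (pB \<sigma> c) (pB \<sigma>' c'))) * (\<bar>\<sigma> - \<sigma>'\<bar> + \<bar>c - c'\<bar>)))"

text \<open>Only the wells produce logarithms. On the middle piece the energy stays away from 0, so
  that its contribution is bounded and Lipschitz in (\<sigma>, c) uniformly in \<epsilon> and can be
  put into C.\<close>

lemma weighted_integral_estimate:
  assumes "0 < \<theta>"
  shows "\<exists>d>0. \<exists>C\<ge>0. \<exists>\<epsilon>1>0. \<epsilon>1 \<le> 1 \<and>
    time_estimate (\<lambda>z. p * z + q) ((p * a0 + q) / sqrt (F2 a0) / 2) ((p * b0 + q) / sqrt (F2 b0) / 2) \<theta> d C \<epsilon>1"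
proof -
  let ?w = "\<lambda>z. p * z + q"
  define gA where "gA = (p * a0 + q) / sqrt (F2 a0) / 2"
  define gB where "gB = (p * b0 + q) / sqrt (F2 b0) / 2"
  obtain \<eta>A where eA: "0 < \<eta>A" "a0 + \<eta>A < a" and
    hA: "\<And>\<eta>. 0 < \<eta> \<Longrightarrow> \<eta> \<le> \<eta>A \<Longrightarrow> \<exists>d>0. \<exists>C\<ge>0. \<exists>L. half_estimate L pA gA \<theta> d C \<and>
      (\<forall>\<epsilon> \<sigma> c. 0 \<le> \<epsilon> \<and> \<epsilon> \<le> 1 \<and> near d \<sigma> c \<longrightarrow>
         ((\<lambda>z. ?w z * slowness \<epsilon> \<sigma> c z) has_integral L \<epsilon> \<sigma> c) {zl \<sigma> c..a0 + \<eta>} \<and>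
         zl \<sigma> c < a0 + \<eta> \<and> \<bar>zl \<sigma> c - a0\<bar> \<le> C * (\<bar>\<sigma> - s0\<bar> + sqrt (c - left_min \<sigma>)))"
    by (rule left_half[OF assms, of p q, folded gA_def], rule that, assumption+)
  obtain \<eta>B where eB: "0 < \<eta>B" "b < b0 - \<eta>B" and
    hB: "\<And>\<eta>. 0 < \<eta> \<Longrightarrow> \<eta> \<le> \<eta>B \<Longrightarrow> \<exists>d>0. \<exists>C\<ge>0. \<exists>L. half_estimate L pB gB \<theta> d C \<and>
      (\<forall>\<epsilon> \<sigma> c. 0 \<le> \<epsilon> \<and> \<epsilon> \<le> 1 \<and> near d \<sigma> c \<longrightarrow>
         ((\<lambda>z. ?w z * slowness \<epsilon> \<sigma> c z) has_integral L \<epsilon> \<sigma> c) {b0 - \<eta>..zr \<sigma> c} \<and>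
         b0 - \<eta> < zr \<sigma> c \<and> \<bar>zr \<sigma> c - b0\<bar> \<le> C * (\<bar>\<sigma> - s0\<bar> + sqrt (c - right_min \<sigma>)))"
    by (rule right_half[OF assms, of p q, folded gB_def], rule that, assumption+)
  define \<eta> where "\<eta> = min \<eta>A \<eta>B"
  have eta: "0 < \<eta>" "\<eta> \<le> \<eta>A" "\<eta> \<le> \<eta>B" using eA eB by (auto simp: \<eta>_def)
  have eta2: "a0 + \<eta> < a" "b < b0 - \<eta>" using eta eA eB by auto
  obtain dA CA LA where A: "0 < dA" "0 \<le> CA" "half_estimate LA pA gA \<theta> dA CA"
    "\<And>\<epsilon> \<sigma> c. 0 \<le> \<epsilon> \<Longrightarrow> \<epsilon> \<le> 1 \<Longrightarrow> near dA \<sigma> c \<Longrightarrow>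
      ((\<lambda>z. ?w z * slowness \<epsilon> \<sigma> c z) has_integral LA \<epsilon> \<sigma> c) {zl \<sigma> c..a0 + \<eta>} \<and>
      zl \<sigma> c < a0 + \<eta> \<and> \<bar>zl \<sigma> c - a0\<bar> \<le> CA * (\<bar>\<sigma> - s0\<bar> + sqrt (c - left_min \<sigma>))"
    using hA[OF eta(1,2)] by blast
  obtain dB CB LB where B: "0 < dB" "0 \<le> CB" "half_estimate LB pB gB \<theta> dB CB"
    "\<And>\<epsilon> \<sigma> c. 0 \<le> \<epsilon> \<Longrightarrow> \<epsilon> \<le> 1 \<Longrightarrow> near dB \<sigma> c \<Longrightarrow>
      ((\<lambda>z. ?w z * slowness \<epsilon> \<sigma> c z) has_integral LB \<epsilon> \<sigma> c) {b0 - \<eta>..zr \<sigma> c} \<and>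
      b0 - \<eta> < zr \<sigma> c \<and> \<bar>zr \<sigma> c - b0\<bar> \<le> CB * (\<bar>\<sigma> - s0\<bar> + sqrt (c - right_min \<sigma>))"
    using hB[OF eta(1,3)] by blast
  obtain \<epsilon>1 where e1: "0 < \<epsilon>1" "\<epsilon>1 \<le> 1"
    "\<And>\<epsilon> \<sigma> c z. 0 \<le> \<epsilon> \<Longrightarrow> \<epsilon> < \<epsilon>1 \<Longrightarrow> near 1 \<sigma> c \<Longrightarrow> z \<in> {zl \<sigma> c..zr \<sigma> c} \<Longrightarrow>
      \<epsilon>\<^sup>2 * (Gibbs F \<sigma> z - c) \<le> 1 / 2"
    by (rule energy_bound, rule that, assumption+)
  obtain m d1 where m: "0 < m" "0 < d1" "d1 \<le> 1"
    "\<And>\<sigma> c z. \<bar>\<sigma> - s0\<bar> < d1 \<Longrightarrow> \<bar>c - c0\<bar> < d1 \<Longrightarrow> z \<in> {a0 + \<eta>..b0 - \<eta>} \<Longrightarrow> m \<le> Gibbs F \<sigma> z - c"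
    by (rule middle_bound[OF eta(1) eta2], rule that, assumption+)
  define d where "d = min (min dA dB) d1"
  have d: "0 < d" "d \<le> dA" "d \<le> dB" "d \<le> d1" "d \<le> 1" using A B m by (auto simp: d_def)
  define Mw where "Mw = \<bar>p\<bar> * b0 + \<bar>q\<bar>"
  define Cm where "Cm = 2 / sqrt m + 1 / (m * sqrt m)"
  \<comment> \<open>\<open>MI\<close> bounds the middle integral and \<open>MD\<close> its Lipschitz
    constant; the factor b0 + 1 there bounds the change |\<sigma> - \<sigma>'| z + |c - c'| of the
    energy.\<close>
  define MI where "MI = Mw * (1 / sqrt m) * (b0 - a0)"
  define MD where "MD = Mw * (Cm * (b0 + 1)) * (b0 - a0)"
  define C where "C = CA + CB + MI + MD"
  have b0p: "0 < b0" using a0b0 by linarith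
  have nn: "0 \<le> Mw" "0 \<le> Cm" "0 \<le> MI" "0 \<le> MD" using m a0b0 b0p by (auto simp: Mw_def Cm_def MI_def MD_def)
  have C: "0 \<le> C" "CA \<le> C" "CB \<le> C" "CA + CB + MD \<le> C" "CA + CB + MI \<le> C" using A B nn by (auto simp: C_def)
  have mid: "a0 + \<eta> \<le> b0 - \<eta>" using eta2 ab by linarith
  have wb: "\<bar>?w z\<bar> \<le> Mw" if "z \<in> {a0 + \<eta>..b0 - \<eta>}" for z
  proof -
    have "\<bar>z\<bar> \<le> b0" using that a0b0 eta by auto
    then have "\<bar>p * z\<bar> \<le> \<bar>p\<bar> * b0" by (simp add: abs_mult mult_left_mono)
    then show ?thesis unfolding Mw_def by linarith
  qed
  have "time_estimate ?w gA gB \<theta> d C \<epsilon>1"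
    unfolding time_estimate_def
  proof (intro allI impI, elim conjE, goal_cases)
    case (1 \<epsilon> \<sigma> c)
    note eps = 1(1,2) and n = 1(3)
    have eps': "0 \<le> \<epsilon>" "\<epsilon> \<le> 1" using eps e1 by auto
    have F1: "zl \<sigma> c < a0 + \<eta>" "b0 - \<eta> < zr \<sigma> c"
      "\<And>z. z \<in> {a0 + \<eta>..b0 - \<eta>} \<Longrightarrow> m \<le> Gibbs F \<sigma> z - c"
      "\<And>z. z \<in> {zl \<sigma> c..zr \<sigma> c} \<Longrightarrow> \<epsilon>\<^sup>2 * (Gibbs F \<sigma> z - c) \<le> 1 / 2"
      "\<And>z. z \<in> {a0 + \<eta>..b0 - \<eta>} \<Longrightarrow> \<epsilon>\<^sup>2 * (Gibbs F \<sigma> z - c) \<le> 1"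
      if n: "near d \<sigma> c" for \<sigma> c
    proof -
      show 1: "zl \<sigma> c < a0 + \<eta>" "b0 - \<eta> < zr \<sigma> c"
        using A(4)[OF eps' near_mono[OF n d(2)]] B(4)[OF eps' near_mono[OF n d(3)]] by auto
      show "m \<le> Gibbs F \<sigma> z - c" if "z \<in> {a0 + \<eta>..b0 - \<eta>}" for z
        by (rule m(4)) (use n d that in \<open>auto simp: near_def\<close>)
      show 2: "\<epsilon>\<^sup>2 * (Gibbs F \<sigma> z - c) \<le> 1 / 2" if "z \<in> {zl \<sigma> c..zr \<sigma> c}" for z
        by (rule e1(3)[OF eps'(1) eps(2) near_mono[OF n d(5)] that])
      show "\<epsilon>\<^sup>2 * (Gibbs F \<sigma> z - c) \<le> 1" if "z \<in> {a0 + \<eta>..b0 - \<eta>}" for z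
        using 2[of z] 1 that by auto
    qed
    have cont: "continuous_on {a0 + \<eta>..b0 - \<eta>} (\<lambda>z. ?w z * slowness \<epsilon> \<sigma> c z)" if n: "near d \<sigma> c" for \<sigma> c
    proof -
      have g: "continuous_on {a0 + \<eta>..b0 - \<eta>} (\<lambda>z. Gibbs F \<sigma> z - c)"
        using cont_Gibbs[of "a0 + \<eta>"] a0b0 eta by (intro continuous_intros) auto
      have c1: "continuous_on {a0 + \<eta>..b0 - \<eta>} (\<lambda>z. slowness_factor (\<epsilon>\<^sup>2 * (Gibbs F \<sigma> z - c)))"
      proof (rule continuous_on_compose2[OF continuous_on_slowness_factor])
        show "continuous_on {a0 + \<eta>..b0 - \<eta>} (\<lambda>z. \<epsilon>\<^sup>2 * (Gibbs F \<sigma> z - c))" by (intro continuous_intros g)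
        show "(\<lambda>z. \<epsilon>\<^sup>2 * (Gibbs F \<sigma> z - c)) ` {a0 + \<eta>..b0 - \<eta>} \<subseteq> {0..1}"
        proof (rule image_subsetI)
          fix z assume z: "z \<in> {a0 + \<eta>..b0 - \<eta>}"
          have "0 \<le> \<epsilon>\<^sup>2 * (Gibbs F \<sigma> z - c)" using F1(3)[OF n z] m(1) by (intro mult_nonneg_nonneg) auto
          then show "\<epsilon>\<^sup>2 * (Gibbs F \<sigma> z - c) \<in> {0..1}" using F1(5)[OF n z] by simp
        qed
      qed
      have c2: "continuous_on {a0 + \<eta>..b0 - \<eta>} (\<lambda>z. sqrt (Gibbs F \<sigma> z - c))" by (intro continuous_intros g)
      have c3: "\<forall>z\<in>{a0 + \<eta>..b0 - \<eta>}. sqrt (Gibbs F \<sigma> z - c) \<noteq> 0" using F1(3)[OF n] m(1) by fastforce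
      show ?thesis unfolding slowness_def
        by (rule continuous_on_mult[OF _ continuous_on_divide[OF c1 c2 c3]]) (intro continuous_intros)
    qed
    define L where "L = LA \<epsilon>"
    define I where "I \<sigma> c = integral {a0 + \<eta>..b0 - \<eta>} (\<lambda>z. ?w z * slowness \<epsilon> \<sigma> c z)" for \<sigma> c
    define R where "R = LB \<epsilon>"
    have HA: "0 \<le> pA \<sigma> c" "\<bar>L \<sigma> c - gA * pA \<sigma> c\<bar> \<le> \<theta> * pA \<sigma> c + CA"
      "\<And>\<sigma>' c'. near d \<sigma>' c' \<Longrightarrow> \<bar>L \<sigma> c - L \<sigma>' c' - gA * (pA \<sigma> c - pA \<sigma>' c')\<bar>
        \<le> \<theta> * \<bar>pA \<sigma> c - pA \<sigma>' c'\<bar> + CA * (1 + max (pA \<sigma> c) (pA \<sigma>' c')) * \<bar>\<sigma> - \<sigma>'\<bar>" if n: "near d \<sigma> c" for \<sigma> c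
      using A(3)[unfolded half_estimate_def, rule_format, OF conjI[OF eps'(1) conjI[OF eps'(2) near_mono[OF n d(2)]]]]
        near_mono[OF _ d(2)] unfolding L_def by blast+
    have HB: "0 \<le> pB \<sigma> c" "\<bar>R \<sigma> c - gB * pB \<sigma> c\<bar> \<le> \<theta> * pB \<sigma> c + CB"
      "\<And>\<sigma>' c'. near d \<sigma>' c' \<Longrightarrow> \<bar>R \<sigma> c - R \<sigma>' c' - gB * (pB \<sigma> c - pB \<sigma>' c')\<bar>
        \<le> \<theta> * \<bar>pB \<sigma> c - pB \<sigma>' c'\<bar> + CB * (1 + max (pB \<sigma> c) (pB \<sigma>' c')) * \<bar>\<sigma> - \<sigma>'\<bar>" if n: "near d \<sigma> c" for \<sigma> c
      using B(3)[unfolded half_estimate_def, rule_format, OF conjI[OF eps'(1) conjI[OF eps'(2) near_mono[OF n d(3)]]]]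
        near_mono[OF _ d(3)] unfolding R_def by blast+
    have JJi: "((\<lambda>z. ?w z * slowness \<epsilon> \<sigma> c z) has_integral (L \<sigma> c + I \<sigma> c + R \<sigma> c)) {zl \<sigma> c..zr \<sigma> c}"
      if n: "near d \<sigma> c" for \<sigma> c
    proof -
      have 1: "((\<lambda>z. ?w z * slowness \<epsilon> \<sigma> c z) has_integral (L \<sigma> c + I \<sigma> c)) {zl \<sigma> c..b0 - \<eta>}"
      proof (rule has_integral_combine[of _ "a0 + \<eta>"])
        show "((\<lambda>z. ?w z * slowness \<epsilon> \<sigma> c z) has_integral L \<sigma> c) {zl \<sigma> c..a0 + \<eta>}"
          using A(4)[OF eps' near_mono[OF n d(2)]] by (simp add: L_def)
        show "((\<lambda>z. ?w z * slowness \<epsilon> \<sigma> c z) has_integral I \<sigma> c) {a0 + \<eta>..b0 - \<eta>}"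
          unfolding I_def by (intro integrable_integral integrable_continuous_real cont n)
      qed (use F1(1)[OF n] mid in auto)
      show ?thesis
        by (rule has_integral_combine[OF _ _ 1]) (use F1(1,2)[OF n] mid B(4)[OF eps' near_mono[OF n d(3)]] in \<open>auto simp: R_def\<close>)
    qed
    have JJe: "weighted_integral ?w \<epsilon> \<sigma> c = L \<sigma> c + I \<sigma> c + R \<sigma> c" if "near d \<sigma> c" for \<sigma> c
      unfolding weighted_integral_def by (rule integral_unique[OF JJi[OF that]])
    have Ib: "\<bar>I \<sigma> c\<bar> \<le> MI"
    proof -
      have "\<bar>integral {a0 + \<eta>..b0 - \<eta>} (\<lambda>z. ?w z * slowness \<epsilon> \<sigma> c z) - integral {a0 + \<eta>..b0 - \<eta>} (\<lambda>_. 0)\<bar>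
          \<le> Mw * (1 / sqrt m) * ((b0 - \<eta>) - (a0 + \<eta>))"
      proof (rule abs_integral_diff_le_const[OF cont[OF n] continuous_on_const mid])
        fix z assume z: "z \<in> {a0 + \<eta>..b0 - \<eta>}"
        note y = F1(3)[OF n z] F1(5)[OF n z]
        have "\<bar>slowness_factor (\<epsilon>\<^sup>2 * (Gibbs F \<sigma> z - c))\<bar> \<le> 1"
          by (rule slowness_factor_bound) (use y m(1) in auto)
        moreover have "1 / sqrt (Gibbs F \<sigma> z - c) \<le> 1 / sqrt m" using y m(1) by (intro divide_left_mono) auto
        ultimately have "\<bar>slowness_factor (\<epsilon>\<^sup>2 * (Gibbs F \<sigma> z - c))\<bar> * (1 / sqrt (Gibbs F \<sigma> z - c)) \<le> 1 * (1 / sqrt m)"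
          using y m(1) by (intro mult_mono) auto
        then have "\<bar>slowness \<epsilon> \<sigma> c z\<bar> \<le> 1 / sqrt m" using y m(1) by (simp add: slowness_def abs_divide)
        then have "\<bar>?w z\<bar> * \<bar>slowness \<epsilon> \<sigma> c z\<bar> \<le> Mw * (1 / sqrt m)" using wb[OF z] nn by (intro mult_mono) auto
        then show "\<bar>?w z * slowness \<epsilon> \<sigma> c z - 0\<bar> \<le> Mw * (1 / sqrt m)" by (simp add: abs_mult)
      qed
      also have "\<dots> \<le> MI" unfolding MI_def using nn m eta by (intro mult_left_mono) auto
      finally show ?thesis by (simp add: I_def)
    qed
    have IL: "\<bar>I \<sigma> c - I \<sigma>' c'\<bar> \<le> MD * (\<bar>\<sigma> - \<sigma>'\<bar> + \<bar>c - c'\<bar>)" if n': "near d \<sigma>' c'" for \<sigma>' c'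
    proof -
      define E where "E = \<bar>\<sigma> - \<sigma>'\<bar> + \<bar>c - c'\<bar>"
      have "\<bar>I \<sigma> c - I \<sigma>' c'\<bar> \<le> (Mw * (Cm * ((b0 + 1) * E))) * ((b0 - \<eta>) - (a0 + \<eta>))"
        unfolding I_def
      proof (rule abs_integral_diff_le_const[OF cont[OF n] cont[OF n'] mid])
        fix z assume z: "z \<in> {a0 + \<eta>..b0 - \<eta>}"
        have zb: "0 < z" "z \<le> b0" using z a0b0 eta by auto
        have "\<bar>(Gibbs F \<sigma> z - c) - (Gibbs F \<sigma>' z - c')\<bar> = \<bar>(\<sigma> - \<sigma>') * z + (c - c')\<bar>"
          by (simp add: Gibbs_def algebra_simps abs_if)
        also have "\<dots> \<le> \<bar>\<sigma> - \<sigma>'\<bar> * z + \<bar>c - c'\<bar>"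
          using zb by (intro order_trans[OF abs_triangle_ineq]) (simp add: abs_mult)
        also have "\<dots> \<le> \<bar>\<sigma> - \<sigma>'\<bar> * (b0 + 1) + \<bar>c - c'\<bar> * (b0 + 1)"
          using zb mult_left_mono[of 1 "b0 + 1" "\<bar>c - c'\<bar>"] by (intro add_mono mult_left_mono) auto
        also have "\<dots> = (b0 + 1) * E" by (simp add: E_def algebra_simps)
        finally have y: "\<bar>(Gibbs F \<sigma> z - c) - (Gibbs F \<sigma>' z - c')\<bar> \<le> (b0 + 1) * E" .
        have "\<bar>slowness \<epsilon> \<sigma> c z - slowness \<epsilon> \<sigma>' c' z\<bar> \<le> Cm * \<bar>(Gibbs F \<sigma> z - c) - (Gibbs F \<sigma>' z - c')\<bar>"
          unfolding slowness_def Cm_def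
          by (rule slowness_factor_sqrt_lipschitz[OF m(1) F1(3)[OF n z] F1(3)[OF n' z] eps' F1(5)[OF n z] F1(5)[OF n' z]])
        also have "\<dots> \<le> Cm * ((b0 + 1) * E)" by (rule mult_left_mono[OF y nn(2)])
        finally have "\<bar>?w z\<bar> * \<bar>slowness \<epsilon> \<sigma> c z - slowness \<epsilon> \<sigma>' c' z\<bar> \<le> Mw * (Cm * ((b0 + 1) * E))"
          using wb[OF z] nn by (intro mult_mono) auto
        then show "\<bar>?w z * slowness \<epsilon> \<sigma> c z - ?w z * slowness \<epsilon> \<sigma>' c' z\<bar> \<le> Mw * (Cm * ((b0 + 1) * E))"
          by (simp only: right_diff_distrib[symmetric] abs_mult)
      qed
      also have "\<dots> \<le> (Mw * (Cm * ((b0 + 1) * E))) * (b0 - a0)"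
        using nn b0p eta by (intro mult_left_mono) (auto simp: E_def)
      also have "\<dots> = MD * E" by (simp add: MD_def)
      finally show ?thesis by (simp add: E_def)
    qed
    show ?case
    proof (intro conjI allI impI ballI)
      show "(\<lambda>z. ?w z * slowness \<epsilon> \<sigma> c z) integrable_on {zl \<sigma> c..zr \<sigma> c}" using JJi[OF n] by blast
      show "0 \<le> pA \<sigma> c" "0 \<le> pB \<sigma> c" using HA(1)[OF n] HB(1)[OF n] by auto
      show "\<epsilon>\<^sup>2 * (Gibbs F \<sigma> z - c) \<le> 1 / 2" if "z \<in> {zl \<sigma> c..zr \<sigma> c}" for z
        by (rule F1(4)[OF n that])
      have sq: "0 \<le> \<bar>\<sigma> - s0\<bar> + sqrt (c - left_min \<sigma>)" "0 \<le> \<bar>\<sigma> - s0\<bar> + sqrt (c - right_min \<sigma>)"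
        using near_energy(3,4)[OF n] by auto
      show "\<bar>zl \<sigma> c - a0\<bar> \<le> C * (\<bar>\<sigma> - s0\<bar> + sqrt (c - left_min \<sigma>))"
        using A(4)[OF eps' near_mono[OF n d(2)]] mult_right_mono[OF C(2) sq(1)] by linarith
      show "\<bar>zr \<sigma> c - b0\<bar> \<le> C * (\<bar>\<sigma> - s0\<bar> + sqrt (c - right_min \<sigma>))"
        using B(4)[OF eps' near_mono[OF n d(3)]] mult_right_mono[OF C(3) sq(2)] by linarith
      have "\<bar>weighted_integral ?w \<epsilon> \<sigma> c - (gA * pA \<sigma> c + gB * pB \<sigma> c)\<bar>
          \<le> \<bar>L \<sigma> c - gA * pA \<sigma> c\<bar> + \<bar>R \<sigma> c - gB * pB \<sigma> c\<bar> + \<bar>I \<sigma> c\<bar>"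
        unfolding JJe[OF n] by linarith
      also have "\<dots> \<le> (\<theta> * pA \<sigma> c + CA) + (\<theta> * pB \<sigma> c + CB) + MI"
        by (intro add_mono HA(2)[OF n] HB(2)[OF n] Ib)
      also have "\<dots> \<le> \<theta> * (pA \<sigma> c + pB \<sigma> c) + C" using C(5) by (simp add: algebra_simps)
      finally show "\<bar>weighted_integral ?w \<epsilon> \<sigma> c - (gA * pA \<sigma> c + gB * pB \<sigma> c)\<bar> \<le> \<theta> * (pA \<sigma> c + pB \<sigma> c) + C" .
      fix \<sigma>' c' assume n': "near d \<sigma>' c'"
      define mx where "mx = max (max (pA \<sigma> c) (pA \<sigma>' c')) (max (pB \<sigma> c) (pB \<sigma>' c'))"
      define E where "E = \<bar>\<sigma> - \<sigma>'\<bar> + \<bar>c - c'\<bar>"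
      have mx: "0 \<le> mx" "max (pA \<sigma> c) (pA \<sigma>' c') \<le> mx" "max (pB \<sigma> c) (pB \<sigma>' c') \<le> mx"
        using HA(1)[OF n] by (auto simp: mx_def max_def)
      have mxn: "0 \<le> max (pA \<sigma> c) (pA \<sigma>' c')" "0 \<le> max (pB \<sigma> c) (pB \<sigma>' c')"
        using HA(1)[OF n] HB(1)[OF n] by (simp_all add: le_max_iff_disj)
      have E: "0 \<le> E" "\<bar>\<sigma> - \<sigma>'\<bar> \<le> E" by (auto simp: E_def)
      define X where "X = L \<sigma> c - L \<sigma>' c' - gA * (pA \<sigma> c - pA \<sigma>' c')"
      define Z where "Z = R \<sigma> c - R \<sigma>' c' - gB * (pB \<sigma> c - pB \<sigma>' c')"
      define U where "U = I \<sigma> c - I \<sigma>' c'"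
      have X: "\<bar>X\<bar> \<le> \<theta> * \<bar>pA \<sigma> c - pA \<sigma>' c'\<bar> + CA * (1 + mx) * E"
      proof -
        have "\<bar>X\<bar> \<le> \<theta> * \<bar>pA \<sigma> c - pA \<sigma>' c'\<bar> + CA * (1 + max (pA \<sigma> c) (pA \<sigma>' c')) * \<bar>\<sigma> - \<sigma>'\<bar>"
          unfolding X_def by (rule HA(3)[OF n n'])
        also have "\<dots> \<le> \<theta> * \<bar>pA \<sigma> c - pA \<sigma>' c'\<bar> + CA * (1 + mx) * E"
          using mx mxn E A(2) by (intro add_left_mono mult_mono) auto
        finally show ?thesis .
      qed
      have Z: "\<bar>Z\<bar> \<le> \<theta> * \<bar>pB \<sigma> c - pB \<sigma>' c'\<bar> + CB * (1 + mx) * E"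
      proof -
        have "\<bar>Z\<bar> \<le> \<theta> * \<bar>pB \<sigma> c - pB \<sigma>' c'\<bar> + CB * (1 + max (pB \<sigma> c) (pB \<sigma>' c')) * \<bar>\<sigma> - \<sigma>'\<bar>"
          unfolding Z_def by (rule HB(3)[OF n n'])
        also have "\<dots> \<le> \<theta> * \<bar>pB \<sigma> c - pB \<sigma>' c'\<bar> + CB * (1 + mx) * E"
          using mx mxn E B(2) by (intro add_left_mono mult_mono) auto
        finally show ?thesis .
      qed
      have U: "\<bar>U\<bar> \<le> MD * (1 + mx) * E"
      proof -
        have "\<bar>U\<bar> \<le> MD * E" unfolding U_def E_def by (rule IL[OF n'])
        also have "\<dots> \<le> MD * (1 + mx) * E"
          using nn mx E mult_left_mono[of 1 "1 + mx" MD] by (intro mult_right_mono) auto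
        finally show ?thesis .
      qed
      have "weighted_integral ?w \<epsilon> \<sigma> c - weighted_integral ?w \<epsilon> \<sigma>' c' - (gA * (pA \<sigma> c - pA \<sigma>' c') + gB * (pB \<sigma> c - pB \<sigma>' c')) = X + Z + U"
        unfolding JJe[OF n] JJe[OF n'] X_def Z_def U_def by simp
      also have "\<bar>\<dots>\<bar> \<le> \<bar>X\<bar> + \<bar>Z\<bar> + \<bar>U\<bar>" by linarith
      also have "\<dots> \<le> (\<theta> * \<bar>pA \<sigma> c - pA \<sigma>' c'\<bar> + CA * (1 + mx) * E)
          + (\<theta> * \<bar>pB \<sigma> c - pB \<sigma>' c'\<bar> + CB * (1 + mx) * E) + MD * (1 + mx) * E"
        by (intro add_mono X Z U)
      also have "\<dots> = \<theta> * (\<bar>pA \<sigma> c - pA \<sigma>' c'\<bar> + \<bar>pB \<sigma> c - pB \<sigma>' c'\<bar>) + (CA + CB + MD) * ((1 + mx) * E)"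
        by (simp add: algebra_simps)
      also have "\<dots> \<le> \<theta> * (\<bar>pA \<sigma> c - pA \<sigma>' c'\<bar> + \<bar>pB \<sigma> c - pB \<sigma>' c'\<bar>) + C * ((1 + mx) * E)"
        using mx E C(4) by (intro add_left_mono mult_right_mono) auto
      finally show "\<bar>weighted_integral ?w \<epsilon> \<sigma> c - weighted_integral ?w \<epsilon> \<sigma>' c' - (gA * (pA \<sigma> c - pA \<sigma>' c') + gB * (pB \<sigma> c - pB \<sigma>' c'))\<bar>
        \<le> \<theta> * (\<bar>pA \<sigma> c - pA \<sigma>' c'\<bar> + \<bar>pB \<sigma> c - pB \<sigma>' c'\<bar>)
          + C * (1 + max (max (pA \<sigma> c) (pA \<sigma>' c')) (max (pB \<sigma> c) (pB \<sigma>' c'))) * (\<bar>\<sigma> - \<sigma>'\<bar> + \<bar>c - c'\<bar>)"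
        by (simp add: mx_def E_def mult.assoc)
    qed
  qed
  then show ?thesis using d(1) C(1) e1(1,2) unfolding gA_def gB_def by blast
qed

end

section \<open>Logarithmic coordinates, contraction and localization\<close>

context double_well
begin

text \<open>Inverts (\<sigma>, c) -> (c - \<open>left_min\<close>, c - \<open>right_min\<close>).
  The difference of the two energies is the gap up to sign, which determines \<sigma> with constant
  1 / (b - a); then c follows from the first energy.\<close>

lemma param_lipschitz:
  assumes "\<sigma> \<in> rng" "\<sigma>' \<in> rng"
  shows "\<bar>\<sigma> - \<sigma>'\<bar> + \<bar>c - c'\<bar>
    \<le> (1 + (1 + a) / (b - a)) * (\<bar>(c - left_min \<sigma>) - (c' - left_min \<sigma>')\<bar> + \<bar>(c - right_min \<sigma>) - (c' - right_min \<sigma>')\<bar>)"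
proof -
  define U where "U = \<bar>(c - left_min \<sigma>) - (c' - left_min \<sigma>')\<bar>"
  define V where "V = \<bar>(c - right_min \<sigma>) - (c' - right_min \<sigma>')\<bar>"
  have "\<bar>min_gap \<sigma> - min_gap \<sigma>'\<bar> \<le> U + V" unfolding U_def V_def min_gap_def by linarith
  then have "(b - a) * \<bar>\<sigma> - \<sigma>'\<bar> \<le> U + V" using min_gap_expanding[OF assms] by linarith
  then have s: "\<bar>\<sigma> - \<sigma>'\<bar> \<le> (U + V) / (b - a)" using ab by (simp add: pos_le_divide_eq mult.commute)
  have "\<bar>c - c'\<bar> \<le> U + \<bar>left_min \<sigma> - left_min \<sigma>'\<bar>" unfolding U_def by linarith
  also have "\<dots> \<le> (U + V) + a * \<bar>\<sigma> - \<sigma>'\<bar>" using left_min_lip[OF assms] by (intro add_mono) (auto simp: V_def)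
  finally have "\<bar>\<sigma> - \<sigma>'\<bar> + \<bar>c - c'\<bar> \<le> (U + V) + (1 + a) * \<bar>\<sigma> - \<sigma>'\<bar>" by (simp add: algebra_simps)
  also have "\<dots> \<le> (U + V) + (1 + a) * ((U + V) / (b - a))"
    using s a_pos by (intro add_left_mono mult_left_mono) auto
  also have "\<dots> = (1 + (1 + a) / (b - a)) * (U + V)" by (simp add: distrib_right)
  finally show ?thesis by (simp add: U_def V_def)
qed

text \<open>Given energies u and v, solve \<open>min_gap\<close> \<sigma> = v - u and put c = u +
  \<open>left_min\<close> \<sigma>. Nearness follows from \<open>param_lipschitz\<close> against the
  Maxwell point, where both energies are 0.\<close>

lemma param_exists:
  assumes "0 < d"
  obtains u0 where "0 < u0"
    "\<And>u v. 0 < u \<Longrightarrow> u \<le> u0 \<Longrightarrow> 0 < v \<Longrightarrow> v \<le> u0 \<Longrightarrow> \<exists>\<sigma> c. near d \<sigma> c \<and> c - left_min \<sigma> = u \<and> c - right_min \<sigma> = v"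
proof -
  obtain d1 where d1: "0 < d1" "\<And>\<sigma> c. \<bar>\<sigma> - s0\<bar> < d1 \<Longrightarrow> \<bar>c - c0\<bar> < d1 \<Longrightarrow> left_min \<sigma> < c \<Longrightarrow> right_min \<sigma> < c \<Longrightarrow> admissible F a b (\<sigma>, c)"
    by (rule near_admissible, rule that, assumption+)
  define Cp where "Cp = 1 + (1 + a) / (b - a)"
  have Cp: "1 \<le> Cp" using a_pos ab by (simp add: Cp_def)
  define t where "t = min (- min_gap (F1 b)) (min_gap (F1 a))"
  have t: "0 < t" using min_gap_ends by (simp add: t_def)
  have pm: "0 < min d d1" using assms d1(1) by simp
  define u0 where "u0 = min (t / 2) (min d d1 / (4 * Cp))"
  have u0: "0 < u0" using t Cp assms d1 by (simp add: u0_def)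
  have u0d: "2 * Cp * u0 < min d d1"
  proof -
    have "2 * Cp * u0 \<le> 2 * Cp * (min d d1 / (4 * Cp))" using Cp by (intro mult_left_mono) (auto simp: u0_def)
    also have "\<dots> = min d d1 / 2" using Cp by simp
    also have "\<dots> < min d d1" using pm by linarith
    finally show ?thesis .
  qed
  show thesis
  proof (rule that[OF u0])
    fix u v assume uv: "0 < u" "u \<le> u0" "0 < v" "v \<le> u0"
    have "u0 \<le> t / 2" by (simp add: u0_def)
    then have "\<bar>v - u\<bar> < t" using uv t by auto
    then have "min_gap (F1 b) < v - u" "v - u < min_gap (F1 a)" by (auto simp: t_def abs_less_iff)
    then obtain \<sigma> where s: "\<sigma> \<in> \<sigma>_range F a b" "min_gap \<sigma> = v - u" by (rule min_gap_onto)
    note r = \<sigma>_range_subset[OF s(1)]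
    define c where "c = u + left_min \<sigma>"
    have c: "c - left_min \<sigma> = u" "c - right_min \<sigma> = v" using s(2) by (auto simp: c_def min_gap_def)
    have "\<bar>\<sigma> - s0\<bar> + \<bar>c - c0\<bar> \<le> Cp * (\<bar>(c - left_min \<sigma>) - (c0 - left_min s0)\<bar> + \<bar>(c - right_min \<sigma>) - (c0 - right_min s0)\<bar>)"
      unfolding Cp_def by (rule param_lipschitz[OF r s0_rng])
    also have "\<dots> = Cp * (u + v)" using c c0 uv by simp
    also have "\<dots> \<le> Cp * (2 * u0)" using uv Cp by (intro mult_left_mono) auto
    finally have "\<bar>\<sigma> - s0\<bar> + \<bar>c - c0\<bar> < min d d1" using u0d by simp
    then have n: "\<bar>\<sigma> - s0\<bar> < min d d1" "\<bar>c - c0\<bar> < min d d1" by linarith+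
    have "admissible F a b (\<sigma>, c)" by (rule d1(2)) (use n c uv in auto)
    then have "near d \<sigma> c" using n by (auto simp: near_def)
    then show "\<exists>\<sigma> c. near d \<sigma> c \<and> c - left_min \<sigma> = u \<and> c - right_min \<sigma> = v" using c by blast
  qed
qed

lemma time_estimate_mono:
  assumes "time_estimate w gA gB \<theta> d C \<epsilon>1" "d' \<le> d" "C \<le> C'" "\<epsilon>1' \<le> \<epsilon>1"
  shows "time_estimate w gA gB \<theta> d' C' \<epsilon>1'"
  unfolding time_estimate_def
proof (intro allI impI, elim conjE)
  fix \<epsilon> \<sigma> c :: real assume eps: "0 < \<epsilon>" "\<epsilon> < \<epsilon>1'" and n: "near d' \<sigma> c"
  have e: "\<epsilon> < \<epsilon>1" using eps assms(4) by linarith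
  note h = assms(1)[unfolded time_estimate_def, rule_format, OF conjI[OF eps(1) conjI[OF e near_mono[OF n assms(2)]]]]
  have sq: "0 \<le> \<bar>\<sigma> - s0\<bar> + sqrt (c - left_min \<sigma>)" "0 \<le> \<bar>\<sigma> - s0\<bar> + sqrt (c - right_min \<sigma>)"
    using near_energy(3,4)[OF n] by auto
  have p: "0 \<le> pA \<sigma> c" using h by blast
  have hz: "\<bar>zl \<sigma> c - a0\<bar> \<le> C * (\<bar>\<sigma> - s0\<bar> + sqrt (c - left_min \<sigma>))"
    "\<bar>zr \<sigma> c - b0\<bar> \<le> C * (\<bar>\<sigma> - s0\<bar> + sqrt (c - right_min \<sigma>))"
    "\<bar>weighted_integral w \<epsilon> \<sigma> c - (gA * pA \<sigma> c + gB * pB \<sigma> c)\<bar> \<le> \<theta> * (pA \<sigma> c + pB \<sigma> c) + C"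
    using h by blast+
  show "(\<lambda>z. w z * slowness \<epsilon> \<sigma> c z) integrable_on {zl \<sigma> c..zr \<sigma> c} \<and>
     (\<forall>z\<in>{zl \<sigma> c..zr \<sigma> c}. \<epsilon>\<^sup>2 * (Gibbs F \<sigma> z - c) \<le> 1 / 2) \<and>
     0 \<le> pA \<sigma> c \<and> 0 \<le> pB \<sigma> c \<and>
     \<bar>weighted_integral w \<epsilon> \<sigma> c - (gA * pA \<sigma> c + gB * pB \<sigma> c)\<bar> \<le> \<theta> * (pA \<sigma> c + pB \<sigma> c) + C' \<and>
     \<bar>zl \<sigma> c - a0\<bar> \<le> C' * (\<bar>\<sigma> - s0\<bar> + sqrt (c - left_min \<sigma>)) \<and>
     \<bar>zr \<sigma> c - b0\<bar> \<le> C' * (\<bar>\<sigma> - s0\<bar> + sqrt (c - right_min \<sigma>)) \<and>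
     (\<forall>\<sigma>' c'. near d' \<sigma>' c' \<longrightarrow>
        \<bar>weighted_integral w \<epsilon> \<sigma> c - weighted_integral w \<epsilon> \<sigma>' c' - (gA * (pA \<sigma> c - pA \<sigma>' c') + gB * (pB \<sigma> c - pB \<sigma>' c'))\<bar>
        \<le> \<theta> * (\<bar>pA \<sigma> c - pA \<sigma>' c'\<bar> + \<bar>pB \<sigma> c - pB \<sigma>' c'\<bar>)
          + C' * (1 + max (max (pA \<sigma> c) (pA \<sigma>' c')) (max (pB \<sigma> c) (pB \<sigma>' c'))) * (\<bar>\<sigma> - \<sigma>'\<bar> + \<bar>c - c'\<bar>))"
  proof (intro conjI allI impI)
    show "\<bar>weighted_integral w \<epsilon> \<sigma> c - (gA * pA \<sigma> c + gB * pB \<sigma> c)\<bar> \<le> \<theta> * (pA \<sigma> c + pB \<sigma> c) + C'"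
      by (rule order_trans[OF hz(3) add_left_mono[OF assms(3)]])
    show "\<bar>zl \<sigma> c - a0\<bar> \<le> C' * (\<bar>\<sigma> - s0\<bar> + sqrt (c - left_min \<sigma>))"
      by (rule order_trans[OF hz(1) mult_right_mono[OF assms(3) sq(1)]])
    show "\<bar>zr \<sigma> c - b0\<bar> \<le> C' * (\<bar>\<sigma> - s0\<bar> + sqrt (c - right_min \<sigma>))"
      by (rule order_trans[OF hz(2) mult_right_mono[OF assms(3) sq(2)]])
    fix \<sigma>' c' assume n': "near d' \<sigma>' c'"
    define mx where "mx = max (max (pA \<sigma> c) (pA \<sigma>' c')) (max (pB \<sigma> c) (pB \<sigma>' c'))"
    have mx: "0 \<le> mx" using p by (simp add: mx_def le_max_iff_disj)
    have "\<bar>weighted_integral w \<epsilon> \<sigma> c - weighted_integral w \<epsilon> \<sigma>' c' - (gA * (pA \<sigma> c - pA \<sigma>' c') + gB * (pB \<sigma> c - pB \<sigma>' c'))\<bar>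
        \<le> \<theta> * (\<bar>pA \<sigma> c - pA \<sigma>' c'\<bar> + \<bar>pB \<sigma> c - pB \<sigma>' c'\<bar>) + C * (1 + mx) * (\<bar>\<sigma> - \<sigma>'\<bar> + \<bar>c - c'\<bar>)"
      unfolding mx_def using h near_mono[OF n' assms(2)] by blast
    also have "\<dots> \<le> \<theta> * (\<bar>pA \<sigma> c - pA \<sigma>' c'\<bar> + \<bar>pB \<sigma> c - pB \<sigma>' c'\<bar>) + C' * (1 + mx) * (\<bar>\<sigma> - \<sigma>'\<bar> + \<bar>c - c'\<bar>)"
      using mx assms(3) by (intro add_left_mono mult_right_mono) auto
    finally show "\<bar>weighted_integral w \<epsilon> \<sigma> c - weighted_integral w \<epsilon> \<sigma>' c' - (gA * (pA \<sigma> c - pA \<sigma>' c') + gB * (pB \<sigma> c - pB \<sigma>' c'))\<bar>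
        \<le> \<theta> * (\<bar>pA \<sigma> c - pA \<sigma>' c'\<bar> + \<bar>pB \<sigma> c - pB \<sigma>' c'\<bar>)
          + C' * (1 + max (max (pA \<sigma> c) (pA \<sigma>' c')) (max (pB \<sigma> c) (pB \<sigma>' c'))) * (\<bar>\<sigma> - \<sigma>'\<bar> + \<bar>c - c'\<bar>)"
      by (simp only: mx_def)
  qed (use h in blast)+
qed

text \<open>Each weight isolates one well: it is \<open>1\<close> at one Maxwell state and \<open>0\<close> at the other.\<close>
definition wA :: "real \<Rightarrow> real" where "wA z = (- 1 / (b0 - a0)) * z + b0 / (b0 - a0)"
definition wB :: "real \<Rightarrow> real" where "wB z = (1 / (b0 - a0)) * z + (- a0 / (b0 - a0))"

lemma weight_values:
  "(- 1 / (b0 - a0)) * a0 + b0 / (b0 - a0) = 1" "(- 1 / (b0 - a0)) * b0 + b0 / (b0 - a0) = 0"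
  "(1 / (b0 - a0)) * a0 + (- a0 / (b0 - a0)) = 0" "(1 / (b0 - a0)) * b0 + (- a0 / (b0 - a0)) = 1"
  using a0b0(6) by (simp_all add: diff_divide_distrib[symmetric])

text \<open>The right-hand sides are the weighted times of an orbit of length 2/\<epsilon> and mass
  2r/\<epsilon>, as \<open>wA\<close> z = (b0 - z) / (b0 - a0) and \<open>wB\<close> z = (z - a0) /
  (b0 - a0). Uniqueness is claimed in a neighborhood of size d independent of \<epsilon>, which is
  more than the fixed point argument gives.\<close>

lemma unique_pair:
  assumes delta: "0 < \<delta>" and dmax: "0 < dmax"
  obtains d \<epsilon>0 C k where "0 < d" "d \<le> dmax" "0 < \<epsilon>0" "0 \<le> C" "0 < k"
    "\<And>\<epsilon> \<sigma> c. 0 < \<epsilon> \<Longrightarrow> \<epsilon> < \<epsilon>0 \<Longrightarrow> near d \<sigma> c \<Longrightarrow>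
      (\<lambda>z. wA z * slowness \<epsilon> \<sigma> c z) integrable_on {zl \<sigma> c..zr \<sigma> c} \<and>
      (\<lambda>z. wB z * slowness \<epsilon> \<sigma> c z) integrable_on {zl \<sigma> c..zr \<sigma> c} \<and>
      (\<forall>z\<in>{zl \<sigma> c..zr \<sigma> c}. \<epsilon>\<^sup>2 * (Gibbs F \<sigma> z - c) \<le> 1 / 2) \<and>
      \<bar>zl \<sigma> c - a0\<bar> \<le> C * (\<bar>\<sigma> - s0\<bar> + sqrt (c - left_min \<sigma>)) \<and>
      \<bar>zr \<sigma> c - b0\<bar> \<le> C * (\<bar>\<sigma> - s0\<bar> + sqrt (c - right_min \<sigma>))"
    "\<And>\<epsilon> r. 0 < \<epsilon> \<Longrightarrow> \<epsilon> < \<epsilon>0 \<Longrightarrow> r \<in> {a0 + \<delta>..b0 - \<delta>} \<Longrightarrow>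
      \<exists>\<sigma> c. near d \<sigma> c \<and>
        weighted_integral wA \<epsilon> \<sigma> c = 2 * (b0 - r) / ((b0 - a0) * \<epsilon>) \<and> weighted_integral wB \<epsilon> \<sigma> c = 2 * (r - a0) / ((b0 - a0) * \<epsilon>) \<and>
        c - left_min \<sigma> \<le> exp (- (k / \<epsilon>)) \<and> c - right_min \<sigma> \<le> exp (- (k / \<epsilon>)) \<and>
        (\<forall>\<sigma>' c'. near d \<sigma>' c' \<and> weighted_integral wA \<epsilon> \<sigma>' c' = 2 * (b0 - r) / ((b0 - a0) * \<epsilon>) \<and>
           weighted_integral wB \<epsilon> \<sigma>' c' = 2 * (r - a0) / ((b0 - a0) * \<epsilon>) \<longrightarrow> \<sigma>' = \<sigma> \<and> c' = c)"
proof -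
  define L where "L = b0 - a0"
  have L: "0 < L" using a0b0(6) by (simp add: L_def)
  have F2p: "0 < F2 a0" "0 < F2 b0" using convex a0b0 by auto
  define g1 where "g1 = 1 / sqrt (F2 a0) / 2"
  define g2 where "g2 = 1 / sqrt (F2 b0) / 2"
  have g12: "0 < g1" "0 < g2" using F2p by (auto simp: g1_def g2_def)
  define g where "g = min g1 g2"
  define gm where "gm = max g1 g2"
  have g: "0 < g" "g \<le> g1" "g \<le> g2" "0 < gm" "g1 \<le> gm" "g2 \<le> gm" using g12 by (auto simp: g_def gm_def)
  \<comment> \<open>R = \<rho>/\<epsilon> will be the radius of the box. With this \<rho> both
    targets are at least 2 \<open>gm\<close> R whenever r keeps distance \<delta> from the Maxwell
    states, so the box stays in p, q >= R.\<close>
  define \<rho> where "\<rho> = \<delta> / (L * gm)"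
  have rho: "0 < \<rho>" using delta L g by (simp add: \<rho>_def)
  \<comment> \<open>Coordinates in the box are at most B/\<epsilon>: the center contributes 2 / (g
    \<epsilon>) and the radius \<rho>/\<epsilon>.\<close>
  define B where "B = 2 / g + \<rho>"
  have B: "0 < B" using g rho by (simp add: B_def add_pos_pos)
  \<comment> \<open>In this order the three bounds serve the contraction, the displacement of the
    center, and the localization of all competitors in the box.\<close>
  define \<theta> where "\<theta> = min (g / 16) (min (g * \<rho> / (8 * B)) (g * g * \<rho> / 16))"
  have theta: "0 < \<theta>" using g rho B by (simp add: \<theta>_def)
  have th1: "\<theta> \<le> g / 16" by (simp add: \<theta>_def)
  have th2: "\<theta> * (2 * B) \<le> g * \<rho> / 4"
  proof -
    have "\<theta> \<le> g * \<rho> / (8 * B)" by (simp add: \<theta>_def)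
    then have "\<theta> * (2 * B) \<le> g * \<rho> / (8 * B) * (2 * B)" using B by (intro mult_right_mono) auto
    also have "\<dots> = g * \<rho> / 4" using B by simp
    finally show ?thesis .
  qed
  have th3: "\<theta> * (8 / g) \<le> g * \<rho> / 2"
  proof -
    have "\<theta> \<le> g * g * \<rho> / 16" by (simp add: \<theta>_def)
    then have "\<theta> * (8 / g) \<le> g * g * \<rho> / 16 * (8 / g)" using g by (intro mult_right_mono) auto
    also have "\<dots> = g * \<rho> / 2" using g by simp
    finally show ?thesis .
  qed
  have wAB: "(\<lambda>z. (- 1 / (b0 - a0)) * z + b0 / (b0 - a0)) = wA" "(\<lambda>z. (1 / (b0 - a0)) * z + (- a0 / (b0 - a0))) = wB"
    by (rule ext, simp add: wA_def wB_def)+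
  obtain dA CA eA where A: "0 < dA" "0 \<le> CA" "0 < eA" "eA \<le> 1" "time_estimate wA g1 0 \<theta> dA CA eA"
    using weighted_integral_estimate[OF theta, of "- 1 / (b0 - a0)" "b0 / (b0 - a0)"]
    unfolding weight_values wAB g1_def by auto
  obtain dB CB eB where Bb: "0 < dB" "0 \<le> CB" "0 < eB" "eB \<le> 1" "time_estimate wB 0 g2 \<theta> dB CB eB"
    using weighted_integral_estimate[OF theta, of "1 / (b0 - a0)" "- a0 / (b0 - a0)"]
    unfolding weight_values wAB g2_def by auto
  define d where "d = min dmax (min dA dB)"
  define C where "C = max CA CB"
  define e1 where "e1 = min eA eB"
  have d: "0 < d" "d \<le> dA" "d \<le> dB" "d \<le> dmax" using A Bb dmax by (auto simp: d_def)
  have C: "0 \<le> C" "CA \<le> C" "CB \<le> C" using A by (auto simp: C_def)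
  have e1: "0 < e1" "e1 \<le> 1" "e1 \<le> eA" "e1 \<le> eB" using A Bb by (auto simp: e1_def)
  have TA: "time_estimate wA g1 0 \<theta> d C e1" by (rule time_estimate_mono[OF A(5) d(2) C(2) e1(3)])
  have TB: "time_estimate wB 0 g2 \<theta> d C e1" by (rule time_estimate_mono[OF Bb(5) d(3) C(3) e1(4)])
  obtain u0 where u0: "0 < u0" "\<And>u v. 0 < u \<Longrightarrow> u \<le> u0 \<Longrightarrow> 0 < v \<Longrightarrow> v \<le> u0 \<Longrightarrow> \<exists>\<sigma> c. near d \<sigma> c \<and> c - left_min \<sigma> = u \<and> c - right_min \<sigma> = v"
    by (rule param_exists[OF d(1)], rule that, assumption+)
  \<comment> \<open>The smallness condition is placed inside the existential so that a total
    function of p and q can be chosen; its values for large energies are arbitrary.\<close>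
  have "\<exists>x. exp (- p) \<le> u0 \<and> exp (- q) \<le> u0 \<longrightarrow> near d (fst x) (snd x) \<and> snd x - left_min (fst x) = exp (- p) \<and> snd x - right_min (fst x) = exp (- q)" for p q :: real
  proof (cases "exp (- p) \<le> u0 \<and> exp (- q) \<le> u0")
    case True
    then obtain \<sigma> c where "near d \<sigma> c" "c - left_min \<sigma> = exp (- p)" "c - right_min \<sigma> = exp (- q)"
      using u0(2)[of "exp (- p)" "exp (- q)"] by auto
    then show ?thesis by (intro exI[of _ "(\<sigma>, c)"]) auto
  qed auto
  then have "\<exists>f. \<forall>p q. exp (- p) \<le> u0 \<and> exp (- q) \<le> u0 \<longrightarrow> near d (fst (f p q)) (snd (f p q)) \<and>
     snd (f p q) - left_min (fst (f p q)) = exp (- p) \<and> snd (f p q) - right_min (fst (f p q)) = exp (- q)" by metis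
  then obtain f where f: "\<And>p q. exp (- p) \<le> u0 \<Longrightarrow> exp (- q) \<le> u0 \<Longrightarrow> near d (fst (f p q)) (snd (f p q)) \<and>
     snd (f p q) - left_min (fst (f p q)) = exp (- p) \<and> snd (f p q) - right_min (fst (f p q)) = exp (- q)" by blast
  define Cp where "Cp = 1 + (1 + a) / (b - a)"
  have Cp: "1 \<le> Cp" using a_pos ab by (simp add: Cp_def)
  \<comment> \<open>\<open>e2\<close> yields C <= g R / 4, \<open>e3\<close> yields C <=
    1/\<epsilon>, \<open>e4\<close> makes the exponentially small Lipschitz term at most g/16, and
    \<rho> \<open>u0\<close> in the minimum ensures exp (-R) <= \<open>u0\<close>.\<close>
  define e2 where "e2 = g * \<rho> / (4 * (C + 1))"
  define e3 where "e3 = 1 / (C + 1)"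
  define e4 where "e4 = g * \<rho>\<^sup>2 / (32 * (C + 1) * Cp * (1 + B))"
  define \<epsilon>0 where "\<epsilon>0 = min (min e1 (\<rho> * u0)) (min e2 (min e3 e4))"
  have epos: "0 < e2" "0 < e3" "0 < e4" using g rho C Cp B by (auto simp: e2_def e3_def e4_def)
  have e0: "0 < \<epsilon>0" "\<epsilon>0 \<le> e1" "\<epsilon>0 \<le> \<rho> * u0" "\<epsilon>0 \<le> e2" "\<epsilon>0 \<le> e3" "\<epsilon>0 \<le> e4" "\<epsilon>0 \<le> 1"
    using e1 rho u0(1) epos by (auto simp: \<epsilon>0_def)
  have main: "\<exists>\<sigma> c. near d \<sigma> c \<and>
        weighted_integral wA \<epsilon> \<sigma> c = 2 * (b0 - r) / (L * \<epsilon>) \<and> weighted_integral wB \<epsilon> \<sigma> c = 2 * (r - a0) / (L * \<epsilon>) \<and>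
        c - left_min \<sigma> \<le> exp (- (\<rho> / \<epsilon>)) \<and> c - right_min \<sigma> \<le> exp (- (\<rho> / \<epsilon>)) \<and>
        (\<forall>\<sigma>' c'. near d \<sigma>' c' \<and> weighted_integral wA \<epsilon> \<sigma>' c' = 2 * (b0 - r) / (L * \<epsilon>) \<and>
           weighted_integral wB \<epsilon> \<sigma>' c' = 2 * (r - a0) / (L * \<epsilon>) \<longrightarrow> \<sigma>' = \<sigma> \<and> c' = c)"
    if eps: "0 < \<epsilon>" "\<epsilon> < \<epsilon>0" and r: "r \<in> {a0 + \<delta>..b0 - \<delta>}" for \<epsilon> r
  proof -
    have eps1: "\<epsilon> < e1" "\<epsilon> \<le> 1" using eps e0 by auto
    define Y1 where "Y1 = 2 * (b0 - r) / (L * \<epsilon>)"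
    define Y2 where "Y2 = 2 * (r - a0) / (L * \<epsilon>)"
    define R where "R = \<rho> / \<epsilon>"
    have R: "0 < R" using rho eps by (simp add: R_def)
    have Ylow: "2 * gm * R \<le> Y1" "2 * gm * R \<le> Y2"
    proof -
      have "2 * gm * R = 2 * \<delta> / (L * \<epsilon>)" using g L eps by (simp add: R_def \<rho>_def)
      moreover have "2 * \<delta> / (L * \<epsilon>) \<le> Y1" "2 * \<delta> / (L * \<epsilon>) \<le> Y2"
        unfolding Y1_def Y2_def using r L eps by (auto intro!: divide_right_mono)
      ultimately show "2 * gm * R \<le> Y1" "2 * gm * R \<le> Y2" by simp_all
    qed
    have Yup: "Y1 \<le> 2 / \<epsilon>" "Y2 \<le> 2 / \<epsilon>" and Ysum: "Y1 + Y2 = 2 / \<epsilon>"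
    proof -
      have "Y1 \<le> 2 * L / (L * \<epsilon>)" "Y2 \<le> 2 * L / (L * \<epsilon>)"
        unfolding Y1_def Y2_def using r L eps delta by (auto intro!: divide_right_mono simp: L_def)
      then show "Y1 \<le> 2 / \<epsilon>" "Y2 \<le> 2 / \<epsilon>" using L by simp_all
      have "Y1 + Y2 = 2 * L / (L * \<epsilon>)" unfolding Y1_def Y2_def add_divide_distrib[symmetric] by (simp add: L_def)
      then show "Y1 + Y2 = 2 / \<epsilon>" using L by simp
    qed
    \<comment> \<open>The center of the box solves the two equations with all error terms
      dropped.\<close>
    define x where "x = Y1 / g1"
    define y where "y = Y2 / g2"
    have Ypos: "0 \<le> Y1" "0 \<le> Y2" using Ylow R g by (auto intro: order_trans[of 0 "2 * gm * R"])
    have x: "2 * R \<le> x" "x \<le> 2 / g / \<epsilon>"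
    proof -
      have "2 * g1 * R \<le> 2 * gm * R" using g R by (intro mult_right_mono) auto
      then have "2 * g1 * R \<le> Y1" using Ylow by linarith
      then show "2 * R \<le> x" using g12 by (simp add: x_def field_simps)
      have "x \<le> (2 / \<epsilon>) / g" unfolding x_def using Yup Ypos g g12 eps by (intro frac_le) auto
      then show "x \<le> 2 / g / \<epsilon>" by (simp add: mult.commute)
    qed
    have y: "2 * R \<le> y" "y \<le> 2 / g / \<epsilon>"
    proof -
      have "2 * g2 * R \<le> 2 * gm * R" using g R by (intro mult_right_mono) auto
      then have "2 * g2 * R \<le> Y2" using Ylow by linarith
      then show "2 * R \<le> y" using g12 by (simp add: y_def field_simps)
      have "y \<le> (2 / \<epsilon>) / g" unfolding y_def using Yup Ypos g g12 eps by (intro frac_le) auto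
      then show "y \<le> 2 / g / \<epsilon>" by (simp add: mult.commute)
    qed
    have gY: "g1 * x = Y1" "g2 * y = Y2" using g12 by (auto simp: x_def y_def)
    define S where "S = {x - R..x + R} \<times> {y - R..y + R}"
    have BE: "B / \<epsilon> = 2 / g / \<epsilon> + R" by (simp add: B_def R_def add_divide_distrib)
    have Sb: "R \<le> p \<and> R \<le> q \<and> p \<le> B / \<epsilon> \<and> q \<le> B / \<epsilon>" if "(p, q) \<in> S" for p q
      using that x y unfolding BE S_def by auto
    have expR: "exp (- R) \<le> u0"
    proof -
      have "R \<le> exp R" using exp_ge_add_one_self[of R] by linarith
      then have "exp (- R) \<le> 1 / R" using R by (simp add: exp_minus field_simps)
      also have "\<dots> = \<epsilon> / \<rho>" by (simp add: R_def)
      also have "\<dots> \<le> u0" using eps e0 rho by (simp add: field_simps)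
      finally show ?thesis .
    qed
    have fR: "near d (fst (f p q)) (snd (f p q))" "snd (f p q) - left_min (fst (f p q)) = exp (- p)"
      "snd (f p q) - right_min (fst (f p q)) = exp (- q)" "pA (fst (f p q)) (snd (f p q)) = p" "pB (fst (f p q)) (snd (f p q)) = q"
      if "R \<le> p" "R \<le> q" for p q
    proof -
      have "exp (- p) \<le> exp (- R)" "exp (- q) \<le> exp (- R)" using that by auto
      then have "exp (- p) \<le> u0" "exp (- q) \<le> u0" using expR by linarith+
      from f[OF this] show "near d (fst (f p q)) (snd (f p q))" "snd (f p q) - left_min (fst (f p q)) = exp (- p)"
        "snd (f p q) - right_min (fst (f p q)) = exp (- q)" "pA (fst (f p q)) (snd (f p q)) = p" "pB (fst (f p q)) (snd (f p q)) = q"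
        by (auto simp: pA_def pB_def)
    qed
    \<comment> \<open>A quadratic lower bound for exp R suffices: exp (-R) of order \<epsilon>^2
      beats the factor 1/\<epsilon> coming from p and q.\<close>
    have small: "C * (1 + B / \<epsilon>) * (Cp * exp (- R)) \<le> g / 16"
    proof -
      have "R\<^sup>2 / 2 \<le> exp R" using exp_lower_Taylor_quadratic[of R] R by linarith
      then have "exp (- R) \<le> 2 / R\<^sup>2" using R by (simp add: exp_minus field_simps)
      also have "\<dots> = 2 * \<epsilon>\<^sup>2 / \<rho>\<^sup>2" by (simp add: R_def power_divide)
      finally have 1: "exp (- R) \<le> 2 * \<epsilon>\<^sup>2 / \<rho>\<^sup>2" .
      have 2: "1 + B / \<epsilon> \<le> (1 + B) / \<epsilon>" using eps eps1 by (simp add: field_simps)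
      have "C * (1 + B / \<epsilon>) * (Cp * exp (- R)) \<le> (C + 1) * ((1 + B) / \<epsilon>) * (Cp * (2 * \<epsilon>\<^sup>2 / \<rho>\<^sup>2))"
        using 1 2 C Cp B eps by (intro mult_mono) auto
      also have "\<dots> = 2 * (C + 1) * Cp * (1 + B) * \<epsilon> / \<rho>\<^sup>2"
        using eps by (simp add: power2_eq_square)
      also have "\<dots> \<le> 2 * (C + 1) * Cp * (1 + B) * e4 / \<rho>\<^sup>2"
        using eps e0 C Cp B by (intro divide_right_mono mult_left_mono) auto
      also have "\<dots> = g / 16"
      proof -
        have "2 * D * Cp * E * (g * \<rho>\<^sup>2 / (32 * D * Cp * E)) / \<rho>\<^sup>2 = g / 16" if "0 < D" "0 < E" for D E
          using that Cp rho by (simp add: field_simps)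
        from this[of "C + 1" "1 + B"] show ?thesis using C B by (simp add: e4_def)
      qed
      finally show ?thesis .
    qed
    have CR: "C \<le> g * R / 4"
    proof -
      have "\<epsilon> * (4 * (C + 1)) \<le> e2 * (4 * (C + 1))" using eps e0 C by (intro mult_right_mono) auto
      also have "\<dots> = g * \<rho>" using C by (simp add: e2_def)
      finally have "\<epsilon> * (4 * C) \<le> g * \<rho>" using eps by (simp add: algebra_simps)
      then show ?thesis using eps by (simp add: R_def field_simps)
    qed
    have Ce: "C \<le> 1 / \<epsilon>"
    proof -
      have "\<epsilon> * (C + 1) \<le> e3 * (C + 1)" using eps e0 C by (intro mult_right_mono) auto
      also have "\<dots> = 1" using C by (simp add: e3_def)
      finally show ?thesis using eps by (simp add: field_simps)
    qed
    define H1 where "H1 p q = weighted_integral wA \<epsilon> (fst (f p q)) (snd (f p q))" for p q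
    define H2 where "H2 p q = weighted_integral wB \<epsilon> (fst (f p q)) (snd (f p q))" for p q
    have TA': "\<bar>weighted_integral wA \<epsilon> \<sigma> c - g1 * pA \<sigma> c\<bar> \<le> \<theta> * (pA \<sigma> c + pB \<sigma> c) + C" "0 \<le> pA \<sigma> c" "0 \<le> pB \<sigma> c"
      "\<And>\<sigma>' c'. near d \<sigma>' c' \<Longrightarrow> \<bar>weighted_integral wA \<epsilon> \<sigma> c - weighted_integral wA \<epsilon> \<sigma>' c' - g1 * (pA \<sigma> c - pA \<sigma>' c')\<bar>
        \<le> \<theta> * (\<bar>pA \<sigma> c - pA \<sigma>' c'\<bar> + \<bar>pB \<sigma> c - pB \<sigma>' c'\<bar>)
          + C * (1 + max (max (pA \<sigma> c) (pA \<sigma>' c')) (max (pB \<sigma> c) (pB \<sigma>' c'))) * (\<bar>\<sigma> - \<sigma>'\<bar> + \<bar>c - c'\<bar>)"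
      if n: "near d \<sigma> c" for \<sigma> c
      using TA[unfolded time_estimate_def, rule_format, OF conjI[OF eps(1) conjI[OF eps1(1) n]]] by auto
    have TB': "\<bar>weighted_integral wB \<epsilon> \<sigma> c - g2 * pB \<sigma> c\<bar> \<le> \<theta> * (pA \<sigma> c + pB \<sigma> c) + C"
      "\<And>\<sigma>' c'. near d \<sigma>' c' \<Longrightarrow> \<bar>weighted_integral wB \<epsilon> \<sigma> c - weighted_integral wB \<epsilon> \<sigma>' c' - g2 * (pB \<sigma> c - pB \<sigma>' c')\<bar>
        \<le> \<theta> * (\<bar>pA \<sigma> c - pA \<sigma>' c'\<bar> + \<bar>pB \<sigma> c - pB \<sigma>' c'\<bar>)
          + C * (1 + max (max (pA \<sigma> c) (pA \<sigma>' c')) (max (pB \<sigma> c) (pB \<sigma>' c'))) * (\<bar>\<sigma> - \<sigma>'\<bar> + \<bar>c - c'\<bar>)"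
      if n: "near d \<sigma> c" for \<sigma> c
      using TB[unfolded time_estimate_def, rule_format, OF conjI[OF eps(1) conjI[OF eps1(1) n]]] by auto
    \<comment> \<open>The error term with the large constant is a small Lipschitz term in p and q,
      because \<sigma> and c move by at most a constant times exp (-R) times the change of p and
      q.\<close>
    have lipS: "C * (1 + max (max p p') (max q q')) * (\<bar>fst (f p q) - fst (f p' q')\<bar> + \<bar>snd (f p q) - snd (f p' q')\<bar>)
        \<le> g / 16 * (\<bar>p - p'\<bar> + \<bar>q - q'\<bar>)" if "(p, q) \<in> S" "(p', q') \<in> S" for p q p' q'
    proof -
      note s = Sb[OF that(1)] and s' = Sb[OF that(2)]
      note n = fR[of p q] and n' = fR[of p' q']
      have "\<bar>fst (f p q) - fst (f p' q')\<bar> + \<bar>snd (f p q) - snd (f p' q')\<bar> \<le> Cp * (\<bar>exp (- p) - exp (- p')\<bar> + \<bar>exp (- q) - exp (- q')\<bar>)"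
        using param_lipschitz[OF near_energy(2) near_energy(2), OF n(1) n'(1), of "snd (f p q)" "snd (f p' q')"] n(2,3) n'(2,3) s s'
        unfolding Cp_def by simp
      also have "\<dots> \<le> Cp * (exp (- R) * \<bar>p - p'\<bar> + exp (- R) * \<bar>q - q'\<bar>)"
        using Cp s s' by (intro mult_left_mono add_mono exp_minus_lipschitz) auto
      also have "\<dots> = Cp * exp (- R) * (\<bar>p - p'\<bar> + \<bar>q - q'\<bar>)" by (simp add: algebra_simps)
      finally have 1: "\<bar>fst (f p q) - fst (f p' q')\<bar> + \<bar>snd (f p q) - snd (f p' q')\<bar>
          \<le> Cp * exp (- R) * (\<bar>p - p'\<bar> + \<bar>q - q'\<bar>)" .
      have 2: "max (max p p') (max q q') \<le> B / \<epsilon>" using s s' by simp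
      have 3: "0 \<le> max (max p p') (max q q')" using s R by (simp add: le_max_iff_disj)
      have "C * (1 + max (max p p') (max q q')) * (\<bar>fst (f p q) - fst (f p' q')\<bar> + \<bar>snd (f p q) - snd (f p' q')\<bar>)
          \<le> C * (1 + B / \<epsilon>) * (Cp * exp (- R) * (\<bar>p - p'\<bar> + \<bar>q - q'\<bar>))"
        using 1 2 3 C B eps by (intro mult_mono[OF mult_left_mono]) auto
      also have "\<dots> = C * (1 + B / \<epsilon>) * (Cp * exp (- R)) * (\<bar>p - p'\<bar> + \<bar>q - q'\<bar>)" by simp
      also have "\<dots> \<le> g / 16 * (\<bar>p - p'\<bar> + \<bar>q - q'\<bar>)" using small by (intro mult_right_mono) auto
      finally show ?thesis .
    qed
    have cS: "(x, y) \<in> S" using R by (simp add: S_def)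
    have cb: "\<theta> * (x + y) + C \<le> g * R / 2"
    proof -
      have "x \<le> B / \<epsilon>" "y \<le> B / \<epsilon>" using Sb[OF cS] by auto
      then have "\<theta> * (x + y) \<le> \<theta> * (2 * B / \<epsilon>)" using theta by (intro mult_left_mono) auto
      also have "\<dots> = \<theta> * (2 * B) / \<epsilon>" by simp
      also have "\<dots> \<le> g * \<rho> / 4 / \<epsilon>" using th2 eps by (intro divide_right_mono) auto
      also have "\<dots> = g * R / 4" by (simp add: R_def)
      finally show ?thesis using CR by linarith
    qed
    note fc = fR[of x y] and cR = Sb[OF cS]
    have "\<exists>p q. (p, q) \<in> S \<and> H1 p q = Y1 \<and> H2 p q = Y2 \<and>
      (\<forall>p' q'. (p', q') \<in> S \<and> H1 p' q' = Y1 \<and> H2 p' q' = Y2 \<longrightarrow> p' = p \<and> q' = q)"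
      unfolding S_def
    proof (rule unique_solution_in_box[OF g12 less_imp_le[OF R]])
      have gR: "g * R / 2 \<le> g1 * R / 2" "g * R / 2 \<le> g2 * R / 2"
        using g R by (auto intro!: divide_right_mono mult_right_mono)
      show "\<bar>H1 x y - Y1\<bar> \<le> g1 * R / 2" "\<bar>H2 x y - Y2\<bar> \<le> g2 * R / 2"
        using TA'(1)[OF fc(1)] TB'(1)[OF fc(1)] cR cb gR fc(4,5) by (auto simp: H1_def H2_def gY)
    next
      fix p q p' q' assume "(p, q) \<in> {x - R..x + R} \<times> {y - R..y + R}" "(p', q') \<in> {x - R..x + R} \<times> {y - R..y + R}"
      then have in_S: "(p, q) \<in> S" "(p', q') \<in> S" by (simp_all add: S_def)
      note s = Sb[OF in_S(1)] and s' = Sb[OF in_S(2)]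
      have pq: "R \<le> p" "R \<le> q" "R \<le> p'" "R \<le> q'" using s s' by auto
      note n = fR[OF pq(1,2)] and n' = fR[OF pq(3,4)]
      define E where "E = \<bar>p - p'\<bar> + \<bar>q - q'\<bar>"
      have E: "0 \<le> E" by (simp add: E_def)
      have th: "\<theta> * E \<le> g / 16 * E" by (rule mult_right_mono[OF th1 E])
      have well_integrand: "g / 8 * E \<le> g1 / 8 * E" "g / 8 * E \<le> g2 / 8 * E" using g E by (auto intro!: mult_right_mono)
      have e8: "g / 16 * E + g / 16 * E = g / 8 * E" by simp
      have "\<bar>H1 p q - H1 p' q' - g1 * (p - p')\<bar> \<le> \<theta> * E + g / 16 * E"
        using TA'(4)[OF n(1) n'(1)] lipS[OF in_S] unfolding n(4,5) n'(4,5) H1_def E_def by linarith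
      then show "\<bar>H1 p q - H1 p' q' - g1 * (p - p')\<bar> \<le> g1 / 8 * (\<bar>p - p'\<bar> + \<bar>q - q'\<bar>)"
        unfolding E_def[symmetric] using th well_integrand e8 by linarith
      have "\<bar>H2 p q - H2 p' q' - g2 * (q - q')\<bar> \<le> \<theta> * E + g / 16 * E"
        using TB'(2)[OF n(1) n'(1)] lipS[OF in_S] unfolding n(4,5) n'(4,5) H2_def E_def by linarith
      then show "\<bar>H2 p q - H2 p' q' - g2 * (q - q')\<bar> \<le> g2 / 8 * (\<bar>p - p'\<bar> + \<bar>q - q'\<bar>)"
        unfolding E_def[symmetric] using th well_integrand e8 by linarith
    qed
    then obtain p q where pq: "(p, q) \<in> S" "H1 p q = Y1" "H2 p q = Y2"
      "\<And>p' q'. (p', q') \<in> S \<Longrightarrow> H1 p' q' = Y1 \<Longrightarrow> H2 p' q' = Y2 \<Longrightarrow> p' = p \<and> q' = q" by blast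
    have pqR: "R \<le> p" "R \<le> q" using Sb[OF pq(1)] by auto
    note n = fR[OF pqR]
    \<comment> \<open>A competitor is only known to be near. Adding both estimates and absorbing the
      error by \<theta> <= g/16 bounds p' + q' by 8 / (g \<epsilon>). Then \<open>th3\<close> makes
      the error at most g R, which places (p', q') in the box, where the fixed point is
      unique.\<close>
    have uniq: "\<sigma>' = fst (f p q) \<and> c' = snd (f p q)"
      if n': "near d \<sigma>' c'" and J: "weighted_integral wA \<epsilon> \<sigma>' c' = Y1" "weighted_integral wB \<epsilon> \<sigma>' c' = Y2" for \<sigma>' c'
    proof -
      define p' where "p' = pA \<sigma>' c'"
      define q' where "q' = pB \<sigma>' c'"
      have nn: "0 \<le> p'" "0 \<le> q'" using TA'(2,3)[OF n'] by (auto simp: p'_def q'_def)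
      have E1: "\<bar>Y1 - g1 * p'\<bar> \<le> \<theta> * (p' + q') + C" and E2: "\<bar>Y2 - g2 * q'\<bar> \<le> \<theta> * (p' + q') + C"
        using TA'(1)[OF n'] TB'(1)[OF n'] J by (auto simp: p'_def q'_def)
      have "g * p' + g * q' \<le> g1 * p' + g2 * q'" using g nn by (intro add_mono mult_right_mono) auto
      also have "\<dots> \<le> 2 / \<epsilon> + 2 * (\<theta> * (p' + q')) + 2 * C" using E1 E2 Ysum by linarith
      also have "\<theta> * (p' + q') \<le> g / 16 * (p' + q')" using th1 nn by (intro mult_right_mono) auto
      finally have "g * (p' + q') - 2 * (g / 16 * (p' + q')) \<le> 2 / \<epsilon> + 2 * C" by (simp add: algebra_simps)
      also have "\<dots> \<le> 4 / \<epsilon>" using Ce by simp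
      finally have "7 / 8 * (g * (p' + q')) \<le> 4 / \<epsilon>" by simp
      moreover have "1 / 2 * (g * (p' + q')) \<le> 7 / 8 * (g * (p' + q'))" using g nn by (intro mult_right_mono) auto
      ultimately have "g * (p' + q') \<le> 8 / \<epsilon>" by simp
      then have s: "p' + q' \<le> 8 / g / \<epsilon>" using g eps by (simp add: field_simps)
      have "\<theta> * (p' + q') \<le> \<theta> * (8 / g / \<epsilon>)" using s theta by (intro mult_left_mono) auto
      also have "\<dots> = \<theta> * (8 / g) / \<epsilon>" by simp
      also have "\<dots> \<le> g * \<rho> / 2 / \<epsilon>" using th3 eps by (intro divide_right_mono) auto
      also have "\<dots> = g * R / 2" by (simp add: R_def)
      finally have "\<theta> * (p' + q') \<le> g * R / 2" .
      then have gR: "\<theta> * (p' + q') + C \<le> g * R" using CR mult_pos_pos[OF g(1) R] by linarith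
      have "\<bar>x - p'\<bar> \<le> R"
      proof -
        have "g1 * \<bar>x - p'\<bar> = \<bar>Y1 - g1 * p'\<bar>"
          using g12 by (simp add: gY(1)[symmetric] right_diff_distrib[symmetric] abs_mult)
        also have "\<dots> \<le> g * R" using E1 gR by linarith
        also have "\<dots> \<le> g1 * R" using g R by (intro mult_right_mono) auto
        finally show ?thesis using g12 by simp
      qed
      moreover have "\<bar>y - q'\<bar> \<le> R"
      proof -
        have "g2 * \<bar>y - q'\<bar> = \<bar>Y2 - g2 * q'\<bar>"
          using g12 by (simp add: gY(2)[symmetric] right_diff_distrib[symmetric] abs_mult)
        also have "\<dots> \<le> g * R" using E2 gR by linarith
        also have "\<dots> \<le> g2 * R" using g R by (intro mult_right_mono) auto
        finally show ?thesis using g12 by simp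
      qed
      ultimately have in_S: "(p', q') \<in> S" by (auto simp: S_def abs_le_iff)
      have pR: "R \<le> p'" "R \<le> q'" using Sb[OF in_S] by auto
      note m = fR[OF pR] and ne = near_energy[OF n']
      have u: "c' - left_min \<sigma>' = exp (- p')" "c' - right_min \<sigma>' = exp (- q')"
        using ne(3,4) by (auto simp: p'_def q'_def pA_def pB_def)
      \<comment> \<open>\<open>f\<close> picks some pair with these two energies; by
        \<open>param_lipschitz\<close> there is only one.\<close>
      have "\<bar>\<sigma>' - fst (f p' q')\<bar> + \<bar>c' - snd (f p' q')\<bar> \<le> 0"
        using param_lipschitz[OF ne(2) near_energy(2)[OF m(1)], of c' "snd (f p' q')"] unfolding u m(2,3) by simp
      then have eq: "\<sigma>' = fst (f p' q')" "c' = snd (f p' q')" by linarith+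
      have "p' = p \<and> q' = q" by (rule pq(4)[OF in_S]) (use J eq in \<open>auto simp: H1_def H2_def\<close>)
      then show ?thesis using eq by simp
    qed
    show ?thesis
      unfolding Y1_def[symmetric] Y2_def[symmetric] R_def[symmetric]
    proof (intro exI conjI allI impI)
      show "near d (fst (f p q)) (snd (f p q))" by (rule n)
      show "weighted_integral wA \<epsilon> (fst (f p q)) (snd (f p q)) = Y1" "weighted_integral wB \<epsilon> (fst (f p q)) (snd (f p q)) = Y2"
        using pq(2,3) by (auto simp: H1_def H2_def)
      show "snd (f p q) - left_min (fst (f p q)) \<le> exp (- R)" "snd (f p q) - right_min (fst (f p q)) \<le> exp (- R)"
        using n(2,3) pqR by auto
    qed (use uniq in auto)
  qed
  have gen: "(\<lambda>z. wA z * slowness \<epsilon> \<sigma> c z) integrable_on {zl \<sigma> c..zr \<sigma> c} \<and>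
      (\<lambda>z. wB z * slowness \<epsilon> \<sigma> c z) integrable_on {zl \<sigma> c..zr \<sigma> c} \<and>
      (\<forall>z\<in>{zl \<sigma> c..zr \<sigma> c}. \<epsilon>\<^sup>2 * (Gibbs F \<sigma> z - c) \<le> 1 / 2) \<and>
      \<bar>zl \<sigma> c - a0\<bar> \<le> C * (\<bar>\<sigma> - s0\<bar> + sqrt (c - left_min \<sigma>)) \<and>
      \<bar>zr \<sigma> c - b0\<bar> \<le> C * (\<bar>\<sigma> - s0\<bar> + sqrt (c - right_min \<sigma>))"
    if eps: "0 < \<epsilon>" "\<epsilon> < \<epsilon>0" and n: "near d \<sigma> c" for \<epsilon> \<sigma> c
  proof -
    have e: "\<epsilon> < e1" using eps e0 by linarith
    show ?thesis
      using TA[unfolded time_estimate_def, rule_format, OF conjI[OF eps(1) conjI[OF e n]]]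
        TB[unfolded time_estimate_def, rule_format, OF conjI[OF eps(1) conjI[OF e n]]] by blast
  qed
  show thesis
    by (rule that[OF d(1,4) e0(1) C(1) rho], rule gen, assumption+, rule main[unfolded L_def], assumption+)
qed

end

section \<open>Orbits of the energy integral\<close>

lemma sqrt_one_plus_square_pos: "0 < sqrt (1 + s\<^sup>2)" for s :: real
  by (simp add: add_pos_nonneg)

lemma deriv_Q: "deriv Q = (\<lambda>s. s / sqrt (1 + s\<^sup>2))"
proof
  fix s :: real
  have p: "0 < 1 + s\<^sup>2" by (simp add: add_pos_nonneg)
  have "(Q has_real_derivative s / sqrt (1 + s\<^sup>2)) (at s)"
    unfolding Q_def using p by (auto intro!: derivative_eq_intros simp: field_simps)
  then show "deriv Q s = s / sqrt (1 + s\<^sup>2)" by (rule DERIV_imp_deriv)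
qed

lemma deriv2_Q: "(deriv ^^ 2) Q s = 1 / sqrt (1 + s\<^sup>2) ^ 3"
proof -
  have p: "0 < 1 + s\<^sup>2" by (simp add: add_pos_nonneg)
  define t where "t = sqrt (1 + s\<^sup>2)"
  have t: "0 < t" "t * t = 1 + s\<^sup>2" using p by (auto simp: t_def)
  have "((\<lambda>s. sqrt (1 + s\<^sup>2)) has_real_derivative s / t) (at s)"
    unfolding t_def using p by (auto intro!: derivative_eq_intros simp: field_simps)
  from DERIV_divide[OF DERIV_ident this]
  have "((\<lambda>s. s / sqrt (1 + s\<^sup>2)) has_real_derivative (1 * t - s * (s / t)) / (t * t)) (at s)"
    using t by (simp add: t_def)
  moreover have "(1 * t - s * (s / t)) / (t * t) = (t * t - s * s) / (t * t * t)"
    using t(1) by (simp add: field_simps)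
  moreover have "\<dots> = 1 / t ^ 3" using t(2) by (simp add: power2_eq_square power3_eq_cube)
  ultimately have "((\<lambda>s. s / sqrt (1 + s\<^sup>2)) has_real_derivative 1 / t ^ 3) (at s)" by simp
  then have "deriv (\<lambda>s. s / sqrt (1 + s\<^sup>2)) s = 1 / t ^ 3" by (rule DERIV_imp_deriv)
  then show ?thesis by (simp add: numeral_2_eq_2 deriv_Q t_def)
qed

lemma P_eq:
  assumes "0 < \<epsilon>"
  shows "P \<epsilon> s = (1 - 1 / sqrt (1 + (\<epsilon> * s)\<^sup>2)) / \<epsilon>\<^sup>2"
proof -
  let ?f = "\<lambda>u. (deriv ^^ 2) Q (\<epsilon> * u) * u"
  let ?G = "\<lambda>u. - (1 / sqrt (1 + (\<epsilon> * u)\<^sup>2)) / \<epsilon>\<^sup>2"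
  have d: "(?G has_real_derivative ?f u) (at u)" for u
  proof -
    define t where "t = sqrt (1 + (\<epsilon> * u)\<^sup>2)"
    have p: "0 < 1 + (\<epsilon> * u)\<^sup>2" by (simp add: add_pos_nonneg)
    have t: "0 < t" using p by (simp add: t_def)
    have "((\<lambda>u. sqrt (1 + (\<epsilon> * u)\<^sup>2)) has_real_derivative \<epsilon>\<^sup>2 * u / t) (at u)"
      unfolding t_def using p by (auto intro!: derivative_eq_intros simp: field_simps power2_eq_square)
    from DERIV_cdivide[OF DERIV_minus[OF DERIV_inverse_fun[OF this]], of "\<epsilon>\<^sup>2"]
    have "(?G has_real_derivative (\<epsilon>\<^sup>2 * u / t) / (t * t) / \<epsilon>\<^sup>2) (at u)"
      using t by (simp add: t_def divide_inverse power2_eq_square mult_ac)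
    also have "(\<epsilon>\<^sup>2 * u / t) / (t * t) / \<epsilon>\<^sup>2 = ?f u"
      using assms t by (simp add: deriv2_Q t_def[symmetric] power3_eq_cube)
    finally show ?thesis .
  qed
  have "(LBINT u=ereal 0..ereal s. ?f u) = ?G s - ?G 0"
  proof (rule interval_integral_FTC_finite)
    show "continuous_on {min 0 s..max 0 s} ?f"
      unfolding deriv2_Q using sqrt_one_plus_square_pos
      by (intro continuous_intros ballI) (metis less_irrefl power_not_zero)+
    fix x show "(?G has_vector_derivative ?f x) (at x within {min 0 s..max 0 s})"
      using d[of x] by (simp add: has_real_derivative_iff_has_vector_derivative has_vector_derivative_at_within)
  qed
  then show ?thesis by (simp add: P_def zero_ereal_def diff_divide_distrib)
qed

text \<open>The inverse of \<open>P \<epsilon>\<close> on the nonnegative half-line: the slope at energy \<open>y = \<Phi>\<^sub>\<sigma>(z) - c\<close>.\<close>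
definition energy_slope :: "real \<Rightarrow> real \<Rightarrow> real" where
  "energy_slope \<epsilon> y = sqrt ((1 / (1 - \<epsilon>\<^sup>2 * y)\<^sup>2 - 1) / \<epsilon>\<^sup>2)"

context
  fixes \<epsilon> :: real
  assumes eps: "0 < \<epsilon>"
begin

lemma energy_slope_square:
  assumes "0 \<le> y" "\<epsilon>\<^sup>2 * y < 1"
  shows "(\<epsilon> * energy_slope \<epsilon> y)\<^sup>2 = 1 / (1 - \<epsilon>\<^sup>2 * y)\<^sup>2 - 1" "0 \<le> energy_slope \<epsilon> y"
proof -
  define q where "q = 1 - \<epsilon>\<^sup>2 * y"
  have q: "0 < q" "q \<le> 1" using assms by (auto simp: q_def)
  then have "q\<^sup>2 \<le> 1" by (simp add: power_le_one)
  then have "0 \<le> 1 / q\<^sup>2 - 1" using q by (simp add: field_simps)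
  then show "(\<epsilon> * energy_slope \<epsilon> y)\<^sup>2 = 1 / (1 - \<epsilon>\<^sup>2 * y)\<^sup>2 - 1" "0 \<le> energy_slope \<epsilon> y"
    using eps by (auto simp: energy_slope_def power_mult_distrib q_def[symmetric])
qed

lemma sqrt_energy_slope:
  assumes "0 \<le> y" "\<epsilon>\<^sup>2 * y < 1"
  shows "sqrt (1 + (\<epsilon> * energy_slope \<epsilon> y)\<^sup>2) = 1 / (1 - \<epsilon>\<^sup>2 * y)"
  using assms by (simp add: energy_slope_square real_sqrt_divide)

lemma P_energy_slope: "0 \<le> y \<Longrightarrow> \<epsilon>\<^sup>2 * y < 1 \<Longrightarrow> P \<epsilon> (energy_slope \<epsilon> y) = y"
  using eps by (simp add: P_eq sqrt_energy_slope)

text \<open>\<open>P\<close> \<epsilon> is even, so the sign of s selects the branch. On nonnegative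
  s it takes values in [0, 1/\<epsilon>^2), whence the two bounds on y.\<close>

lemma P_inverse:
  assumes "0 \<le> s" "P \<epsilon> s = y"
  shows "0 \<le> y" "\<epsilon>\<^sup>2 * y < 1" "s = energy_slope \<epsilon> y"
proof -
  define t where "t = sqrt (1 + (\<epsilon> * s)\<^sup>2)"
  have t: "1 \<le> t" "t\<^sup>2 = 1 + (\<epsilon> * s)\<^sup>2" by (auto simp: t_def)
  have y: "\<epsilon>\<^sup>2 * y = 1 - 1 / t" using eps P_eq[OF eps, of s] unfolding assms(2) t_def[symmetric] by simp
  have "0 \<le> \<epsilon>\<^sup>2 * y" unfolding y using t by simp
  then show "0 \<le> y" using eps by (simp add: zero_le_mult_iff)
  show "\<epsilon>\<^sup>2 * y < 1" unfolding y using t by simp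
  have "1 / (1 - \<epsilon>\<^sup>2 * y)\<^sup>2 = t\<^sup>2" unfolding y by (simp add: power_divide)
  then have "energy_slope \<epsilon> y = sqrt ((\<epsilon> * s)\<^sup>2 / \<epsilon>\<^sup>2)" using t by (simp add: energy_slope_def)
  also have "\<dots> = s" using assms(1) eps by (simp add: power_mult_distrib)
  finally show "s = energy_slope \<epsilon> y" ..
qed

lemma deriv2_Q_energy_slope:
  assumes "0 \<le> y" "\<epsilon>\<^sup>2 * y < 1"
  shows "(deriv ^^ 2) Q (\<epsilon> * energy_slope \<epsilon> y) = (1 - \<epsilon>\<^sup>2 * y) ^ 3"
  using assms by (simp add: deriv2_Q sqrt_energy_slope power_divide)

lemma energy_slope_eq:
  assumes "0 \<le> y" "\<epsilon>\<^sup>2 * y < 1"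
  shows "energy_slope \<epsilon> y = sqrt y * sqrt (2 - \<epsilon>\<^sup>2 * y) / (1 - \<epsilon>\<^sup>2 * y)"
proof -
  define q where "q = 1 - \<epsilon>\<^sup>2 * y"
  have q: "0 < q" using assms by (simp add: q_def)
  have "1 / q\<^sup>2 - 1 = (1 - q\<^sup>2) / q\<^sup>2" using q by (simp add: diff_divide_distrib)
  also have "1 - q\<^sup>2 = \<epsilon>\<^sup>2 * (y * (2 - \<epsilon>\<^sup>2 * y))" by (simp add: q_def algebra_simps power2_eq_square)
  finally have "(1 / q\<^sup>2 - 1) / \<epsilon>\<^sup>2 = y * (2 - \<epsilon>\<^sup>2 * y) / q\<^sup>2" using eps by simp
  then show ?thesis using q by (simp add: energy_slope_def q_def[symmetric] real_sqrt_divide real_sqrt_mult)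
qed

lemma inverse_energy_slope:
  assumes "0 < y" "\<epsilon>\<^sup>2 * y < 1"
  shows "slowness_factor (\<epsilon>\<^sup>2 * y) / sqrt y = 1 / energy_slope \<epsilon> y" "0 < energy_slope \<epsilon> y"
  using assms by (auto simp: slowness_factor_def energy_slope_eq field_simps)

lemma energy_slope_bound:
  assumes "0 \<le> y" "\<epsilon>\<^sup>2 * y \<le> 1 / 2"
  shows "energy_slope \<epsilon> y \<le> 4 * sqrt y"
proof -
  have "energy_slope \<epsilon> y = sqrt y * sqrt (2 - \<epsilon>\<^sup>2 * y) / (1 - \<epsilon>\<^sup>2 * y)" using assms by (intro energy_slope_eq) auto
  also have "\<dots> \<le> sqrt y * 2 / (1 / 2)"
  proof (rule frac_le)
    have "sqrt (2 - \<epsilon>\<^sup>2 * y) \<le> 2" 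
    proof (rule real_le_lsqrt)
      have "0 \<le> \<epsilon>\<^sup>2 * y" using assms(1) by simp
      then show "2 - \<epsilon>\<^sup>2 * y \<le> 2\<^sup>2" unfolding power2_eq_square[of "2::real"] by linarith
    qed (use assms in auto)
    then show "sqrt y * sqrt (2 - \<epsilon>\<^sup>2 * y) \<le> sqrt y * 2" using assms by (intro mult_left_mono) auto
  qed (use assms in auto)
  finally show ?thesis by simp
qed

text \<open>\<open>P\<close> \<epsilon> has derivative Q'' (\<epsilon> s) s, so its inverse has the
  reciprocal of this as derivative, with Q'' taken from \<open>deriv2_Q_energy_slope\<close>. It
  blows up as y tends to 0.\<close>

lemma energy_slope_deriv:
  assumes "0 < y" "\<epsilon>\<^sup>2 * y < 1"
  shows "(energy_slope \<epsilon> has_real_derivative 1 / (energy_slope \<epsilon> y * (1 - \<epsilon>\<^sup>2 * y) ^ 3)) (at y)"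
proof -
  define q where "q = 1 - \<epsilon>\<^sup>2 * y"
  have q: "0 < q" using assms by (simp add: q_def)
  have pos: "0 < (1 / q\<^sup>2 - 1) / \<epsilon>\<^sup>2"
    using inverse_energy_slope(2)[OF assms] unfolding energy_slope_def q_def[symmetric] by (simp only: real_sqrt_gt_0_iff)
  have "((\<lambda>y. 1 - \<epsilon>\<^sup>2 * y) has_real_derivative - \<epsilon>\<^sup>2) (at y)" by (auto intro!: derivative_eq_intros)
  moreover have "((\<lambda>q. (1 / q\<^sup>2 - 1) / \<epsilon>\<^sup>2) has_real_derivative (- 2 / q ^ 3) / \<epsilon>\<^sup>2) (at q)"
  proof -
    have "((\<lambda>q. inverse (q\<^sup>2)) has_real_derivative - (inverse (q\<^sup>2) * (2 * q) * inverse (q\<^sup>2))) (at q)"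
      by (rule DERIV_inverse') (use q in \<open>auto intro!: derivative_eq_intros\<close>)
    also have "- (inverse (q\<^sup>2) * (2 * q) * inverse (q\<^sup>2)) = - 2 / q ^ 3"
      using q by (simp add: field_simps power2_eq_square power3_eq_cube)
    finally have "((\<lambda>q. 1 / q\<^sup>2) has_real_derivative - 2 / q ^ 3) (at q)" by (simp add: inverse_eq_divide)
    from DERIV_cdivide[OF DERIV_diff[OF this DERIV_const[of 1]], of "\<epsilon>\<^sup>2"] show ?thesis by simp
  qed
  ultimately have "((\<lambda>y. (1 / (1 - \<epsilon>\<^sup>2 * y)\<^sup>2 - 1) / \<epsilon>\<^sup>2) has_real_derivative ((- 2 / q ^ 3) / \<epsilon>\<^sup>2) * (- \<epsilon>\<^sup>2)) (at y)"
    unfolding q_def by (intro DERIV_chain2)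
  then have d: "((\<lambda>y. (1 / (1 - \<epsilon>\<^sup>2 * y)\<^sup>2 - 1) / \<epsilon>\<^sup>2) has_real_derivative 2 / q ^ 3) (at y)" using eps by simp
  have "((\<lambda>y. sqrt ((1 / (1 - \<epsilon>\<^sup>2 * y)\<^sup>2 - 1) / \<epsilon>\<^sup>2)) has_real_derivative
      (inverse (sqrt ((1 / q\<^sup>2 - 1) / \<epsilon>\<^sup>2)) / 2) * (2 / q ^ 3)) (at y)"
    by (rule DERIV_chain2[OF _ d]) (use DERIV_real_sqrt[OF pos] in \<open>simp add: q_def\<close>)
  moreover have "(inverse (sqrt ((1 / q\<^sup>2 - 1) / \<epsilon>\<^sup>2)) / 2) * (2 / q ^ 3) = 1 / (energy_slope \<epsilon> y * q ^ 3)"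
  proof -
    have "inverse W / 2 * (2 / x) = 1 / (W * x)" for W x :: real by (simp add: inverse_eq_divide)
    then show ?thesis unfolding energy_slope_def q_def[symmetric] .
  qed
  ultimately show ?thesis unfolding energy_slope_def[abs_def] q_def by (simp only:)
qed

lemma energy_slope_cont: "continuous_on {y. \<epsilon>\<^sup>2 * y < 1} (energy_slope \<epsilon>)"
proof -
  have n: "(1 - \<epsilon>\<^sup>2 * y)\<^sup>2 \<noteq> 0" if "\<epsilon>\<^sup>2 * y < 1" for y
  proof -
    have "1 - \<epsilon>\<^sup>2 * y \<noteq> 0" using that by linarith
    then show ?thesis by (simp only: power_eq_0_iff) simp
  qed
  have e: "\<epsilon>\<^sup>2 \<noteq> 0" using eps by simp
  show ?thesis
    unfolding energy_slope_def
    by (intro continuous_on_real_sqrt continuous_on_divide continuous_on_diff continuous_on_power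
        continuous_on_mult continuous_on_const continuous_on_id ballI n e) blast
qed

end

text \<open>exp (-k x) g x is nonincreasing and starts at a nonpositive value.\<close>

lemma gronwall_nonpos:
  fixes g :: "real \<Rightarrow> real"
  assumes "p \<le> q" "continuous_on {p..q} g" "g p \<le> 0"
    and "\<And>x. p < x \<Longrightarrow> x < q \<Longrightarrow> \<exists>D. (g has_real_derivative D) (at x) \<and> D \<le> k * g x"
  shows "g q \<le> 0"
proof -
  let ?h = "\<lambda>x. - (exp (- k * x) * g x)"
  have "?h p \<le> ?h q"
  proof (rule DERIV_nonneg_imp_increasing_open[OF assms(1)])
    show "continuous_on {p..q} ?h" by (intro continuous_intros assms(2))
    fix x assume "p < x" "x < q"
    then obtain D where D: "(g has_real_derivative D) (at x)" "D \<le> k * g x" using assms(4) by blast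
    have "(?h has_real_derivative exp (- k * x) * (k * g x - D)) (at x)"
      by (rule derivative_eq_intros D refl)+ (simp add: algebra_simps)
    moreover have "0 \<le> exp (- k * x) * (k * g x - D)" using D(2) by simp
    ultimately show "\<exists>y. (?h has_real_derivative y) (at x) \<and> 0 \<le> y" by blast
  qed
  moreover have "exp (- k * p) * g p \<le> 0" using assms(3) by (simp add: mult_le_0_iff)
  ultimately have "exp (- k * q) * g q \<le> 0" by linarith
  then show ?thesis by (simp add: mult_le_0_iff)
qed

text \<open>Inside the interval the one-sided \<open>slope\<close> is the ordinary derivative. Its
  nonnegativity, a consequence of monotonicity, is what later selects the branch of the inverse of
  \<open>P\<close>.\<close>

lemma simple_solutionD:
  assumes "simple_solution F \<epsilon> r w \<sigma>" "0 < \<epsilon>"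
  defines "I \<equiv> {-1/\<epsilon>..1/\<epsilon>}"
  shows "\<And>x. x \<in> I \<Longrightarrow> (w has_vector_derivative slope \<epsilon> w x) (at x within I)"
    "\<And>x. -1/\<epsilon> < x \<Longrightarrow> x < 1/\<epsilon> \<Longrightarrow> (w has_real_derivative slope \<epsilon> w x) (at x)"
    "continuous_on I w" "mono_on I w" "\<And>x. x \<in> I \<Longrightarrow> 0 < w x" "\<not> w constant_on I"
    "\<And>x. x \<in> I \<Longrightarrow> 0 \<le> slope \<epsilon> w x" "slope \<epsilon> w (-1/\<epsilon>) = 0" "slope \<epsilon> w (1/\<epsilon>) = 0"
    "(w has_integral (2 * r / \<epsilon>)) I"
    "\<And>x. -1/\<epsilon> < x \<Longrightarrow> x < 1/\<epsilon> \<Longrightarrow> (deriv ^^ 2) Q (\<epsilon> * slope \<epsilon> w x) * deriv (slope \<epsilon> w) x = deriv F (w x) - \<sigma>"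
proof -
  note s = assms(1)[unfolded simple_solution_def]
  show hd: "(w has_vector_derivative slope \<epsilon> w x) (at x within I)" if "x \<in> I" for x
    using s that unfolding I_def slope_def differentiable_on_def by (metis vector_derivative_works)
  show hr: "(w has_real_derivative slope \<epsilon> w x) (at x)" if "-1/\<epsilon> < x" "x < 1/\<epsilon>" for x
    using hd[of x] that at_within_Icc_at[of "-1/\<epsilon>" x "1/\<epsilon>"]
    by (simp add: I_def has_real_derivative_iff_has_vector_derivative)
  show "continuous_on I w" using s differentiable_imp_continuous_on unfolding I_def by blast
  show m: "mono_on I w" "\<And>x. x \<in> I \<Longrightarrow> 0 < w x" "\<not> w constant_on I"
    "slope \<epsilon> w (-1/\<epsilon>) = 0" "slope \<epsilon> w (1/\<epsilon>) = 0" "(w has_integral (2 * r / \<epsilon>)) I"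
    "\<And>x. -1/\<epsilon> < x \<Longrightarrow> x < 1/\<epsilon> \<Longrightarrow> (deriv ^^ 2) Q (\<epsilon> * slope \<epsilon> w x) * deriv (slope \<epsilon> w) x = deriv F (w x) - \<sigma>"
    using s unfolding I_def by auto
  show "0 \<le> slope \<epsilon> w x" if "x \<in> I" for x
  proof (cases "-1/\<epsilon> < x \<and> x < 1/\<epsilon>")
    case True
    then show ?thesis
      by (intro mono_on_imp_deriv_nonneg[OF m(1) hr]) (auto simp: I_def interior_atLeastAtMost_real)
  next
    case False
    then have "x = -1/\<epsilon> \<or> x = 1/\<epsilon>" using that by (auto simp: I_def)
    then show ?thesis using m(4,5) by auto
  qed
qed

text \<open>The energy bound and the integrability of both weighted slownesses are stated in the
  form in which \<open>unique_pair\<close> supplies them for near pairs.\<close>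

locale orbit = double_well +
  fixes \<epsilon> \<sigma> c :: real
  assumes eps: "0 < \<epsilon>" and adm: "admissible F a b (\<sigma>, c)"
    and en: "\<And>z. z \<in> {zl \<sigma> c..zr \<sigma> c} \<Longrightarrow> \<epsilon>\<^sup>2 * (Gibbs F \<sigma> z - c) \<le> 1 / 2"
    and intA: "(\<lambda>z. wA z * slowness \<epsilon> \<sigma> c z) integrable_on {zl \<sigma> c..zr \<sigma> c}"
    and intB: "(\<lambda>z. wB z * slowness \<epsilon> \<sigma> c z) integrable_on {zl \<sigma> c..zr \<sigma> c}"
begin

abbreviation Z1 :: real where "Z1 \<equiv> zl \<sigma> c"
abbreviation Z2 :: real where "Z2 \<equiv> zr \<sigma> c"
definition orbit_energy :: "real \<Rightarrow> real" where "orbit_energy z = Gibbs F \<sigma> z - c"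
definition orbit_slope :: "real \<Rightarrow> real" where "orbit_slope z = energy_slope \<epsilon> (orbit_energy z)"

lemma rng: "\<sigma> \<in> rng" using adm by (auto simp: admissible_def dest: \<sigma>_range_subset)

lemma Z12: "0 < Z1" "Z1 < Z2" "al \<sigma> < Z1" "Z1 < ze \<sigma>" "ze \<sigma> < Z2" "Z2 < be \<sigma>"
  using z1(1,2)[OF adm] z2(1,2)[OF adm] al(1)[OF rng] by linarith+

lemma orbit_energy_ends: "orbit_energy Z1 = 0" "orbit_energy Z2 = 0"
  using z1(3)[OF adm] z2(3)[OF adm] by (simp_all add: orbit_energy_def)

lemma orbit_energy_pos: "Z1 < z \<Longrightarrow> z < Z2 \<Longrightarrow> 0 < orbit_energy z"
  using Gibbs_above[OF adm] by (simp add: orbit_energy_def)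

lemma orbit_energy_nonneg: "z \<in> {Z1..Z2} \<Longrightarrow> 0 \<le> orbit_energy z"
  using orbit_energy_pos[of z] orbit_energy_ends by (cases "z = Z1 \<or> z = Z2") auto

lemma orbit_energy_small: "z \<in> {Z1..Z2} \<Longrightarrow> \<epsilon>\<^sup>2 * orbit_energy z < 1"
  using en[of z] by (simp add: orbit_energy_def)

lemma orbit_slope_pos: "Z1 < z \<Longrightarrow> z < Z2 \<Longrightarrow> 0 < orbit_slope z"
  unfolding orbit_slope_def by (rule inverse_energy_slope(2)[OF eps]) (auto simp: orbit_energy_pos intro: orbit_energy_small)

lemma orbit_slope_ends: "orbit_slope Z1 = 0" "orbit_slope Z2 = 0"
  by (simp_all add: orbit_slope_def orbit_energy_ends energy_slope_def)

lemma orbit_slope_cont: "continuous_on {Z1..Z2} orbit_slope"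
  unfolding orbit_slope_def
proof (rule continuous_on_compose2[OF energy_slope_cont[OF eps]])
  show "continuous_on {Z1..Z2} orbit_energy" unfolding orbit_energy_def by (intro continuous_intros cont_Gibbs Z12)
qed (use orbit_energy_small in auto)

lemma slowness_orbit_slope: "z \<in> {Z1..Z2} \<Longrightarrow> slowness \<epsilon> \<sigma> c z = 1 / orbit_slope z"
proof (cases "z = Z1 \<or> z = Z2")
  case True
  \<comment> \<open>At the turning points both sides are 0 by the convention x / 0 = 0.\<close>
  then show ?thesis using orbit_energy_ends orbit_slope_ends by (auto simp: slowness_def orbit_energy_def)
next
  case False
  assume z: "z \<in> {Z1..Z2}"
  then show ?thesis using inverse_energy_slope(1)[OF eps, of "orbit_energy z"] orbit_energy_pos[of z] orbit_energy_small[OF z] False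
    by (auto simp: slowness_def orbit_energy_def orbit_slope_def)
qed

lemma orbit_slope_deriv:
  assumes "Z1 < z" "z < Z2"
  shows "(orbit_slope has_real_derivative (F1 z - \<sigma>) / (orbit_slope z * (1 - \<epsilon>\<^sup>2 * orbit_energy z) ^ 3)) (at z)"
proof -
  have "(orbit_energy has_real_derivative F1 z - \<sigma>) (at z)"
    unfolding orbit_energy_def using DERIV_diff[OF D_Gibbs DERIV_const, of z \<sigma> c] Z12 assms by simp
  from DERIV_chain2[OF energy_slope_deriv[OF eps orbit_energy_pos[OF assms] orbit_energy_small] this]
  show ?thesis using assms unfolding orbit_slope_def[abs_def] by simp
qed

text \<open>Along an orbit dx = \<open>slowness\<close> dz, so these are the length and the mass
  accumulated between leaving Z1 and reaching \<zeta>.\<close>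

definition time_map :: "real \<Rightarrow> real" where "time_map \<zeta> = integral {Z1..\<zeta>} (slowness \<epsilon> \<sigma> c)"
definition mass_map :: "real \<Rightarrow> real" where "mass_map \<zeta> = integral {Z1..\<zeta>} (\<lambda>z. z * slowness \<epsilon> \<sigma> c z)"

text \<open>The weights are the barycentric coordinates of z with respect to a0 and b0.\<close>

lemma weight_identities: "wA z + wB z = 1" "a0 * wA z + b0 * wB z = z"
proof -
  have "b0 - a0 \<noteq> 0" using a0b0 by simp
  then show "wA z + wB z = 1" "a0 * wA z + b0 * wB z = z"
    by (simp_all add: wA_def wB_def divide_simps) (simp_all add: algebra_simps)
qed

lemma slowness_has_integral: "(slowness \<epsilon> \<sigma> c has_integral (weighted_integral wA \<epsilon> \<sigma> c + weighted_integral wB \<epsilon> \<sigma> c)) {Z1..Z2}"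
proof -
  have "wA z * slowness \<epsilon> \<sigma> c z + wB z * slowness \<epsilon> \<sigma> c z = slowness \<epsilon> \<sigma> c z" for z
    using weight_identities(1)[of z] by (simp add: distrib_right[symmetric])
  then show ?thesis
    using has_integral_add[OF integrable_integral[OF intA] integrable_integral[OF intB]]
    by (simp add: weighted_integral_def)
qed

lemma z_slowness_has_integral: "((\<lambda>z. z * slowness \<epsilon> \<sigma> c z) has_integral (a0 * weighted_integral wA \<epsilon> \<sigma> c + b0 * weighted_integral wB \<epsilon> \<sigma> c)) {Z1..Z2}"
proof -
  have "a0 * (wA z * slowness \<epsilon> \<sigma> c z) + b0 * (wB z * slowness \<epsilon> \<sigma> c z) = z * slowness \<epsilon> \<sigma> c z" for z
    using weight_identities(2)[of z] by (simp only: mult.assoc[symmetric] distrib_right[symmetric])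
  then show ?thesis
    using has_integral_add[OF has_integral_mult_right[OF integrable_integral[OF intA], of a0]
        has_integral_mult_right[OF integrable_integral[OF intB], of b0]]
    by (simp add: weighted_integral_def)
qed

lemma time_map_ends: "time_map Z1 = 0" "time_map Z2 = weighted_integral wA \<epsilon> \<sigma> c + weighted_integral wB \<epsilon> \<sigma> c"
  "mass_map Z1 = 0" "mass_map Z2 = a0 * weighted_integral wA \<epsilon> \<sigma> c + b0 * weighted_integral wB \<epsilon> \<sigma> c"
  using integral_unique[OF slowness_has_integral] integral_unique[OF z_slowness_has_integral] by (simp_all add: time_map_def mass_map_def)

lemma time_map_cont: "continuous_on {Z1..Z2} time_map" "continuous_on {Z1..Z2} mass_map"
  unfolding time_map_def mass_map_def
  by (rule indefinite_integral_continuous_1; rule has_integral_integrable, rule slowness_has_integral z_slowness_has_integral)+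

lemma isCont_slowness: "Z1 < z \<Longrightarrow> z < Z2 \<Longrightarrow> isCont (slowness \<epsilon> \<sigma> c) z"
proof -
  assume z: "Z1 < z" "z < Z2"
  have "isCont (\<lambda>z. 1 / orbit_slope z) z"
    using DERIV_isCont[OF orbit_slope_deriv[OF z]] orbit_slope_pos[OF z] by (intro continuous_intros) auto
  moreover have "\<forall>\<^sub>F x in nhds z. 1 / orbit_slope x = slowness \<epsilon> \<sigma> c x"
    using eventually_nhds_in_open[of "{Z1<..<Z2}" z] z slowness_orbit_slope by (auto elim!: eventually_mono)
  ultimately show ?thesis using isCont_cong by fast
qed

text \<open>The integrands are unbounded near the turning points, so the primitives are
  differentiated only at interior points, where the integrands are continuous.\<close>

lemma time_map_deriv:
  assumes "Z1 < z" "z < Z2"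
  shows "(time_map has_real_derivative 1 / orbit_slope z) (at z)" "(mass_map has_real_derivative z / orbit_slope z) (at z)"
proof -
  have w: "at z within {Z1..Z2} = at z" by (rule at_within_Icc_at) (use assms in auto)
  have k: "slowness \<epsilon> \<sigma> c z = 1 / orbit_slope z" using slowness_orbit_slope[of z] assms by simp
  have "((\<lambda>u. integral {Z1..u} (slowness \<epsilon> \<sigma> c)) has_vector_derivative slowness \<epsilon> \<sigma> c z) (at z within {Z1..Z2} - {})"
    by (rule integral_has_vector_derivative_continuous_at[OF has_integral_integrable[OF slowness_has_integral] _ _
          continuous_at_imp_continuous_at_within[OF isCont_slowness[OF assms]]]) (use assms in simp_all)
  then show "(time_map has_real_derivative 1 / orbit_slope z) (at z)"
    using w k by (simp add: time_map_def[abs_def] has_real_derivative_iff_has_vector_derivative)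
  have "((\<lambda>u. integral {Z1..u} (\<lambda>z. z * slowness \<epsilon> \<sigma> c z)) has_vector_derivative z * slowness \<epsilon> \<sigma> c z) (at z within {Z1..Z2} - {})"
    by (rule integral_has_vector_derivative_continuous_at[OF has_integral_integrable[OF z_slowness_has_integral] _ _
          continuous_at_imp_continuous_at_within[OF isCont_mult[OF continuous_ident isCont_slowness[OF assms]]]])
       (use assms in simp_all)
  then show "(mass_map has_real_derivative z / orbit_slope z) (at z)"
    using w k by (simp add: mass_map_def[abs_def] has_real_derivative_iff_has_vector_derivative)
qed

lemma time_map_strict_mono: "Z1 \<le> x \<Longrightarrow> x < y \<Longrightarrow> y \<le> Z2 \<Longrightarrow> time_map x < time_map y"
proof -
  assume h: "Z1 \<le> x" "x < y" "y \<le> Z2"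
  show "time_map x < time_map y"
  proof (rule DERIV_pos_imp_increasing_open[OF h(2)])
    show "continuous_on {x..y} time_map" by (rule continuous_on_subset[OF time_map_cont(1)]) (use h in auto)
    fix z assume "x < z" "z < y"
    then have "Z1 < z" "z < Z2" using h by auto
    then show "\<exists>D. (time_map has_real_derivative D) (at z) \<and> 0 < D" using time_map_deriv(1) orbit_slope_pos by force
  qed
qed

lemma time_map_inj: "inj_on time_map {Z1..Z2}"
proof (rule inj_onI)
  fix x y assume "x \<in> {Z1..Z2}" "y \<in> {Z1..Z2}" "time_map x = time_map y"
  then show "x = y"
    using time_map_strict_mono[of x y] time_map_strict_mono[of y x] by (cases x y rule: linorder_cases) auto
qed

text \<open>By the chain rule \<open>time_map\<close> (w x) has derivative 1 and
  \<open>mass_map\<close> (w x) has derivative w x. Integrating over the whole interval turns its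
  length and the mass constraint into values at Z2.\<close>

lemma time_along_solution:
  assumes sol: "simple_solution F \<epsilon> r w \<sigma>"
    and sl: "\<And>x. -1/\<epsilon> < x \<Longrightarrow> x < 1/\<epsilon> \<Longrightarrow> slope \<epsilon> w x = orbit_slope (w x)"
    and ends: "w (-1/\<epsilon>) = Z1" "w (1/\<epsilon>) = Z2"
    and inner: "\<And>x. -1/\<epsilon> < x \<Longrightarrow> x < 1/\<epsilon> \<Longrightarrow> Z1 < w x \<and> w x < Z2"
  shows "\<And>x. x \<in> {-1/\<epsilon>..1/\<epsilon>} \<Longrightarrow> time_map (w x) = x + 1/\<epsilon>" "time_map Z2 = 2 / \<epsilon>" "mass_map Z2 = 2 * r / \<epsilon>"
    "\<And>x. x \<in> {-1/\<epsilon>..1/\<epsilon>} \<Longrightarrow> w x \<in> {Z1..Z2}"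
proof -
  let ?I = "{-1/\<epsilon>..1/\<epsilon>}"
  note S = simple_solutionD[OF sol eps]
  have le: "-1/\<epsilon> \<le> 1/\<epsilon>" using eps by simp
  show in_Z: "w x \<in> {Z1..Z2}" if "x \<in> ?I" for x
  proof (cases "-1/\<epsilon> < x \<and> x < 1/\<epsilon>")
    case True
    then show ?thesis using inner[of x] by auto
  next
    case False
    then have "x = -1/\<epsilon> \<or> x = 1/\<epsilon>" using that by auto
    then show ?thesis using ends Z12 by auto
  qed
  have sub: "w ` ?I \<subseteq> {Z1..Z2}" by (rule image_subsetI) (rule in_Z)
  have cT: "continuous_on ?I (\<lambda>x. time_map (w x))" and cM: "continuous_on ?I (\<lambda>x. mass_map (w x))"
    by (rule continuous_on_compose2[OF time_map_cont(1) S(3) sub], rule continuous_on_compose2[OF time_map_cont(2) S(3) sub])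
  have dT: "((\<lambda>x. time_map (w x)) has_real_derivative 1) (at x)" "((\<lambda>x. mass_map (w x)) has_real_derivative w x) (at x)"
    if "-1/\<epsilon> < x" "x < 1/\<epsilon>" for x
  proof -
    have z: "Z1 < w x" "w x < Z2" using inner[OF that] by auto
    have d: "(w has_real_derivative orbit_slope (w x)) (at x)" using S(2)[OF that] sl[OF that] by simp
    show "((\<lambda>x. time_map (w x)) has_real_derivative 1) (at x)" "((\<lambda>x. mass_map (w x)) has_real_derivative w x) (at x)"
      using DERIV_chain2[OF time_map_deriv(1)[OF z] d] DERIV_chain2[OF time_map_deriv(2)[OF z] d] orbit_slope_pos[OF z] by simp_all
  qed
  show TTw: "time_map (w x) = x + 1/\<epsilon>" if "x \<in> ?I" for x
  proof -
    have "((\<lambda>_. 1) has_integral (time_map (w x) - time_map (w (-1/\<epsilon>)))) {-1/\<epsilon>..x}"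
      by (rule FTC_interior_real)
         (use that dT(1) in \<open>auto intro: continuous_on_subset[OF cT]\<close>)
    moreover have "((\<lambda>_. 1) has_integral (x - (-1/\<epsilon>))) {-1/\<epsilon>..x}"
      using has_integral_const_real[of "1::real" "-1/\<epsilon>" x] that by simp
    ultimately have "time_map (w x) - time_map (w (-1/\<epsilon>)) = x - (-1/\<epsilon>)" by (rule has_integral_unique)
    then show ?thesis unfolding ends time_map_ends by simp
  qed
  have "time_map (w (1/\<epsilon>)) = 1/\<epsilon> + 1/\<epsilon>" by (rule TTw) (use le in simp)
  then show "time_map Z2 = 2 / \<epsilon>" unfolding ends by simp
  have "(w has_integral (mass_map (w (1/\<epsilon>)) - mass_map (w (-1/\<epsilon>)))) ?I"
    by (rule FTC_interior_real[OF le cM dT(2)])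
  from has_integral_unique[OF this S(10)] show "mass_map Z2 = 2 * r / \<epsilon>" unfolding ends time_map_ends(3) by simp
qed

lemma solution_exists:
  assumes T: "time_map Z2 = 2 / \<epsilon>" and M: "mass_map Z2 = 2 * r / \<epsilon>"
  shows "\<exists>w. simple_solution F \<epsilon> r w \<sigma> \<and> corresponding_pair F \<epsilon> w (\<sigma>, c)"
proof -
  let ?I = "{-1/\<epsilon>..1/\<epsilon>}"
  have lt: "-1/\<epsilon> < 1/\<epsilon>" using eps by simp
  \<comment> \<open>The shift by 1/\<epsilon> lets the left end of the interval correspond to time
    0.\<close>
  define w where "w x = the_inv_into {Z1..Z2} time_map (x + 1/\<epsilon>)" for x
  have img: "time_map ` {Z1..Z2} = {0..2/\<epsilon>}"
  proof
    show "time_map ` {Z1..Z2} \<subseteq> {0..2/\<epsilon>}"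
    proof (rule image_subsetI)
      fix z assume z: "z \<in> {Z1..Z2}"
      have "time_map Z1 \<le> time_map z" using time_map_strict_mono[of Z1 z] z by (cases "z = Z1") auto
      moreover have "time_map z \<le> time_map Z2" using time_map_strict_mono[of z Z2] z by (cases "z = Z2") auto
      ultimately show "time_map z \<in> {0..2/\<epsilon>}" using time_map_ends(1) T by auto
    qed
    show "{0..2/\<epsilon>} \<subseteq> time_map ` {Z1..Z2}"
    proof
      fix t assume "t \<in> {0..2/\<epsilon>}"
      then have "\<exists>z. Z1 \<le> z \<and> z \<le> Z2 \<and> time_map z = t"
        by (intro IVT') (use time_map_ends(1) T time_map_cont Z12 in auto)
      then show "t \<in> time_map ` {Z1..Z2}" by auto
    qed
  qed
  have tI: "x + 1/\<epsilon> \<in> time_map ` {Z1..Z2}" if "x \<in> ?I" for x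
    unfolding img using that eps by (auto simp: field_simps)
  have wT: "time_map (w x) = x + 1/\<epsilon>" "w x \<in> {Z1..Z2}" if "x \<in> ?I" for x
    unfolding w_def using f_the_inv_into_f[OF time_map_inj tI[OF that]] the_inv_into_into[OF time_map_inj tI[OF that] order_refl] by auto
  have wTT: "w (time_map z - 1/\<epsilon>) = z" if "z \<in> {Z1..Z2}" for z
    using the_inv_into_f_f[OF time_map_inj that] by (simp add: w_def)
  have ends: "w (-1/\<epsilon>) = Z1" "w (1/\<epsilon>) = Z2"
    using wTT[of Z1] wTT[of Z2] Z12 time_map_ends(1) T by simp_all
  have mono: "w x < w y" if "x \<in> ?I" "y \<in> ?I" "x < y" for x y
  proof (rule ccontr)
    assume "\<not> w x < w y"
    then have "time_map (w y) \<le> time_map (w x)"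
      using time_map_strict_mono[of "w y" "w x"] wT(2)[OF that(1)] wT(2)[OF that(2)] by (cases "w x = w y") auto
    then show False using wT(1)[OF that(1)] wT(1)[OF that(2)] that(3) by simp
  qed
  have inner: "Z1 < w x" "w x < Z2" if "-1/\<epsilon> < x" "x < 1/\<epsilon>" for x
    using mono[of "-1/\<epsilon>" x] mono[of x "1/\<epsilon>"] that lt ends by auto
  have cinv: "continuous_on (time_map ` {Z1..Z2}) (the_inv_into {Z1..Z2} time_map)"
    by (rule continuous_on_inv[OF time_map_cont(1) compact_Icc]) (use the_inv_into_f_f[OF time_map_inj] in auto)
  have cw: "continuous_on ?I w"
    unfolding w_def
    by (rule continuous_on_compose2[OF cinv _ image_subsetI[OF tI]]) (intro continuous_intros)
  have dw: "(w has_real_derivative orbit_slope (w x)) (at x)" if x: "-1/\<epsilon> < x" "x < 1/\<epsilon>" for x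
  proof -
    have z: "Z1 < w x" "w x < Z2" using inner[OF x] by auto
    have "(w has_real_derivative inverse (1 / orbit_slope (w x))) (at x)"
    proof (rule DERIV_inverse_function[where f="\<lambda>z. time_map z - 1/\<epsilon>"])
      show "((\<lambda>z. time_map z - 1/\<epsilon>) has_real_derivative 1 / orbit_slope (w x)) (at (w x))"
        using DERIV_diff[OF time_map_deriv(1)[OF z] DERIV_const] by simp
      show "1 / orbit_slope (w x) \<noteq> 0" using orbit_slope_pos[OF z] by simp
      show "-1/\<epsilon> < x" "x < 1/\<epsilon>" by fact+
      show "time_map (w y) - 1/\<epsilon> = y" if "-1/\<epsilon> < y" "y < 1/\<epsilon>" for y using wT(1)[of y] that by simp
      show "isCont w x" using continuous_on_interior[OF cw] x by (simp add: interior_atLeastAtMost_real)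
    qed
    then show ?thesis by simp
  qed
  have cS: "continuous_on ?I (\<lambda>x. orbit_slope (w x))"
    by (rule continuous_on_compose2[OF orbit_slope_cont cw]) (use wT(2) in blast)
  \<comment> \<open>The time map has an infinite derivative at the turning points, so the inverse
    function rule says nothing at the ends. Writing w as the integral of the continuous function
    \<open>orbit_slope\<close> (w x) yields the one-sided derivatives there.\<close>
  have weq: "w x = Z1 + integral {-1/\<epsilon>..x} (\<lambda>x. orbit_slope (w x))" if x: "x \<in> ?I" for x
  proof -
    have "((\<lambda>x. orbit_slope (w x)) has_integral (w x - w (-1/\<epsilon>))) {-1/\<epsilon>..x}"
    proof (rule FTC_interior_real)
      show "continuous_on {-1/\<epsilon>..x} w" by (rule continuous_on_subset[OF cw]) (use x in auto)
    qed (use x dw in auto)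
    from integral_unique[OF this] show ?thesis unfolding ends by simp
  qed
  have hv: "(w has_vector_derivative orbit_slope (w x)) (at x within ?I)" if x: "x \<in> ?I" for x
  proof (rule has_vector_derivative_transform[OF x])
    show "((\<lambda>x. Z1 + integral {-1/\<epsilon>..x} (\<lambda>x. orbit_slope (w x))) has_vector_derivative orbit_slope (w x)) (at x within ?I)"
      using has_vector_derivative_add[OF has_vector_derivative_const integral_has_vector_derivative[OF cS x]] by simp
  qed (use weq in auto)
  have sl: "slope \<epsilon> w x = orbit_slope (w x)" if "x \<in> ?I" for x
    unfolding slope_def by (rule vector_derivative_within_closed_interval[OF lt that hv[OF that]])
  \<comment> \<open>In the chain rule w' cancels the singular factor 1 / \<open>orbit_slope\<close>
    of \<open>orbit_slope_deriv\<close>; the remaining cube is Q'' at the slope, so the second-order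
    equation can be read off.\<close>
  define A where "A x = (F1 (w x) - \<sigma>) / (1 - \<epsilon>\<^sup>2 * orbit_energy (w x)) ^ 3" for x
  have dsl: "(slope \<epsilon> w has_real_derivative A x) (at x)" if x: "-1/\<epsilon> < x" "x < 1/\<epsilon>" for x
  proof -
    have z: "Z1 < w x" "w x < Z2" using inner[OF x] by auto
    have "((\<lambda>x. orbit_slope (w x)) has_real_derivative A x) (at x)"
      using DERIV_chain2[OF orbit_slope_deriv[OF z] dw[OF x]] orbit_slope_pos[OF z] by (simp add: A_def)
    then show ?thesis
      by (rule has_field_derivative_transform_within_open[of _ _ _ "{-1/\<epsilon><..<1/\<epsilon>}"]) (use x sl in auto)
  qed
  have dA: "deriv (slope \<epsilon> w) x = A x" if "-1/\<epsilon> < x" "x < 1/\<epsilon>" for x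
    by (rule DERIV_imp_deriv[OF dsl[OF that]])
  have wpos: "0 < w x" if "x \<in> ?I" for x using wT(2)[OF that] Z12(1) by auto
  have small: "\<epsilon>\<^sup>2 * orbit_energy (w x) < 1" if "x \<in> ?I" for x by (rule orbit_energy_small[OF wT(2)[OF that]])
  have sub: "{-1/\<epsilon><..<1/\<epsilon>} \<subseteq> ?I" by auto
  have cA: "continuous_on {-1/\<epsilon><..<1/\<epsilon>} A"
  proof -
    have c1: "continuous_on {-1/\<epsilon><..<1/\<epsilon>} w" by (rule continuous_on_subset[OF cw sub])
    have im: "w ` {-1/\<epsilon><..<1/\<epsilon>} \<subseteq> {Z1..Z2}" using wT(2) by auto
    have c2: "continuous_on {-1/\<epsilon><..<1/\<epsilon>} (\<lambda>x. F1 (w x))"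
      by (rule continuous_on_compose2[OF cont_F1[OF Z12(1)] c1 im])
    have c3: "continuous_on {-1/\<epsilon><..<1/\<epsilon>} (\<lambda>x. orbit_energy (w x))"
      unfolding orbit_energy_def by (intro continuous_intros continuous_on_compose2[OF cont_Gibbs[OF Z12(1)] c1 im])
    have n: "\<forall>x\<in>{-1/\<epsilon><..<1/\<epsilon>}. (1 - \<epsilon>\<^sup>2 * orbit_energy (w x)) ^ 3 \<noteq> 0"
    proof
      fix x assume "x \<in> {-1/\<epsilon><..<1/\<epsilon>}"
      then have "0 < 1 - \<epsilon>\<^sup>2 * orbit_energy (w x)" using small[of x] by simp
      then show "(1 - \<epsilon>\<^sup>2 * orbit_energy (w x)) ^ 3 \<noteq> 0" by simp
    qed
    show ?thesis unfolding A_def using n by (intro continuous_on_divide continuous_intros c2 c3) auto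
  qed
  have "simple_solution F \<epsilon> r w \<sigma>"
    unfolding simple_solution_def
  proof (intro conjI)
    show "w differentiable_on ?I"
      unfolding differentiable_on_def using hv differentiableI_vector by blast
    show "continuous_on ?I (slope \<epsilon> w)"
      using cS by (rule continuous_on_eq) (use sl in auto)
    show "slope \<epsilon> w differentiable_on {-1/\<epsilon><..<1/\<epsilon>}"
      unfolding differentiable_on_def
      using dsl real_differentiable_def differentiable_at_withinI by fastforce
    show "continuous_on {-1/\<epsilon><..<1/\<epsilon>} (deriv (slope \<epsilon> w))"
      using cA by (rule continuous_on_eq) (use dA in auto)
    show "\<forall>x\<in>?I. 0 < w x" using wpos by blast
    show "mono_on ?I w" using mono by (intro mono_onI) (metis less_eq_real_def)
    show "\<not> w constant_on ?I"
    proof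
      assume "w constant_on ?I"
      then obtain k where "\<forall>x\<in>?I. w x = k" by (auto simp: constant_on_def)
      then have "w (-1/\<epsilon>) = w (1/\<epsilon>)" using lt by auto
      then show False using ends Z12 by simp
    qed
    show "\<forall>x\<in>{-1/\<epsilon><..<1/\<epsilon>}. (deriv ^^ 2) Q (\<epsilon> * slope \<epsilon> w x) * deriv (slope \<epsilon> w) x = F1 (w x) - \<sigma>"
    proof
      fix x assume "x \<in> {-1/\<epsilon><..<1/\<epsilon>}"
      then have x: "-1/\<epsilon> < x" "x < 1/\<epsilon>" "x \<in> ?I" by auto
      have "0 < 1 - \<epsilon>\<^sup>2 * orbit_energy (w x)" using small[OF x(3)] by simp
      then show "(deriv ^^ 2) Q (\<epsilon> * slope \<epsilon> w x) * deriv (slope \<epsilon> w) x = F1 (w x) - \<sigma>"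
        using deriv2_Q_energy_slope[OF eps orbit_energy_nonneg[OF wT(2)[OF x(3)]] small[OF x(3)]]
        by (simp add: sl[OF x(3)] orbit_slope_def dA[OF x(1,2)] A_def)
    qed
    show "slope \<epsilon> w (-1/\<epsilon>) = 0" "slope \<epsilon> w (1/\<epsilon>) = 0"
      using sl[of "-1/\<epsilon>"] sl[of "1/\<epsilon>"] lt ends orbit_slope_ends by auto
    have sub2: "w ` ?I \<subseteq> {Z1..Z2}" by (rule image_subsetI) (rule wT(2))
    have "(w has_integral (mass_map (w (1/\<epsilon>)) - mass_map (w (-1/\<epsilon>)))) ?I"
    proof (rule FTC_interior_real[OF less_imp_le[OF lt] continuous_on_compose2[OF time_map_cont(2) cw sub2]])
      fix x assume x: "-1/\<epsilon> < x" "x < 1/\<epsilon>"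
      have z: "Z1 < w x" "w x < Z2" using inner[OF x] by auto
      show "((\<lambda>x. mass_map (w x)) has_real_derivative w x) (at x)"
        using DERIV_chain2[OF time_map_deriv(2)[OF z] dw[OF x]] orbit_slope_pos[OF z] by simp
    qed
    then show "(w has_integral (2 * r / \<epsilon>)) ?I" unfolding ends time_map_ends(3) M by simp
  qed
  moreover have "corresponding_pair F \<epsilon> w (\<sigma>, c)"
    unfolding corresponding_pair_def
    using P_energy_slope[OF eps orbit_energy_nonneg[OF wT(2)] small] by (auto simp: sl orbit_slope_def orbit_energy_def)
  ultimately show ?thesis by blast
qed

end

section \<open>Uniqueness and the asymptotic estimates\<close>

context double_well
begin

text \<open>Upper bounds at the bottoms, each on the side facing the other well, with half the
  largest curvature as constant. They provide the hypothesis \<open>quad\<close> of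
  \<open>no_departure\<close>.\<close>

lemma energy_quadratic:
  assumes "\<sigma> \<in> \<sigma>_range F a b"
  obtains \<rho> H where "0 < \<rho>" "0 < H" "\<rho> < a"
    "\<And>x. 0 \<le> x \<Longrightarrow> x \<le> \<rho> \<Longrightarrow> Gibbs F \<sigma> (al \<sigma> + x) - left_min \<sigma> \<le> H * x\<^sup>2"
    "\<And>x. 0 \<le> x \<Longrightarrow> x \<le> \<rho> \<Longrightarrow> Gibbs F \<sigma> (be \<sigma> - x) - right_min \<sigma> \<le> H * x\<^sup>2"
proof -
  note r = \<sigma>_range_subset[OF assms] and cs = crit_strict[OF assms]
  obtain \<rho>1 K1 lo1 hi1 where W1: "well F F1 F2 (al \<sigma>) \<rho>1 K1 lo1 hi1"
    using exists_well[of "al \<sigma>"] al(1)[OF r] cs(1) by metis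
  obtain \<rho>2 K2 lo2 hi2 where W2: "well F F1 F2 (be \<sigma>) \<rho>2 K2 lo2 hi2"
    using exists_well[of "be \<sigma>"] cs(4) a_pos ab by (metis less_trans)
  interpret A: well F F1 F2 "al \<sigma>" \<rho>1 K1 lo1 hi1 by fact
  interpret B: well "\<lambda>x. F (- x)" "\<lambda>x. - F1 (- x)" "\<lambda>x. F2 (- x)" "- be \<sigma>" \<rho>2 K2 lo2 hi2
    by (rule well_reflect[OF W2])
  define \<rho> where "\<rho> = min (a / 2) (min \<rho>1 \<rho>2)"
  define H where "H = max hi1 hi2 / 2"
  have H: "hi1 / 2 \<le> H" "hi2 / 2 \<le> H" by (simp_all add: H_def)
  show thesis
  proof (rule that[of \<rho> H])
    show "0 < \<rho>" "\<rho> < a" using A.rho B.rho a_pos by (auto simp: \<rho>_def min_def)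
    show "0 < H" using A.hi by (simp add: H_def less_max_iff_disj)
    fix x assume x: "0 \<le> x" "x \<le> \<rho>"
    have dA: "A.dom (al \<sigma>) x" and dB: "B.dom (- be \<sigma>) x"
      using x A.rho B.rho by (auto simp: A.dom_def B.dom_def \<rho>_def)
    have "Gibbs F \<sigma> (al \<sigma> + x) - left_min \<sigma> = x\<^sup>2 * A.dd (al \<sigma>) 0 x"
      using A.dd_eq[OF dA, of 0] x al(3)[OF r] by (simp add: Gibbs_def left_min_def algebra_simps)
    also have "\<dots> \<le> x\<^sup>2 * H" using A.dd_bounds(2)[OF dA, of 0] x H by (intro mult_left_mono) auto
    finally show "Gibbs F \<sigma> (al \<sigma> + x) - left_min \<sigma> \<le> H * x\<^sup>2" by (simp add: mult.commute)
    have "Gibbs F \<sigma> (be \<sigma> - x) - right_min \<sigma> = x\<^sup>2 * B.dd (- be \<sigma>) 0 x"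
      using B.dd_eq[OF dB, of 0] x be(2)[OF r] by (simp add: Gibbs_def right_min_def algebra_simps)
    also have "\<dots> \<le> x\<^sup>2 * H" using B.dd_bounds(2)[OF dB, of 0] x H by (intro mult_left_mono) auto
    finally show "Gibbs F \<sigma> (be \<sigma> - x) - right_min \<sigma> \<le> H * x\<^sup>2" by (simp add: mult.commute)
  qed
qed

text \<open>Since \<open>energy_slope \<epsilon> e\<close> grows like \<open>sqrt e\<close>, the quadratic bound on \<open>e\<close> makes \<open>g'\<close> at most
  linear in \<open>g\<close>, and Gronwall's inequality applies.\<close>
lemma no_departure:
  fixes g e :: "real \<Rightarrow> real"
  assumes eps: "0 < \<epsilon>" and pq: "p \<le> q" and g: "continuous_on {p..q} g" "g p = 0"
    and H: "0 < H" "0 < \<rho>"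
    and d: "\<And>x. p < x \<Longrightarrow> x < q \<Longrightarrow> 0 \<le> e x \<and> 0 \<le> g x \<and> (g has_real_derivative energy_slope \<epsilon> (e x)) (at x)"
    and m: "\<And>x y. p \<le> x \<Longrightarrow> x \<le> y \<Longrightarrow> y \<le> q \<Longrightarrow> g x \<le> g y"
    and quad: "\<And>x. p < x \<Longrightarrow> x < q \<Longrightarrow> g x \<le> \<rho> \<Longrightarrow> e x \<le> H * (g x)\<^sup>2"
  shows "g q = 0"
proof (rule ccontr)
  assume "g q \<noteq> 0"
  then have gq: "0 < g q" using m[of p q] pq g(2) by auto
  \<comment> \<open>A positive level that g would have to cross, small enough for
    \<open>quad\<close> and for 2 H \<epsilon>^2 v^2 <= 1. The latter gives \<epsilon>^2 e <= 1/2,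
    as \<open>energy_slope_bound\<close> requires. Gronwall up to the crossing then contradicts v >
    0.\<close>
  define v where "v = min (g q) (min \<rho> (1 / (\<epsilon> * sqrt (2 * H))))"
  have v: "0 < v" "v \<le> g q" "v \<le> \<rho>" "v \<le> 1 / (\<epsilon> * sqrt (2 * H))" using gq H eps by (auto simp: v_def)
  have "\<exists>x. p \<le> x \<and> x \<le> q \<and> g x = v" by (rule IVT') (use g v pq in auto)
  then obtain s where s: "p \<le> s" "s \<le> q" "g s = v" by auto
  have "g s \<le> 0"
  proof (rule gronwall_nonpos[where k="4 * sqrt H", OF s(1)])
    show "continuous_on {p..s} g" by (rule continuous_on_subset[OF g(1)]) (use s in auto)
    show "g p \<le> 0" using g(2) by simp
    fix x assume x: "p < x" "x < s"
    then have xq: "x < q" using s by simp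
    have gx: "g x \<le> v" using m[of x s] x s by auto
    note dx = d[OF x(1) xq]
    have ex: "e x \<le> H * (g x)\<^sup>2" by (rule quad[OF x(1) xq]) (use gx v in linarith)
    have "(\<epsilon> * sqrt (2 * H)) * g x \<le> (\<epsilon> * sqrt (2 * H)) * (1 / (\<epsilon> * sqrt (2 * H)))"
      using gx v eps H by (intro mult_left_mono) auto
    then have "\<epsilon> * sqrt (2 * H) * g x \<le> 1" using eps H by simp
    then have "(\<epsilon> * sqrt (2 * H) * g x)\<^sup>2 \<le> 1" using eps H dx by (intro power_le_one) auto
    then have "\<epsilon>\<^sup>2 * (H * (g x)\<^sup>2) \<le> 1 / 2" using H by (simp add: power_mult_distrib)
    moreover have "\<epsilon>\<^sup>2 * e x \<le> \<epsilon>\<^sup>2 * (H * (g x)\<^sup>2)" using ex by (intro mult_left_mono) auto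
    ultimately have "energy_slope \<epsilon> (e x) \<le> 4 * sqrt (e x)" using dx by (intro energy_slope_bound[OF eps]) auto
    also have "\<dots> \<le> 4 * sqrt (H * (g x)\<^sup>2)" using ex by simp
    also have "\<dots> = 4 * sqrt H * g x" using dx by (simp add: real_sqrt_mult)
    finally show "\<exists>D. (g has_real_derivative D) (at x) \<and> D \<le> 4 * sqrt H * g x" using dx by blast
  qed
  then show False using s v by simp
qed

text \<open>To stay above c and return to it, \<Phi> must rise and fall, so the interval contains
  \<zeta> in its interior; if it extended beyond a minimizer, \<Phi> would be below c at that
  minimizer. Ending exactly at a minimizer is still allowed here.\<close>

lemma Gibbs_level_trap:
  assumes r: "\<sigma> \<in> rng" and AB: "0 < A" "A < B"
    and ge: "\<And>z. A \<le> z \<Longrightarrow> z \<le> B \<Longrightarrow> c \<le> Gibbs F \<sigma> z"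
    and ends: "Gibbs F \<sigma> A = c" "Gibbs F \<sigma> B = c"
  shows "al \<sigma> \<le> A" "A < ze \<sigma>" "ze \<sigma> < B" "B \<le> be \<sigma>"
proof -
  note G = Gibbs_mono[OF r] and cr = al[OF r] ze[OF r] be[OF r]
  show Aze: "A < ze \<sigma>"
  proof (rule ccontr)
    assume n: "\<not> A < ze \<sigma>"
    show False
    proof (cases "A < be \<sigma>")
      case True
      define m where "m = min B (be \<sigma>)"
      have "Gibbs F \<sigma> m < Gibbs F \<sigma> A" by (rule G(3)) (use True n AB in \<open>auto simp: m_def\<close>)
      moreover have "c \<le> Gibbs F \<sigma> m" by (rule ge) (use True AB in \<open>auto simp: m_def\<close>)
      ultimately show False using ends by simp
    next
      case False
      then have "Gibbs F \<sigma> A < Gibbs F \<sigma> B" by (intro G(4)) (use AB in auto)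
      then show False using ends by simp
    qed
  qed
  show zeB: "ze \<sigma> < B"
  proof (rule ccontr)
    assume n: "\<not> ze \<sigma> < B"
    show False
    proof (cases "al \<sigma> < B")
      case True
      define m where "m = max A (al \<sigma>)"
      have "Gibbs F \<sigma> m < Gibbs F \<sigma> B" by (rule G(2)) (use True n AB in \<open>auto simp: m_def\<close>)
      moreover have "c \<le> Gibbs F \<sigma> m" by (rule ge) (use True AB in \<open>auto simp: m_def\<close>)
      ultimately show False using ends by simp
    next
      case False
      then have "Gibbs F \<sigma> B < Gibbs F \<sigma> A" by (intro G(1)) (use AB in auto)
      then show False using ends by simp
    qed
  qed
  show "al \<sigma> \<le> A"
  proof (rule ccontr)
    assume "\<not> al \<sigma> \<le> A"
    then have "Gibbs F \<sigma> (al \<sigma>) < Gibbs F \<sigma> A" by (intro G(1)) (use AB in auto)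
    moreover have "c \<le> Gibbs F \<sigma> (al \<sigma>)" by (rule ge) (use \<open>\<not> al \<sigma> \<le> A\<close> zeB cr in auto)
    ultimately show False using ends by simp
  qed
  show "B \<le> be \<sigma>"
  proof (rule ccontr)
    assume "\<not> B \<le> be \<sigma>"
    then have "Gibbs F \<sigma> (be \<sigma>) < Gibbs F \<sigma> B" by (intro G(4)) auto
    moreover have "c \<le> Gibbs F \<sigma> (be \<sigma>)" by (rule ge) (use \<open>\<not> B \<le> be \<sigma>\<close> Aze cr in auto)
    ultimately show False using ends by simp
  qed
qed

text \<open>Inside an interval of constancy the slope and its derivative both vanish, and so does
  the left-hand side of the equation.\<close>

lemma no_plateau:
  assumes sol: "simple_solution F \<epsilon> r w \<sigma>" and eps: "0 < \<epsilon>"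
    and pq: "-1/\<epsilon> \<le> p" "p < q" "q \<le> 1/\<epsilon>" and const: "\<And>x. p < x \<Longrightarrow> x < q \<Longrightarrow> w x = k"
  shows "F1 k = \<sigma>"
proof -
  note S = simple_solutionD[OF sol eps]
  have slope0: "slope \<epsilon> w x = 0" if "p < x" "x < q" for x
  proof -
    have "(w has_real_derivative slope \<epsilon> w x) (at x)" by (rule S(2)) (use that pq in auto)
    moreover have "(w has_real_derivative 0) (at x)"
      by (rule has_field_derivative_transform_within_open[OF DERIV_const[of k], of "{p<..<q}"]) (use that const in auto)
    ultimately show ?thesis by (rule DERIV_unique)
  qed
  define x where "x = (p + q) / 2"
  have x: "p < x" "x < q" using pq(2) by (auto simp: x_def field_simps)
  have "(slope \<epsilon> w has_real_derivative 0) (at x)"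
    by (rule has_field_derivative_transform_within_open[OF DERIV_const[of 0], of "{p<..<q}"]) (use x slope0 in auto)
  then have "deriv (slope \<epsilon> w) x = 0" by (rule DERIV_imp_deriv)
  moreover have "(deriv ^^ 2) Q (\<epsilon> * slope \<epsilon> w x) * deriv (slope \<epsilon> w) x = F1 (w x) - \<sigma>"
    by (rule S(11)) (use x pq in auto)
  ultimately show ?thesis using const[OF x] by simp
qed

text \<open>Only \<sigma> is assumed to be in range; nothing is assumed about c. The levels that
  must be excluded are those touching a minimum: their orbits need infinite time to leave or reach
  the critical state.\<close>

lemma solution_on_orbit:
  assumes sol: "simple_solution F \<epsilon> r w \<sigma>" and pair: "corresponding_pair F \<epsilon> w (\<sigma>, c)"
    and eps: "0 < \<epsilon>" and sr: "\<sigma> \<in> \<sigma>_range F a b"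
  shows "admissible F a b (\<sigma>, c)" "w (-1/\<epsilon>) = zl \<sigma> c" "w (1/\<epsilon>) = zr \<sigma> c"
    "\<And>x. -1/\<epsilon> < x \<Longrightarrow> x < 1/\<epsilon> \<Longrightarrow> zl \<sigma> c < w x \<and> w x < zr \<sigma> c"
    "\<And>x. x \<in> {-1/\<epsilon>..1/\<epsilon>} \<Longrightarrow> slope \<epsilon> w x = energy_slope \<epsilon> (Gibbs F \<sigma> (w x) - c)"
proof -
  let ?I = "{-1/\<epsilon>..1/\<epsilon>}"
  note S = simple_solutionD[OF sol eps] and r = \<sigma>_range_subset[OF sr]
  have lt: "-1/\<epsilon> < 1/\<epsilon>" using eps by simp
  define A where "A = w (-1/\<epsilon>)"
  define B where "B = w (1/\<epsilon>)"
  have Pw: "P \<epsilon> (slope \<epsilon> w x) = Gibbs F \<sigma> (w x) - c" if "x \<in> ?I" for x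
    using pair that by (auto simp: corresponding_pair_def)
  note inv = P_inverse[OF eps S(7) Pw]
  show sl: "slope \<epsilon> w x = energy_slope \<epsilon> (Gibbs F \<sigma> (w x) - c)" if "x \<in> ?I" for x by (rule inv(3)[OF that that])
  have mono: "w x \<le> w y" if "x \<in> ?I" "y \<in> ?I" "x \<le> y" for x y using S(4) that by (auto simp: mono_on_def)
  have Apos: "0 < A" unfolding A_def by (rule S(5)) (use lt in auto)
  have bd: "A \<le> w x" "w x \<le> B" if "x \<in> ?I" for x
    unfolding A_def B_def by (rule mono; use that lt in auto)+
  have AB: "A < B"
  proof (rule ccontr)
    assume "\<not> A < B"
    then have "w x = A" if "x \<in> ?I" for x using bd[OF that] by linarith
    then show False using S(6) by (auto simp: constant_on_def)
  qed
  have ivt: "\<exists>x\<in>?I. w x = z" if "A \<le> z" "z \<le> B" for z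
  proof -
    have "\<exists>x. -1/\<epsilon> \<le> x \<and> x \<le> 1/\<epsilon> \<and> w x = z"
      by (rule IVT') (use that lt S(3) in \<open>auto simp: A_def B_def\<close>)
    then show ?thesis by auto
  qed
  have ge: "c \<le> Gibbs F \<sigma> z" if "A \<le> z" "z \<le> B" for z
  proof -
    obtain x where "x \<in> ?I" "w x = z" using ivt[OF \<open>A \<le> z\<close> \<open>z \<le> B\<close>] by blast
    then show ?thesis using inv(1)[of x] by auto
  qed
  have m1: "-1/\<epsilon> \<in> ?I" and m2: "1/\<epsilon> \<in> ?I" using lt by auto
  have "P \<epsilon> 0 = 0" using eps by (simp add: P_eq)
  then have ends: "Gibbs F \<sigma> A = c" "Gibbs F \<sigma> B = c"
    using Pw[OF m1] Pw[OF m2] unfolding S(8) S(9) A_def B_def by simp_all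
  note trap = Gibbs_level_trap[OF r Apos AB ge ends]
  obtain \<rho> H where H: "0 < \<rho>" "0 < H"
    "\<And>x. 0 \<le> x \<Longrightarrow> x \<le> \<rho> \<Longrightarrow> Gibbs F \<sigma> (al \<sigma> + x) - left_min \<sigma> \<le> H * x\<^sup>2"
    "\<And>x. 0 \<le> x \<Longrightarrow> x \<le> \<rho> \<Longrightarrow> Gibbs F \<sigma> (be \<sigma> - x) - right_min \<sigma> \<le> H * x\<^sup>2"
    using energy_quadratic[OF sr] by metis
  have Aal: "A \<noteq> al \<sigma>"
  proof
    assume Ae: "A = al \<sigma>"
    then have cA: "c = left_min \<sigma>" using ends(1) by (simp add: left_min_def)
    define g where "g x = w x - A" for x
    have "g (1/\<epsilon>) = 0"
    proof (rule no_departure[OF eps less_imp_le[OF lt] _ _ H(2,1), where e="\<lambda>x. Gibbs F \<sigma> (w x) - c"])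
      show "continuous_on ?I g" unfolding g_def by (intro continuous_intros S(3))
      show "g (-1/\<epsilon>) = 0" by (simp only: g_def A_def diff_self)
      fix x assume x: "-1/\<epsilon> < x" "x < 1/\<epsilon>"
      then have xI: "x \<in> ?I" by simp
      show "0 \<le> Gibbs F \<sigma> (w x) - c \<and> 0 \<le> g x \<and> (g has_real_derivative energy_slope \<epsilon> (Gibbs F \<sigma> (w x) - c)) (at x)"
        using inv(1)[OF xI xI] bd(1)[OF xI] DERIV_diff[OF S(2)[OF x] DERIV_const, of A] sl[OF xI]
        by (simp add: g_def[abs_def])
      show "Gibbs F \<sigma> (w x) - c \<le> H * (g x)\<^sup>2" if "g x \<le> \<rho>"
        using H(3)[of "g x"] that bd(1)[OF xI] by (simp add: g_def Ae cA)
    next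
      fix x y assume "-1/\<epsilon> \<le> x" "x \<le> y" "y \<le> 1/\<epsilon>"
      then show "g x \<le> g y" using mono[of x y] by (simp add: g_def)
    qed
    then show False using AB by (simp add: g_def B_def)
  qed
  have Bbe: "B \<noteq> be \<sigma>"
  proof
    assume Be: "B = be \<sigma>"
    then have cB: "c = right_min \<sigma>" using ends(2) by (simp add: right_min_def)
    \<comment> \<open>Reversing the direction of x turns arrival at \<beta> at the right end into
      departure from it, the situation of \<open>no_departure\<close>.\<close>
    define g where "g x = B - w (- x)" for x
    have nI: "- x \<in> ?I" if "x \<in> ?I" for x using that by auto
    have "g (1/\<epsilon>) = 0"
    proof (rule no_departure[OF eps less_imp_le[OF lt] _ _ H(2,1), where e="\<lambda>x. Gibbs F \<sigma> (w (- x)) - c"])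
      have "continuous_on ?I (\<lambda>x. w (- x))"
        by (rule continuous_on_compose2[OF S(3) _ image_subsetI[OF nI]]) (intro continuous_intros)
      then show "continuous_on ?I g" unfolding g_def by (intro continuous_intros)
      show "g (-1/\<epsilon>) = 0" by (simp add: g_def B_def)
      fix x assume x: "-1/\<epsilon> < x" "x < 1/\<epsilon>"
      then have xI: "- x \<in> ?I" and x': "-1/\<epsilon> < - x" "- x < 1/\<epsilon>" by auto
      have "(g has_real_derivative 0 - slope \<epsilon> w (- x) * (- 1)) (at x)"
        unfolding g_def[abs_def]
        by (rule DERIV_diff[OF DERIV_const DERIV_chain2[OF S(2)[OF x'] DERIV_minus[OF DERIV_ident]]])
      then show "0 \<le> Gibbs F \<sigma> (w (- x)) - c \<and> 0 \<le> g x \<and> (g has_real_derivative energy_slope \<epsilon> (Gibbs F \<sigma> (w (- x)) - c)) (at x)"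
        using inv(1)[OF xI xI] bd(2)[OF xI] sl[OF xI] by (simp add: g_def)
      show "Gibbs F \<sigma> (w (- x)) - c \<le> H * (g x)\<^sup>2" if "g x \<le> \<rho>"
        using H(4)[of "g x"] that bd(2)[OF xI] by (simp add: g_def Be cB)
    next
      fix x y assume "-1/\<epsilon> \<le> x" "x \<le> y" "y \<le> 1/\<epsilon>"
      then have "- y \<in> ?I" "- x \<in> ?I" "- y \<le> - x" by auto
      then show "g x \<le> g y" using mono[of "- y" "- x"] by (simp add: g_def)
    qed
    then have "B = w (-(1/\<epsilon>))" by (simp add: g_def)
    then show False using AB by (simp add: A_def)
  qed
  have in1: "al \<sigma> < A" "B < be \<sigma>" using trap Aal Bbe by auto
  show adm: "admissible F a b (\<sigma>, c)"
    using Gibbs_mono(2)[OF r, of "al \<sigma>" A] Gibbs_mono(2)[OF r, of A "ze \<sigma>"] Gibbs_mono(3)[OF r, of B "be \<sigma>"]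
      trap in1 ends sr by (auto simp: admissible_def)
  show Az: "w (-1/\<epsilon>) = zl \<sigma> c" using z1(4)[OF adm in1(1) trap(2) ends(1)] by (simp add: A_def)
  show Bz: "w (1/\<epsilon>) = zr \<sigma> c" using z2(4)[OF adm trap(3) in1(2) ends(2)] by (simp add: B_def)
  fix x assume x: "-1/\<epsilon> < x" "x < 1/\<epsilon>"
  then have xI: "x \<in> ?I" by simp
  have "w x \<noteq> A"
  proof
    assume e: "w x = A"
    have "F1 A = \<sigma>"
    proof (rule no_plateau[OF sol eps order_refl x(1)])
      show "x \<le> 1/\<epsilon>" using x by simp
      fix y assume y: "-1/\<epsilon> < y" "y < x"
      then have "y \<in> ?I" using x by simp
      then show "w y = A" using bd(1)[of y] mono[of y x] xI y e by auto
    qed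
    then show False using F1_sign(2)[OF r in1(1) trap(2)] by simp
  qed
  moreover have "w x \<noteq> B"
  proof
    assume e: "w x = B"
    have "F1 B = \<sigma>"
    proof (rule no_plateau[OF sol eps _ x(2) order_refl])
      show "-1/\<epsilon> \<le> x" using x by simp
      fix y assume y: "x < y" "y < 1/\<epsilon>"
      then have "y \<in> ?I" using x by simp
      then show "w y = B" using bd(2)[of y] mono[of x y] xI y e by auto
    qed
    then show False using F1_sign(3)[OF r trap(3) in1(2)] by simp
  qed
  ultimately show "zl \<sigma> c < w x \<and> w x < zr \<sigma> c"
    using bd[OF xI] Az Bz by (simp add: A_def B_def)
qed

end

section \<open>Existence, uniqueness and exponential closeness of the pair\<close>

context double_well
begin

text \<open>Length and mass are the image of the two weighted times under the matrix with rows (1,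
  1) and (a0, b0), which is invertible because a0 < b0.\<close>

lemma weighted_times_iff:
  assumes "0 < \<epsilon>"
  shows "JA = 2 * (b0 - r) / ((b0 - a0) * \<epsilon>) \<and> JB = 2 * (r - a0) / ((b0 - a0) * \<epsilon>)
    \<longleftrightarrow> JA + JB = 2 / \<epsilon> \<and> a0 * JA + b0 * JB = 2 * r / \<epsilon>"
proof -
  define L where "L = b0 - a0"
  have L: "0 < L" "b0 = L + a0" using a0b0(6) by (auto simp: L_def)
  have "JA = (2 * (b0 - r) / \<epsilon>) / L \<and> JB = (2 * (r - a0) / \<epsilon>) / L \<longleftrightarrow> L * JA = 2 * (b0 - r) / \<epsilon> \<and> L * JB = 2 * (r - a0) / \<epsilon>"
  proof -
    have "X = Y / L \<longleftrightarrow> L * X = Y" for X Y using L(1) by (auto simp: field_simps)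
    then show ?thesis by (simp only:)
  qed
  also have "\<dots> \<longleftrightarrow> JA + JB = 2 / \<epsilon> \<and> a0 * JA + b0 * JB = 2 * r / \<epsilon>"
  proof
    assume h: "L * JA = 2 * (b0 - r) / \<epsilon> \<and> L * JB = 2 * (r - a0) / \<epsilon>"
    have "L * (JA + JB) = L * (2 / \<epsilon>)" using h assms unfolding L_def by (simp add: field_simps)
    moreover have "L * (a0 * JA + b0 * JB) = a0 * (L * JA) + b0 * (L * JB)" by (simp add: algebra_simps)
    then have "L * (a0 * JA + b0 * JB) = a0 * (2 * (b0 - r) / \<epsilon>) + b0 * (2 * (r - a0) / \<epsilon>)"
      using h by simp
    then have "L * (a0 * JA + b0 * JB) = L * (2 * r / \<epsilon>)" using assms by (simp add: L_def field_simps)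
    moreover have "X = Y" if "L * X = L * Y" for X Y using that L(1) by simp
    ultimately show "JA + JB = 2 / \<epsilon> \<and> a0 * JA + b0 * JB = 2 * r / \<epsilon>" by blast
  next
    assume h: "JA + JB = 2 / \<epsilon> \<and> a0 * JA + b0 * JB = 2 * r / \<epsilon>"
    have "L * JA = b0 * (JA + JB) - (a0 * JA + b0 * JB)" "L * JB = (a0 * JA + b0 * JB) - a0 * (JA + JB)"
      by (simp_all add: L_def algebra_simps)
    then show "L * JA = 2 * (b0 - r) / \<epsilon> \<and> L * JB = 2 * (r - a0) / \<epsilon>"
      using h assms by (simp add: field_simps)
  qed
  finally show ?thesis unfolding L_def by (simp only: divide_divide_eq_left mult.commute[of \<epsilon>])
qed

lemma small_solutions:
  assumes delta: "0 < \<delta>"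
  shows "\<exists>\<epsilon>\<^sub>\<delta> > 0. \<exists>N. open N \<and> Maxwell_point F a b \<in> N \<and>
    (\<exists>\<Delta> :: real \<Rightarrow> real \<Rightarrow> real \<times> real.
      (\<forall>\<epsilon>\<in>{0<..<\<epsilon>\<^sub>\<delta>}. \<forall>r\<in>{a0 + \<delta>..b0 - \<delta>}.
         \<Delta> \<epsilon> r \<in> N \<and> admissible F a b (\<Delta> \<epsilon> r) \<and>
         (\<exists>z. simple_solution F \<epsilon> r z (fst (\<Delta> \<epsilon> r)) \<and> corresponding_pair F \<epsilon> z (\<Delta> \<epsilon> r) \<and>
            (\<forall>w \<Delta>'. simple_solution F \<epsilon> r w (fst \<Delta>') \<and> corresponding_pair F \<epsilon> w \<Delta>' \<and> \<Delta>' \<in> N \<longrightarrow>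
               \<Delta>' = \<Delta> \<epsilon> r \<and> (\<forall>x\<in>{-1/\<epsilon>..1/\<epsilon>}. w x = z x)))) \<and>
      (\<exists>C>0. \<exists>K. \<forall>\<^sub>F \<epsilon> in at_right 0. \<forall>r\<in>{a0 + \<delta>..b0 - \<delta>}.
         dist (\<Delta> \<epsilon> r) (Maxwell_point F a b) \<le> K * exp (- C / \<epsilon>) \<and>
         \<bar>z\<^sub>1 F a b (\<Delta> \<epsilon> r) - a0\<bar> \<le> K * exp (- C / \<epsilon>) \<and>
         \<bar>z\<^sub>2 F a b (\<Delta> \<epsilon> r) - b0\<bar> \<le> K * exp (- C / \<epsilon>)))"
proof -
  \<comment> \<open>Within \<open>dm\<close> every \<sigma> is in range, so
    \<open>solution_on_orbit\<close> applies to all pairs of the neighborhood, including those not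
    yet known to be admissible.\<close>
  obtain dm where dm: "0 < dm" "\<And>\<sigma>. \<bar>\<sigma> - s0\<bar> < dm \<Longrightarrow> \<sigma> \<in> \<sigma>_range F a b"
    using near_admissible by metis
  obtain d \<epsilon>0 C k where d: "0 < d" "d \<le> dm" and e0: "0 < \<epsilon>0" and C: "0 \<le> C" and k: "0 < k" and
    gen: "\<And>\<epsilon> \<sigma> c. 0 < \<epsilon> \<Longrightarrow> \<epsilon> < \<epsilon>0 \<Longrightarrow> near d \<sigma> c \<Longrightarrow>
      (\<lambda>z. wA z * slowness \<epsilon> \<sigma> c z) integrable_on {zl \<sigma> c..zr \<sigma> c} \<and>
      (\<lambda>z. wB z * slowness \<epsilon> \<sigma> c z) integrable_on {zl \<sigma> c..zr \<sigma> c} \<and>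
      (\<forall>z\<in>{zl \<sigma> c..zr \<sigma> c}. \<epsilon>\<^sup>2 * (Gibbs F \<sigma> z - c) \<le> 1 / 2) \<and>
      \<bar>zl \<sigma> c - a0\<bar> \<le> C * (\<bar>\<sigma> - s0\<bar> + sqrt (c - left_min \<sigma>)) \<and>
      \<bar>zr \<sigma> c - b0\<bar> \<le> C * (\<bar>\<sigma> - s0\<bar> + sqrt (c - right_min \<sigma>))" and
    ex: "\<And>\<epsilon> r. 0 < \<epsilon> \<Longrightarrow> \<epsilon> < \<epsilon>0 \<Longrightarrow> r \<in> {a0 + \<delta>..b0 - \<delta>} \<Longrightarrow>
      \<exists>\<sigma> c. near d \<sigma> c \<and>
        weighted_integral wA \<epsilon> \<sigma> c = 2 * (b0 - r) / ((b0 - a0) * \<epsilon>) \<and> weighted_integral wB \<epsilon> \<sigma> c = 2 * (r - a0) / ((b0 - a0) * \<epsilon>) \<and>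
        c - left_min \<sigma> \<le> exp (- (k / \<epsilon>)) \<and> c - right_min \<sigma> \<le> exp (- (k / \<epsilon>)) \<and>
        (\<forall>\<sigma>' c'. near d \<sigma>' c' \<and> weighted_integral wA \<epsilon> \<sigma>' c' = 2 * (b0 - r) / ((b0 - a0) * \<epsilon>) \<and>
           weighted_integral wB \<epsilon> \<sigma>' c' = 2 * (r - a0) / ((b0 - a0) * \<epsilon>) \<longrightarrow> \<sigma>' = \<sigma> \<and> c' = c)"
    by (rule unique_pair[OF delta dm(1)], rule that, assumption+)
  define good where "good \<epsilon> r D \<longleftrightarrow> near d (fst D) (snd D) \<and>
        weighted_integral wA \<epsilon> (fst D) (snd D) = 2 * (b0 - r) / ((b0 - a0) * \<epsilon>) \<and> weighted_integral wB \<epsilon> (fst D) (snd D) = 2 * (r - a0) / ((b0 - a0) * \<epsilon>) \<and>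
        snd D - left_min (fst D) \<le> exp (- (k / \<epsilon>)) \<and> snd D - right_min (fst D) \<le> exp (- (k / \<epsilon>)) \<and>
        (\<forall>\<sigma>' c'. near d \<sigma>' c' \<and> weighted_integral wA \<epsilon> \<sigma>' c' = 2 * (b0 - r) / ((b0 - a0) * \<epsilon>) \<and>
           weighted_integral wB \<epsilon> \<sigma>' c' = 2 * (r - a0) / ((b0 - a0) * \<epsilon>) \<longrightarrow> \<sigma>' = fst D \<and> c' = snd D)" for \<epsilon> r :: real and D
  \<comment> \<open>For the \<epsilon> and r in question \<open>good\<close> determines the pair;
    the choice merely makes it a function of \<epsilon> and r.\<close>
  define \<Delta> where "\<Delta> \<epsilon> r = (SOME D. good \<epsilon> r D)" for \<epsilon> r
  have good: "good \<epsilon> r (\<Delta> \<epsilon> r)" if er: "0 < \<epsilon>" "\<epsilon> < \<epsilon>0" "r \<in> {a0 + \<delta>..b0 - \<delta>}" for \<epsilon> r :: real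
  proof -
    obtain \<sigma> c where "good \<epsilon> r (\<sigma>, c)" using ex[OF er] unfolding good_def fst_conv snd_conv by blast
    then show ?thesis unfolding \<Delta>_def by (rule someI)
  qed
  have orb: "orbit F a b \<epsilon> \<sigma> c" if "0 < \<epsilon>" "\<epsilon> < \<epsilon>0" "near d \<sigma> c" for \<epsilon> \<sigma> c :: real
  proof
    show "0 < \<epsilon>" by fact
    show "admissible F a b (\<sigma>, c)" using that(3) by (simp add: near_def)
  qed (use gen[OF that] in blast)+
  \<comment> \<open>An open square, so it also contains pairs that are not admissible; the pair of a
    simple solution lying in it is nevertheless \<open>near\<close>, by
    \<open>solution_on_orbit\<close>.\<close>
  define N where "N = {s0 - d<..<s0 + d} \<times> {c0 - d<..<c0 + d}"
  have N: "open N" "Maxwell_point F a b \<in> N"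
    using d by (auto simp: N_def Maxwell_point_eq intro: open_Times)
  have inN: "(\<sigma>, c) \<in> N \<longleftrightarrow> \<bar>\<sigma> - s0\<bar> < d \<and> \<bar>c - c0\<bar> < d" for \<sigma> c
    by (auto simp: N_def abs_less_iff)
  have part1: "\<Delta> \<epsilon> r \<in> N \<and> admissible F a b (\<Delta> \<epsilon> r) \<and>
         (\<exists>z. simple_solution F \<epsilon> r z (fst (\<Delta> \<epsilon> r)) \<and> corresponding_pair F \<epsilon> z (\<Delta> \<epsilon> r) \<and>
            (\<forall>w \<Delta>'. simple_solution F \<epsilon> r w (fst \<Delta>') \<and> corresponding_pair F \<epsilon> w \<Delta>' \<and> \<Delta>' \<in> N \<longrightarrow>
               \<Delta>' = \<Delta> \<epsilon> r \<and> (\<forall>x\<in>{-1/\<epsilon>..1/\<epsilon>}. w x = z x)))"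
    if er: "0 < \<epsilon>" "\<epsilon> < \<epsilon>0" "r \<in> {a0 + \<delta>..b0 - \<delta>}" for \<epsilon> r
  proof -
    obtain \<sigma> c where D: "\<Delta> \<epsilon> r = (\<sigma>, c)" by fastforce
    note g = good[OF er, unfolded D good_def fst_conv snd_conv]
    have n: "near d \<sigma> c" using g by blast
    interpret O: orbit F a b \<epsilon> \<sigma> c by (rule orb[OF er(1,2) n])
    have J: "weighted_integral wA \<epsilon> \<sigma> c + weighted_integral wB \<epsilon> \<sigma> c = 2 / \<epsilon>" "a0 * weighted_integral wA \<epsilon> \<sigma> c + b0 * weighted_integral wB \<epsilon> \<sigma> c = 2 * r / \<epsilon>"
      using g weighted_times_iff[OF er(1)] by blast+
    obtain z where z: "simple_solution F \<epsilon> r z \<sigma>" "corresponding_pair F \<epsilon> z (\<sigma>, c)"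
      using O.solution_exists[of r] J O.time_map_ends(2,4) by auto
    have time: "O.time_map (w x) = x + 1/\<epsilon>" "w x \<in> {O.Z1..O.Z2}"
      if w: "simple_solution F \<epsilon> r w \<sigma>" "corresponding_pair F \<epsilon> w (\<sigma>, c)" and x: "x \<in> {-1/\<epsilon>..1/\<epsilon>}" for w x
    proof -
      note o = solution_on_orbit[OF w er(1) near_energy(1)[OF n]]
      have sl: "slope \<epsilon> w y = O.orbit_slope (w y)" if "-1/\<epsilon> < y" "y < 1/\<epsilon>" for y
        using o(5)[of y] that by (simp add: O.orbit_slope_def O.orbit_energy_def)
      show "O.time_map (w x) = x + 1/\<epsilon>" "w x \<in> {O.Z1..O.Z2}"
        using O.time_along_solution(1,4)[OF w(1) sl o(2,3,4) x] by blast+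
    qed
    have uniq: "\<Delta>' = (\<sigma>, c) \<and> (\<forall>x\<in>{-1/\<epsilon>..1/\<epsilon>}. w x = z x)"
      if w: "simple_solution F \<epsilon> r w (fst \<Delta>')" "corresponding_pair F \<epsilon> w \<Delta>'" "\<Delta>' \<in> N" for w \<Delta>'
    proof -
      obtain \<sigma>' c' where D': "\<Delta>' = (\<sigma>', c')" by fastforce
      have sc: "\<bar>\<sigma>' - s0\<bar> < d" "\<bar>c' - c0\<bar> < d" using w(3) inN by (auto simp: D')
      have sr: "\<sigma>' \<in> \<sigma>_range F a b" by (rule dm(2)) (use sc d in linarith)
      have w': "simple_solution F \<epsilon> r w \<sigma>'" "corresponding_pair F \<epsilon> w (\<sigma>', c')" using w(1,2) by (auto simp: D')
      note o = solution_on_orbit[OF w' er(1) sr]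
      have n': "near d \<sigma>' c'" using o(1) sc by (simp add: near_def)
      interpret O': orbit F a b \<epsilon> \<sigma>' c' by (rule orb[OF er(1,2) n'])
      have sl: "slope \<epsilon> w y = O'.orbit_slope (w y)" if "-1/\<epsilon> < y" "y < 1/\<epsilon>" for y
        using o(5)[of y] that by (simp add: O'.orbit_slope_def O'.orbit_energy_def)
      have "weighted_integral wA \<epsilon> \<sigma>' c' + weighted_integral wB \<epsilon> \<sigma>' c' = 2 / \<epsilon>" "a0 * weighted_integral wA \<epsilon> \<sigma>' c' + b0 * weighted_integral wB \<epsilon> \<sigma>' c' = 2 * r / \<epsilon>"
        using O'.time_along_solution(2,3)[OF w'(1) sl o(2,3,4)] O'.time_map_ends(2,4) by auto
      then have "weighted_integral wA \<epsilon> \<sigma>' c' = 2 * (b0 - r) / ((b0 - a0) * \<epsilon>) \<and> weighted_integral wB \<epsilon> \<sigma>' c' = 2 * (r - a0) / ((b0 - a0) * \<epsilon>)"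
        using weighted_times_iff[OF er(1)] by blast
      then have eq: "\<sigma>' = \<sigma>" "c' = c" using g n' by blast+
      have "w x = z x" if x: "x \<in> {-1/\<epsilon>..1/\<epsilon>}" for x
        by (rule inj_onD[OF O.time_map_inj _ time(2)[OF w'[unfolded eq] x] time(2)[OF z x]])
           (simp only: time(1)[OF w'[unfolded eq] x] time(1)[OF z x])
      then show ?thesis using eq D' by blast
    qed
    have "(\<sigma>, c) \<in> N" "admissible F a b (\<sigma>, c)" using n inN by (auto simp: near_def)
    then show ?thesis unfolding D fst_conv using z uniq by blast
  qed
  define Cp where "Cp = 1 + (1 + a) / (b - a)"
  have Cp: "1 \<le> Cp" using a_pos ab by (simp add: Cp_def)
  \<comment> \<open>The first summand bounds the distance of the pair, the second that of the
    turning points. The rate becomes k/2 because the turning points involve roots of energies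
    bounded by exp (-k/\<epsilon>).\<close>
  define K where "K = 2 * Cp + C * (2 * Cp + 1)"
  have part2: "dist (\<Delta> \<epsilon> r) (Maxwell_point F a b) \<le> K * exp (- (k / 2) / \<epsilon>) \<and>
         \<bar>z\<^sub>1 F a b (\<Delta> \<epsilon> r) - a0\<bar> \<le> K * exp (- (k / 2) / \<epsilon>) \<and>
         \<bar>z\<^sub>2 F a b (\<Delta> \<epsilon> r) - b0\<bar> \<le> K * exp (- (k / 2) / \<epsilon>)"
    if er: "0 < \<epsilon>" "\<epsilon> < \<epsilon>0" "r \<in> {a0 + \<delta>..b0 - \<delta>}" for \<epsilon> r
  proof -
    obtain \<sigma> c where D: "\<Delta> \<epsilon> r = (\<sigma>, c)" by fastforce
    note g = good[OF er, unfolded D good_def fst_conv snd_conv]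
    have n: "near d \<sigma> c" and u: "c - left_min \<sigma> \<le> exp (- (k / \<epsilon>))" "c - right_min \<sigma> \<le> exp (- (k / \<epsilon>))" using g by blast+
    note ne = near_energy[OF n]
    define e where "e = exp (- (k / 2) / \<epsilon>)"
    have e2: "exp (- (k / \<epsilon>)) = e * e" by (simp add: e_def exp_add[symmetric])
    have e: "0 < e" "e \<le> 1" using er k by (auto simp: e_def)
    have ee: "e * e \<le> e" using e mult_left_le[of e e] by simp
    have sq: "sqrt (c - left_min \<sigma>) \<le> e" "sqrt (c - right_min \<sigma>) \<le> e"
      using u e unfolding e2 by (auto intro!: real_le_lsqrt simp: power2_eq_square less_imp_le ne(3,4))
    have "\<bar>\<sigma> - s0\<bar> + \<bar>c - c0\<bar> \<le> Cp * (\<bar>(c - left_min \<sigma>) - (c0 - left_min s0)\<bar> + \<bar>(c - right_min \<sigma>) - (c0 - right_min s0)\<bar>)"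
      unfolding Cp_def by (rule param_lipschitz[OF ne(2) s0_rng])
    also have "\<dots> = Cp * ((c - left_min \<sigma>) + (c - right_min \<sigma>))" using c0 ne(3,4) by simp
    also have "\<dots> \<le> Cp * (e + e)" using u ee Cp unfolding e2 by (intro mult_left_mono add_mono) auto
    finally have s: "\<bar>\<sigma> - s0\<bar> + \<bar>c - c0\<bar> \<le> 2 * Cp * e" by simp
    have Ke: "2 * Cp * e \<le> K * e" "C * (2 * Cp + 1) * e \<le> K * e"
      using e C Cp by (auto simp: K_def intro!: mult_right_mono)
    have "dist (\<sigma>, c) (s0, c0) \<le> \<bar>\<sigma> - s0\<bar> + \<bar>c - c0\<bar>"
      by (simp add: dist_Pair_Pair dist_real_def sqrt_sum_squares_le_sum_abs)
    then have 1: "dist (\<sigma>, c) (s0, c0) \<le> K * e" using s Ke by linarith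
    have zb: "C * (\<bar>\<sigma> - s0\<bar> + x) \<le> K * e" if "x \<le> e" for x
    proof -
      have "\<bar>\<sigma> - s0\<bar> + x \<le> (2 * Cp + 1) * e" using s that by (simp add: distrib_right)
      then have "C * (\<bar>\<sigma> - s0\<bar> + x) \<le> C * ((2 * Cp + 1) * e)" using C by (intro mult_left_mono) auto
      then show ?thesis using Ke by (simp add: mult.assoc)
    qed
    have "\<bar>zl \<sigma> c - a0\<bar> \<le> K * e" "\<bar>zr \<sigma> c - b0\<bar> \<le> K * e"
      using gen[OF er(1,2) n] zb[OF sq(1)] zb[OF sq(2)] by (blast intro: order_trans)+
    then show ?thesis using 1 unfolding D Maxwell_point_eq e_def by blast
  qed
  have "\<forall>\<^sub>F \<epsilon> in at_right 0. \<forall>r\<in>{a0 + \<delta>..b0 - \<delta>}.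
         dist (\<Delta> \<epsilon> r) (Maxwell_point F a b) \<le> K * exp (- (k / 2) / \<epsilon>) \<and>
         \<bar>z\<^sub>1 F a b (\<Delta> \<epsilon> r) - a0\<bar> \<le> K * exp (- (k / 2) / \<epsilon>) \<and>
         \<bar>z\<^sub>2 F a b (\<Delta> \<epsilon> r) - b0\<bar> \<le> K * exp (- (k / 2) / \<epsilon>)"
    unfolding eventually_at_right_field using e0 part2 by blast
  note ev = this
  have k2: "0 < k / 2" using k by simp
  show ?thesis
  proof (rule exI[of _ \<epsilon>0], rule conjI[OF e0], rule exI[of _ N], rule conjI[OF N(1)], rule conjI[OF N(2)],
      rule exI[of _ \<Delta>], rule conjI, goal_cases)
    case 1
    show ?case by (intro ballI, rule part1) simp_all
  next
    case 2
    show ?case by (rule exI[of _ "k / 2"], rule conjI[OF k2], rule exI[of _ K], rule ev)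
  qed
qed

end

text \<open>The strict inequalities for the limits persist for z close to 0 and for large z, and any
  such z is a witness for \<open>low\<close> or \<open>high\<close>.\<close>

lemma double_wellI:
  fixes F'0 F'inf :: ereal
  assumes "0 < a" and "a < b"
    and F: "Ck_on 5 F {0<..}"
    and "\<forall>z\<in>{0<..<a} \<union> {b<..}. (deriv ^^ 2) F z > 0"
    and "\<forall>z\<in>{a<..<b}. (deriv ^^ 2) F z < 0"
    and l0: "((\<lambda>z. ereal (deriv F z)) \<longlongrightarrow> F'0) (at_right 0)" "F'0 < ereal (deriv F b)"
    and li: "((\<lambda>z. ereal (deriv F z)) \<longlongrightarrow> F'inf) at_top" "F'inf > ereal (deriv F a)"
  shows "double_well F a b"
proof
  have D: "((deriv ^^ j) F has_real_derivative (deriv ^^ Suc j) F z) (at z)" if "0 < z" "j < 5" for j z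
  proof -
    have "(deriv ^^ j) F differentiable at z"
      using F that by (auto simp: Ck_on_def differentiable_on_eq_differentiable_at)
    then show ?thesis by (simp add: DERIV_deriv_iff_real_differentiable)
  qed
  show "(F has_real_derivative deriv F z) (at z)" if "0 < z" for z using D[OF that, of 0] by simp
  show "(deriv F has_real_derivative (deriv ^^ 2) F z) (at z)" if "0 < z" for z
    using D[OF that, of 1] by (simp add: numeral_2_eq_2)
  show "((deriv ^^ 2) F has_real_derivative (deriv ^^ 3) F z) (at z)" if "0 < z" for z
    using D[OF that, of 2] by (simp add: eval_nat_numeral)
  show "continuous_on {0<..} ((deriv ^^ 3) F)"
    using F by (intro differentiable_imp_continuous_on) (auto simp: Ck_on_def)
  have "\<forall>\<^sub>F z in at_right 0. ereal (deriv F z) < ereal (deriv F b)" by (rule order_tendstoD(2)[OF l0])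
  moreover have "\<forall>\<^sub>F z in at_right 0. z \<in> {0<..<a}" by (rule eventually_at_right_real[OF assms(1)])
  ultimately have "\<forall>\<^sub>F z in at_right 0. 0 < z \<and> z < a \<and> deriv F z < deriv F b" by eventually_elim auto
  then show "\<exists>z. 0 < z \<and> z < a \<and> deriv F z < deriv F b"
    by (rule eventually_happens'[rotated]) simp
  have "\<forall>\<^sub>F z in at_top. ereal (deriv F a) < ereal (deriv F z)" by (rule order_tendstoD(1)[OF li])
  moreover have "\<forall>\<^sub>F z in at_top. b < z" by (rule eventually_gt_at_top)
  ultimately have "\<forall>\<^sub>F z in at_top. b < z \<and> deriv F a < deriv F z" by eventually_elim auto
  then show "\<exists>z>b. deriv F a < deriv F z"
    by (rule eventually_happens'[rotated]) simp
qed (use assms in auto)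

text \<open>Extended real limits admit F' unbounded at 0 and at infinity. Solutions are compared on
  the closed interval because their values elsewhere are arbitrary. C and K are chosen before r,
  which expresses the uniformity.\<close>

theorem theorem4:
  fixes F :: "real \<Rightarrow> real" and a b \<delta> :: real and F'0 F'inf :: ereal
  assumes "0 < a" and "a < b"
    and "Ck_on 5 F {0<..}"
    and "\<forall>z\<in>{0<..<a} \<union> {b<..}. (deriv ^^ 2) F z > 0"
    and "\<forall>z\<in>{a<..<b}. (deriv ^^ 2) F z < 0"
    and "((\<lambda>z. ereal (deriv F z)) \<longlongrightarrow> F'0) (at_right 0)" and "F'0 < ereal (deriv F b)"
    and "((\<lambda>z. ereal (deriv F z)) \<longlongrightarrow> F'inf) at_top" and "F'inf > ereal (deriv F a)"
    and "\<delta> \<in> {0<..<(Maxwell_\<beta> F a b - Maxwell_\<alpha> F a b) / 2}"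
  shows "\<exists>\<epsilon>\<^sub>\<delta> > 0. \<exists>N. open N \<and> Maxwell_point F a b \<in> N \<and>
    (\<exists>\<Delta> :: real \<Rightarrow> real \<Rightarrow> real \<times> real.
      (\<forall>\<epsilon>\<in>{0<..<\<epsilon>\<^sub>\<delta>}. \<forall>r\<in>{Maxwell_\<alpha> F a b + \<delta>..Maxwell_\<beta> F a b - \<delta>}.
         \<Delta> \<epsilon> r \<in> N \<and> admissible F a b (\<Delta> \<epsilon> r) \<and>
         (\<exists>z. simple_solution F \<epsilon> r z (fst (\<Delta> \<epsilon> r)) \<and> corresponding_pair F \<epsilon> z (\<Delta> \<epsilon> r) \<and>
            (\<forall>w \<Delta>'. simple_solution F \<epsilon> r w (fst \<Delta>') \<and> corresponding_pair F \<epsilon> w \<Delta>' \<and> \<Delta>' \<in> N \<longrightarrow>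
               \<Delta>' = \<Delta> \<epsilon> r \<and> (\<forall>x\<in>{-1/\<epsilon>..1/\<epsilon>}. w x = z x)))) \<and>
      (\<exists>C>0. \<exists>K. \<forall>\<^sub>F \<epsilon> in at_right 0. \<forall>r\<in>{Maxwell_\<alpha> F a b + \<delta>..Maxwell_\<beta> F a b - \<delta>}.
         dist (\<Delta> \<epsilon> r) (Maxwell_point F a b) \<le> K * exp (- C / \<epsilon>) \<and>
         \<bar>z\<^sub>1 F a b (\<Delta> \<epsilon> r) - Maxwell_\<alpha> F a b\<bar> \<le> K * exp (- C / \<epsilon>) \<and>
         \<bar>z\<^sub>2 F a b (\<Delta> \<epsilon> r) - Maxwell_\<beta> F a b\<bar> \<le> K * exp (- C / \<epsilon>)))"
proof -
  interpret double_well F a b by (rule double_wellI[OF assms(1-9)])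
  show ?thesis by (rule small_solutions) (use assms(10) in simp)
qed

end
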